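(* Let $(M,\omega)$ be a compact complex $n$-dimensional manifold, endowed with a positive Kähler-Einstein structure. Let $G$ be a compact Lie group acting isometrically on $M$, whose generic orbit is $n$-dimensional and totally real. Then $M$ contains a minimal Lagrangian submanifold. This submanifold is a $G$-orbit in $M$; it is isolated within the class of minimal Lagrangian $G$-orbits.
   Context: Dimension of $M$ is complex dimension; dimension of orbits is real dimension. A positive Kähler-Einstein structure is a Kähler structure whose Ricci form is a positive constant multiple of the Kähler form $\omega$. A real $n$-dimensional submanifold $L$ of a complex $n$-dimensional manifold $(M,J)$ is totally real if $T_pM=T_pL\oplus J(T_pL)$ for every $p\in L$. "Generic orbit" means principal orbit (the orbits through an open dense set of points). Lagrangian means $n$-dimensional with $\omega|_{TL}=0$; minimal means zero mean curvature with respect to the Kähler metric. A minimal Lagrangian $G$-orbit is isolated in the class of minimal Lagrangian $G$-orbits if it has a neighbourhood in $M$ that contains no other minimal Lagrangian $G$-orbit.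
   Formalization: It is assumed in addition that G is connected or acts by holomorphic maps; for disconnected G acting by mere Riemannian isometries the claim fails, e.g. SO(3) x Z_2 on CP^1 x CP^2 with Z_2 conjugating the second factor. *)

theory Defs
  imports "HOL-Analysis.Analysis" "HOL-Algebra.Group_Action"
begin

section \<open>Smooth and holomorphic maps between open sets\<close>

primrec Ck_on :: "nat \<Rightarrow> 'a::euclidean_space set \<Rightarrow> ('a \<Rightarrow> 'b::euclidean_space) \<Rightarrow> bool" where
  "Ck_on 0 S f = continuous_on S f"
| "Ck_on (Suc k) S f =
     ((\<forall>x\<in>S. f differentiable (at x)) \<and>
      (\<forall>v. Ck_on k S (\<lambda>x. frechet_derivative f (at x) v)))"

definition smooth_on :: "'a::euclidean_space set \<Rightarrow> ('a \<Rightarrow> 'b::euclidean_space) \<Rightarrow> bool" where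
  "smooth_on S f \<longleftrightarrow> (\<forall>k. Ck_on k S f)"

text \<open>The standard complex structure of \<open>\<complex>\<^sup>n\<close>, regarded as a real Euclidean space.\<close>

abbreviation J :: "complex^'n \<Rightarrow> complex^'n" where
  "J v \<equiv> \<i> *s v"

definition holo_on :: "(complex^'n) set \<Rightarrow> (complex^'n \<Rightarrow> complex^'n) \<Rightarrow> bool" where
  "holo_on S f \<longleftrightarrow>
     (\<forall>z\<in>S. \<exists>D. (f has_derivative D) (at z) \<and> (\<forall>v. D (J v) = J (D v)))"


section \<open>Manifolds\<close>

text \<open>
  The underlying space of a manifold is a Hausdorff topological type. A chart is a pair of a
  domain and a coordinate map; values of the coordinate map off its domain are irrelevant.
  Second countability is not required, since all manifolds considered here are compact.
\<close>

type_synonym ('x, 'e) chart = "'x set \<times> ('x \<Rightarrow> 'e)"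

definition is_chart :: "('x::topological_space, 'e::euclidean_space) chart \<Rightarrow> bool" where
  "is_chart c \<longleftrightarrow> open (fst c) \<and> open (snd c ` fst c) \<and>
     (\<exists>h. homeomorphism (fst c) (snd c ` fst c) (snd c) h)"

text \<open>Coordinate expression of a map with respect to a chart of the source and one of the target,
  and the set on which it is defined.\<close>

definition coord :: "('x, 'd) chart \<Rightarrow> ('y, 'e) chart \<Rightarrow> ('x \<Rightarrow> 'y) \<Rightarrow> 'd \<Rightarrow> 'e" where
  "coord c d f = snd d \<circ> f \<circ> inv_into (fst c) (snd c)"

definition coord_dom :: "('x, 'd) chart \<Rightarrow> ('y, 'e) chart \<Rightarrow> ('x \<Rightarrow> 'y) \<Rightarrow> 'd set" where
  "coord_dom c d f = snd c ` (fst c \<inter> f -` fst d)"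

definition differential ::
  "('x, 'd::euclidean_space) chart \<Rightarrow> ('y, 'e::euclidean_space) chart \<Rightarrow> ('x \<Rightarrow> 'y) \<Rightarrow> 'x \<Rightarrow> 'd \<Rightarrow> 'e" where
  "differential c d f p = frechet_derivative (coord c d f) (at (snd c p))"

definition smooth_atlas :: "('x::topological_space, 'e::euclidean_space) chart set \<Rightarrow> bool" where
  "smooth_atlas A \<longleftrightarrow> (\<forall>c\<in>A. is_chart c) \<and> (\<Union>c\<in>A. fst c) = UNIV \<and>
     (\<forall>c\<in>A. \<forall>d\<in>A. smooth_on (coord_dom c d id) (coord c d id))"

definition complex_atlas :: "('x::topological_space, complex^'n) chart set \<Rightarrow> bool" where
  "complex_atlas A \<longleftrightarrow> (\<forall>c\<in>A. is_chart c) \<and> (\<Union>c\<in>A. fst c) = UNIV \<and>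
     (\<forall>c\<in>A. \<forall>d\<in>A. holo_on (coord_dom c d id) (coord c d id))"

definition prod_atlas ::
  "('x, 'd) chart set \<Rightarrow> ('y, 'e) chart set \<Rightarrow> ('x \<times> 'y, 'd \<times> 'e) chart set" where
  "prod_atlas A B = {(fst c \<times> fst d, map_prod (snd c) (snd d)) | c d. c \<in> A \<and> d \<in> B}"

definition smooth_map ::
  "('x::topological_space, 'd::euclidean_space) chart set \<Rightarrow>
   ('y::topological_space, 'e::euclidean_space) chart set \<Rightarrow> ('x \<Rightarrow> 'y) \<Rightarrow> bool" where
  "smooth_map A B f \<longleftrightarrow> continuous_on UNIV f \<and>
     (\<forall>c\<in>A. \<forall>d\<in>B. smooth_on (coord_dom c d f) (coord c d f))"

definition holomorphic_map :: "('x::topological_space, complex^'n) chart set \<Rightarrow> ('x \<Rightarrow> 'x) \<Rightarrow> bool" where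
  "holomorphic_map A f \<longleftrightarrow> continuous_on UNIV f \<and>
     (\<forall>c\<in>A. \<forall>d\<in>A. holo_on (coord_dom c d f) (coord c d f))"


section \<open>Kaehler and Kaehler-Einstein structures\<close>

text \<open>
  A covariant 2-tensor is given by its coordinate expressions \<open>T c z u v\<close>, where \<open>z\<close> is a point of the
  image of the chart \<open>c\<close> and \<open>u\<close>, \<open>v\<close> are coordinate vectors. The predicate \<open>preserves A T f\<close> is the
  equation \<open>f\<^sup>*T = T\<close>; for \<open>f = id\<close> it is the transformation law under change of charts, i.e. the
  condition that the coordinate expressions define a tensor on the manifold.
\<close>

type_synonym ('x, 'e) tensor2 = "('x, 'e) chart \<Rightarrow> 'e \<Rightarrow> 'e \<Rightarrow> 'e \<Rightarrow> real"

definition preserves ::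
  "('x, 'e::euclidean_space) chart set \<Rightarrow> ('x, 'e) tensor2 \<Rightarrow> ('x \<Rightarrow> 'x) \<Rightarrow> bool" where
  "preserves A T f \<longleftrightarrow>
     (\<forall>c\<in>A. \<forall>d\<in>A. \<forall>p\<in>fst c \<inter> f -` fst d. \<forall>u v.
        T d (snd d (f p)) (differential c d f p u) (differential c d f p v) = T c (snd c p) u v)"

text \<open>Directional derivative of a function of the coordinates.\<close>

abbreviation Dir :: "'a \<Rightarrow> ('a::real_normed_vector \<Rightarrow> 'b::real_normed_vector) \<Rightarrow> 'a \<Rightarrow> 'b" where
  "Dir u f z \<equiv> frechet_derivative f (at z) u"

text \<open>The Kaehler metric \<open>g\<close> of the form \<open>\<omega>\<close>, with the convention \<open>\<omega>(u, v) = g(Ju, v)\<close>.\<close>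

definition metric :: "('x, complex^'n) tensor2 \<Rightarrow> ('x, complex^'n) tensor2" where
  "metric \<omega> c z u v = \<omega> c z u (J v)"

text \<open>A Kaehler form: a smooth closed positive real form of type (1,1).
  The last condition is \<open>d\<omega> = 0\<close>, evaluated on constant coordinate vector fields.\<close>

definition kahler_form :: "('x, complex^'n) chart set \<Rightarrow> ('x, complex^'n) tensor2 \<Rightarrow> bool" where
  "kahler_form A \<omega> \<longleftrightarrow>
     preserves A \<omega> id \<and>
     (\<forall>c\<in>A. \<forall>u v. smooth_on (snd c ` fst c) (\<lambda>z. \<omega> c z u v)) \<and>
     (\<forall>c\<in>A. \<forall>z\<in>snd c ` fst c.
        bilinear (\<omega> c z) \<and>
        (\<forall>u v. \<omega> c z u v = - \<omega> c z v u) \<and>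
        (\<forall>u v. \<omega> c z (J u) (J v) = \<omega> c z u v) \<and>
        (\<forall>u. u \<noteq> 0 \<longrightarrow> metric \<omega> c z u u > 0) \<and>
        (\<forall>u v w. Dir u (\<lambda>y. \<omega> c y v w) z + Dir v (\<lambda>y. \<omega> c y w u) z
                 + Dir w (\<lambda>y. \<omega> c y u v) z = 0))"

text \<open>Levi-Civita connection of a metric \<open>g\<close> on constant coordinate vector fields (Koszul formula),
  and its curvature and Ricci tensors.\<close>

definition christoffel ::
  "('x, 'e::euclidean_space) tensor2 \<Rightarrow> ('x, 'e) chart \<Rightarrow> 'e \<Rightarrow> 'e \<Rightarrow> 'e \<Rightarrow> 'e" where
  "christoffel g c z u v = (THE w. \<forall>x.
     2 * g c z w x = Dir u (\<lambda>y. g c y v x) z + Dir v (\<lambda>y. g c y u x) z - Dir x (\<lambda>y. g c y u v) z)"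

definition curvature ::
  "('x, 'e::euclidean_space) tensor2 \<Rightarrow> ('x, 'e) chart \<Rightarrow> 'e \<Rightarrow> 'e \<Rightarrow> 'e \<Rightarrow> 'e \<Rightarrow> 'e" where
  "curvature g c z u v w =
     Dir u (\<lambda>y. christoffel g c y v w) z - Dir v (\<lambda>y. christoffel g c y u w) z
     + christoffel g c z u (christoffel g c z v w) - christoffel g c z v (christoffel g c z u w)"

text \<open>The trace of \<open>u \<mapsto> R(u, v) w\<close>; it is computed in the standard basis of the coordinate space,
  but does not depend on the basis.\<close>

definition ricci :: "('x, 'e::euclidean_space) tensor2 \<Rightarrow> ('x, 'e) tensor2" where
  "ricci g c z v w = (\<Sum>b\<in>Basis. curvature g c z b v w \<bullet> b)"

definition ricci_form :: "('x, complex^'n) tensor2 \<Rightarrow> ('x, complex^'n) tensor2" where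
  "ricci_form \<omega> c z u v = ricci (metric \<omega>) c z (J u) v"

definition positive_kahler_einstein ::
  "('x, complex^'n) chart set \<Rightarrow> ('x, complex^'n) tensor2 \<Rightarrow> bool" where
  "positive_kahler_einstein A \<omega> \<longleftrightarrow> kahler_form A \<omega> \<and>
     (\<exists>\<kappa>>0. \<forall>c\<in>A. \<forall>z\<in>snd c ` fst c. \<forall>u v. ricci_form \<omega> c z u v = \<kappa> * \<omega> c z u v)"


section \<open>Submanifolds of real dimension \<open>n\<close>\<close>

text \<open>\<open>f\<close> parametrizes a relatively open piece of \<open>L\<close> by an open set \<open>W\<close> of \<open>\<real>\<^sup>n\<close>,
  where \<open>n\<close> is the complex dimension of the ambient manifold.\<close>

definition local_param ::
  "('x::topological_space, complex^'n) chart set \<Rightarrow> 'x set \<Rightarrow> (real^'n) set \<Rightarrow> (real^'n \<Rightarrow> 'x) \<Rightarrow> bool" where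
  "local_param A L W f \<longleftrightarrow> open W \<and> (\<exists>V. open V \<and> f ` W = L \<inter> V) \<and>
     (\<exists>h. homeomorphism W (f ` W) f h) \<and>
     (\<forall>c\<in>A. smooth_on (W \<inter> f -` fst c) (snd c \<circ> f) \<and>
        (\<forall>x\<in>W \<inter> f -` fst c. inj (frechet_derivative (snd c \<circ> f) (at x))))"

definition n_submanifold :: "('x::topological_space, complex^'n) chart set \<Rightarrow> 'x set \<Rightarrow> bool" where
  "n_submanifold A L \<longleftrightarrow> (\<forall>p\<in>L. \<exists>W f. local_param A L W f \<and> p \<in> f ` W)"

text \<open>The tangent space at \<open>p\<close>, in the chart \<open>c\<close>: velocities of smooth curves in \<open>L\<close>.\<close>

definition tangent_space :: "('x, 'e::euclidean_space) chart \<Rightarrow> 'x set \<Rightarrow> 'x \<Rightarrow> 'e set" where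
  "tangent_space c L p =
     {v. \<exists>(\<gamma> :: real \<Rightarrow> 'x) e. 0 < e \<and> \<gamma> 0 = p \<and> \<gamma> ` {-e<..<e} \<subseteq> L \<inter> fst c \<and>
           smooth_on {-e<..<e} (snd c \<circ> \<gamma>) \<and> (snd c \<circ> \<gamma> has_vector_derivative v) (at 0)}"

definition totally_real :: "('x::topological_space, complex^'n) chart set \<Rightarrow> 'x set \<Rightarrow> bool" where
  "totally_real A L \<longleftrightarrow> n_submanifold A L \<and>
     (\<forall>c\<in>A. \<forall>p\<in>L \<inter> fst c.
        {u + J v | u v. u \<in> tangent_space c L p \<and> v \<in> tangent_space c L p} = UNIV \<and>
        tangent_space c L p \<inter> J ` tangent_space c L p = {0})"

definition lagrangian ::
  "('x::topological_space, complex^'n) chart set \<Rightarrow> ('x, complex^'n) tensor2 \<Rightarrow> 'x set \<Rightarrow> bool" where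
  "lagrangian A \<omega> L \<longleftrightarrow> n_submanifold A L \<and>
     (\<forall>c\<in>A. \<forall>p\<in>L \<inter> fst c. \<forall>u\<in>tangent_space c L p. \<forall>v\<in>tangent_space c L p.
        \<omega> c (snd c p) u v = 0)"

text \<open>
  Mean curvature vector at \<open>f x\<close>, expressed in the chart \<open>c\<close>, of a submanifold parametrized by \<open>f\<close>.
  With \<open>F = snd c \<circ> f\<close> and coordinate fields \<open>\<partial>\<^sub>a\<close> on the parameter domain, \<open>frame a\<close> is
  \<open>\<partial>\<^sub>aF\<close>, \<open>gram\<close> is the induced metric, \<open>cov a b\<close> is the ambient covariant derivative of
  \<open>\<partial>\<^sub>bF\<close> along \<open>\<partial>\<^sub>aF\<close>, and \<open>nor\<close> is the orthogonal projection onto the normal space;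
  thus \<open>nor (cov a b)\<close> is the second fundamental form, whose trace is taken.
\<close>

definition mean_curvature ::
  "('x, complex^'n) tensor2 \<Rightarrow> ('x, complex^'n) chart \<Rightarrow> (real^'n \<Rightarrow> 'x) \<Rightarrow> real^'n \<Rightarrow> complex^'n" where
  "mean_curvature g c f x =
     (let F = snd c \<circ> f;
          frame = (\<lambda>a y. Dir (axis a 1) F y);
          gram = (\<chi> a b. g c (F x) (frame a x) (frame b x)) :: real^'n^'n;
          inv_gram = matrix_inv gram;
          cov = (\<lambda>a b. Dir (axis a 1) (frame b) x + christoffel g c (F x) (frame a x) (frame b x));
          nor = (\<lambda>w. w - (\<Sum>a\<in>UNIV. \<Sum>b\<in>UNIV.
                  (inv_gram $ a $ b * g c (F x) w (frame a x)) *\<^sub>R frame b x))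
      in (\<Sum>a\<in>UNIV. \<Sum>b\<in>UNIV. (inv_gram $ a $ b) *\<^sub>R nor (cov a b)))"

definition minimal_submanifold ::
  "('x::topological_space, complex^'n) chart set \<Rightarrow> ('x, complex^'n) tensor2 \<Rightarrow> 'x set \<Rightarrow> bool" where
  "minimal_submanifold A g L \<longleftrightarrow> n_submanifold A L \<and>
     (\<forall>W f. local_param A L W f \<longrightarrow>
        (\<forall>c\<in>A. \<forall>x\<in>W \<inter> f -` fst c. mean_curvature g c f x = 0))"

definition minimal_lagrangian ::
  "('x::topological_space, complex^'n) chart set \<Rightarrow> ('x, complex^'n) tensor2 \<Rightarrow> 'x set \<Rightarrow> bool" where
  "minimal_lagrangian A \<omega> L \<longleftrightarrow> lagrangian A \<omega> L \<and> minimal_submanifold A (metric \<omega>) L"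


section \<open>Compact Lie groups and their actions\<close>

text \<open>The model space of \<open>G\<close> is a \<open>euclidean_space\<close>, hence of positive dimension.
  This excludes only finite groups, whose orbits cannot have dimension \<open>n \<ge> 1\<close>.\<close>

definition compact_lie_group ::
  "('g::t2_space) monoid \<Rightarrow> ('g, 'e::euclidean_space) chart set \<Rightarrow> bool" where
  "compact_lie_group G B \<longleftrightarrow> group G \<and> carrier G = UNIV \<and> compact (UNIV :: 'g set) \<and>
     smooth_atlas B \<and>
     smooth_map (prod_atlas B B) B (\<lambda>(x, y). x \<otimes>\<^bsub>G\<^esub> y) \<and>
     smooth_map B B (\<lambda>x. inv\<^bsub>G\<^esub> x)"

definition smooth_action ::
  "('g::t2_space) monoid \<Rightarrow> ('g, 'd::euclidean_space) chart set \<Rightarrow>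
   ('x::t2_space, 'e::euclidean_space) chart set \<Rightarrow> ('g \<Rightarrow> 'x \<Rightarrow> 'x) \<Rightarrow> bool" where
  "smooth_action G B A \<phi> \<longleftrightarrow> group_action G UNIV \<phi> \<and>
     smooth_map (prod_atlas B A) A (\<lambda>(g, p). \<phi> g p)"

text \<open>
  Isometric means: preserving the Riemannian metric. Isometries need not be holomorphic, but on a
  compact Kaehler manifold those in a connected compact group are. Theorems on Kaehler manifolds
  should therefore assume in addition that \<open>G\<close> is connected or that it acts holomorphically: on
  \<open>\<complex>P\<^sup>1 \<times> \<complex>P\<^sup>2\<close> with \<open>SO(3)\<close> acting diagonally, complex conjugation of the second factor is an
  isometry that commutes with \<open>SO(3)\<close> but does not map Lagrangian orbits to Lagrangian orbits.
\<close>

definition isometric_action ::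
  "('g, 'c) monoid_scheme \<Rightarrow> ('x, complex^'n) chart set \<Rightarrow> ('x, complex^'n) tensor2 \<Rightarrow>
   ('g \<Rightarrow> 'x \<Rightarrow> 'x) \<Rightarrow> bool" where
  "isometric_action G A \<omega> \<phi> \<longleftrightarrow> (\<forall>g\<in>carrier G. preserves A (metric \<omega>) (\<phi> g))"

text \<open>The orbit of \<open>p\<close> is principal: the isotropy group at \<open>p\<close> is contained, up to conjugation, in
  the isotropy group at every nearby point (isotropy groups along an orbit are conjugate).\<close>

definition principal_orbit_at ::
  "('g, 'c) monoid_scheme \<Rightarrow> ('g \<Rightarrow> 'x::topological_space \<Rightarrow> 'x) \<Rightarrow> 'x \<Rightarrow> bool" where
  "principal_orbit_at G \<phi> p \<longleftrightarrow>
     (\<exists>V. open V \<and> p \<in> V \<and>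
       (\<forall>q\<in>V. \<exists>g\<in>carrier G. stabilizer G \<phi> p \<subseteq> stabilizer G \<phi> (\<phi> g q)))"

text \<open>The generic orbit has property \<open>P\<close>: the orbits through an open dense set of points are
  principal and satisfy \<open>P\<close>.\<close>

definition generic_orbit ::
  "('g, 'c) monoid_scheme \<Rightarrow> ('g \<Rightarrow> 'x::topological_space \<Rightarrow> 'x) \<Rightarrow> ('x set \<Rightarrow> bool) \<Rightarrow> bool" where
  "generic_orbit G \<phi> P \<longleftrightarrow>
     (\<exists>U. open U \<and> closure U = UNIV \<and>
       (\<forall>p\<in>U. principal_orbit_at G \<phi> p \<and> P (orbit G \<phi> p)))"

definition minimal_lagrangian_orbit ::
  "('g, 'c) monoid_scheme \<Rightarrow> ('g \<Rightarrow> 'x \<Rightarrow> 'x) \<Rightarrow> ('x::topological_space, complex^'n) chart set \<Rightarrow>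
   ('x, complex^'n) tensor2 \<Rightarrow> 'x set \<Rightarrow> bool" where
  "minimal_lagrangian_orbit G \<phi> A \<omega> L \<longleftrightarrow>
     (\<exists>p. L = orbit G \<phi> p) \<and> minimal_lagrangian A \<omega> L"

definition isolated_minimal_lagrangian_orbit ::
  "('g, 'c) monoid_scheme \<Rightarrow> ('g \<Rightarrow> 'x \<Rightarrow> 'x) \<Rightarrow> ('x::topological_space, complex^'n) chart set \<Rightarrow>
   ('x, complex^'n) tensor2 \<Rightarrow> 'x set \<Rightarrow> bool" where
  "isolated_minimal_lagrangian_orbit G \<phi> A \<omega> L \<longleftrightarrow>
     minimal_lagrangian_orbit G \<phi> A \<omega> L \<and>
     (\<exists>U. open U \<and> L \<subseteq> U \<and>
       (\<forall>L'. minimal_lagrangian_orbit G \<phi> A \<omega> L' \<and> L' \<subseteq> U \<longrightarrow> L' = L))"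

end

theory Submission
  imports Defs
begin

text \<open>
  Fix \<open>\<xi>\<^sub>1, \<dots>, \<xi>\<^sub>n\<close> in the Lie algebra and let \<open>X\<^sub>j\<close> be their fundamental vector fields, which are
  holomorphic and Killing (an isometry in a connected group is holomorphic: the parallel endomorphism
  \<open>[\<phi>\<^sup>*J, J]\<close> vanishes by the Einstein condition). The function \<open>N = |det h(X\<^sub>j, X\<^sub>k)|\<close> is global
  and continuous, and \<open>\<beta> = d ln N\<close> satisfies \<open>D\<^sub>v \<beta>(w) + D\<^sub>J\<^sub>v \<beta>(Jw) = - 2\<kappa> g(v, w)\<close>.
  Where the \<open>X\<^sub>j\<close> are independent over the complex numbers, every fundamental field is a combination of
  them with coefficients that are holomorphic and, as generic orbits are totally real, real; hence
  constant. So \<open>N\<close> is multiplied by a constant under \<open>\<phi> g\<close>, and at a maximum \<open>p\<close> of \<open>N\<close> it is constant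
  along the orbit. There \<open>\<beta> = 0\<close>, and \<open>(v, w) = (X\<^sub>j, J X\<^sub>k)\<close> in the identity above gives
  \<open>g(X\<^sub>j, J X\<^sub>k) = 0\<close>, so the orbit is Lagrangian. On a Lagrangian orbit Killing's equation turns \<open>\<beta>\<close>
  into \<open>-2 g(\<cdot>, S)\<close>, where \<open>S\<close> is the trace of \<open>\<nabla>\<^sub>X X\<close>, whose normal part is the mean curvature; so
  near \<open>p\<close> the minimal Lagrangian orbits are the zeros of \<open>\<beta>\<close>. They are isolated since the derivative of
  \<open>\<beta>\<close> on the slice in the directions \<open>J X\<^sub>j\<close> is \<open>-2\<kappa> g\<close>.
\<close>

section \<open>Differential calculus\<close>

text \<open>Where the frame is independent, \<open>ln N\<close> is
  \<open>2 ln |det X| + ln |det H|\<close>, with \<open>H\<close> the coordinate matrix of the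
  hermitian metric. The first term is pluriharmonic since the fields are holomorphic; the second
  carries the Ricci form, which is the origin of \<open>- 2\<kappa> g\<close>. \<open>N\<close> is
  built from fixed Lie algebra elements, so nothing is integrated over orbits and the maximum may
  lie outside the generic set. The price is that \<open>\<phi> g\<close> moves these elements by the
  adjoint action, so invariance of \<open>N\<close> must be recovered: constant coefficients give a
  local factor, and comparing \<open>g\<close> with its inverse at a maximum shows that it is 1.
  Thus orbit points near \<open>p\<close> are maxima as well and \<open>\<beta>\<close> vanishes
  along the orbit; by symmetry of second derivatives both terms of the identity vanish for
  \<open>(X\<^sub>j, J X\<^sub>k)\<close>. Minimality is demanded for every parametrization, so at
  each point the fields are chosen anew to match the coordinate frame. A nearby minimal Lagrangian
  orbit has tangential \<open>S\<close>; since \<open>\<beta>\<close> kills orbit directions,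
  \<open>S\<close> is orthogonal to itself.\<close>

lemma norm_linear_le_sum:
  fixes f :: "'a::euclidean_space \<Rightarrow> 'b::euclidean_space"
  assumes "linear f" shows "norm (f v) \<le> (\<Sum>b\<in>Basis. norm (f b)) * norm v"
proof -
  have "f v = f (\<Sum>i\<in>Basis. (v \<bullet> i) *\<^sub>R i)" by (simp add: euclidean_representation)
  also have "\<dots> = (\<Sum>b\<in>Basis. (v \<bullet> b) *\<^sub>R f b)" using assms by (simp add: linear_sum linear_scale)
  finally have "norm (f v) \<le> (\<Sum>b\<in>Basis. norm ((v \<bullet> b) *\<^sub>R f b))" by (metis norm_sum)
  also have "\<dots> \<le> (\<Sum>b\<in>Basis. norm v * norm (f b))"
    by (intro sum_mono) (simp add: mult_right_mono Basis_le_norm)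
  finally show ?thesis by (simp add: sum_distrib_left mult.commute)
qed

text \<open>Tensor fields are only known through their values on constant vectors. Expanding the
  argument in the standard basis reduces the product rule to finitely many terms of the form scalar
  times vector, so no derivative of \<open>G\<close> in operator norm has to be formed.\<close>

lemma has_derivative_linear_section:
  fixes G :: "'a::euclidean_space \<Rightarrow> 'b::euclidean_space \<Rightarrow> 'c::euclidean_space"
  assumes S: "open S" "z0 \<in> S" and lin: "\<And>z. z \<in> S \<Longrightarrow> linear (G z)"
    and G': "\<And>v. ((\<lambda>z. G z v) has_derivative G' v) (at z0)"
    and a: "(a has_derivative a') (at z0)"
  shows "((\<lambda>z. G z (a z)) has_derivative (\<lambda>h. G' (a z0) h + G z0 (a' h))) (at z0)"
proof -
  have exp: "G z v = (\<Sum>i\<in>Basis. (v \<bullet> i) *\<^sub>R G z i)" if "z \<in> S" for z v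
  proof -
    have "G z v = G z (\<Sum>i\<in>Basis. (v \<bullet> i) *\<^sub>R i)" by (simp add: euclidean_representation)
    also have "\<dots> = (\<Sum>i\<in>Basis. (v \<bullet> i) *\<^sub>R G z i)"
      using lin[OF that] by (simp add: linear_sum linear_scale)
    finally show ?thesis .
  qed
  \<comment> \<open>\<open>G'\<close> is linear in \<open>v\<close> because both sides are
    derivatives of the same function near \<open>z0\<close>.\<close>
  have G'exp: "G' v h = (\<Sum>i\<in>Basis. (v \<bullet> i) *\<^sub>R G' i h)" for v h
  proof -
    have "((\<lambda>z. \<Sum>i\<in>Basis. (v \<bullet> i) *\<^sub>R G z i) has_derivative (\<lambda>h. \<Sum>i\<in>Basis. (v \<bullet> i) *\<^sub>R G' i h)) (at z0)"
      by (intro has_derivative_sum has_derivative_scaleR_right G')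
    moreover have "((\<lambda>z. \<Sum>i\<in>Basis. (v \<bullet> i) *\<^sub>R G z i) has_derivative G' v) (at z0)"
      by (rule has_derivative_transform_within_open[OF G' S]) (rule exp)
    ultimately have "G' v = (\<lambda>h. \<Sum>i\<in>Basis. (v \<bullet> i) *\<^sub>R G' i h)"
      using has_derivative_unique by blast
    then show ?thesis by simp
  qed
  have "((\<lambda>z. \<Sum>i\<in>Basis. (a z \<bullet> i) *\<^sub>R G z i) has_derivative
      (\<lambda>h. \<Sum>i\<in>Basis. (a z0 \<bullet> i) *\<^sub>R G' i h + (a' h \<bullet> i) *\<^sub>R G z0 i)) (at z0)"
    by (intro has_derivative_sum has_derivative_scaleR has_derivative_inner_left G' a)
  then have "((\<lambda>z. G z (a z)) has_derivative
      (\<lambda>h. \<Sum>i\<in>Basis. (a z0 \<bullet> i) *\<^sub>R G' i h + (a' h \<bullet> i) *\<^sub>R G z0 i)) (at z0)"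
    by (rule has_derivative_transform_within_open[OF _ S]) (simp add: exp)
  moreover have "(\<lambda>h. \<Sum>i\<in>Basis. (a z0 \<bullet> i) *\<^sub>R G' i h + (a' h \<bullet> i) *\<^sub>R G z0 i)
      = (\<lambda>h. G' (a z0) h + G z0 (a' h))"
  proof
    fix h
    show "(\<Sum>i\<in>Basis. (a z0 \<bullet> i) *\<^sub>R G' i h + (a' h \<bullet> i) *\<^sub>R G z0 i) = G' (a z0) h + G z0 (a' h)"
      unfolding G'exp[of "a z0" h] exp[OF S(2), of "a' h"] by (rule sum.distrib)
  qed
  ultimately show ?thesis by simp
qed

lemma has_derivative_bilinear_section:
  fixes B :: "'a::euclidean_space \<Rightarrow> 'b::euclidean_space \<Rightarrow> 'c::euclidean_space \<Rightarrow> 'd::euclidean_space"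
  assumes S: "open S" "z0 \<in> S" and bil: "\<And>z. z \<in> S \<Longrightarrow> bilinear (B z)"
    and B': "\<And>u v. ((\<lambda>z. B z u v) has_derivative B' u v) (at z0)"
    and a: "(a has_derivative a') (at z0)" and b: "(b has_derivative b') (at z0)"
  shows "((\<lambda>z. B z (a z) (b z)) has_derivative
      (\<lambda>h. B' (a z0) (b z0) h + B z0 (a' h) (b z0) + B z0 (a z0) (b' h))) (at z0)"
proof -
  have 1: "((\<lambda>z. B z u (b z)) has_derivative (\<lambda>h. B' u (b z0) h + B z0 u (b' h))) (at z0)" for u
    by (rule has_derivative_linear_section[OF S _ B' b]) (use bil in \<open>auto simp: bilinear_def\<close>)
  have "((\<lambda>z. B z (a z) (b z)) has_derivative
      (\<lambda>h. (B' (a z0) (b z0) h + B z0 (a z0) (b' h)) + B z0 (a' h) (b z0))) (at z0)"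
    by (rule has_derivative_linear_section[OF S _ 1 a]) (use bil in \<open>auto simp: bilinear_def\<close>)
  then show ?thesis by (simp add: algebra_simps)
qed

lemma frechet_derivative_eq: "(f has_derivative f') (at x) \<Longrightarrow> frechet_derivative f (at x) = f'"
  by (rule frechet_derivative_at[symmetric])

lemma has_derivative_frechet:
  "f differentiable (at x) \<Longrightarrow> (f has_derivative frechet_derivative f (at x)) (at x)"
  by (simp add: frechet_derivative_works)

lemma frechet_derivative_cong_open:
  assumes "open S" "x \<in> S" "\<And>y. y \<in> S \<Longrightarrow> f y = g y"
  shows "frechet_derivative f (at x) = frechet_derivative g (at x)"
proof -
  have "(f has_derivative D) (at x) = (g has_derivative D) (at x)" for D
  proof
    assume "(f has_derivative D) (at x)"
    then show "(g has_derivative D) (at x)"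
      by (rule has_derivative_transform_within_open[OF _ assms(1,2)]) (rule assms(3))
  next
    assume "(g has_derivative D) (at x)"
    then show "(f has_derivative D) (at x)"
      by (rule has_derivative_transform_within_open[OF _ assms(1,2)]) (rule assms(3)[symmetric])
  qed
  then show ?thesis unfolding frechet_derivative_def by simp
qed

lemma differentiable_cong_open:
  assumes "open S" "x \<in> S" "\<And>y. y \<in> S \<Longrightarrow> f y = g y" "f differentiable (at x)"
  shows "g differentiable (at x)"
proof -
  obtain D where D: "(f has_derivative D) (at x)" using assms(4) by (auto simp: differentiable_def)
  have "(g has_derivative D) (at x)"
    by (rule has_derivative_transform_within_open[OF D assms(1,2)]) (rule assms(3))
  then show ?thesis by (auto simp: differentiable_def)
qed

text \<open>The mean value theorem is applied in the direction \<open>u\<close> to the increment of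
  \<open>f\<close> along \<open>t *\<^sub>R v\<close>; differentiability of \<open>Dir u f\<close>
  at the single point \<open>x\<close> then compares the two values of \<open>Dir u f\<close> that
  occur.\<close>

lemma second_difference_real:
  fixes f :: "'a::euclidean_space \<Rightarrow> real"
  assumes S: "open S" "x \<in> S" and f: "\<And>y. y \<in> S \<Longrightarrow> f differentiable (at y)"
    and D: "((\<lambda>y. Dir u f y) has_derivative A) (at x)" and e: "0 < e"
  shows "\<exists>d>0. \<forall>t. 0 < t \<and> t < d \<longrightarrow>
     \<bar>f (x + t *\<^sub>R u + t *\<^sub>R v) - f (x + t *\<^sub>R u) - f (x + t *\<^sub>R v) + f x - t\<^sup>2 * A v\<bar>
       \<le> t\<^sup>2 * (e * (2 * norm u + norm v))"
proof -
  obtain r where r: "0 < r" "ball x r \<subseteq> S" using S openE by blast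
  obtain d where d: "0 < d" and
    dd: "\<And>y. norm (y - x) < d \<Longrightarrow> \<bar>Dir u f y - Dir u f x - A (y - x)\<bar> \<le> e * norm (y - x)"
    using D e unfolding has_derivative_at_alt by (metis real_norm_def)
  have linA: "linear A" using D has_derivative_linear by blast
  \<comment> \<open>Points \<open>x + s u + t v\<close> with \<open>s\<close> and \<open>t\<close>
    in \<open>[0, k)\<close> stay both in the ball inside \<open>S\<close> and in the range of the
    estimate \<open>dd\<close>; the \<open>+ 1\<close> keeps the denominator positive and the bound
    strict.\<close>
  define k where "k = min r d / (norm u + norm v + 1)"
  have k: "0 < k" using r d by (simp add: k_def add_nonneg_pos)
  have small: "norm (s *\<^sub>R u + t' *\<^sub>R v) < min r d" if "0 \<le> s" "s < k" "0 \<le> t'" "t' < k" for s t'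
  proof -
    have "norm (s *\<^sub>R u + t' *\<^sub>R v) \<le> s * norm u + t' * norm v"
      using norm_triangle_ineq[of "s *\<^sub>R u" "t' *\<^sub>R v"] that by simp
    also have "\<dots> \<le> k * norm u + k * norm v"
      using that by (intro add_mono mult_right_mono) auto
    also have "\<dots> < k * (norm u + norm v + 1)" using k by (simp add: algebra_simps)
    also have "\<dots> = min r d"
      using add_nonneg_pos[of "norm u + norm v" 1] by (simp add: k_def)
    finally show ?thesis .
  qed
  show ?thesis
  proof (intro exI[of _ k] conjI allI impI k)
    fix t assume "0 < t \<and> t < k"
    then have t: "0 < t" "t < k" by auto
    define \<phi> where "\<phi> s = f (x + s *\<^sub>R u + t *\<^sub>R v) - f (x + s *\<^sub>R u)" for s
    define \<phi>' where "\<phi>' s = Dir u f (x + s *\<^sub>R u + t *\<^sub>R v) - Dir u f (x + s *\<^sub>R u)" for s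
    have der: "(\<phi> has_real_derivative \<phi>' s) (at s)" if s: "0 \<le> s" "s \<le> t" for s
    proof -
      have in1: "x + s *\<^sub>R u + t *\<^sub>R v \<in> S" and in2: "x + s *\<^sub>R u \<in> S"
        using small[of s t] small[of s 0] s t r(2) k
        by (auto intro!: subsetD[OF r(2)] simp: mem_ball dist_norm add.assoc)
          (metis norm_minus_cancel minus_add_distrib uminus_add_conv_diff add.commute diff_conv_add_uminus)
      have c: "((\<lambda>s. f (y + s *\<^sub>R u)) has_real_derivative Dir u f (y + s *\<^sub>R u)) (at s)"
        if "y + s *\<^sub>R u \<in> S" for y
      proof -
        have "((\<lambda>s. y + s *\<^sub>R u) has_derivative (\<lambda>h. h *\<^sub>R u)) (at s)"
          by (auto intro!: derivative_eq_intros)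
        from diff_chain_at[OF this has_derivative_frechet[OF f[OF that]]]
        have "((\<lambda>s. f (y + s *\<^sub>R u)) has_derivative (\<lambda>h. h * Dir u f (y + s *\<^sub>R u))) (at s)"
          using linear_frechet_derivative[OF f[OF that]]
          by (simp add: o_def linear_scale)
        then show ?thesis by (simp add: has_field_derivative_def mult.commute[of _ "Dir u f (y + s *\<^sub>R u)"])
      qed
      have "x + t *\<^sub>R v + s *\<^sub>R u \<in> S" using in1 by (simp add: algebra_simps)
      from DERIV_diff[OF c[OF this] c[OF in2]] show ?thesis
        unfolding \<phi>_def[abs_def] \<phi>'_def by (simp add: algebra_simps)
    qed
    obtain s where s: "0 < s" "s < t" "\<phi> t - \<phi> 0 = (t - 0) * \<phi>' s"
      using MVT2[OF t(1), of \<phi> \<phi>'] der by auto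
    define a where "a = s *\<^sub>R u + t *\<^sub>R v"
    define b where "b = s *\<^sub>R u"
    have na: "norm a < d" and nb: "norm b < d"
      using small[of s t] small[of s 0] s t by (auto simp: a_def b_def)
    have la: "norm a \<le> t * (norm u + norm v)"
    proof -
      have "norm a \<le> s * norm u + t * norm v"
        unfolding a_def using norm_triangle_ineq[of "s *\<^sub>R u" "t *\<^sub>R v"] s t by simp
      also have "\<dots> \<le> t * norm u + t * norm v" using s by (intro add_mono mult_right_mono) auto
      finally show ?thesis by (simp add: algebra_simps)
    qed
    have lb: "norm b \<le> t * norm u" unfolding b_def using s by (auto intro: mult_right_mono)
    have e1: "\<bar>Dir u f (x + a) - Dir u f x - A a\<bar> \<le> e * norm a" using dd[of "x + a"] na by simp
    have e2: "\<bar>Dir u f (x + b) - Dir u f x - A b\<bar> \<le> e * norm b" using dd[of "x + b"] nb by simp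
    have Aab: "A a - A b = t * A v"
      unfolding a_def b_def using linA by (simp add: linear_add linear_scale)
    have ph: "\<phi>' s = Dir u f (x + a) - Dir u f (x + b)"
      unfolding \<phi>'_def a_def b_def by (simp add: add.assoc)
    have "\<bar>\<phi>' s - t * A v\<bar> \<le> e * norm a + e * norm b" unfolding ph using e1 e2 Aab by linarith
    also have "\<dots> \<le> e * (t * (norm u + norm v)) + e * (t * norm u)"
      using la lb e by (intro add_mono mult_left_mono) auto
    finally have bd: "\<bar>\<phi>' s - t * A v\<bar> \<le> t * (e * (2 * norm u + norm v))" by (simp add: algebra_simps)
    have "f (x + t *\<^sub>R u + t *\<^sub>R v) - f (x + t *\<^sub>R u) - f (x + t *\<^sub>R v) + f x = t * \<phi>' s"
      using s(3) unfolding \<phi>_def by simp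
    then have "\<bar>f (x + t *\<^sub>R u + t *\<^sub>R v) - f (x + t *\<^sub>R u) - f (x + t *\<^sub>R v) + f x - t\<^sup>2 * A v\<bar> = t * \<bar>\<phi>' s - t * A v\<bar>"
    proof -
      have "t * \<phi>' s - t\<^sup>2 * A v = t * (\<phi>' s - t * A v)" by (simp add: power2_eq_square algebra_simps)
      then show ?thesis using t \<open>_ = t * \<phi>' s\<close> by (simp add: abs_mult)
    qed
    also have "\<dots> \<le> t * (t * (e * (2 * norm u + norm v)))" using bd t by (intro mult_left_mono) auto
    finally show "\<bar>f (x + t *\<^sub>R u + t *\<^sub>R v) - f (x + t *\<^sub>R u) - f (x + t *\<^sub>R v) + f x - t\<^sup>2 * A v\<bar>
       \<le> t\<^sup>2 * (e * (2 * norm u + norm v))" by (simp add: power2_eq_square mult.assoc)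
  qed
qed

text \<open>The second difference is symmetric in \<open>u\<close> and \<open>v\<close>, so
  \<open>t\<^sup>2 * A v\<close> and \<open>t\<^sup>2 * B u\<close> approximate the same number with
  an error of order \<open>e * t\<^sup>2\<close>.\<close>

lemma second_derivative_symmetric_real:
  fixes f :: "'a::euclidean_space \<Rightarrow> real"
  assumes S: "open S" "x \<in> S" and f: "\<And>y. y \<in> S \<Longrightarrow> f differentiable (at y)"
    and A: "((\<lambda>y. Dir u f y) has_derivative A) (at x)"
    and B: "((\<lambda>y. Dir v f y) has_derivative B) (at x)"
  shows "A v = B u"
proof (rule ccontr)
  assume ne: "A v \<noteq> B u"
  define N where "N = 3 * norm u + 3 * norm v + 1"
  have N: "N > 0" by (simp add: N_def add_nonneg_pos)
  \<comment> \<open>Divided by \<open>t\<^sup>2\<close>, the two errors sum to at most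
    \<open>e * N\<close>, half of the supposed gap.\<close>
  define e where "e = \<bar>A v - B u\<bar> / (2 * N)"
  have e: "e > 0" using ne N by (simp add: e_def)
  obtain d1 where d1: "d1 > 0" "\<And>t. 0 < t \<Longrightarrow> t < d1 \<Longrightarrow>
     \<bar>f (x + t *\<^sub>R u + t *\<^sub>R v) - f (x + t *\<^sub>R u) - f (x + t *\<^sub>R v) + f x - t\<^sup>2 * A v\<bar>
       \<le> t\<^sup>2 * (e * (2 * norm u + norm v))"
    using second_difference_real[OF S f A e, of v] by blast
  obtain d2 where d2: "d2 > 0" "\<And>t. 0 < t \<Longrightarrow> t < d2 \<Longrightarrow>
     \<bar>f (x + t *\<^sub>R v + t *\<^sub>R u) - f (x + t *\<^sub>R v) - f (x + t *\<^sub>R u) + f x - t\<^sup>2 * B u\<bar>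
       \<le> t\<^sup>2 * (e * (2 * norm v + norm u))"
    using second_difference_real[OF S f B e, of u] by blast
  define t where "t = min d1 d2 / 2"
  have t: "0 < t" "t < d1" "t < d2" using d1(1) d2(1) by (auto simp: t_def)
  have c: "x + t *\<^sub>R v + t *\<^sub>R u = x + t *\<^sub>R u + t *\<^sub>R v" by simp
  have "\<bar>t\<^sup>2 * A v - t\<^sup>2 * B u\<bar> \<le> t\<^sup>2 * (e * (2 * norm u + norm v)) + t\<^sup>2 * (e * (2 * norm v + norm u))"
    using d1(2)[OF t(1,2)] d2(2)[OF t(1,3)] unfolding c by linarith
  also have "\<dots> = t\<^sup>2 * (e * (3 * norm u + 3 * norm v))" by (simp add: algebra_simps)
  finally have "t\<^sup>2 * \<bar>A v - B u\<bar> \<le> t\<^sup>2 * (e * (3 * norm u + 3 * norm v))"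
    by (simp add: abs_mult flip: right_diff_distrib)
  then have "\<bar>A v - B u\<bar> \<le> e * (3 * norm u + 3 * norm v)" using t by simp
  also have "\<dots> \<le> e * N" using e by (simp add: N_def)
  also have "\<dots> = \<bar>A v - B u\<bar> / 2" using N by (simp add: e_def)
  finally show False using ne by simp
qed

lemma Dir_inner:
  assumes "f differentiable (at x)"
  shows "Dir u (\<lambda>y. f y \<bullet> b) x = Dir u f x \<bullet> b"
  by (simp add: frechet_derivative_eq[OF has_derivative_inner_left[OF has_derivative_frechet[OF assms]]])

lemma second_derivative_symmetric:
  fixes f :: "'a::euclidean_space \<Rightarrow> 'b::euclidean_space"
  assumes S: "open S" "x \<in> S" and f: "\<And>y. y \<in> S \<Longrightarrow> f differentiable (at y)"
    and A: "(\<lambda>y. Dir u f y) differentiable (at x)"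
    and B: "(\<lambda>y. Dir v f y) differentiable (at x)"
  shows "Dir v (\<lambda>y. Dir u f y) x = Dir u (\<lambda>y. Dir v f y) x"
proof (rule euclidean_eqI)
  fix b :: 'b assume "b \<in> Basis"
  have d: "((\<lambda>y. Dir w (\<lambda>y. f y \<bullet> b) y) has_derivative (\<lambda>h. Dir h (\<lambda>y. Dir w f y) x \<bullet> b)) (at x)"
    if "(\<lambda>y. Dir w f y) differentiable (at x)" for w
    by (rule has_derivative_transform_within_open[OF has_derivative_inner_left[OF has_derivative_frechet[OF that]] S])
      (simp add: Dir_inner[OF f])
  show "Dir v (\<lambda>y. Dir u f y) x \<bullet> b = Dir u (\<lambda>y. Dir v f y) x \<bullet> b"
    by (rule second_derivative_symmetric_real[OF S _ d[OF A] d[OF B]])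
      (use f in \<open>auto intro: differentiable_inner\<close>)
qed

text \<open>\<open>y\<close> is not known to be continuous beforehand. With a left inverse
  \<open>L\<close> of \<open>G z0\<close>, the residual \<open>r\<close> is a differentiable first
  approximation of \<open>y - y z0\<close>, and the remaining error is a vanishing factor times
  \<open>y z - y z0\<close>. This yields differentiability of Christoffel symbols, of pulled back
  complex structures and of frame coefficients without differentiating an inverse matrix.\<close>

lemma differentiable_linear_solution:
  fixes G :: "'a::euclidean_space \<Rightarrow> 'b::euclidean_space \<Rightarrow> 'c::euclidean_space"
  assumes S: "open S" "z0 \<in> S" and lin: "\<And>z. z \<in> S \<Longrightarrow> linear (G z)"
    and G: "\<And>v. (\<lambda>z. G z v) differentiable (at z0)"
    and K: "K differentiable (at z0)" and inj: "inj (G z0)"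
    and sol: "\<And>z. z \<in> S \<Longrightarrow> G z (y z) = K z"
  shows "y differentiable (at z0)"
proof -
  obtain L where L: "linear L" "L \<circ> G z0 = id"
    using linear_injective_left_inverse[OF lin[OF S(2)] inj] by blast
  have LG: "L (G z0 v) = v" for v using L(2) by (metis comp_def id_apply)
  define r where "r z = L (K z - G z (y z0))" for z
  have "(\<lambda>z. K z - G z (y z0)) differentiable (at z0)"
    using G K by (intro differentiable_diff) auto
  then obtain D where D: "((\<lambda>z. K z - G z (y z0)) has_derivative D) (at z0)" by (auto simp: differentiable_def)
  define r' where "r' h = L (D h)" for h
  have r': "(r has_derivative r') (at z0)"
    unfolding r_def[abs_def] r'_def[abs_def]
    using bounded_linear.has_derivative[OF _ D] L(1) linear_conv_bounded_linear by blast
  have r0: "r z0 = 0" using sol[OF S(2)] L(1) by (simp add: r_def linear_0)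
  \<comment> \<open>Dominates the norm of \<open>L \<circ> (G z - G z0)\<close>; its limit only
    involves the finitely many basis vectors.\<close>
  define m where "m z = (\<Sum>b\<in>Basis. norm (L (G z b - G z0 b)))" for z
  have m0: "(m \<longlongrightarrow> 0) (at z0)"
  proof -
    have "((\<lambda>z. L (G z b - G z0 b)) \<longlongrightarrow> L (G z0 b - G z0 b)) (at z0)" for b
      using linear_continuous_at[of L "G z0 b - G z0 b"] differentiable_imp_continuous_within[OF G, of b] L(1)
      by (intro isCont_tendsto_compose[of _ L] tendsto_diff)
        (auto simp: linear_continuous_at linear_conv_bounded_linear continuous_within)
    then have "(m \<longlongrightarrow> (\<Sum>b\<in>(Basis::'b set). norm (L (G z0 b - G z0 b)))) (at z0)"
      unfolding m_def by (intro tendsto_sum tendsto_norm)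
    then show ?thesis using L(1) by (simp add: linear_0)
  qed
  have mb: "norm (L (G z v - G z0 v)) \<le> m z * norm v" if "z \<in> S" for z v
  proof -
    have lin2: "linear (\<lambda>v. L (G z v - G z0 v))"
      using linear_compose[OF linear_compose_sub[OF lin[OF that] lin[OF S(2)]] L(1)] by (simp add: o_def)
    show ?thesis using norm_linear_le_sum[OF lin2] by (simp add: m_def)
  qed
  define q where "q z = y z - y z0 - r z" for z
  have qb: "norm (q z) \<le> m z * norm (y z - y z0)" if "z \<in> S" for z
  proof -
    have "r z = L (G z (y z) - G z (y z0))" using sol[OF that] by (simp add: r_def)
    also have "\<dots> = L (G z (y z - y z0))" using lin[OF that] by (simp add: linear_diff)
    finally have "q z = L (G z0 (y z - y z0)) - L (G z (y z - y z0))" by (simp add: q_def LG)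
    then have "norm (q z) = norm (L (G z (y z - y z0) - G z0 (y z - y z0)))"
      using L(1) by (simp add: linear_diff norm_minus_commute)
    then show ?thesis using mb[OF that] by simp
  qed
  have ev: "eventually (\<lambda>z. norm (q z) \<le> 2 * m z * norm (r z)) (at z0)"
  proof -
    have "eventually (\<lambda>z. z \<in> S) (at z0)" using S by (simp add: eventually_at_topological) blast
    \<comment> \<open>Below \<open>1/2\<close> the term \<open>m z * norm (y z - y z0)\<close> can
      be absorbed, which gives \<open>norm (y z - y z0) \<le> 2 * norm (r z)\<close>.\<close>
    moreover have "eventually (\<lambda>z. m z < 1/2) (at z0)" by (rule order_tendstoD(2)[OF m0]) simp
    ultimately show ?thesis
    proof eventually_elim
      case (elim z)
      have mz: "0 \<le> m z" unfolding m_def by (intro sum_nonneg) auto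
      have "norm (y z - y z0) \<le> norm (q z) + norm (r z)"
        using norm_triangle_ineq[of "q z" "r z"] by (simp add: q_def)
      also have "norm (q z) \<le> (1/2) * norm (y z - y z0)"
        using qb[OF elim(1)] elim(2) mult_right_mono[of "m z" "1/2" "norm (y z - y z0)"] by simp
      finally have "norm (y z - y z0) \<le> 2 * norm (r z)" by simp
      then have "m z * norm (y z - y z0) \<le> m z * (2 * norm (r z))" using mz by (rule mult_left_mono)
      then show ?case using qb[OF elim(1)] by simp
    qed
  qed
  have "(q has_derivative (\<lambda>h. 0)) (at z0)"
  proof -
    have rl: "((\<lambda>z. norm (r z - r z0 - r' (z - z0)) / norm (z - z0)) \<longlongrightarrow> 0) (at z0)"
      using r' by (simp add: has_derivative_iff_norm)
    obtain C where C: "\<And>h. norm (r' h) \<le> C * norm h"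
      using bounded_linear.bounded[OF has_derivative_bounded_linear[OF r']] by (metis mult.commute)
    have "((\<lambda>z. norm (q z - q z0 - 0) / norm (z - z0)) \<longlongrightarrow> 0) (at z0)"
    proof (rule Lim_null_comparison)
      show "eventually (\<lambda>z. norm (norm (q z - q z0 - 0) / norm (z - z0))
          \<le> 2 * m z * (norm (r z - r z0 - r' (z - z0)) / norm (z - z0) + C)) (at z0)"
        using ev eventually_neq_at_within[of z0]
      proof eventually_elim
        case (elim z)
        have nz: "norm (z - z0) > 0" using elim by simp
        have mz: "0 \<le> m z" unfolding m_def by (intro sum_nonneg) auto
        have "norm (r z) \<le> norm (r z - r z0 - r' (z - z0)) + C * norm (z - z0)"
          using norm_triangle_sub[of "r z" "r' (z - z0)"] C[of "z - z0"] r0 by simp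
        then have "norm (r z) / norm (z - z0) \<le> norm (r z - r z0 - r' (z - z0)) / norm (z - z0) + C"
          using nz by (simp add: field_simps)
        then have "2 * m z * (norm (r z) / norm (z - z0)) \<le> 2 * m z * (norm (r z - r z0 - r' (z - z0)) / norm (z - z0) + C)"
          using mz by (intro mult_left_mono) auto
        moreover have "norm (q z) / norm (z - z0) \<le> 2 * m z * (norm (r z) / norm (z - z0))"
          using elim(1) nz by (simp add: field_simps)
        ultimately show ?case by (simp add: q_def r0)
      qed
      have "((\<lambda>z. 2 * m z * (norm (r z - r z0 - r' (z - z0)) / norm (z - z0) + C)) \<longlongrightarrow> 2 * 0 * (0 + C)) (at z0)"
        by (intro tendsto_intros m0 rl)
      then show "((\<lambda>z. 2 * m z * (norm (r z - r z0 - r' (z - z0)) / norm (z - z0) + C)) \<longlongrightarrow> 0) (at z0)" by simp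
    qed
    then show ?thesis by (simp add: has_derivative_iff_norm)
  qed
  then have "((\<lambda>z. q z + r z + y z0) has_derivative (\<lambda>h. 0 + r' h + 0)) (at z0)"
    by (intro has_derivative_add r' has_derivative_const)
  then have "(y has_derivative (\<lambda>h. 0 + r' h + 0)) (at z0)" by (simp add: q_def)
  then show ?thesis by (auto simp: differentiable_def)
qed

section \<open>Maps of class C^k: sums, products and affine substitutions\<close>

lemma Ck_on_imp_continuous_on: "Ck_on k S f \<Longrightarrow> continuous_on S f"
  by (cases k) (auto intro!: differentiable_imp_continuous_on simp: differentiable_on_def
      differentiable_at_withinI)

lemma Ck_on_SucD: "Ck_on (Suc k) S f \<Longrightarrow> Ck_on k S f"
proof (induction k arbitrary: f)
  case 0
  then show ?case using Ck_on_imp_continuous_on by fastforce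
next
  case (Suc k)
  then show ?case by (metis Ck_on.simps(2))
qed

lemma Ck_on_subset: "Ck_on k S f \<Longrightarrow> T \<subseteq> S \<Longrightarrow> Ck_on k T f"
  by (induction k arbitrary: f) (auto intro: continuous_on_subset)

lemma Ck_on_cong:
  assumes "open S" and "\<And>x. x \<in> S \<Longrightarrow> f x = g x" and "Ck_on k S f"
  shows "Ck_on k S g"
  using assms(2,3)
proof (induction k arbitrary: f g)
  case 0
  then show ?case by (simp cong: continuous_on_cong)
next
  case (Suc k)
  have "Dir v f x = Dir v g x" if "x \<in> S" for v x
    using frechet_derivative_cong_open[OF assms(1) that, of f g] Suc.prems by simp
  then have "Ck_on k S (\<lambda>x. Dir v g x)" for v
    using Suc.IH[of "\<lambda>x. Dir v f x" "\<lambda>x. Dir v g x"] Suc.prems by simp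
  moreover have "g differentiable (at x)" if "x \<in> S" for x
    using differentiable_cong_open[OF assms(1) that, of f g] Suc.prems that by simp
  ultimately show ?case by simp
qed

text \<open>The derivative of an affine map is constant, so the induction hypothesis applies
  directly to \<open>Dir (L v) f\<close>. Affine substitutions restrict a map to a factor of a
  product chart, to a line, or to a subspace.\<close>

lemma Ck_on_compose_affine:
  assumes S: "open S" and L: "bounded_linear L" and f: "Ck_on k S f"
    and T: "T \<subseteq> (\<lambda>x. a + L x) -` S" "open T"
  shows "Ck_on k T (\<lambda>x. f (a + L x))"
  using f
proof (induction k arbitrary: f)
  case 0
  have "continuous_on T (\<lambda>x. a + L x)"
    using L by (intro continuous_on_add continuous_on_const linear_continuous_on)
  then show ?case using 0 T by (auto intro!: continuous_on_compose2[of S f])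
next
  case (Suc k)
  have der: "((\<lambda>x. f (a + L x)) has_derivative (\<lambda>v. Dir (L v) f (a + L x))) (at x)" if "x \<in> T" for x
  proof -
    have 1: "((\<lambda>x. a + L x) has_derivative L) (at x)"
      using has_derivative_add[OF has_derivative_const bounded_linear_imp_has_derivative[OF L]] by simp
    have "f differentiable (at (a + L x))" using Suc.prems T that by auto
    from diff_chain_at[OF 1 has_derivative_frechet[OF this]] show ?thesis by (simp add: o_def)
  qed
  have "Ck_on k T (\<lambda>x. Dir v (\<lambda>x. f (a + L x)) x)" for v
  proof (rule Ck_on_cong[OF T(2)])
    show "Ck_on k T (\<lambda>x. Dir (L v) f (a + L x))" using Suc.IH[of "\<lambda>x. Dir (L v) f x"] Suc.prems by simp
  next
    fix x assume "x \<in> T"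
    then show "Dir (L v) f (a + L x) = Dir v (\<lambda>x. f (a + L x)) x"
      by (simp add: frechet_derivative_eq[OF der])
  qed
  then show ?case using der by (auto simp: differentiable_def)
qed

lemma Ck_on_const: "Ck_on k S (\<lambda>x. c)"
  by (induction k arbitrary: c) (auto simp: frechet_derivative_const)

lemma Ck_on_add:
  assumes "open S" "Ck_on k S f" "Ck_on k S g" shows "Ck_on k S (\<lambda>x. f x + g x)"
  using assms(2,3)
proof (induction k arbitrary: f g)
  case 0
  then show ?case by (auto intro: continuous_on_add)
next
  case (Suc k)
  have der: "((\<lambda>x. f x + g x) has_derivative (\<lambda>v. Dir v f x + Dir v g x)) (at x)" if "x \<in> S" for x
    by (rule has_derivative_add[OF has_derivative_frechet has_derivative_frechet]) (use Suc.prems that in auto)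
  have "Ck_on k S (\<lambda>x. Dir v (\<lambda>x. f x + g x) x)" for v
    by (rule Ck_on_cong[OF assms(1) _ Suc.IH[of "\<lambda>x. Dir v f x" "\<lambda>x. Dir v g x"]])
      (use Suc.prems in \<open>auto simp: frechet_derivative_eq[OF der]\<close>)
  then show ?case using der by (auto simp: differentiable_def)
qed

lemma Ck_on_sum:
  assumes "open S" "\<And>i. i \<in> I \<Longrightarrow> Ck_on k S (f i)" shows "Ck_on k S (\<lambda>x. \<Sum>i\<in>I. f i x)"
  using assms(2)
  by (induction I rule: infinite_finite_induct) (auto intro: Ck_on_const Ck_on_add[OF assms(1)])

lemma Ck_on_bilinear:
  assumes S: "open S" and B: "bounded_bilinear B" and "Ck_on k S f" "Ck_on k S g"
  shows "Ck_on k S (\<lambda>x. B (f x) (g x))"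
  using assms(3,4)
proof (induction k arbitrary: f g)
  case 0
  then show ?case using bounded_bilinear.continuous_on[OF B] by auto
next
  case (Suc k)
  have der: "((\<lambda>x. B (f x) (g x)) has_derivative (\<lambda>v. B (f x) (Dir v g x) + B (Dir v f x) (g x))) (at x)"
    if "x \<in> S" for x
    by (rule bounded_bilinear.FDERIV[OF B has_derivative_frechet has_derivative_frechet])
      (use Suc.prems that in auto)
  have "Ck_on k S (\<lambda>x. Dir v (\<lambda>x. B (f x) (g x)) x)" for v
  proof (rule Ck_on_cong[OF S])
    show "Ck_on k S (\<lambda>x. B (f x) (Dir v g x) + B (Dir v f x) (g x))"
      using Suc.prems Ck_on_SucD[of k S f] Ck_on_SucD[of k S g]
      by (intro Ck_on_add[OF S] Suc.IH) auto
  qed (simp add: frechet_derivative_eq[OF der])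
  then show ?case using der by (auto simp: differentiable_def)
qed

lemma Ck_on_bounded_linear:
  assumes S: "open S" and L: "bounded_linear L" and "Ck_on k S f"
  shows "Ck_on k S (\<lambda>x. L (f x))"
  using assms(3)
proof (induction k arbitrary: f)
  case 0
  then show ?case using bounded_linear.continuous_on[OF L] by auto
next
  case (Suc k)
  have der: "((\<lambda>x. L (f x)) has_derivative (\<lambda>v. L (Dir v f x))) (at x)" if "x \<in> S" for x
    by (rule bounded_linear.has_derivative[OF L has_derivative_frechet]) (use Suc.prems that in auto)
  have "Ck_on k S (\<lambda>x. Dir v (\<lambda>x. L (f x)) x)" for v
    by (rule Ck_on_cong[OF S _ Suc.IH[of "\<lambda>x. Dir v f x"]])
      (use Suc.prems in \<open>auto simp: frechet_derivative_eq[OF der]\<close>)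
  then show ?case using der by (auto simp: differentiable_def)
qed

lemma Ck_on_mult:
  fixes f g :: "'a::euclidean_space \<Rightarrow> complex"
  shows "open S \<Longrightarrow> Ck_on k S f \<Longrightarrow> Ck_on k S g \<Longrightarrow> Ck_on k S (\<lambda>x. f x * g x)"
  by (rule Ck_on_bilinear[OF _ bounded_bilinear_mult])

lemma Ck_on_prod:
  fixes f :: "'i \<Rightarrow> 'a::euclidean_space \<Rightarrow> complex"
  assumes "open S" "\<And>i. i \<in> I \<Longrightarrow> Ck_on k S (f i)" shows "Ck_on k S (\<lambda>x. \<Prod>i\<in>I. f i x)"
  using assms(2)
  by (induction I rule: infinite_finite_induct) (auto intro: Ck_on_const Ck_on_mult[OF assms(1)])

lemma Ck_on_det:
  fixes Z :: "'a::euclidean_space \<Rightarrow> complex^'n^'n"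
  assumes "open S" "\<And>i j. Ck_on k S (\<lambda>x. Z x $ i $ j)"
  shows "Ck_on k S (\<lambda>x. det (Z x))"
  unfolding det_def by (intro Ck_on_sum Ck_on_mult Ck_on_prod Ck_on_const assms)

lemma smooth_onD: "smooth_on S f \<Longrightarrow> Ck_on k S f" by (simp add: smooth_on_def)

lemma smooth_on_differentiable: "smooth_on S f \<Longrightarrow> x \<in> S \<Longrightarrow> f differentiable (at x)"
  using smooth_onD[of S f "Suc 0"] by simp

lemma smooth_on_Dir: "smooth_on S f \<Longrightarrow> smooth_on S (\<lambda>x. Dir v f x)"
  unfolding smooth_on_def by (metis Ck_on.simps(2))

lemma smooth_on_subset: "smooth_on S f \<Longrightarrow> T \<subseteq> S \<Longrightarrow> smooth_on T f"
  unfolding smooth_on_def using Ck_on_subset by blast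

lemma smooth_on_cong:
  "open S \<Longrightarrow> (\<And>x. x \<in> S \<Longrightarrow> f x = g x) \<Longrightarrow> smooth_on S f \<Longrightarrow> smooth_on S g"
  unfolding smooth_on_def using Ck_on_cong by blast

lemma smooth_on_compose_affine:
  assumes "open S" "bounded_linear L" "smooth_on S f" "T \<subseteq> (\<lambda>x. a + L x) -` S" "open T"
  shows "smooth_on T (\<lambda>x. f (a + L x))"
  using assms Ck_on_compose_affine unfolding smooth_on_def by blast

subsection \<open>Determinants and traces\<close>

lemma has_derivative_prod_diag:
  fixes A :: "'a::euclidean_space \<Rightarrow> 'i \<Rightarrow> complex"
  assumes "\<And>i. i \<in> I \<Longrightarrow> ((\<lambda>z. A z i) has_derivative A' i) (at z0)" "finite I"
  shows "((\<lambda>z. \<Prod>i\<in>I. A z i) has_derivative (\<lambda>h. \<Sum>i\<in>I. A' i h * (\<Prod>j\<in>I - {i}. A z0 j))) (at z0)"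
  using has_derivative_prod[of I "\<lambda>i z. A z i" A' z0 UNIV] assms by simp

text \<open>In the Leibniz expansion a permutation other than the identity moves at least two
  indices, so after one factor has been differentiated a zero off-diagonal entry of
  \<open>mat 1\<close> is still present.\<close>

lemma has_derivative_det_at_1:
  fixes A :: "'a::euclidean_space \<Rightarrow> complex^'n^'n"
  assumes A: "\<And>i j. ((\<lambda>z. A z $ i $ j) has_derivative (\<lambda>h. A' h $ i $ j)) (at z0)"
    and A0: "A z0 = mat 1"
  shows "((\<lambda>z. det (A z)) has_derivative (\<lambda>h. trace (A' h))) (at z0)"
proof -
  let ?P = "{p. p permutes (UNIV::'n set)}"
  have fin: "finite ?P" by (simp add: finite_permutations)
  have d: "((\<lambda>z. det (A z)) has_derivative (\<lambda>h. \<Sum>p\<in>?P. of_int (sign p) *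
      (\<Sum>i\<in>UNIV. A' h $ i $ p i * (\<Prod>j\<in>UNIV - {i}. A z0 $ j $ p j)))) (at z0)"
    unfolding det_def
    by (intro has_derivative_sum has_derivative_mult_right has_derivative_prod_diag A) auto
  have "(\<Sum>p\<in>?P. of_int (sign p) *
      (\<Sum>i\<in>UNIV. A' h $ i $ p i * (\<Prod>j\<in>UNIV - {i}. A z0 $ j $ p j))) = trace (A' h)" for h
  proof -
    have z: "(\<Prod>j\<in>UNIV - {i}. A z0 $ j $ p j) = 0" if p: "p permutes UNIV" "p \<noteq> id" for p and i :: 'n
    proof -
      obtain k where k: "p k \<noteq> k" using p(2) by (auto simp: fun_eq_iff)
      have "p (p k) \<noteq> p k" using k permutes_inj[OF p(1)] by (metis injD)
      then obtain j where j: "p j \<noteq> j" "j \<noteq> i" using k by metis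
      then have "A z0 $ j $ p j = 0" by (simp add: A0 mat_def)
      then show ?thesis using j by (intro prod_zero) auto
    qed
    have "(\<Sum>p\<in>?P. of_int (sign p) *
      (\<Sum>i\<in>UNIV. A' h $ i $ p i * (\<Prod>j\<in>UNIV - {i}. A z0 $ j $ p j))) =
      (\<Sum>p\<in>{id}. of_int (sign p) *
      (\<Sum>i\<in>UNIV. A' h $ i $ p i * (\<Prod>j\<in>UNIV - {i}. A z0 $ j $ p j)))"
      by (rule sum.mono_neutral_right[OF fin]) (auto simp: permutes_id z)
    also have "\<dots> = trace (A' h)" by (simp add: trace_def A0 mat_def sign_id)
    finally show ?thesis .
  qed
  with d show ?thesis by simp
qed

lemma matrix_inv_works:
  fixes A :: "'a::field^'n^'n"
  assumes "invertible A"
  shows "matrix_inv A ** A = mat 1" "A ** matrix_inv A = mat 1"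
proof -
  have "A ** matrix_inv A = mat 1 \<and> matrix_inv A ** A = mat 1"
    unfolding matrix_inv_def by (rule someI_ex) (use assms in \<open>auto simp: invertible_def\<close>)
  then show "matrix_inv A ** A = mat 1" "A ** matrix_inv A = mat 1" by auto
qed

lemma has_derivative_matrix_mult_entry:
  fixes A :: "'a::euclidean_space \<Rightarrow> complex^'n^'n"
  assumes A: "\<And>i j. ((\<lambda>z. A z $ i $ j) has_derivative (\<lambda>h. A' h $ i $ j)) (at z0)"
  shows "((\<lambda>z. (C ** A z) $ i $ j) has_derivative (\<lambda>h. (C ** A' h) $ i $ j)) (at z0)"
  unfolding matrix_matrix_mult_def
  by (simp, intro has_derivative_sum has_derivative_mult_right A)

text \<open>Jacobi's formula follows from the case of the identity matrix by multiplying with the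
  constant matrix \<open>matrix_inv (A z0)\<close>.\<close>

lemma has_derivative_det:
  fixes A :: "'a::euclidean_space \<Rightarrow> complex^'n^'n"
  assumes A: "\<And>i j. ((\<lambda>z. A z $ i $ j) has_derivative (\<lambda>h. A' h $ i $ j)) (at z0)"
    and nz: "det (A z0) \<noteq> 0"
  shows "((\<lambda>z. det (A z)) has_derivative (\<lambda>h. det (A z0) * trace (matrix_inv (A z0) ** A' h))) (at z0)"
proof -
  have inv: "invertible (A z0)" using nz invertible_det_nz by blast
  let ?C = "matrix_inv (A z0)"
  have C: "?C ** A z0 = mat 1" "A z0 ** ?C = mat 1"
    using matrix_inv_works[OF inv] by auto
  have "((\<lambda>z. det (?C ** A z)) has_derivative (\<lambda>h. trace (?C ** A' h))) (at z0)"
    by (rule has_derivative_det_at_1[OF has_derivative_matrix_mult_entry[OF A] C(1)])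
  then have "((\<lambda>z. det (A z0) * det (?C ** A z)) has_derivative (\<lambda>h. det (A z0) * trace (?C ** A' h))) (at z0)"
    by (rule has_derivative_mult_right)
  moreover have "det (A z0) * det (?C ** A z) = det (A z)" for z
  proof -
    have "det (A z0) * det ?C = 1" using C(2) by (metis det_I det_mul)
    then show ?thesis by (simp add: det_mul mult.assoc[symmetric])
  qed
  ultimately show ?thesis by simp
qed

lemma has_derivative_ln_norm:
  fixes d :: "'a::euclidean_space \<Rightarrow> complex"
  assumes d: "(d has_derivative d') (at z0)" and nz: "d z0 \<noteq> 0"
  shows "((\<lambda>z. ln (norm (d z))) has_derivative (\<lambda>h. Re (d' h / d z0))) (at z0)"
proof -
  have "((\<lambda>z. ln (norm (d z))) has_derivative (\<lambda>h. (1 / norm (d z0)) * ((d z0 \<bullet> d' h) / norm (d z0)))) (at z0)"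
  proof -
    have 1: "((\<lambda>z. norm (d z)) has_derivative (\<lambda>h. d' h \<bullet> sgn (d z0))) (at z0)"
      using has_derivative_compose[OF d has_derivative_norm[OF nz]] by simp
    have "((\<lambda>z. ln (norm (d z))) has_derivative (\<lambda>h. (d' h \<bullet> sgn (d z0)) * inverse (norm (d z0)))) (at z0)"
      using has_derivative_ln[OF _ 1] nz by (simp add: mult.commute)
    then show ?thesis
      by (simp add: sgn_div_norm inverse_eq_divide inner_commute mult.commute)
  qed
  moreover have "(1 / norm (d z0)) * ((d z0 \<bullet> d' h) / norm (d z0)) = Re (d' h / d z0)" for h
    using nz cmod_power2[of "d z0"]
    by (simp add: Re_divide inner_complex_def power2_eq_square mult.commute)
  ultimately show ?thesis by simp
qed

lemma has_derivative_ln_det: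
  fixes A :: "'a::euclidean_space \<Rightarrow> complex^'n^'n"
  assumes A: "\<And>i j. ((\<lambda>z. A z $ i $ j) has_derivative (\<lambda>h. A' h $ i $ j)) (at z0)"
    and nz: "det (A z0) \<noteq> 0"
  shows "((\<lambda>z. ln (norm (det (A z)))) has_derivative (\<lambda>h. Re (trace (matrix_inv (A z0) ** A' h)))) (at z0)"
  using has_derivative_ln_norm[OF has_derivative_det[OF A nz] nz] nz by simp

definition real_trace :: "('a::euclidean_space \<Rightarrow> 'a) \<Rightarrow> real" where
  "real_trace f = (\<Sum>b\<in>Basis. f b \<bullet> b)"

lemma real_trace_comp_commute:
  fixes f :: "'b::euclidean_space \<Rightarrow> 'a::euclidean_space" and g :: "'a \<Rightarrow> 'b"
  assumes "linear f" "linear g"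
  shows "real_trace (\<lambda>v. f (g v)) = real_trace (\<lambda>v. g (f v))"
proof -
  have f: "f x \<bullet> b = (\<Sum>c\<in>Basis. (x \<bullet> c) * (f c \<bullet> b))" for x b
  proof -
    have "f x = f (\<Sum>c\<in>Basis. (x \<bullet> c) *\<^sub>R c)" by (simp add: euclidean_representation)
    also have "\<dots> = (\<Sum>c\<in>Basis. (x \<bullet> c) *\<^sub>R f c)" using assms(1) by (simp add: linear_sum linear_scale)
    finally show ?thesis by (simp add: inner_sum_left)
  qed
  have g: "g x \<bullet> b = (\<Sum>c\<in>Basis. (x \<bullet> c) * (g c \<bullet> b))" for x b
  proof -
    have "g x = g (\<Sum>c\<in>Basis. (x \<bullet> c) *\<^sub>R c)" by (simp add: euclidean_representation)
    also have "\<dots> = (\<Sum>c\<in>Basis. (x \<bullet> c) *\<^sub>R g c)" using assms(2) by (simp add: linear_sum linear_scale)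
    finally show ?thesis by (simp add: inner_sum_left)
  qed
  have "real_trace (\<lambda>v. f (g v)) = (\<Sum>b\<in>Basis. \<Sum>c\<in>Basis. (g b \<bullet> c) * (f c \<bullet> b))"
    unfolding real_trace_def by (intro sum.cong refl f)
  also have "\<dots> = (\<Sum>c\<in>Basis. \<Sum>b\<in>Basis. (f c \<bullet> b) * (g b \<bullet> c))"
    by (subst sum.swap) (simp add: mult.commute)
  also have "\<dots> = real_trace (\<lambda>v. g (f v))"
    unfolding real_trace_def by (intro sum.cong refl g[symmetric])
  finally show ?thesis .
qed

lemma real_trace_minus: "real_trace (\<lambda>v. - f v) = - real_trace f"
  by (simp add: real_trace_def sum_negf)

lemma real_trace_diff: "real_trace (\<lambda>v. f v - g v) = real_trace f - real_trace g"
  by (simp add: real_trace_def inner_diff_left sum_subtractf)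

lemma real_trace_conjugate:
  fixes f :: "'a::euclidean_space \<Rightarrow> 'a" and p :: "'b::euclidean_space \<Rightarrow> 'a"
  assumes "linear f" "linear p" "linear q" "\<And>v. p (q v) = v"
  shows "real_trace (\<lambda>v. q (f (p v))) = real_trace f"
  using real_trace_comp_commute[OF assms(3) linear_compose[OF assms(2,1)]] assms(4)
  by (simp add: o_def)

subsection \<open>The constant rank theorem\<close>

lemma linear_inj_on_of_dim_le:
  fixes R :: "'b::euclidean_space \<Rightarrow> 'a::euclidean_space"
  assumes R: "linear R" and V: "subspace V" and le: "dim V \<le> dim (R ` V)" and v: "v \<in> V" "R v = 0"
  shows "v = 0"
proof -
  obtain B where B: "B \<subseteq> V" "independent B" "V \<subseteq> span B" "card B = dim V"
    using basis_exists by blast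
  have fB: "finite B" using B(2) independent_imp_finite by blast
  have sB: "span B = V" using B V span_minimal by blast
  have RB: "R ` V = span (R ` B)" using sB linear_span_image[OF R] by blast
  have "dim (R ` V) \<le> card (R ` B)" unfolding RB using dim_le_card'[of "R ` B"] fB by simp
  then have c: "card (R ` B) = card B" using le B(4) card_image_le[OF fB, of R] by linarith
  then have injB: "inj_on R B" using fB eq_card_imp_inj_on by blast
  have "dim (span (R ` B)) \<ge> card (R ` B)" using le B(4) RB c by simp
  then have "independent (R ` B)"
    using card_le_dim_spanning[of "R ` B" "span (R ` B)"] fB
    by (simp add: span_superset)
  then have "inj_on R (span B)"
    using linear_inj_on_span_independent_image[OF R] injB by blast
  then show ?thesis using v sB linear_0[OF R] V by (metis inj_onD subspace_0)
qed

text \<open>Near \<open>x0\<close> the image of \<open>f\<close> is parametrized by the affine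
  subspace \<open>x0 + range R\<close>, on which \<open>h\<close> is a left inverse of
  \<open>f\<close> that is differentiable as a map of the ambient space. \<open>R\<close> is a
  generalized inverse of the derivative \<open>E\<close>, so \<open>range R\<close> is a complement
  of the kernel of \<open>E\<close>. The rank cannot drop near \<open>x0\<close>, so the upper bound
  amounts to constant rank.\<close>

lemma constant_rank:
  fixes f :: "'a::euclidean_space \<Rightarrow> 'b::euclidean_space"
  assumes S: "open S" "x0 \<in> S" and f: "Ck_on 1 S f"
    and E: "E = frechet_derivative f (at x0)"
    and rank: "\<And>x. x \<in> S \<Longrightarrow> dim (range (frechet_derivative f (at x))) \<le> dim (range E)"
    and R: "linear R" and ERE: "\<And>v. E (R (E v)) = E v" and RER: "\<And>w. R (E (R w)) = R w"
  obtains O' h where "open O'" "x0 \<in> O'" "O' \<subseteq> S"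
    "\<And>x. x \<in> O' \<Longrightarrow> h (f x) \<in> range R \<and> x0 + h (f x) \<in> O' \<and> f (x0 + h (f x)) = f x"
    "\<And>t. t \<in> range R \<Longrightarrow> x0 + t \<in> O' \<Longrightarrow> h (f (x0 + t)) = t"
    "\<And>x. x \<in> O' \<Longrightarrow> h differentiable (at (f x))"
proof -
  have df: "(f has_derivative frechet_derivative f (at x)) (at x)" if "x \<in> S" for x
    using f that has_derivative_frechet by auto
  have linE: "linear E" using df[OF S(2)] E has_derivative_linear by blast
  have bE: "bounded_linear E" and bR: "bounded_linear R" using linE R linear_conv_bounded_linear by auto
  have REl: "linear (\<lambda>x. R (E x))" using linear_compose[OF linE R] by (simp add: o_def)
  have bRE: "bounded_linear (\<lambda>x. R (E x))" using REl linear_conv_bounded_linear by blast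
  \<comment> \<open>Straightening coordinates: the value of \<open>f\<close> is recorded along
    \<open>range R\<close>, and the point itself along the kernel of \<open>E\<close>. The
    derivative at \<open>x0\<close> is \<open>R E + (1 - R E) = 1\<close>.\<close>
  define \<Phi> where "\<Phi> x = R (f x - f x0) + ((x - x0) - R (E (x - x0)))" for x
  define \<Phi>' where "\<Phi>' x v = R (frechet_derivative f (at x) v) + (v - R (E v))" for x v
  have d\<Phi>: "(\<Phi> has_derivative \<Phi>' x) (at x)" if "x \<in> S" for x
  proof -
    have 1: "((\<lambda>x. R (f x - f x0)) has_derivative (\<lambda>v. R (frechet_derivative f (at x) v - 0))) (at x)"
      by (intro bounded_linear.has_derivative[OF bR] has_derivative_diff df that has_derivative_const)
    have 2: "((\<lambda>x. (x - x0) - R (E (x - x0))) has_derivative (\<lambda>v. (v - 0) - R (E (v - 0)))) (at x)"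
      by (intro has_derivative_diff has_derivative_ident has_derivative_const bounded_linear.has_derivative[OF bRE])
    show ?thesis using has_derivative_add[OF 1 2] unfolding \<Phi>_def[abs_def] \<Phi>'_def[abs_def] by simp
  qed
  have b\<Phi>: "bounded_linear (\<Phi>' x)" if "x \<in> S" for x using d\<Phi>[OF that] has_derivative_bounded_linear by blast
  define F' where "F' x = Blinfun (\<Phi>' x)" for x
  have F': "blinfun_apply (F' x) = \<Phi>' x" if "x \<in> S" for x
    unfolding F'_def using b\<Phi>[OF that] by (simp add: bounded_linear_Blinfun_apply)
  have contF: "continuous_on S F'"
  proof (rule continuous_on_blinfun_componentwise)
    fix i :: 'a
    have "continuous_on S (\<lambda>x. Dir i f x)" using f by simp
    then have "continuous_on S (\<lambda>x. \<Phi>' x i)"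
      unfolding \<Phi>'_def by (intro continuous_on_add continuous_on_const bounded_linear.continuous_on[OF bR])
    then show "continuous_on S (\<lambda>x. F' x i)" using F' by (simp cong: continuous_on_cong)
  qed
  have id: "id_blinfun o\<^sub>L F' x0 = id_blinfun"
  proof (rule blinfun_eqI)
    fix v show "blinfun_apply (id_blinfun o\<^sub>L F' x0) v = blinfun_apply id_blinfun v"
      using F'[OF S(2)] by (simp add: \<Phi>'_def E[symmetric])
  qed
  obtain U V \<Psi> \<Psi>' where U: "open U" "U \<subseteq> S" "x0 \<in> U" and V: "open V" "\<Phi> x0 \<in> V"
    and hom: "homeomorphism U V \<Phi> \<Psi>"
    and d\<Psi>: "\<And>y. y \<in> V \<Longrightarrow> (\<Psi> has_derivative (\<Psi>' y)) (at y)"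
    using inverse_function_theorem[OF S(1) _ contF S(2) id, of \<Phi>] d\<Phi> F' by metis
  have \<Phi>0: "\<Phi> x0 = 0" unfolding \<Phi>_def using R linE by (simp add: linear_0)
  obtain r where r: "r > 0" "ball 0 r \<subseteq> V" using V \<Phi>0 by (metis openE)
  define P where "P y = R (E y)" for y
  have linP: "linear P" using REl by (simp add: P_def[abs_def])
  have PP: "P (P y) = P y" for y using RER by (simp add: P_def)
  \<comment> \<open>Convex and mapped into itself by the projection \<open>P\<close>, so that the
    segment from \<open>y\<close> to \<open>P y\<close> stays where \<open>\<Psi>\<close> is
    differentiable.\<close>
  define D where "D = ball 0 r \<inter> P -` ball 0 r"
  have contP: "continuous_on UNIV P" using linP linear_continuous_on linear_conv_bounded_linear by blast
  have openD: "open D" unfolding D_def using contP by (intro open_Int open_ball open_vimage)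
  have DV: "D \<subseteq> V" using r by (auto simp: D_def)
  have DP: "P y \<in> D" if "y \<in> D" for y using that PP by (auto simp: D_def)
  have convD: "convex D"
    unfolding D_def using convex_linear_vimage[OF linP convex_ball] by (intro convex_Int convex_ball) auto
  have D0: "0 \<in> D" using r linP by (simp add: D_def linear_0)
  define O' where "O' = U \<inter> \<Phi> -` D"
  have \<Psi>\<Phi>: "\<Psi> (\<Phi> x) = x" if "x \<in> U" for x using hom that by (simp add: homeomorphism_def)
  have \<Phi>\<Psi>: "\<Phi> (\<Psi> y) = y" if "y \<in> V" for y using hom that by (simp add: homeomorphism_def)
  have \<Psi>U: "\<Psi> y \<in> U" if "y \<in> V" for y using hom that by (auto simp: homeomorphism_def)
  have openO: "open O'"
    using continuous_open_preimage[OF _ U(1) openD] hom by (simp add: O'_def homeomorphism_def)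
  have x0O: "x0 \<in> O'" using U(3) \<Phi>0 D0 by (simp add: O'_def)
  have \<Psi>O: "\<Psi> y \<in> O'" if "y \<in> D" for y using that DV \<Psi>U \<Phi>\<Psi> by (auto simp: O'_def)
  have R\<Phi>: "R (f x - f x0) = P (\<Phi> x)" for x
    unfolding \<Phi>_def P_def using RER R linE by (simp add: linear_add linear_diff)
  \<comment> \<open>In the coordinates \<open>\<Psi>\<close> the map \<open>f\<close> depends on \<open>P y\<close> only: its derivative kills \<open>ker P\<close>,
    because \<open>R\<close> is injective on the range of the derivative.\<close>
  have key: "f (\<Psi> y) = f (\<Psi> (P y))" if y: "y \<in> D" for y
  proof -
    define c where "c s = y + s *\<^sub>R (P y - y)" for s :: real
    have cD: "c s \<in> D" if "0 \<le> s" "s \<le> 1" for s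
    proof -
      have "c s = (1 - s) *\<^sub>R y + s *\<^sub>R P y" by (simp add: c_def algebra_simps)
      then show ?thesis using convexD[OF convD y DP[OF y], of "1 - s" s] that by simp
    qed
    have der: "((\<lambda>s. f (\<Psi> (c s))) has_derivative (\<lambda>h. 0)) (at s)" if s: "0 \<le> s" "s \<le> 1" for s
    proof -
      have cs: "c s \<in> D" using cD s by blast
      then have \<Psi>S: "\<Psi> (c s) \<in> S" using \<Psi>U DV U(2) by blast
      define T where "T = frechet_derivative f (at (\<Psi> (c s)))"
      have linT: "linear T" unfolding T_def using df[OF \<Psi>S] has_derivative_linear by blast
      have 1: "((\<lambda>y. f (\<Psi> y)) has_derivative (\<lambda>v. T (\<Psi>' (c s) v))) (at (c s))"
        using diff_chain_at[OF d\<Psi> df[OF \<Psi>S]] cs DV by (auto simp: o_def T_def)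
      have 2: "((\<lambda>y. R (f (\<Psi> y) - f x0)) has_derivative (\<lambda>v. R (T (\<Psi>' (c s) v) - 0))) (at (c s))"
        by (intro bounded_linear.has_derivative[OF bR] has_derivative_diff 1 has_derivative_const)
      have "((\<lambda>y. P y) has_derivative (\<lambda>v. R (T (\<Psi>' (c s) v) - 0))) (at (c s))"
        by (rule has_derivative_transform_within_open[OF 2 openD cs]) (use R\<Phi> \<Phi>\<Psi> DV in auto)
      moreover have "(P has_derivative P) (at (c s))"
        using linP linear_conv_bounded_linear bounded_linear_imp_has_derivative by blast
      ultimately have RT: "R (T (\<Psi>' (c s) v)) = P v" for v
        using has_derivative_unique[of P _ "c s" P] by (metis diff_zero)
      \<comment> \<open>The chain of inequalities runs from the range of \<open>T\<close> to its
        image under \<open>R\<close>; a linear map that does not lower the dimension of a subspace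
        is injective on it.\<close>
      have "dim (range T) \<le> dim (range E)" using rank[OF \<Psi>S] by (simp add: T_def)
      also have "dim (range E) \<le> dim (range P)"
      proof -
        have "E v \<in> E ` range P" for v
          by (rule image_eqI[of _ _ "P v"]) (simp_all add: P_def ERE)
        then have "range E = E ` range P" by blast
        then show ?thesis using dim_image_le[OF linE, of "range P"] by simp
      qed
      also have "dim (range P) \<le> dim (R ` range T)"
      proof (rule dim_subset)
        have "P v \<in> R ` range T" for v using RT[of v, symmetric] by blast
        then show "range P \<subseteq> R ` range T" by blast
      qed
      finally have inj: "w = 0" if "w \<in> range T" "R w = 0" for w
        using linear_inj_on_of_dim_le[OF R _ _ that] linT linear_subspace_image[OF linT subspace_UNIV] by blast
      have "R (T (\<Psi>' (c s) (P y - y))) = 0" using RT PP linP by (simp add: linear_diff)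
      then have T0: "T (\<Psi>' (c s) (P y - y)) = 0" using inj by blast
      have dc: "(c has_derivative (\<lambda>h. h *\<^sub>R (P y - y))) (at s)"
        unfolding c_def[abs_def] by (auto intro!: derivative_eq_intros)
      have "linear (\<Psi>' (c s))" using d\<Psi> cs DV has_derivative_linear by blast
      then have "(\<lambda>h. T (\<Psi>' (c s) (h *\<^sub>R (P y - y)))) = (\<lambda>h. 0)"
        using T0 linT by (simp add: linear_scale)
      with diff_chain_at[OF dc 1] show ?thesis by (simp add: o_def)
    qed
    have "f (\<Psi> (c 0)) = f (\<Psi> (c 1))"
      by (rule has_derivative_zero_unique[of "{0..1}" "\<lambda>s. f (\<Psi> (c s))"])
        (auto intro: has_derivative_at_withinI der)
    then show ?thesis by (simp add: c_def)
  qed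
  \<comment> \<open>The outer \<open>R (E ...)\<close> changes nothing at \<open>f x\<close> with
    \<open>x \<in> O'\<close>, but it puts every value of \<open>h\<close> into
    \<open>range R\<close>.\<close>
  define h where "h z = R (E (\<Psi> (R (z - f x0)) - x0))" for z
  have \<Psi>P: "\<Psi> y - x0 = P (\<Psi> y - x0)" if "y \<in> D" "P y = y" for y
  proof -
    have "\<Phi> (\<Psi> y) = y" using \<Phi>\<Psi> that DV by blast
    moreover have "\<Phi> (\<Psi> y) = P y + ((\<Psi> y - x0) - P (\<Psi> y - x0))"
      using R\<Phi>[of "\<Psi> y"] \<Phi>\<Psi> that DV unfolding \<Phi>_def P_def by auto
    ultimately show ?thesis using that(2) by simp
  qed
  have hf: "h (f x) = \<Psi> (P (\<Phi> x)) - x0" if "x \<in> O'" for x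
  proof -
    have "P (\<Phi> x) \<in> D" using that DP by (simp add: O'_def)
    then show ?thesis unfolding h_def R\<Phi> using \<Psi>P[of "P (\<Phi> x)"] PP by (simp add: P_def)
  qed
  show thesis
  proof (rule that[of O' h])
    show "open O'" "x0 \<in> O'" "O' \<subseteq> S" using openO x0O U by (auto simp: O'_def)
    show "h (f x) \<in> range R \<and> x0 + h (f x) \<in> O' \<and> f (x0 + h (f x)) = f x" if x: "x \<in> O'" for x
    proof (intro conjI)
      show "h (f x) \<in> range R" by (simp add: h_def)
      have D: "\<Phi> x \<in> D" "P (\<Phi> x) \<in> D" using x DP by (auto simp: O'_def)
      show "x0 + h (f x) \<in> O'" unfolding hf[OF x] using \<Psi>O[OF D(2)] by simp
      have "f x = f (\<Psi> (\<Phi> x))" using \<Psi>\<Phi> x by (simp add: O'_def)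
      then show "f (x0 + h (f x)) = f x" unfolding hf[OF x] using key[OF D(1)] by simp
    qed
    show "h (f (x0 + t)) = t" if t: "t \<in> range R" "x0 + t \<in> O'" for t
    proof -
      have Pt: "P t = t" using t(1) RER by (auto simp: P_def)
      then have "\<Phi> (x0 + t) = P (\<Phi> (x0 + t))" using R\<Phi>[of "x0 + t"] by (simp add: \<Phi>_def P_def)
      then show ?thesis using hf[OF t(2)] \<Psi>\<Phi>[of "x0 + t"] t(2) by (simp add: O'_def)
    qed
    show "h differentiable (at (f x))" if x: "x \<in> O'" for x
    proof -
      have PD: "P (\<Phi> x) \<in> V" using x DP DV by (auto simp: O'_def)
      have 1: "((\<lambda>z. R (z - f x0)) has_derivative (\<lambda>v. R (v - 0))) (at (f x))"
        by (intro bounded_linear.has_derivative[OF bR] has_derivative_diff has_derivative_const has_derivative_ident)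
      have "((\<lambda>z. \<Psi> (R (z - f x0))) has_derivative (\<lambda>v. \<Psi>' (P (\<Phi> x)) (R (v - 0)))) (at (f x))"
        using diff_chain_at[OF 1, of \<Psi>] d\<Psi>[OF PD] R\<Phi> by (simp add: o_def)
      then have "(h has_derivative (\<lambda>v. R (E (\<Psi>' (P (\<Phi> x)) (R (v - 0)) - 0)))) (at (f x))"
        unfolding h_def[abs_def]
        by (intro bounded_linear.has_derivative[OF bRE] has_derivative_diff has_derivative_const)
      then show ?thesis by (auto simp: differentiable_def)
    qed
  qed
qed

text \<open>A right inverse \<open>g\<close> of \<open>E\<close> on its range gives
  \<open>E g E = E\<close>; passing to \<open>g E g\<close> also gives the second identity.\<close>

lemma linear_quasi_inverse:
  fixes E :: "'a::euclidean_space \<Rightarrow> 'b::euclidean_space"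
  assumes "linear E"
  obtains R where "linear R" "\<And>v. E (R (E v)) = E v" "\<And>w. R (E (R w)) = R w"
proof -
  obtain g where g: "linear g" "\<And>v. v \<in> range E \<Longrightarrow> E (g v) = v"
    using linear_exists_right_inverse_on[OF assms subspace_UNIV] by auto
  have "linear (\<lambda>w. g (E (g w)))"
    using linear_compose[OF linear_compose[OF g(1) assms] g(1)] by (simp add: o_def)
  then show thesis by (rule that) (simp_all add: g(2))
qed

section \<open>Kaehler geometry in a chart\<close>

lemma linear_J: "linear (J :: complex^'n \<Rightarrow> complex^'n)"
  by (rule linearI) (simp_all add: vec_eq_iff algebra_simps)

lemmas J_add = linear_add[OF linear_J] and J_diff = linear_diff[OF linear_J]
  and J_minus = linear_neg[OF linear_J] and J_scaleR = linear_scale[OF linear_J]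
  and J_zero = linear_0[OF linear_J]

lemma J_J: "J (J v) = - v" for v :: "complex^'n"
  by (simp add: vec_eq_iff)

lemma bounded_linear_J: "bounded_linear (J :: complex^'n \<Rightarrow> complex^'n)"
  using linear_J linear_conv_bounded_linear by blast

lemma bilinear_Dir:
  fixes B :: "'a::euclidean_space \<Rightarrow> 'b::euclidean_space \<Rightarrow> 'c::euclidean_space \<Rightarrow> 'd::euclidean_space"
  assumes S: "open S" "z \<in> S" and bil: "\<And>y. y \<in> S \<Longrightarrow> bilinear (B y)"
    and d: "\<And>u v. (\<lambda>y. B y u v) differentiable (at z)"
  shows "bilinear (\<lambda>u v. Dir w (\<lambda>y. B y u v) z)"
proof -
  have D: "((\<lambda>y. B y u v) has_derivative (\<lambda>h. Dir h (\<lambda>y. B y u v) z)) (at z)" for u v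
    using has_derivative_frechet[OF d] .
  have eq: "Dir w (\<lambda>y. B y u v) z = D' w"
    if "((\<lambda>y. C y) has_derivative D') (at z)" "\<And>y. y \<in> S \<Longrightarrow> B y u v = C y" for C D' u v
    using frechet_derivative_cong_open[OF S that(2)] frechet_derivative_eq[OF that(1)] by simp
  show ?thesis
    unfolding bilinear_def
  proof (intro conjI allI linearI)
    show "Dir w (\<lambda>y. B y u (a + b)) z = Dir w (\<lambda>y. B y u a) z + Dir w (\<lambda>y. B y u b) z" for u a b
      by (rule eq[OF has_derivative_add[OF D D]]) (simp add: bilinear_radd[OF bil])
    show "Dir w (\<lambda>y. B y (a + b) u) z = Dir w (\<lambda>y. B y a u) z + Dir w (\<lambda>y. B y b u) z" for u a b
      by (rule eq[OF has_derivative_add[OF D D]]) (simp add: bilinear_ladd[OF bil])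
    show "Dir w (\<lambda>y. B y u (r *\<^sub>R a)) z = r *\<^sub>R Dir w (\<lambda>y. B y u a) z" for u r a
      by (rule eq[OF has_derivative_scaleR_right[OF D]]) (simp add: bilinear_rmul[OF bil])
    show "Dir w (\<lambda>y. B y (r *\<^sub>R a) u) z = r *\<^sub>R Dir w (\<lambda>y. B y a u) z" for u r a
      by (rule eq[OF has_derivative_scaleR_right[OF D]]) (simp add: bilinear_lmul[OF bil])
  qed
qed

lemma linear_Dir: "f differentiable (at z) \<Longrightarrow> linear (\<lambda>w. Dir w f z)"
  by (rule linear_frechet_derivative)

text \<open>The chart \<open>c\<close> serves as the index of the tensor and \<open>S\<close> stands
  for its image, so that all local geometry is computed on an open subset of complex coordinate
  space.\<close>

locale kahler_chart =
  fixes \<omega> :: "('m, complex^'n) tensor2" and c :: "('m, complex^'n) chart" and S :: "(complex^'n) set"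
  assumes openS: "open S"
    and smooth: "\<And>u v. smooth_on S (\<lambda>z. \<omega> c z u v)"
    and bil_form: "\<And>z. z \<in> S \<Longrightarrow> bilinear (\<omega> c z)"
    and skew: "\<And>z u v. z \<in> S \<Longrightarrow> \<omega> c z u v = - \<omega> c z v u"
    and form_J: "\<And>z u v. z \<in> S \<Longrightarrow> \<omega> c z (J u) (J v) = \<omega> c z u v"
    and pos: "\<And>z u. z \<in> S \<Longrightarrow> u \<noteq> 0 \<Longrightarrow> metric \<omega> c z u u > 0"
    and closed_form: "\<And>z u v w. z \<in> S \<Longrightarrow> Dir u (\<lambda>y. \<omega> c y v w) z + Dir v (\<lambda>y. \<omega> c y w u) z
                 + Dir w (\<lambda>y. \<omega> c y u v) z = 0"
begin

abbreviation g where "g \<equiv> metric \<omega> c"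
abbreviation \<Gamma> where "\<Gamma> \<equiv> christoffel (metric \<omega>) c"

lemma form_diff: "z \<in> S \<Longrightarrow> (\<lambda>y. \<omega> c y u v) differentiable (at z)"
  using smooth smooth_on_differentiable by blast

lemma g_smooth: "smooth_on S (\<lambda>y. g y u v)"
  unfolding metric_def by (rule smooth)

lemma g_diff: "z \<in> S \<Longrightarrow> (\<lambda>y. g y u v) differentiable (at z)"
  using g_smooth smooth_on_differentiable by blast

lemma bil_g: "z \<in> S \<Longrightarrow> bilinear (g z)"
  unfolding metric_def bilinear_def
  using bil_form linear_compose[OF linear_J]
  by (auto simp: bilinear_def o_def)

lemma g_sym: "z \<in> S \<Longrightarrow> g z u v = g z v u"
proof -
  assume z: "z \<in> S"
  have "g z v u = - \<omega> c z (J u) v" using skew[OF z, of v "J u"] by (simp add: metric_def)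
  also have "\<dots> = - \<omega> c z (J (J u)) (J v)" using form_J[OF z, of "J u" v] by simp
  also have "\<dots> = g z u v" using bilinear_lneg[OF bil_form[OF z]] by (simp add: J_J metric_def)
  finally show ?thesis by simp
qed

lemma g_JJ: "z \<in> S \<Longrightarrow> g z (J u) (J v) = g z u v"
  unfolding metric_def by (rule form_J)

lemma g_J: "z \<in> S \<Longrightarrow> g z (J u) v = - g z u (J v)"
  by (simp add: metric_def form_J J_J bilinear_rneg[OF bil_form])

lemma form_g: "z \<in> S \<Longrightarrow> \<omega> c z u v = - g z u (J v)"
  using bilinear_rneg[OF bil_form] by (simp add: metric_def J_J)

lemma g_nondegenerate: "z \<in> S \<Longrightarrow> (\<And>x. g z u x = g z v x) \<Longrightarrow> u = v"
  using pos[of z "u - v"] bilinear_lsub[OF bil_g, of z u v "u - v"] by force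

text \<open>Testing against the standard basis gives a linear map that is injective by positivity,
  hence onto.\<close>

lemma g_represent:
  assumes z: "z \<in> S" and K: "linear K"
  shows "\<exists>w. \<forall>x. g z w x = (K x :: real)"
proof -
  define G where "G w = (\<Sum>b\<in>Basis. g z w b *\<^sub>R b)" for w
  have linG: "linear G"
    unfolding G_def by (rule linearI)
      (simp_all add: bilinear_ladd[OF bil_g[OF z]] bilinear_lmul[OF bil_g[OF z]] algebra_simps sum.distrib scaleR_sum_right)
  have Gb: "G w \<bullet> b = g z w b" if "b \<in> Basis" for w b
    unfolding G_def using that by (simp add: inner_sum_left inner_Basis if_distrib cong: if_cong)
  have lin: "linear (\<lambda>x. g z w x)" for w using bil_g[OF z] by (simp add: bilinear_def)
  have expand: "L x = (\<Sum>b\<in>Basis. (x \<bullet> b) * L b)" if "linear L" for L :: "complex^'n \<Rightarrow> real" and x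
  proof -
    have "L x = L (\<Sum>b\<in>Basis. (x \<bullet> b) *\<^sub>R b)" by (simp add: euclidean_representation)
    then show ?thesis using that by (simp add: linear_sum linear_scale)
  qed
  have "inj G"
  proof (rule linear_injective_0[THEN iffD2, OF linG], intro allI impI)
    fix w assume "G w = 0"
    then have "g z w b = 0" if "b \<in> Basis" for b using Gb[OF that, of w] by simp
    then have "g z w w = 0" using expand[OF lin, of w w] by simp
    then show "w = 0" using pos[OF z, of w] by fastforce
  qed
  then have "surj G" using linear_injective_imp_surjective[OF linG] by blast
  then obtain w where w: "G w = (\<Sum>b\<in>Basis. K b *\<^sub>R b)" by (metis surjD)
  have "g z w b = K b" if "b \<in> Basis" for b
    using Gb[OF that, of w] that w by (simp add: inner_sum_left inner_Basis if_distrib cong: if_cong)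
  then have "g z w x = K x" for x using expand[OF lin, of w x] expand[OF K, of x] by simp
  then show ?thesis by blast
qed

abbreviation dg where "dg z w u v \<equiv> Dir w (\<lambda>y. g y u v) z"

lemma bil_dg: "z \<in> S \<Longrightarrow> bilinear (\<lambda>u v. dg z w u v)"
  by (rule bilinear_Dir[OF openS]) (auto intro: bil_g g_diff)

lemma lin_dg: "z \<in> S \<Longrightarrow> linear (\<lambda>w. dg z w u v)"
  using g_diff linear_Dir by blast

lemma dg_sym: "z \<in> S \<Longrightarrow> dg z w u v = dg z w v u"
  using frechet_derivative_cong_open[OF openS, of z "\<lambda>y. g y u v" "\<lambda>y. g y v u"] g_sym by auto

text \<open>The right-hand side of the Koszul formula is linear in \<open>x\<close>, so it is
  represented by a unique vector; this makes the definite description in \<open>christoffel\<close>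
  meaningful.\<close>

lemma christoffel_spec:
  assumes z: "z \<in> S"
  shows "2 * g z (\<Gamma> z u v) x = dg z u v x + dg z v u x - dg z x u v"
proof -
  define K where "K x = (dg z u v x + dg z v u x - dg z x u v) / 2" for x
  have "linear K"
    unfolding K_def
    using bil_dg[OF z] lin_dg[OF z]
    by (intro linearI) (simp_all add: bilinear_radd[OF bil_dg[OF z]] bilinear_rmul[OF bil_dg[OF z]]
        linear_add[OF lin_dg[OF z]] linear_scale[OF lin_dg[OF z]] field_simps)
  then obtain w where w: "\<And>x. g z w x = K x" using g_represent[OF z] by blast
  have "\<exists>!w. \<forall>x. 2 * g z w x = dg z u v x + dg z v u x - dg z x u v"
  proof (rule ex1I[of _ w])
    show "\<forall>x. 2 * g z w x = dg z u v x + dg z v u x - dg z x u v"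
      unfolding w K_def by simp
    fix w' assume a: "\<forall>x. 2 * g z w' x = dg z u v x + dg z v u x - dg z x u v"
    have "g z w' x = g z w x" for x using a[rule_format, of x] w[of x] by (simp add: K_def)
    then show "w' = w" using g_nondegenerate[OF z] by blast
  qed
  from theI'[OF this] show ?thesis unfolding christoffel_def by blast
qed

lemma christoffel_eqI:
  assumes z: "z \<in> S" and "\<And>x. 2 * g z w x = dg z u v x + dg z v u x - dg z x u v"
  shows "\<Gamma> z u v = w"
proof (rule g_nondegenerate[OF z])
  show "g z (\<Gamma> z u v) x = g z w x" for x using christoffel_spec[OF z, of u v x] assms(2)[of x] by simp
qed

lemma \<Gamma>_sym: "z \<in> S \<Longrightarrow> \<Gamma> z u v = \<Gamma> z v u"
  using dg_sym[where u = u and v = v] by (intro christoffel_eqI) (simp_all add: christoffel_spec)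

lemma bil_\<Gamma>: assumes z: "z \<in> S" shows "bilinear (\<Gamma> z)"
proof -
  have a: "\<Gamma> z u (v + w) = \<Gamma> z u v + \<Gamma> z u w" for u v w
    using christoffel_spec[OF z]
    by (intro christoffel_eqI[OF z]) (simp add: bilinear_ladd[OF bil_g[OF z]] bilinear_ladd[OF bil_dg[OF z]]
      bilinear_radd[OF bil_dg[OF z]] linear_add[OF lin_dg[OF z]] algebra_simps)
  have b: "\<Gamma> z u (r *\<^sub>R v) = r *\<^sub>R \<Gamma> z u v" for u v r
  proof (rule christoffel_eqI[OF z])
    fix x
    have "2 * g z (r *\<^sub>R \<Gamma> z u v) x = r * (2 * g z (\<Gamma> z u v) x)" by (simp add: bilinear_lmul[OF bil_g[OF z]])
    also have "\<dots> = dg z u (r *\<^sub>R v) x + dg z (r *\<^sub>R v) u x - dg z x u (r *\<^sub>R v)"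
      unfolding christoffel_spec[OF z] by (simp add: bilinear_lmul[OF bil_dg[OF z]]
      bilinear_rmul[OF bil_dg[OF z]] linear_scale[OF lin_dg[OF z]] algebra_simps)
    finally show "2 * g z (r *\<^sub>R \<Gamma> z u v) x = dg z u (r *\<^sub>R v) x + dg z (r *\<^sub>R v) u x - dg z x u (r *\<^sub>R v)" .
  qed
  have "linear (\<lambda>v. \<Gamma> z u v)" for u using a b by (rule linearI)
  moreover have "linear (\<lambda>v. \<Gamma> z v u)" for u unfolding \<Gamma>_sym[OF z, of _ u] using a b by (rule linearI)
  ultimately show ?thesis unfolding bilinear_def by blast
qed

lemma metric_compatible:
  assumes z: "z \<in> S" shows "dg z w u v = g z (\<Gamma> z w u) v + g z u (\<Gamma> z w v)"
  using christoffel_spec[OF z, of w u v] christoffel_spec[OF z, of w v u]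
    g_sym[OF z, of u "\<Gamma> z w v"] dg_sym[OF z, of w v u] dg_sym[OF z, of u v w] dg_sym[OF z, of v u w]
    dg_sym[OF z] by (smt (verit))

text \<open>Closedness of the form enters twice: on \<open>(x, u, v)\<close> and on \<open>(u, Jv, Jx)\<close>.\<close>

lemma \<Gamma>_J:
  assumes z: "z \<in> S" shows "\<Gamma> z u (J v) = J (\<Gamma> z u v)"
proof (rule christoffel_eqI[OF z])
  fix x
  let ?d = "\<lambda>w u v. Dir w (\<lambda>y. \<omega> c y u v) z"
  have cong: "Dir w f z = Dir w h z" if "\<And>y. y \<in> S \<Longrightarrow> f y = h y" for w and f h :: "complex^'n \<Rightarrow> real"
    using frechet_derivative_cong_open[OF openS z that] by simp
  have cneg: "Dir w (\<lambda>y. - f y) z = - Dir w f z" if "f differentiable (at z)" for w and f :: "complex^'n \<Rightarrow> real"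
    using frechet_derivative_eq[OF has_derivative_minus[OF has_derivative_frechet[OF that]]] by simp
  have a1: "dg z u (J v) x = - dg z u v (J x)"
    using cong[of "\<lambda>y. g y (J v) x" "\<lambda>y. - g y v (J x)" u] cneg[OF g_diff[OF z]] by (simp add: g_J)
  have a2: "dg z x u (J v) = - ?d x u v"
    using cong[of "\<lambda>y. g y u (J v)" "\<lambda>y. - \<omega> c y u v" x] cneg[OF form_diff[OF z]] by (simp add: form_g)
  have a3: "dg z v u (J x) = - ?d v u x"
    using cong[of "\<lambda>y. g y u (J x)" "\<lambda>y. - \<omega> c y u x" v] cneg[OF form_diff[OF z]] by (simp add: form_g)
  have a4: "dg z (J v) u x = - ?d (J v) (J x) u"
    using cong[of "\<lambda>y. g y u x" "\<lambda>y. - \<omega> c y (J x) u" "J v"] cneg[OF form_diff[OF z]]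
    by (simp add: metric_def skew[of _ "J x" u])
  have a5: "dg z (J x) u v = ?d (J x) u (J v)"
    by (simp add: metric_def)
  have a6: "?d u (J v) (J x) = ?d u v x" using cong[of "\<lambda>y. \<omega> c y (J v) (J x)" "\<lambda>y. \<omega> c y v x" u] form_J by simp
  have a7: "?d v u x = - ?d v x u"
    using cong[of "\<lambda>y. \<omega> c y u x" "\<lambda>y. - \<omega> c y x u" v] cneg[OF form_diff[OF z]] skew[of _ u x] by simp
  have c1: "?d x u v + ?d u v x + ?d v x u = 0" using closed_form[OF z] .
  have c2: "?d u (J v) (J x) + ?d (J v) (J x) u + ?d (J x) u (J v) = 0" using closed_form[OF z] .
  have "2 * g z (J (\<Gamma> z u v)) x = - (2 * g z (\<Gamma> z u v) (J x))" by (simp add: g_J[OF z])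
  then show "2 * g z (J (\<Gamma> z u v)) x = dg z u (J v) x + dg z (J v) u x - dg z x u (J v)"
    unfolding christoffel_spec[OF z] using a1 a2 a3 a4 a5 a6 a7 c1 c2 by linarith
qed

lemma \<Gamma>_J': "z \<in> S \<Longrightarrow> \<Gamma> z (J u) v = J (\<Gamma> z u v)"
  using \<Gamma>_J[of z v u] \<Gamma>_sym by metis

text \<open>The Koszul formula is a linear system for \<open>\<Gamma>\<close> whose matrix
  \<open>g\<close> and right-hand side are differentiable, which is the situation of
  \<open>differentiable_linear_solution\<close>.\<close>

lemma \<Gamma>_diff:
  assumes z: "z \<in> S" shows "(\<lambda>y. \<Gamma> y u v) differentiable (at z)"
proof -
  define G where "G y w = (\<Sum>b\<in>Basis. g y w b *\<^sub>R b)" for y w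
  define K where "K y = (\<Sum>b\<in>Basis. ((dg y u v b + dg y v u b - dg y b u v) / 2) *\<^sub>R b)" for y
  show ?thesis
  proof (rule differentiable_linear_solution[OF openS z, of G K])
    show linG: "linear (G y)" if "y \<in> S" for y
      unfolding G_def by (rule linearI)
      (simp_all add: bilinear_ladd[OF bil_g[OF that]] bilinear_lmul[OF bil_g[OF that]] algebra_simps sum.distrib scaleR_sum_right)
    show "(\<lambda>y. G y v) differentiable (at z)" for v
      unfolding G_def by (intro differentiable_sum differentiable_scaleR ballI) (auto intro: g_diff z)
    have dd: "(\<lambda>y. dg y w a b) differentiable (at z)" for w a b
      using smooth_on_differentiable[OF smooth_on_Dir[OF g_smooth] z] .
    show "K differentiable (at z)"
      unfolding K_def
      using dd by (intro differentiable_sum differentiable_scaleR ballI) (auto intro!: derivative_intros)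
    have Gb: "G z w \<bullet> b = g z w b" if "b \<in> Basis" for w b
      unfolding G_def using that by (simp add: inner_sum_left inner_Basis if_distrib cong: if_cong)
    show "inj (G z)"
    proof (rule linear_injective_0[THEN iffD2, OF linG[OF z]], intro allI impI)
      fix w assume "G z w = 0"
      then have b: "g z w b = 0" if "b \<in> Basis" for b using Gb[OF that, of w] by simp
      have "g z w w = g z w (\<Sum>b\<in>Basis. (w \<bullet> b) *\<^sub>R b)" by (simp add: euclidean_representation)
      also have "\<dots> = 0" using b bil_g[OF z] by (simp add: bilinear_def linear_sum linear_scale)
      finally show "w = 0" using pos[OF z, of w] by fastforce
    qed
    show "G y (\<Gamma> y u v) = K y" if "y \<in> S" for y
      unfolding G_def K_def by (simp add: christoffel_spec[OF that, symmetric])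
  qed
qed

text \<open>The trace of the connection, which is the logarithmic derivative of the determinant of
  the hermitian metric in coordinates (\<open>ln_det_Hmat_has_derivative\<close>).\<close>

definition lam where "lam z w = real_trace (\<lambda>b. \<Gamma> z w b)"

lemma lam_diff: "z \<in> S \<Longrightarrow> (\<lambda>y. lam y w) differentiable (at z)"
  unfolding lam_def real_trace_def
  by (intro differentiable_sum differentiable_inner ballI) (auto intro: \<Gamma>_diff)

lemma bil_dirder_\<Gamma>: "z \<in> S \<Longrightarrow> bilinear (\<lambda>u v. Dir w (\<lambda>y. \<Gamma> y u v) z)"
  by (rule bilinear_Dir[OF openS]) (auto intro: bil_\<Gamma> \<Gamma>_diff)

section \<open>The Ricci tensor as a derivative of the trace of the connection\<close>

abbreviation Rm where "Rm \<equiv> curvature (metric \<omega>) c"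

lemma ricci_expand:
  assumes z: "z \<in> S"
  shows "ricci (metric \<omega>) c z v w = real_trace (\<lambda>b. Dir b (\<lambda>y. \<Gamma> y v w) z) - Dir v (\<lambda>y. lam y w) z
     + lam z (\<Gamma> z v w) - real_trace (\<lambda>b. \<Gamma> z v (\<Gamma> z w b))"
proof -
  have c: "Dir v (\<lambda>y. \<Gamma> y b w) z = Dir v (\<lambda>y. \<Gamma> y w b) z" for b
    using frechet_derivative_cong_open[OF openS z, of "\<lambda>y. \<Gamma> y b w" "\<lambda>y. \<Gamma> y w b"] \<Gamma>_sym by auto
  have "((\<lambda>y. lam y w) has_derivative (\<lambda>h. \<Sum>b\<in>Basis. Dir h (\<lambda>y. \<Gamma> y w b) z \<bullet> b)) (at z)"
    unfolding lam_def real_trace_def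
    by (intro has_derivative_sum has_derivative_inner_left has_derivative_frechet \<Gamma>_diff z)
  then have d: "Dir v (\<lambda>y. lam y w) z = (\<Sum>b\<in>Basis. Dir v (\<lambda>y. \<Gamma> y w b) z \<bullet> b)"
    by (simp add: frechet_derivative_eq)
  have e: "Rm z b v w = Dir b (\<lambda>y. \<Gamma> y v w) z - Dir v (\<lambda>y. \<Gamma> y w b) z + \<Gamma> z (\<Gamma> z v w) b - \<Gamma> z v (\<Gamma> z w b)" for b
    unfolding curvature_def c using \<Gamma>_sym[OF z, of b w] \<Gamma>_sym[OF z, of b "\<Gamma> z v w"] by simp
  show ?thesis
    unfolding ricci_def e d unfolding real_trace_def lam_def inner_add_left inner_diff_left
       sum.distrib sum_subtractf by simp
qed

text \<open>\<open>\<Gamma>\<close> is complex bilinear, so every term of the expansion other than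
  the derivative of \<open>lam\<close> changes sign when \<open>v\<close> and \<open>w\<close> are
  both multiplied by \<open>J\<close>. This is the real form of the formula that expresses the Ricci
  form through the logarithm of the determinant of the metric.\<close>

lemma ricci_lam:
  assumes z: "z \<in> S"
  shows "ricci (metric \<omega>) c z v w + ricci (metric \<omega>) c z (J v) (J w)
     = - (Dir v (\<lambda>y. lam y w) z + Dir (J v) (\<lambda>y. lam y (J w)) z)"
proof -
  have m: "\<Gamma> y (J v) (J w) = - \<Gamma> y v w" if "y \<in> S" for y v w
    using \<Gamma>_J[OF that] \<Gamma>_J'[OF that] by (simp add: J_J)
  have "Dir b (\<lambda>y. \<Gamma> y (J v) (J w)) z = - Dir b (\<lambda>y. \<Gamma> y v w) z" for b
    using frechet_derivative_cong_open[OF openS z, of "\<lambda>y. \<Gamma> y (J v) (J w)" "\<lambda>y. - \<Gamma> y v w"] m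
      frechet_derivative_eq[OF has_derivative_minus[OF has_derivative_frechet[OF \<Gamma>_diff[OF z]]]] by auto
  then have 1: "real_trace (\<lambda>b. Dir b (\<lambda>y. \<Gamma> y (J v) (J w)) z) = - real_trace (\<lambda>b. Dir b (\<lambda>y. \<Gamma> y v w) z)"
    by (simp add: real_trace_minus)
  have 2: "lam z (\<Gamma> z (J v) (J w)) = - lam z (\<Gamma> z v w)"
    unfolding lam_def m[OF z] bilinear_lneg[OF bil_\<Gamma>[OF z]] real_trace_minus ..
  have 3: "\<Gamma> z (J v) (\<Gamma> z (J w) b) = - \<Gamma> z v (\<Gamma> z w b)" for b
    using \<Gamma>_J[OF z] \<Gamma>_J'[OF z] by (simp add: J_J)
  show ?thesis unfolding ricci_expand[OF z] 1 2 3 real_trace_minus by simp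
qed

lemma einstein_ricci:
  assumes z: "z \<in> S" and E: "\<And>u v. ricci_form \<omega> c z u v = \<kappa> * \<omega> c z u v"
  shows "ricci (metric \<omega>) c z v w = \<kappa> * g z v w"
proof -
  have "ricci (metric \<omega>) c z v w = ricci_form \<omega> c z (- J v) w"
    unfolding ricci_form_def by (simp add: J_J J_minus)
  also have "\<dots> = - \<kappa> * \<omega> c z (J v) w" unfolding E by (simp add: bilinear_lneg[OF bil_form[OF z]])
  also have "\<omega> c z (J v) w = - g z v w" using form_g[OF z] g_JJ[OF z] by simp
  finally show ?thesis by simp
qed

lemma einstein_lam:
  assumes z: "z \<in> S" and E: "\<And>u v. ricci_form \<omega> c z u v = \<kappa> * \<omega> c z u v"
  shows "Dir v (\<lambda>y. lam y w) z + Dir (J v) (\<lambda>y. lam y (J w)) z = - 2 * \<kappa> * g z v w"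
  using ricci_lam[OF z, of v w] einstein_ricci[OF z E] g_JJ[OF z] by simp

end

section \<open>The hermitian metric and its Gram determinants\<close>

lemma matrix_inv_unique_right:
  fixes A :: "'a::field^'n^'n"
  assumes "A ** B = mat 1" shows "matrix_inv A = B"
proof -
  have "B ** A = mat 1" using assms matrix_left_right_inverse by blast
  then have "invertible A" using assms by (auto simp: invertible_def)
  then have "matrix_inv A ** (A ** B) = B"
    by (simp add: matrix_mul_assoc matrix_inv_works)
  then show ?thesis by (simp add: assms)
qed

lemma det_map_of_real: "det (\<chi> i j. complex_of_real (A $ i $ j)) = of_real (det (A :: real^'n^'n))"
  by (simp add: det_def)

lemma det_map_cnj: "det (\<chi> i j. cnj (A $ i $ j)) = cnj (det (A :: complex^'n^'n))"
  by (simp add: det_def)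

lemma smult_re_im: "a *s u = Re a *\<^sub>R u + Im a *\<^sub>R J u" for u :: "complex^'n"
  by (simp add: vec_eq_iff complex_eq_iff)

lemma sum_axis_expansion: "x = (\<Sum>j\<in>UNIV. x $ j *s axis j 1)" for x :: "complex^'n"
  by (simp add: basis_expansion)

definition frame_matrix :: "('n \<Rightarrow> complex^'n) \<Rightarrow> complex^'n^'n" where
  "frame_matrix X = (\<chi> i j. X j $ i)"

context kahler_chart begin

text \<open>The sign of the imaginary part makes the form complex linear in \<open>u\<close> and
  antilinear in \<open>v\<close>.\<close>

definition herm where "herm z u v = complex_of_real (g z u v) + \<i> * complex_of_real (g z u (J v))"

lemma herm_add_left: "z \<in> S \<Longrightarrow> herm z (u + u') v = herm z u v + herm z u' v"
  by (simp add: herm_def bilinear_ladd[OF bil_g] algebra_simps)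

lemma herm_J_left: "z \<in> S \<Longrightarrow> herm z (J u) v = \<i> * herm z u v"
  using g_J[of z u v] g_JJ[of z u v] by (simp add: herm_def algebra_simps)

lemma herm_smult_left: "z \<in> S \<Longrightarrow> herm z (a *s u) v = a * herm z u v"
proof -
  assume z: "z \<in> S"
  have r: "herm z (r *\<^sub>R u) v = of_real r * herm z u v" for r u
    by (simp add: herm_def bilinear_lmul[OF bil_g[OF z]] algebra_simps)
  have "herm z (a *s u) v = of_real (Re a) * herm z u v + of_real (Im a) * (\<i> * herm z u v)"
    unfolding smult_re_im[of a u] herm_add_left[OF z] r herm_J_left[OF z] ..
  also have "\<dots> = (of_real (Re a) + \<i> * of_real (Im a)) * herm z u v" by (simp add: algebra_simps)
  finally show ?thesis using complex_eq[of a] by simp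
qed

lemma herm_cnj: "z \<in> S \<Longrightarrow> herm z v u = cnj (herm z u v)"
proof -
  assume z: "z \<in> S"
  have "g z v (J u) = - g z u (J v)" using g_sym[OF z, of v "J u"] g_J[OF z, of u v] by linarith
  moreover have "g z v u = g z u v" by (rule g_sym[OF z])
  ultimately show ?thesis unfolding herm_def by simp
qed

lemma herm_sum_left: "z \<in> S \<Longrightarrow> herm z (\<Sum>i\<in>I. a i *s u i) v = (\<Sum>i\<in>I. a i * herm z (u i) v)"
proof -
  assume z: "z \<in> S"
  have 0: "herm z 0 v = 0" by (simp add: herm_def bilinear_lzero[OF bil_g[OF z]])
  show ?thesis
    by (induction I rule: infinite_finite_induct)
      (auto simp: 0 herm_add_left[OF z] herm_smult_left[OF z])
qed

lemma herm_sum_right: "z \<in> S \<Longrightarrow> herm z v (\<Sum>i\<in>I. a i *s u i) = (\<Sum>i\<in>I. cnj (a i) * herm z v (u i))"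
proof -
  assume z: "z \<in> S"
  have "herm z v (\<Sum>i\<in>I. a i *s u i) = cnj (\<Sum>i\<in>I. a i * herm z (u i) v)"
    unfolding herm_sum_left[OF z, symmetric] by (rule herm_cnj[OF z])
  also have "\<dots> = (\<Sum>i\<in>I. cnj (a i) * cnj (herm z (u i) v))" by simp
  finally show ?thesis unfolding herm_cnj[OF z, symmetric] .
qed

definition Hmat where "Hmat z = (\<chi> j k. herm z (axis j 1) (axis k 1))"

lemma herm_axis_left: "z \<in> S \<Longrightarrow> herm z x v = (\<Sum>j\<in>UNIV. x $ j * herm z (axis j 1) v)"
  by (subst sum_axis_expansion[of x]) (simp add: herm_sum_left)

lemma herm_axis_right: "z \<in> S \<Longrightarrow> herm z v x = (\<Sum>j\<in>UNIV. cnj (x $ j) * herm z v (axis j 1))"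
  by (subst sum_axis_expansion[of x]) (simp add: herm_sum_right)

lemma herm_pos: "z \<in> S \<Longrightarrow> herm z u u = 0 \<Longrightarrow> u = 0"
  using pos[of z u] by (auto simp: herm_def complex_eq_iff)

lemma det_Hmat: assumes z: "z \<in> S" shows "det (Hmat z) \<noteq> 0"
proof
  assume "det (Hmat z) = 0"
  then have "\<not> (\<exists>B. B ** Hmat z = mat 1)" using invertible_det_nz invertible_left_inverse by blast
  then obtain x where x: "Hmat z *v x = 0" "x \<noteq> 0" by (auto simp: matrix_left_invertible_ker)
  \<comment> \<open>A kernel vector of the matrix must be conjugated, as \<open>herm\<close> is
    antilinear in its second argument.\<close>
  define y :: "complex^'n" where "y = (\<chi> k. cnj (x $ k))"
  have "herm z (axis j 1) y = (Hmat z *v x) $ j" for j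
    unfolding herm_axis_right[OF z, of _ y]
    by (simp add: y_def Hmat_def matrix_vector_mult_def mult.commute)
  then have "herm z y y = 0" using x(1) by (subst herm_axis_left[OF z]) simp
  then have "y = 0" using herm_pos[OF z] by blast
  then show False using x(2) by (simp add: y_def vec_eq_iff)
qed

lemma herm_const_has_derivative:
  assumes z: "z \<in> S"
  shows "((\<lambda>y. herm y u v) has_derivative (\<lambda>w. herm z (\<Gamma> z w u) v + herm z u (\<Gamma> z w v))) (at z)"
proof -
  have "((\<lambda>y. herm y u v) has_derivative (\<lambda>w. of_real (dg z w u v) + \<i> * of_real (dg z w u (J v)))) (at z)"
    unfolding herm_def
    by (rule has_derivative_add[OF has_derivative_of_real[OF has_derivative_frechet[OF g_diff[OF z]]]
       has_derivative_mult_right[OF has_derivative_of_real[OF has_derivative_frechet[OF g_diff[OF z]]]]])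
  moreover have "of_real (dg z w u v) + \<i> * of_real (dg z w u (J v)) = herm z (\<Gamma> z w u) v + herm z u (\<Gamma> z w v)" for w
    unfolding metric_compatible[OF z] \<Gamma>_J[OF z] herm_def by (simp add: distrib_left)
  ultimately show ?thesis by simp
qed

text \<open>For a complex linear endomorphism the basis vectors \<open>axis j \<i>\<close>
  contribute to the real trace the same amounts as \<open>axis j 1\<close>.\<close>

lemma lam_trace:
  assumes z: "z \<in> S"
  shows "lam z w = 2 * Re (\<Sum>j\<in>UNIV. \<Gamma> z w (axis j 1) $ j)"
proof -
  have B: "(Basis :: (complex^'n) set) = (\<lambda>j. axis j 1) ` UNIV \<union> (\<lambda>j. axis j \<i>) ` UNIV"
    by (auto simp: Basis_vec_def Basis_complex_def)
  have i: "axis j \<i> = J (axis j (1::complex))" for j :: 'n by (simp add: vec_eq_iff axis_def)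
  have "lam z w = (\<Sum>b\<in>(\<lambda>j. axis j 1) ` UNIV. \<Gamma> z w b \<bullet> b) + (\<Sum>b\<in>(\<lambda>j::'n. axis j \<i>) ` UNIV. \<Gamma> z w b \<bullet> b)"
    unfolding lam_def real_trace_def B by (rule sum.union_disjoint) (auto simp: axis_eq_axis)
  also have "\<dots> = (\<Sum>j\<in>UNIV. \<Gamma> z w (axis j 1) \<bullet> axis j 1) + (\<Sum>j\<in>(UNIV::'n set). \<Gamma> z w (axis j \<i>) \<bullet> axis j \<i>)"
    by (subst (1 2) sum.reindex) (auto simp: inj_on_def axis_eq_axis)
  also have "\<dots> = (\<Sum>j\<in>UNIV. Re (\<Gamma> z w (axis j 1) $ j)) + (\<Sum>j\<in>UNIV. Re (\<Gamma> z w (axis j 1) $ j))"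
  proof -
    have "\<Gamma> z w (axis j \<i>) \<bullet> axis j \<i> = Re (\<Gamma> z w (axis j 1) $ j)" for j
    proof -
      have "\<Gamma> z w (axis j \<i>) = J (\<Gamma> z w (axis j 1))" unfolding i by (rule \<Gamma>_J[OF z])
      then show ?thesis by (simp add: inner_axis inner_complex_def)
    qed
    then show ?thesis by (simp add: inner_axis inner_complex_def)
  qed
  finally show ?thesis by simp
qed

text \<open>Metric compatibility writes the derivative of \<open>Hmat\<close> as
  \<open>transpose M ** Hmat + Hmat ** Mc\<close>, with \<open>M\<close> the matrix of
  \<open>\<Gamma> z w\<close> and \<open>Mc\<close> its conjugate; after multiplication by the
  inverse the trace is that of \<open>M\<close> plus its conjugate.\<close>

lemma ln_det_Hmat_has_derivative:
  assumes z: "z \<in> S"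
  shows "((\<lambda>y. ln (norm (det (Hmat y)))) has_derivative (\<lambda>w. lam z w)) (at z)"
proof -
  define M :: "complex^'n \<Rightarrow> complex^'n^'n" where "M w = (\<chi> l j. \<Gamma> z w (axis j 1) $ l)" for w
  define Mc :: "complex^'n \<Rightarrow> complex^'n^'n" where "Mc w = (\<chi> l j. cnj (M w $ l $ j))" for w
  define H' where "H' w = transpose (M w) ** Hmat z + Hmat z ** Mc w" for w
  have "((\<lambda>y. Hmat y $ j $ k) has_derivative (\<lambda>w. H' w $ j $ k)) (at z)" for j k
  proof -
    have "herm z (\<Gamma> z w (axis j 1)) (axis k 1) + herm z (axis j 1) (\<Gamma> z w (axis k 1)) = H' w $ j $ k" for w
      unfolding herm_axis_left[OF z, of "\<Gamma> z w (axis j 1)"] herm_axis_right[OF z, of _ "\<Gamma> z w (axis k 1)"]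
      by (simp add: H'_def M_def Mc_def Hmat_def matrix_matrix_mult_def transpose_def mult.commute)
    then show ?thesis using herm_const_has_derivative[OF z, of "axis j 1" "axis k 1"] by (simp add: Hmat_def)
  qed
  from has_derivative_ln_det[OF this det_Hmat[OF z]]
  have "((\<lambda>y. ln (norm (det (Hmat y)))) has_derivative (\<lambda>w. Re (trace (matrix_inv (Hmat z) ** H' w)))) (at z)" .
  moreover have "Re (trace (matrix_inv (Hmat z) ** H' w)) = lam z w" for w
  proof -
    let ?C = "matrix_inv (Hmat z)"
    have inv: "?C ** Hmat z = mat 1" "Hmat z ** ?C = mat 1"
      using matrix_inv_works invertible_det_nz det_Hmat[OF z] by blast+
    have "trace (?C ** H' w) = trace (?C ** (transpose (M w) ** Hmat z)) + trace (?C ** Hmat z ** Mc w)"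
      unfolding H'_def by (simp add: matrix_add_ldistrib trace_add matrix_mul_assoc)
    also have "trace (?C ** (transpose (M w) ** Hmat z)) = trace (transpose (M w) ** Hmat z ** ?C)"
      by (rule trace_mul_sym)
    also have "\<dots> = trace (M w)"
      by (simp add: matrix_mul_assoc[symmetric] inv trace_def transpose_def)
    finally have "trace (?C ** H' w) = trace (M w) + trace (Mc w)" by (simp add: inv)
    also have "Re \<dots> = 2 * Re (trace (M w))" by (simp add: trace_def Mc_def)
    finally show ?thesis unfolding lam_trace[OF z] by (simp add: trace_def M_def)
  qed
  ultimately show ?thesis by simp
qed

definition hgram :: "complex^'n \<Rightarrow> ('n \<Rightarrow> complex^'n) \<Rightarrow> complex^'n^'n" where
  "hgram z X = (\<chi> j k. herm z (X j) (X k))"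

lemma hgram_factor:
  assumes z: "z \<in> S"
  shows "hgram z X = transpose (frame_matrix X) ** Hmat z ** (\<chi> i j. cnj (frame_matrix X $ i $ j))"
proof -
  have "herm z (X j) (X k) = (\<Sum>b\<in>UNIV. (\<Sum>a\<in>UNIV. X j $ a * herm z (axis a 1) (axis b 1)) * cnj (X k $ b))" for j k
    unfolding herm_axis_right[OF z, of _ "X k"] herm_axis_left[OF z, of "X j"] by (simp add: mult.commute)
  then show ?thesis
    by (simp add: vec_eq_iff hgram_def frame_matrix_def Hmat_def matrix_matrix_mult_def transpose_def)
qed

text \<open>Taking logarithms separates the contribution of the frame, \<open>2 ln |det|\<close>,
  which is pluriharmonic for holomorphic fields, from that of the metric.\<close>

lemma det_hgram: "z \<in> S \<Longrightarrow> det (hgram z X) = det (frame_matrix X) * cnj (det (frame_matrix X)) * det (Hmat z)"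
  unfolding hgram_factor by (simp add: det_mul det_transpose det_map_cnj)

lemma det_hgram_nz: "z \<in> S \<Longrightarrow> det (hgram z X) \<noteq> 0 \<longleftrightarrow> det (frame_matrix X) \<noteq> 0"
  by (simp add: det_hgram det_Hmat)

end

section \<open>The logarithm of the Gram determinant of a holomorphic frame\<close>

locale kahler_frame = kahler_chart \<omega> c S for \<omega> :: "('m, complex^'n) tensor2" and c S +
  fixes X :: "'n \<Rightarrow> complex^'n \<Rightarrow> complex^'n" and U
  assumes openU: "open U" and US: "U \<subseteq> S"
    and X_C2: "\<And>j. Ck_on 2 U (X j)"
    and X_holo: "\<And>z j v. z \<in> U \<Longrightarrow> Dir (J v) (X j) z = J (Dir v (X j) z)"
    and indep: "\<And>z. z \<in> U \<Longrightarrow> det (frame_matrix (\<lambda>j. X j z)) \<noteq> 0"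
begin

definition \<zeta> where "\<zeta> z = det (frame_matrix (\<lambda>j. X j z))"

definition lnvol where "lnvol z = ln (norm (det (hgram z (\<lambda>j. X j z))))"

text \<open>The differential of \<open>lnvol\<close>, written out explicitly so that it can be
  differentiated once more.\<close>

definition \<beta> where "\<beta> z w = 2 * Re (Dir w \<zeta> z / \<zeta> z) + lam z w"

lemma X_diff: "z \<in> U \<Longrightarrow> X j differentiable (at z)"
  using X_C2[of j] by (simp add: numeral_2_eq_2)

lemma X_has_derivative: "z \<in> U \<Longrightarrow> (X j has_derivative (\<lambda>v. Dir v (X j) z)) (at z)"
  using has_derivative_frechet[OF X_diff] .

lemma \<zeta>_C2: "Ck_on 2 U \<zeta>"
  unfolding \<zeta>_def[abs_def]
  by (rule Ck_on_det[OF openU]) (simp add: frame_matrix_def Ck_on_bounded_linear[OF openU bounded_linear_vec_nth X_C2])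

lemma \<zeta>_diff: "z \<in> U \<Longrightarrow> \<zeta> differentiable (at z)"
  and D\<zeta>_diff: "z \<in> U \<Longrightarrow> (\<lambda>y. Dir w \<zeta> y) differentiable (at z)"
  using \<zeta>_C2 by (simp_all add: numeral_2_eq_2)

lemma \<zeta>_nz: "z \<in> U \<Longrightarrow> \<zeta> z \<noteq> 0"
  using indep by (simp add: \<zeta>_def)

text \<open>By Jacobi's formula the derivative of the determinant is a trace that is complex linear
  in the derivatives of the fields.\<close>

lemma \<zeta>_J: assumes z: "z \<in> U" shows "Dir (J w) \<zeta> z = \<i> * Dir w \<zeta> z"
proof -
  define A' :: "complex^'n \<Rightarrow> complex^'n^'n" where "A' w = (\<chi> i j. Dir w (X j) z $ i)" for w
  let ?F = "\<lambda>z. frame_matrix (\<lambda>j. X j z)"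
  have "((\<lambda>z. ?F z $ i $ j) has_derivative (\<lambda>w. A' w $ i $ j)) (at z)" for i j
    unfolding frame_matrix_def A'_def
    using bounded_linear.has_derivative[OF bounded_linear_vec_nth X_has_derivative[OF z]] by simp
  from has_derivative_det[OF this indep[OF z]]
  have "(\<zeta> has_derivative (\<lambda>w. det (?F z) * trace (matrix_inv (?F z) ** A' w))) (at z)"
    unfolding \<zeta>_def[abs_def] .
  then have e: "Dir w \<zeta> z = det (?F z) * trace (matrix_inv (?F z) ** A' w)" for w
    by (simp add: frechet_derivative_eq)
  have "trace (C ** A' (J w)) = \<i> * trace (C ** A' w)" for C
    by (simp add: trace_def matrix_matrix_mult_def A'_def X_holo[OF z] sum_distrib_left algebra_simps)
  then show ?thesis by (simp add: e)
qed

lemma lnvol_has_derivative: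
  assumes z: "z \<in> U" shows "(lnvol has_derivative \<beta> z) (at z)"
proof -
  have 1: "((\<lambda>y. ln (norm (\<zeta> y))) has_derivative (\<lambda>w. Re (Dir w \<zeta> z / \<zeta> z))) (at z)"
    by (rule has_derivative_ln_norm[OF has_derivative_frechet[OF \<zeta>_diff[OF z]] \<zeta>_nz[OF z]])
  have 2: "((\<lambda>y. 2 * ln (norm (\<zeta> y)) + ln (norm (det (Hmat y)))) has_derivative
     (\<lambda>w. 2 * Re (Dir w \<zeta> z / \<zeta> z) + lam z w)) (at z)"
    using z US by (intro has_derivative_add has_derivative_mult_right 1 ln_det_Hmat_has_derivative) auto
  show ?thesis unfolding \<beta>_def[abs_def]
  proof (rule has_derivative_transform_within_open[OF 2 openU z])
    fix y assume "y \<in> U"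
    then have y: "y \<in> S" "\<zeta> y \<noteq> 0" using US \<zeta>_nz by auto
    have "norm (det (hgram y (\<lambda>j. X j y))) = norm (\<zeta> y) * norm (\<zeta> y) * norm (det (Hmat y))"
      using det_hgram[OF y(1), of "\<lambda>j. X j y"] by (simp add: norm_mult \<zeta>_def)
    then show "2 * ln (norm (\<zeta> y)) + ln (norm (det (Hmat y))) = lnvol y"
      using y det_Hmat[OF y(1)] by (simp add: lnvol_def ln_mult)
  qed
qed

lemma \<beta>_diff: "z \<in> U \<Longrightarrow> (\<lambda>y. \<beta> y w) differentiable (at z)"
proof -
  assume z: "z \<in> U"
  have "(\<lambda>y. Dir w \<zeta> y / \<zeta> y) differentiable (at z)"
    using z \<zeta>_nz by (intro differentiable_divide D\<zeta>_diff \<zeta>_diff) auto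
  then have "(\<lambda>y. Re (Dir w \<zeta> y / \<zeta> y)) differentiable (at z)"
    using bounded_linear.has_derivative[OF bounded_linear_Re] unfolding differentiable_def by blast
  then show ?thesis unfolding \<beta>_def using z US by (auto intro!: derivative_intros lam_diff)
qed

lemma linear_\<beta>: "z \<in> U \<Longrightarrow> linear (\<beta> z)"
  using lnvol_has_derivative has_derivative_linear by blast

text \<open>\<open>\<beta>\<close> is exact, with primitive \<open>lnvol\<close>, so this is the
  symmetry of second derivatives.\<close>

lemma \<beta>_symmetric:
  assumes z: "z \<in> U" shows "Dir v (\<lambda>y. \<beta> y w) z = Dir w (\<lambda>y. \<beta> y v) z"
proof -
  have e: "Dir w lnvol y = \<beta> y w" if "y \<in> U" for w y
    using frechet_derivative_eq[OF lnvol_has_derivative[OF that]] by simp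
  have e2: "Dir v (\<lambda>y. Dir w lnvol y) z = Dir v (\<lambda>y. \<beta> y w) z" for v w
    using frechet_derivative_cong_open[OF openU z, of "\<lambda>y. Dir w lnvol y" "\<lambda>y. \<beta> y w"] e by simp
  have d: "(\<lambda>y. Dir w lnvol y) differentiable (at z)" for w
    using differentiable_cong_open[OF openU z _ \<beta>_diff[OF z]] e by simp
  show ?thesis
    using second_derivative_symmetric[OF openU z _ d d, of w v] lnvol_has_derivative unfolding e2
    by (auto simp: differentiable_def)
qed

text \<open>The frame part of \<open>\<beta>\<close> is twice the real part of the holomorphic
  quotient \<open>q\<close>: passing from \<open>w\<close> to \<open>J w\<close> and from
  \<open>v\<close> to \<open>J v\<close> each contributes a factor \<open>\<i>\<close>, and their
  product \<open>- 1\<close> cancels it. Only \<open>lam\<close> remains, and there the Einstein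
  condition applies.\<close>

lemma \<beta>_einstein:
  assumes z: "z \<in> U" and E: "\<And>u v. ricci_form \<omega> c z u v = \<kappa> * \<omega> c z u v"
  shows "Dir v (\<lambda>y. \<beta> y w) z + Dir (J v) (\<lambda>y. \<beta> y (J w)) z = - 2 * \<kappa> * g z v w"
proof -
  have zS: "z \<in> S" using z US by blast
  define q where "q y = Dir w \<zeta> y / \<zeta> y" for y
  define q' where "q' h = - Dir w \<zeta> z * (inverse (\<zeta> z) * Dir h \<zeta> z * inverse (\<zeta> z)) + Dir h (\<lambda>y. Dir w \<zeta> y) z / \<zeta> z" for h
  have q: "(q has_derivative q') (at z)"
    unfolding q_def[abs_def] q'_def[abs_def]
    by (rule has_derivative_divide[OF has_derivative_frechet[OF D\<zeta>_diff[OF z]] has_derivative_frechet[OF \<zeta>_diff[OF z]] \<zeta>_nz[OF z]])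
  have sym: "Dir v (\<lambda>y. Dir u \<zeta> y) z = Dir u (\<lambda>y. Dir v \<zeta> y) z" for u v
    by (rule second_derivative_symmetric[OF openU z]) (auto intro: \<zeta>_diff D\<zeta>_diff z)
  have "Dir w (\<lambda>y. Dir (J v) \<zeta> y) z = Dir w (\<lambda>y. \<i> * Dir v \<zeta> y) z" for v
    using frechet_derivative_cong_open[OF openU z, of "\<lambda>y. Dir (J v) \<zeta> y" "\<lambda>y. \<i> * Dir v \<zeta> y"] \<zeta>_J by simp
  also have "\<dots> v = \<i> * Dir w (\<lambda>y. Dir v \<zeta> y) z" for v
    using frechet_derivative_eq[OF has_derivative_mult_right[OF has_derivative_frechet[OF D\<zeta>_diff[OF z]]]] by simp
  finally have J2: "Dir (J v) (\<lambda>y. Dir w \<zeta> y) z = \<i> * Dir v (\<lambda>y. Dir w \<zeta> y) z" for v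
    using sym by metis
  have qJ: "q' (J v) = \<i> * q' v" for v
    unfolding q'_def J2 \<zeta>_J[OF z] by (simp add: algebra_simps)
  have Req: "((\<lambda>y. Re (a * q y)) has_derivative (\<lambda>h. Re (a * q' h))) (at z)" for a
    by (intro bounded_linear.has_derivative[OF bounded_linear_Re] has_derivative_mult_right q)
  have b1: "((\<lambda>y. \<beta> y w) has_derivative (\<lambda>h. 2 * Re (q' h) + Dir h (\<lambda>y. lam y w) z)) (at z)"
    unfolding \<beta>_def q_def[symmetric]
    using has_derivative_add[OF has_derivative_mult_right[OF Req[of 1], of 2] has_derivative_frechet[OF lam_diff[OF zS]]]
    by simp
  have b2': "((\<lambda>y. 2 * Re (\<i> * q y) + lam y (J w)) has_derivative (\<lambda>h. 2 * Re (\<i> * q' h) + Dir h (\<lambda>y. lam y (J w)) z)) (at z)"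
    by (rule has_derivative_add[OF has_derivative_mult_right[OF Req[of \<i>], of 2] has_derivative_frechet[OF lam_diff[OF zS]]])
  have b2: "((\<lambda>y. \<beta> y (J w)) has_derivative (\<lambda>h. 2 * Re (\<i> * q' h) + Dir h (\<lambda>y. lam y (J w)) z)) (at z)"
    by (rule has_derivative_transform_within_open[OF b2' openU z]) (simp add: \<beta>_def q_def \<zeta>_J)
  show ?thesis
    unfolding frechet_derivative_eq[OF b1] frechet_derivative_eq[OF b2] qJ
    using einstein_lam[OF zS E, where v = v and w = w] by simp
qed

abbreviation nabla where "nabla z w j \<equiv> Dir w (X j) z + \<Gamma> z w (X j z)"

lemma g_X_has_derivative:
  assumes z: "z \<in> U"
  shows "((\<lambda>y. g y (X j y) (X k y)) has_derivative
      (\<lambda>w. g z (nabla z w j) (X k z) + g z (X j z) (nabla z w k))) (at z)"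
proof -
  have zS: "z \<in> S" using z US by blast
  have "((\<lambda>y. g y (X j y) (X k y)) has_derivative
      (\<lambda>w. dg z w (X j z) (X k z) + g z (Dir w (X j) z) (X k z) + g z (X j z) (Dir w (X k) z))) (at z)"
    by (rule has_derivative_bilinear_section[OF openS zS bil_g has_derivative_frechet[OF g_diff[OF zS]]
       X_has_derivative[OF z] X_has_derivative[OF z]])
  then show ?thesis
    by (simp add: metric_compatible[OF zS] bilinear_ladd[OF bil_g[OF zS]] bilinear_radd[OF bil_g[OF zS]] algebra_simps)
qed

text \<open>Where the frame spans a Lagrangian subspace, Killing's equation turns the derivative of the
  volume into the trace of \<open>\<nabla>\<^sub>X X\<close>.\<close>

lemma \<beta>_lagrangian:
  fixes z
  defines "Ginv \<equiv> matrix_inv ((\<chi> a b. g z (X a z) (X b z)) :: real^'n^'n)"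
  assumes z: "z \<in> U" and lag: "\<And>j k. \<omega> c z (X j z) (X k z) = 0"
    and killing: "\<And>j u v. g z (nabla z u j) v + g z u (nabla z v j) = 0"
  shows "\<beta> z w = - 2 * g z w (\<Sum>a\<in>UNIV. \<Sum>b\<in>UNIV. Ginv $ a $ b *\<^sub>R nabla z (X a z) b)"
proof -
  have zS: "z \<in> S" using z US by blast
  let ?G = "(\<chi> a b. g z (X a z) (X b z)) :: real^'n^'n"
  let ?K = "\<lambda>y. hgram y (\<lambda>j. X j y)"
  have K: "?K z = (\<chi> a b. complex_of_real (?G $ a $ b))"
    using lag form_g[OF zS] by (simp add: hgram_def herm_def vec_eq_iff)
  have detK: "det (?K z) \<noteq> 0" using det_hgram_nz[OF zS] indep[OF z] by blast
  then have "det ?G \<noteq> 0" unfolding K det_map_of_real by simp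
  then have GG: "?G ** Ginv = mat 1" "Ginv ** ?G = mat 1"
    unfolding Ginv_def using matrix_inv_works invertible_det_nz by blast+
  have Kinv: "matrix_inv (?K z) = (\<chi> a b. complex_of_real (Ginv $ a $ b))"
  proof (rule matrix_inv_unique_right)
    have "(\<Sum>l\<in>UNIV. ?G $ a $ l * Ginv $ l $ b) = (if a = b then 1 else 0)" for a b
      using GG(1) by (simp add: matrix_matrix_mult_def vec_eq_iff mat_def)
    then have "(\<Sum>l\<in>UNIV. complex_of_real (?G $ a $ l) * complex_of_real (Ginv $ l $ b)) = (if a = b then 1 else 0)" for a b
      unfolding of_real_mult[symmetric] of_real_sum[symmetric] by simp
    then show "?K z ** (\<chi> a b. complex_of_real (Ginv $ a $ b)) = mat 1"
      unfolding K by (simp add: matrix_matrix_mult_def vec_eq_iff mat_def)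
  qed
  have Gs: "Ginv $ a $ b = Ginv $ b $ a" for a b
  proof -
    have "transpose ?G = ?G" using g_sym[OF zS] by (simp add: transpose_def vec_eq_iff)
    then have "?G ** transpose Ginv = mat 1" using GG(2) by (metis matrix_transpose_mul transpose_mat)
    then have "transpose Ginv = Ginv" unfolding Ginv_def by (rule matrix_inv_unique_right[symmetric])
    then show ?thesis by (metis transpose_def vec_lambda_beta)
  qed
  define R' where "R' w j k = g z (nabla z w j) (X k z) + g z (X j z) (nabla z w k)" for w j k
  have "(\<lambda>y. g y (X j y) (J (X k y))) differentiable (at z)" for j k
    using has_derivative_bilinear_section[OF openS zS bil_g has_derivative_frechet[OF g_diff[OF zS]]
       X_has_derivative[OF z, of j] bounded_linear.has_derivative[OF bounded_linear_J X_has_derivative[OF z, of k]]]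
    by (auto simp: differentiable_def)
  \<comment> \<open>No formula for the derivative of the imaginary part is wanted: the inverse Gram
    matrix is real, and only the real part of the trace survives.\<close>
  then obtain I' where I': "\<And>j k. ((\<lambda>y. g y (X j y) (J (X k y))) has_derivative I' j k) (at z)"
    unfolding differentiable_def by metis
  define K' :: "complex^'n \<Rightarrow> complex^'n^'n" where "K' w = (\<chi> j k. complex_of_real (R' w j k) + \<i> * complex_of_real (I' j k w))" for w
  have "((\<lambda>y. ?K y $ j $ k) has_derivative (\<lambda>w. K' w $ j $ k)) (at z)" for j k
    unfolding hgram_def herm_def K'_def R'_def
    using has_derivative_add[OF has_derivative_of_real[OF g_X_has_derivative[OF z]]
       has_derivative_mult_right[OF has_derivative_of_real[OF I'], of \<i>]] by simp
  from has_derivative_ln_det[OF this detK]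
  have "(lnvol has_derivative (\<lambda>w. Re (trace (matrix_inv (?K z) ** K' w)))) (at z)"
    unfolding lnvol_def[abs_def] .
  then have "\<beta> z = (\<lambda>w. Re (trace (matrix_inv (?K z) ** K' w)))"
    using lnvol_has_derivative[OF z] has_derivative_unique by blast
  then have "\<beta> z w = (\<Sum>a\<in>UNIV. \<Sum>b\<in>UNIV. Ginv $ a $ b * R' w b a)"
    unfolding Kinv by (simp add: trace_def matrix_matrix_mult_def K'_def algebra_simps)
  \<comment> \<open>Killing's equation moves the direction \<open>w\<close> out of the derivative:
    \<open>g(\<nabla>_w X_b, X_a) = - g(w, \<nabla>_{X_a} X_b)\<close>.\<close>
  also have "\<dots> = (\<Sum>a\<in>UNIV. \<Sum>b\<in>UNIV. Ginv $ a $ b * (- g z w (nabla z (X a z) b) - g z w (nabla z (X b z) a)))"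
  proof (intro sum.cong refl)
    fix a b
    have "R' w b a = - g z w (nabla z (X a z) b) - g z w (nabla z (X b z) a)"
      unfolding R'_def using killing[of b w "X a z"] killing[of a w "X b z"] g_sym[OF zS, of "X b z"] by simp
    then show "Ginv $ a $ b * R' w b a = Ginv $ a $ b * (- g z w (nabla z (X a z) b) - g z w (nabla z (X b z) a))" by simp
  qed
  also have "\<dots> = - (\<Sum>a\<in>UNIV. \<Sum>b\<in>UNIV. Ginv $ a $ b * g z w (nabla z (X a z) b))
       - (\<Sum>a\<in>UNIV. \<Sum>b\<in>UNIV. Ginv $ a $ b * g z w (nabla z (X b z) a))"
    by (simp add: algebra_simps sum.distrib sum_subtractf sum_negf)
  also have "(\<Sum>a\<in>UNIV. \<Sum>b\<in>UNIV. Ginv $ a $ b * g z w (nabla z (X b z) a)) = (\<Sum>a\<in>UNIV. \<Sum>b\<in>UNIV. Ginv $ a $ b * g z w (nabla z (X a z) b))"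
    by (subst sum.swap) (simp add: Gs)
  also have "(\<Sum>a\<in>UNIV. \<Sum>b\<in>UNIV. Ginv $ a $ b * g z w (nabla z (X a z) b)) = g z w (\<Sum>a\<in>UNIV. \<Sum>b\<in>UNIV. Ginv $ a $ b *\<^sub>R nabla z (X a z) b)"
  proof -
    have "linear (g z w)" using bil_g[OF zS] by (simp add: bilinear_def)
    then show ?thesis by (simp add: linear_sum linear_scale)
  qed
  finally show ?thesis by simp
qed

end

section \<open>Isometries commute with the curvature\<close>

context kahler_chart begin

lemma Rm_linear3: assumes z: "z \<in> S" shows "linear (\<lambda>w. Rm z u v w)"
  unfolding curvature_def
  using bil_dirder_\<Gamma>[OF z] bil_\<Gamma>[OF z]
  by (intro linearI)
    (simp_all add: bilinear_radd[OF bil_dirder_\<Gamma>[OF z]] bilinear_rmul[OF bil_dirder_\<Gamma>[OF z]]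
      bilinear_radd[OF bil_\<Gamma>[OF z]] bilinear_rmul[OF bil_\<Gamma>[OF z]] algebra_simps)

lemma Rm_antisym: "Rm z u v w = - Rm z v u w"
  unfolding curvature_def by simp

lemma Rm_J: assumes z: "z \<in> S" shows "Rm z u v (J w) = J (Rm z u v w)"
proof -
  have d: "Dir u (\<lambda>y. \<Gamma> y v (J w)) z = J (Dir u (\<lambda>y. \<Gamma> y v w) z)" for u v
  proof -
    have "Dir u (\<lambda>y. \<Gamma> y v (J w)) z = Dir u (\<lambda>y. J (\<Gamma> y v w)) z"
      using frechet_derivative_cong_open[OF openS z, of "\<lambda>y. \<Gamma> y v (J w)" "\<lambda>y. J (\<Gamma> y v w)"] \<Gamma>_J by simp
    also have "\<dots> = J (Dir u (\<lambda>y. \<Gamma> y v w) z)"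
      using frechet_derivative_eq[OF bounded_linear.has_derivative[OF bounded_linear_J has_derivative_frechet[OF \<Gamma>_diff[OF z]]]]
      by simp
    finally show ?thesis .
  qed
  show ?thesis unfolding curvature_def d \<Gamma>_J[OF z] by (simp only: J_add J_diff)
qed

lemma bianchi: assumes z: "z \<in> S" shows "Rm z u v w + Rm z v w u + Rm z w u v = 0"
proof -
  have d: "Dir a (\<lambda>y. \<Gamma> y b c) z = Dir a (\<lambda>y. \<Gamma> y c b) z" for a b c
    using frechet_derivative_cong_open[OF openS z, of "\<lambda>y. \<Gamma> y b c" "\<lambda>y. \<Gamma> y c b"] \<Gamma>_sym by auto
  show ?thesis unfolding curvature_def
    using d[where a=u and b=v and c=w] d[where a=v and b=w and c=u] d[where a=w and b=u and c=v] \<Gamma>_sym[OF z, of u v] \<Gamma>_sym[OF z, of u w] \<Gamma>_sym[OF z, of v w] by simp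
qed

text \<open>If an orthogonal complex structure \<open>K\<close> commutes with the curvature, then so does
  \<open>E = [K, J]\<close>, and \<open>tr (E R) = 0\<close> because \<open>E\<close> anticommutes with \<open>J\<close> while \<open>R\<close> commutes with it;
  by the Bianchi identity this trace is \<open>2 Ric(v, E w)\<close> up to sign.\<close>

lemma einstein_commute:
  assumes z: "z \<in> S" and E: "\<And>u v. ricci_form \<omega> c z u v = \<kappa> * \<omega> c z u v" and \<kappa>: "\<kappa> \<noteq> 0"
    and linK: "linear K" and KK: "\<And>u. K (K u) = - u" and gK: "\<And>u v. g z (K u) (K v) = g z u v"
    and RK: "\<And>u v w. K (Rm z u v w) = Rm z u v (K w)"
  shows "K (J w) = J (K w)"
proof -
  note bg = bilinear_rsub[OF bil_g[OF z]] bilinear_lsub[OF bil_g[OF z]] bilinear_lneg[OF bil_g[OF z]] bilinear_rneg[OF bil_g[OF z]]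
  \<comment> \<open>The commutator that is denoted \<open>E\<close> in the remark above the lemma;
    inside the proof \<open>E\<close> names the Einstein condition.\<close>
  define C where "C u = K (J u) - J (K u)" for u
  have linC: "linear C"
    unfolding C_def by (rule linearI) (simp_all add: J_add J_scaleR linear_add[OF linK] linear_scale[OF linK] scaleR_diff_right
       del: vector_smult_component)
  have CJ: "C (J u) = - J (C u)" for u
    unfolding C_def by (simp only: J_diff J_J linear_neg[OF linK]) simp
  have RC: "C (Rm z u v w) = Rm z u v (C w)" for u v w
    unfolding C_def linear_diff[OF Rm_linear3[OF z]] Rm_J[OF z] RK[symmetric] by (simp only: Rm_J[OF z, symmetric] RK)
  \<comment> \<open>Conjugation by \<open>J\<close>, with inverse \<open>- J\<close>, preserves the
    trace but changes the sign of \<open>C (Rm z v w b)\<close>, so the trace equals its own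
    negative.\<close>
  have trC: "real_trace (\<lambda>b. C (Rm z v w b)) = 0" for v w
  proof -
    let ?f = "\<lambda>b. C (Rm z v w b)"
    have "linear ?f" using linear_compose[OF Rm_linear3[OF z] linC] by (simp add: o_def)
    moreover have "linear (\<lambda>v. - J v)" using linear_compose_neg[OF linear_J] by simp
    ultimately have "real_trace (\<lambda>v. - J (?f (J v))) = real_trace ?f"
      using real_trace_conjugate[of ?f "J" "\<lambda>v. - J v"] linear_J by (simp add: J_minus J_J)
    moreover have "- J (?f (J b)) = - ?f b" for b by (simp only: Rm_J[OF z] CJ J_minus J_J) simp
    ultimately show ?thesis by (simp add: real_trace_minus)
  qed
  have Ks: "g z (K u) v = - g z u (K v)" for u v using gK[of u "K v"] by (simp add: KK bg)
  have Cs: "g z (C u) v = - g z u (C v)" for u v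
    unfolding C_def bg using Ks[of "J u" v] Ks[of u "J v"] g_J[OF z, of "K u" v] g_J[OF z, of u "K v"] by linarith
  \<comment> \<open>By the Bianchi identity the two Ricci terms differ by a vanishing trace, so
    \<open>g z v (C w)\<close> is symmetric in \<open>v\<close> and \<open>w\<close>; since
    \<open>C\<close> is skew it is also antisymmetric.\<close>
  have "g z v (C w) = 0" for v
  proof -
    have "\<kappa> * g z v (C w) - \<kappa> * g z w (C v) = ricci (metric \<omega>) c z v (C w) - ricci (metric \<omega>) c z w (C v)"
      using einstein_ricci[OF z E] by simp
    also have "\<dots> = real_trace (\<lambda>b. C (Rm z b v w)) - real_trace (\<lambda>b. C (Rm z b w v))"
      unfolding ricci_def real_trace_def RC ..
    also have "\<dots> = real_trace (\<lambda>b. - C (Rm z v w b))"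
    proof -
      have "C (Rm z b v w) - C (Rm z b w v) = - C (Rm z v w b)" for b
      proof -
        have "Rm z b v w - Rm z b w v = - Rm z v w b"
          using bianchi[OF z, of b v w] Rm_antisym[of z w b v] by (simp add: algebra_simps add_eq_0_iff)
        then show ?thesis using linear_diff[OF linC] linear_neg[OF linC] by metis
      qed
      then show ?thesis by (simp add: real_trace_diff[symmetric])
    qed
    also have "\<dots> = 0" by (simp add: real_trace_minus trC)
    finally have "g z v (C w) = g z w (C v)" using \<kappa> by (simp add: right_diff_distrib[symmetric])
    then show ?thesis using Cs[of w v] g_sym[OF z, of "C w" v] by simp
  qed
  then have "C w = 0" using g_nondegenerate[OF z, of "C w" 0] g_sym[OF z]
    by (metis bilinear_lzero[OF bil_g[OF z]])
  then show ?thesis by (simp add: C_def)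
qed

end

section \<open>Isometries and the complex structure that they pull back\<close>

locale kahler_isometry = a: kahler_chart \<omega> c S + b: kahler_chart \<omega> d S'
  for \<omega> :: "('m, complex^'n) tensor2" and c S d S' +
  fixes F :: "complex^'n \<Rightarrow> complex^'n" and T
  assumes openT: "open T" and TS: "T \<subseteq> S" and FT: "F ` T \<subseteq> S'"
    and smoothF: "smooth_on T F"
    and iso: "\<And>z u v. z \<in> T \<Longrightarrow> metric \<omega> d (F z) (Dir u F z) (Dir v F z) = metric \<omega> c z u v"
begin

abbreviation F' where "F' z u \<equiv> Dir u F z"
abbreviation F2 where "F2 z w u \<equiv> Dir w (\<lambda>y. Dir u F y) z"

lemma dF: "z \<in> T \<Longrightarrow> F differentiable (at z)" and dF': "z \<in> T \<Longrightarrow> (\<lambda>y. F' y u) differentiable (at z)"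
  using smooth_on_differentiable[OF smoothF] smooth_on_differentiable[OF smooth_on_Dir[OF smoothF]] by blast+

lemma linF': "z \<in> T \<Longrightarrow> linear (F' z)" using dF linear_Dir by blast

lemma F2_sym: "z \<in> T \<Longrightarrow> F2 z w u = F2 z u w"
  by (rule second_derivative_symmetric[OF openT]) (auto intro: dF dF')

lemma injF': "z \<in> T \<Longrightarrow> inj (F' z)"
proof (rule linear_injective_0[THEN iffD2, OF linF'], assumption, intro allI impI)
  fix u assume z: "z \<in> T" and u: "F' z u = 0"
  have "a.g z u u = 0" using iso[OF z, of u u] FT z bilinear_lzero[OF b.bil_g] unfolding u by fastforce
  then show "u = 0" using a.pos[of z u] z TS by fastforce
qed

lemma surjF': "z \<in> T \<Longrightarrow> surj (F' z)"
  using linear_injective_imp_surjective[OF linF' injF'] by blast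

lemma iso_derivative:
  assumes z: "z \<in> T"
  shows "a.dg z w u v = b.dg (F z) (F' z w) (F' z u) (F' z v) + b.g (F z) (F2 z w u) (F' z v) + b.g (F z) (F' z u) (F2 z w v)"
proof -
  have Fz: "F z \<in> S'" using z FT by blast
  have d: "((\<lambda>y. b.g (F y) p q) has_derivative (\<lambda>w. b.dg (F z) (F' z w) p q)) (at z)" for p q
    using diff_chain_at[OF has_derivative_frechet[OF dF[OF z]] has_derivative_frechet[OF b.g_diff[OF Fz]]] by (simp add: o_def)
  have "((\<lambda>y. b.g (F y) (F' y u) (F' y v)) has_derivative
     (\<lambda>w. b.dg (F z) (F' z w) (F' z u) (F' z v) + b.g (F z) (F2 z w u) (F' z v) + b.g (F z) (F' z u) (F2 z w v))) (at z)"
    by (rule has_derivative_bilinear_section[OF openT z _ d has_derivative_frechet[OF dF'[OF z]] has_derivative_frechet[OF dF'[OF z]]])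
      (use FT b.bil_g in auto)
  from frechet_derivative_eq[OF this]
  have "Dir w (\<lambda>y. b.g (F y) (F' y u) (F' y v)) z = b.dg (F z) (F' z w) (F' z u) (F' z v) + b.g (F z) (F2 z w u) (F' z v) + b.g (F z) (F' z u) (F2 z w v)"
    by simp
  moreover have "Dir w (\<lambda>y. b.g (F y) (F' y u) (F' y v)) z = a.dg z w u v"
    using frechet_derivative_cong_open[OF openT z, of "\<lambda>y. b.g (F y) (F' y u) (F' y v)" "\<lambda>y. a.g y u v"] iso by simp
  ultimately show ?thesis by simp
qed

text \<open>The Koszul formula determines the connection from the metric, so an isometry carries one
  connection to the other; its second derivative is the inhomogeneous term in the transformation of
  Christoffel symbols. Vectors \<open>F' z x\<close> suffice as test vectors because
  \<open>F' z\<close> is onto.\<close>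

lemma affine:
  assumes z: "z \<in> T"
  shows "F2 z u v = F' z (a.\<Gamma> z u v) - b.\<Gamma> (F z) (F' z u) (F' z v)"
proof -
  have Fz: "F z \<in> S'" and zS: "z \<in> S" using z FT TS by auto
  have "F' z (a.\<Gamma> z u v) = F2 z u v + b.\<Gamma> (F z) (F' z u) (F' z v)"
  proof (rule b.g_nondegenerate[OF Fz])
    fix y
    obtain x where x: "y = F' z x" using surjF'[OF z] by (metis surjD)
    have "2 * b.g (F z) (F' z (a.\<Gamma> z u v)) (F' z x) = a.dg z u v x + a.dg z v u x - a.dg z x u v"
      using iso[OF z] a.christoffel_spec[OF zS] by simp
    also have "\<dots> = 2 * b.g (F z) (b.\<Gamma> (F z) (F' z u) (F' z v)) (F' z x) + 2 * b.g (F z) (F2 z u v) (F' z x)"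
      unfolding iso_derivative[OF z] b.christoffel_spec[OF Fz]
      using F2_sym[OF z, of u v] F2_sym[OF z, of u x] F2_sym[OF z, of v x]
        b.g_sym[OF Fz, of "F2 z u x" "F' z v"] b.g_sym[OF Fz, of "F' z u" "F2 z v x"] 
      by simp
    finally show "b.g (F z) (F' z (a.\<Gamma> z u v)) y = b.g (F z) (F2 z u v + b.\<Gamma> (F z) (F' z u) (F' z v)) y"
      unfolding x by (simp add: bilinear_ladd[OF b.bil_g[OF Fz]])
  qed
  then show ?thesis by simp
qed

text \<open>The complex structure of the target pulled back by \<open>F\<close>. The question
  whether \<open>F\<close> is holomorphic becomes whether \<open>K\<close> equals
  \<open>J\<close>.\<close>

definition K where "K z u = inv_into UNIV (F' z) (J (F' z u))"

lemma F'_K: "z \<in> T \<Longrightarrow> F' z (K z u) = J (F' z u)"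
  unfolding K_def using surjF'[of z] by (simp add: surj_f_inv_f)

lemma F'_eqD: "z \<in> T \<Longrightarrow> F' z u = F' z v \<Longrightarrow> u = v"
  using injF' by (meson injD)

lemma linK: assumes z: "z \<in> T" shows "linear (K z)"
proof (rule linearI)
  show "K z (u + v) = K z u + K z v" for u v
    by (rule F'_eqD[OF z]) (simp only: F'_K[OF z] linear_add[OF linF'[OF z]] J_add)
  show "K z (r *\<^sub>R u) = r *\<^sub>R K z u" for r u
    by (rule F'_eqD[OF z]) (simp only: F'_K[OF z] linear_scale[OF linF'[OF z]] J_scaleR)
qed

lemma K_K: assumes z: "z \<in> T" shows "K z (K z u) = - u"
  by (rule F'_eqD[OF z]) (simp only: F'_K[OF z] linear_neg[OF linF'[OF z]] J_J)

lemma g_K: assumes z: "z \<in> T" shows "a.g z (K z u) (K z v) = a.g z u v"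
  using iso[OF z, of "K z u" "K z v"] iso[OF z, of u v] b.g_JJ FT z unfolding F'_K[OF z] by auto

lemma dK: assumes z: "z \<in> T" shows "(\<lambda>y. K y u) differentiable (at z)"
proof (rule differentiable_linear_solution[OF openT z linF' dF'[OF z] _ injF'[OF z]])
  show "(\<lambda>y. J (F' y u)) differentiable (at z)"
    using bounded_linear.has_derivative[OF bounded_linear_J has_derivative_frechet[OF dF'[OF z]]]
    by (auto simp: differentiable_def)
qed (auto simp: F'_K)

text \<open>This is the equation \<open>\<nabla> K = 0\<close>: an isometry is affine and
  \<open>J\<close> is parallel on the target.\<close>

lemma K_parallel:
  assumes z: "z \<in> T"
  shows "Dir w (\<lambda>y. K y u) z = K z (a.\<Gamma> z w u) - a.\<Gamma> z w (K z u)"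
proof (rule F'_eqD[OF z])
  have Fz: "F z \<in> S'" using z FT by auto
  have 1: "((\<lambda>y. F' y (K y u)) has_derivative (\<lambda>w. F2 z w (K z u) + F' z (Dir w (\<lambda>y. K y u) z))) (at z)"
    by (rule has_derivative_linear_section[OF openT z linF' has_derivative_frechet[OF dF'[OF z]] has_derivative_frechet[OF dK[OF z]]])
  have 2: "((\<lambda>y. F' y (K y u)) has_derivative (\<lambda>w. J (F2 z w u))) (at z)"
    by (rule has_derivative_transform_within_open[OF bounded_linear.has_derivative[OF bounded_linear_J has_derivative_frechet[OF dF'[OF z]]] openT z])
      (simp only: F'_K)
  have "F2 z w (K z u) + F' z (Dir w (\<lambda>y. K y u) z) = J (F2 z w u)"
    using has_derivative_unique[OF 1 2] by meson
  then show "F' z (Dir w (\<lambda>y. K y u) z) = F' z (K z (a.\<Gamma> z w u) - a.\<Gamma> z w (K z u))"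
    unfolding affine[OF z] by (simp only: F'_K[OF z] b.\<Gamma>_J[OF Fz] J_diff linear_diff[OF linF'[OF z]]) (simp add: algebra_simps)
qed

text \<open>A parallel endomorphism commutes with the curvature: after differentiating
  \<open>K_parallel\<close> once more, the symmetry of second derivatives is exactly this
  integrability condition.\<close>

lemma K_curvature:
  assumes z: "z \<in> T"
  shows "K z (a.Rm z v w u) = a.Rm z v w (K z u)"
proof -
  have zS: "z \<in> S" using z TS by auto
  have d2: "((\<lambda>y. Dir w (\<lambda>y. K y u) y) has_derivative
     (\<lambda>h. (Dir h (\<lambda>y. K y (a.\<Gamma> z w u)) z + K z (Dir h (\<lambda>y. a.\<Gamma> y w u) z))
        - (Dir h (\<lambda>y. a.\<Gamma> y w (K z u)) z + a.\<Gamma> z w (Dir h (\<lambda>y. K y u) z)))) (at z)" for w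
  proof -
    have 1: "((\<lambda>y. K y (a.\<Gamma> y w u)) has_derivative (\<lambda>h. Dir h (\<lambda>y. K y (a.\<Gamma> z w u)) z + K z (Dir h (\<lambda>y. a.\<Gamma> y w u) z))) (at z)"
      by (rule has_derivative_linear_section[OF openT z linK has_derivative_frechet[OF dK[OF z]] has_derivative_frechet[OF a.\<Gamma>_diff[OF zS]]])
    have 2: "((\<lambda>y. a.\<Gamma> y w (K y u)) has_derivative (\<lambda>h. Dir h (\<lambda>y. a.\<Gamma> y w (K z u)) z + a.\<Gamma> z w (Dir h (\<lambda>y. K y u) z))) (at z)"
      by (rule has_derivative_linear_section[OF openT z _ has_derivative_frechet[OF a.\<Gamma>_diff[OF zS]] has_derivative_frechet[OF dK[OF z]]])
        (use a.bil_\<Gamma> TS in \<open>auto simp: bilinear_def\<close>)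
    show ?thesis
      by (rule has_derivative_transform_within_open[OF has_derivative_diff[OF 1 2] openT z]) (simp add: K_parallel)
  qed
  have "Dir v (\<lambda>y. Dir w (\<lambda>y. K y u) y) z = Dir w (\<lambda>y. Dir v (\<lambda>y. K y u) y) z"
    by (rule second_derivative_symmetric[OF openT z]) (use dK d2 in \<open>auto simp: differentiable_def\<close>)
  then have "(Dir v (\<lambda>y. K y (a.\<Gamma> z w u)) z + K z (Dir v (\<lambda>y. a.\<Gamma> y w u) z))
        - (Dir v (\<lambda>y. a.\<Gamma> y w (K z u)) z + a.\<Gamma> z w (Dir v (\<lambda>y. K y u) z))
     = (Dir w (\<lambda>y. K y (a.\<Gamma> z v u)) z + K z (Dir w (\<lambda>y. a.\<Gamma> y v u) z))
        - (Dir w (\<lambda>y. a.\<Gamma> y v (K z u)) z + a.\<Gamma> z v (Dir w (\<lambda>y. K y u) z))"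
    unfolding frechet_derivative_eq[OF d2] .
  then show ?thesis
    unfolding K_parallel[OF z] curvature_def
    by (simp add: bilinear_rsub[OF a.bil_\<Gamma>[OF zS]] linear_diff[OF linK[OF z]] linear_add[OF linK[OF z]] algebra_simps)
qed

lemma K_commute:
  assumes z: "z \<in> T" and E: "\<And>u v. ricci_form \<omega> c z u v = \<kappa> * \<omega> c z u v" and \<kappa>: "\<kappa> \<noteq> 0"
  shows "K z (J w) = J (K z w)"
  by (rule a.einstein_commute[OF _ E \<kappa> linK K_K g_K K_curvature]) (use z TS in auto)

text \<open>Hence \<open>(K - J)(K + J) = 0\<close>.\<close>

lemma holomorphic_if_close:
  assumes z: "z \<in> T" and E: "\<And>u v. ricci_form \<omega> c z u v = \<kappa> * \<omega> c z u v" and \<kappa>: "\<kappa> \<noteq> 0"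
    and surj: "surj (\<lambda>u. J (F' z u) + F' z (J u))"
  shows "F' z (J u) = J (F' z u)"
proof -
  \<comment> \<open>Through \<open>F'\<close>, the hypothesis says that \<open>K + J\<close> is
    onto, and on its image the two structures agree. It holds whenever the differential is close to
    a complex linear isomorphism.\<close>
  obtain x where x: "F' z u = J (F' z x) + F' z (J x)" using surjD[OF surj, of "F' z u"] by blast
  have u: "u = K z x + J x"
    by (rule F'_eqD[OF z]) (simp only: x linear_add[OF linF'[OF z]] F'_K[OF z])
  have "K z u = J u"
    unfolding u by (simp only: linear_add[OF linK[OF z]] K_K[OF z] J_add J_J K_commute[OF z E \<kappa>]) simp
  then show ?thesis using F'_K[OF z, of u] by simp
qed

end

section \<open>Charts\<close>

abbreviation cinv :: "('x, 'e) chart \<Rightarrow> 'e \<Rightarrow> 'x" where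
  "cinv c \<equiv> inv_into (fst c) (snd c)"

definition chart_atlas :: "('x::topological_space, 'e::euclidean_space) chart set \<Rightarrow> bool" where
  "chart_atlas A \<longleftrightarrow> (\<forall>c\<in>A. is_chart c) \<and> (\<Union>c\<in>A. fst c) = UNIV"

lemma complex_atlas_chart_atlas: "complex_atlas A \<Longrightarrow> chart_atlas A"
  and smooth_atlas_chart_atlas: "smooth_atlas B \<Longrightarrow> chart_atlas B"
  by (simp_all add: complex_atlas_def smooth_atlas_def chart_atlas_def)

lemma chart_atlasD: "chart_atlas A \<Longrightarrow> c \<in> A \<Longrightarrow> is_chart c"
  by (simp add: chart_atlas_def)

lemma chart_at: assumes "chart_atlas A" obtains c where "c \<in> A" "p \<in> fst c" "is_chart c"
  using assms unfolding chart_atlas_def by blast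

lemma chart_open: "is_chart c \<Longrightarrow> open (fst c)" "is_chart c \<Longrightarrow> open (snd c ` fst c)"
  by (simp_all add: is_chart_def)

lemma chart_inj: "is_chart c \<Longrightarrow> inj_on (snd c) (fst c)"
  unfolding is_chart_def homeomorphism_def by (metis inj_on_def)

lemma cinv_chart: "is_chart c \<Longrightarrow> p \<in> fst c \<Longrightarrow> cinv c (snd c p) = p"
  using chart_inj[of c] by (simp add: inv_into_f_f)

lemma cinv_dom: "z \<in> snd c ` fst c \<Longrightarrow> cinv c z \<in> fst c"
  by (rule inv_into_into)

lemma chart_cinv: "z \<in> snd c ` fst c \<Longrightarrow> snd c (cinv c z) = z"
  by (rule f_inv_into_f)

lemma chart_continuous: "is_chart c \<Longrightarrow> continuous_on (fst c) (snd c)"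
  by (auto simp: is_chart_def homeomorphism_def)

lemma cinv_continuous: assumes "is_chart c" shows "continuous_on (snd c ` fst c) (cinv c)"
proof -
  obtain h where h: "homeomorphism (fst c) (snd c ` fst c) (snd c) h" using assms by (auto simp: is_chart_def)
  have "cinv c z = h z" if "z \<in> snd c ` fst c" for z
    using that h cinv_chart[OF assms] by (auto simp: homeomorphism_def)
  then show ?thesis using h by (simp add: homeomorphism_def cong: continuous_on_cong)
qed

lemma chart_open_image:
  assumes c: "is_chart c" and W: "open W" shows "open (snd c ` (fst c \<inter> W))"
proof -
  have "snd c ` (fst c \<inter> W) = snd c ` fst c \<inter> cinv c -` W"
    using cinv_chart[OF c] by (auto simp: image_iff)
  then show ?thesis
    using continuous_open_preimage[OF cinv_continuous[OF c] chart_open(2)[OF c] W] by simp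
qed

lemma chart_isCont: "is_chart c \<Longrightarrow> p \<in> fst c \<Longrightarrow> isCont (snd c) p"
  using chart_continuous[of c] chart_open(1)[of c] by (simp add: continuous_on_eq_continuous_at)

lemma cinv_isCont: "is_chart c \<Longrightarrow> z \<in> snd c ` fst c \<Longrightarrow> isCont (cinv c) z"
  using cinv_continuous[of c] chart_open(2)[of c] by (auto simp: continuous_on_eq_continuous_at)

lemma is_chart_prod:
  assumes c: "is_chart c" and d: "is_chart d"
  shows "is_chart (fst c \<times> fst d, map_prod (snd c) (snd d))"
proof -
  have img: "map_prod (snd c) (snd d) ` (fst c \<times> fst d) = snd c ` fst c \<times> snd d ` fst d" by auto
  have "homeomorphism (fst c \<times> fst d) (snd c ` fst c \<times> snd d ` fst d) (map_prod (snd c) (snd d)) (map_prod (cinv c) (cinv d))"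
  proof (rule homeomorphismI)
    have "continuous_on (fst c \<times> fst d) (\<lambda>x. (snd c (fst x), snd d (snd x)))"
      by (intro continuous_on_Pair continuous_on_compose2[OF chart_continuous[OF c]]
        continuous_on_compose2[OF chart_continuous[OF d]] continuous_on_fst continuous_on_snd continuous_on_id) auto
    then show "continuous_on (fst c \<times> fst d) (map_prod (snd c) (snd d))" by (simp add: map_prod_def case_prod_beta')
    have "continuous_on (snd c ` fst c \<times> snd d ` fst d) (\<lambda>x. (cinv c (fst x), cinv d (snd x)))"
      by (intro continuous_on_Pair continuous_on_compose2[OF cinv_continuous[OF c]]
        continuous_on_compose2[OF cinv_continuous[OF d]] continuous_on_fst continuous_on_snd continuous_on_id) auto
    then show "continuous_on (snd c ` fst c \<times> snd d ` fst d) (map_prod (cinv c) (cinv d))"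
      by (simp add: map_prod_def case_prod_beta')
  qed (auto simp: cinv_chart[OF c] cinv_chart[OF d] cinv_dom)
  then show ?thesis using chart_open[OF c] chart_open[OF d] unfolding is_chart_def fst_conv snd_conv img
    by (auto intro: open_Times)
qed

lemma chart_atlas_prod:
  assumes A: "chart_atlas A" and B: "chart_atlas B" shows "chart_atlas (prod_atlas A B)"
proof -
  have "\<exists>e\<in>prod_atlas A B. p \<in> fst e" for p
  proof -
    obtain c where c: "c \<in> A" "fst p \<in> fst c" using chart_at[OF A] by blast
    obtain d where d: "d \<in> B" "snd p \<in> fst d" using chart_at[OF B] by blast
    have "(fst c \<times> fst d, map_prod (snd c) (snd d)) \<in> prod_atlas A B"
      using c d unfolding prod_atlas_def by blast
    then show ?thesis using c d by (metis fst_conv mem_Times_iff)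
  qed
  moreover have "is_chart e" if "e \<in> prod_atlas A B" for e
  proof -
    obtain c d where "e = (fst c \<times> fst d, map_prod (snd c) (snd d))" "c \<in> A" "d \<in> B"
      using \<open>e \<in> prod_atlas A B\<close> unfolding prod_atlas_def by blast
    then show ?thesis using is_chart_prod chart_atlasD[OF A] chart_atlasD[OF B] by metis
  qed
  ultimately show ?thesis unfolding chart_atlas_def by blast
qed

lemma open_coord_dom:
  assumes "is_chart c" "is_chart d" "continuous_on UNIV f" shows "open (coord_dom c d f)"
  unfolding coord_dom_def
  using chart_open_image[OF assms(1)] open_vimage[OF chart_open(1)[OF assms(2)] assms(3)] by blast

lemma coord_at: "is_chart c \<Longrightarrow> p \<in> fst c \<Longrightarrow> coord c d f (snd c p) = snd d (f p)"
  by (simp add: coord_def cinv_chart)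

text \<open>In contrast to \<open>differential\<close>, which always has a value, this relation
  asserts differentiability; continuity at \<open>p\<close> keeps nearby points inside the target
  chart, as the chain rule requires.\<close>

definition mdiff :: "('x::t2_space, 'd::euclidean_space) chart \<Rightarrow> ('y::t2_space, 'e::euclidean_space) chart
    \<Rightarrow> ('x \<Rightarrow> 'y) \<Rightarrow> 'x \<Rightarrow> ('d \<Rightarrow> 'e) \<Rightarrow> bool" where
  "mdiff c d f p D \<longleftrightarrow> is_chart c \<and> is_chart d \<and> p \<in> fst c \<and> f p \<in> fst d \<and> isCont f p \<and>
     (coord c d f has_derivative D) (at (snd c p))"

lemma mdiff_differential: "mdiff c d f p D \<Longrightarrow> differential c d f p = D"
  by (auto simp: mdiff_def differential_def intro: frechet_derivative_eq)

lemma mdiff_unique: "mdiff c d f p D \<Longrightarrow> mdiff c d f p D' \<Longrightarrow> D = D'"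
  using mdiff_differential[of c d f p D] mdiff_differential[of c d f p D'] by simp

lemma mdiff_linear: "mdiff c d f p D \<Longrightarrow> linear D"
  by (auto simp: mdiff_def intro: has_derivative_linear)

lemma eventually_chart:
  assumes c: "is_chart c" "p \<in> fst c" and P: "eventually P (nhds p)"
  shows "eventually (\<lambda>z. z \<in> snd c ` fst c \<and> P (cinv c z)) (nhds (snd c p))"
proof -
  have 1: "eventually (\<lambda>z. z \<in> snd c ` fst c) (nhds (snd c p))"
    using chart_open(2)[OF c(1)] c(2) by (auto simp: eventually_nhds)
  have "(cinv c \<longlongrightarrow> cinv c (snd c p)) (nhds (snd c p))"
    using cinv_isCont[OF c(1), of "snd c p"] c(2) unfolding isCont_def tendsto_at_iff_tendsto_nhds by blast
  then have 2: "eventually (\<lambda>z. P (cinv c z)) (nhds (snd c p))"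
    using P unfolding filterlim_iff cinv_chart[OF c] by blast
  from 1 2 show ?thesis by eventually_elim auto
qed

lemma isCont_eventually_open:
  fixes f :: "'a::t2_space \<Rightarrow> 'b::topological_space"
  assumes "isCont f p" "open W" "f p \<in> W" shows "eventually (\<lambda>q. f q \<in> W) (nhds p)"
proof -
  have "(f \<longlongrightarrow> f p) (nhds p)" using assms(1) unfolding isCont_def tendsto_at_iff_tendsto_nhds .
  then show ?thesis using eventually_nhds_in_open[OF assms(2,3)] unfolding filterlim_iff by blast
qed

lemma has_derivative_cong_nhds:
  fixes f :: "'a::real_normed_vector \<Rightarrow> 'b::real_normed_vector"
  assumes "(f has_derivative D) (at x)" "eventually (\<lambda>y. f y = g y) (nhds x)"
  shows "(g has_derivative D) (at x)"
proof -
  obtain W where "open W" "x \<in> W" "\<And>y. y \<in> W \<Longrightarrow> f y = g y" using assms(2) by (auto simp: eventually_nhds)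
  then show ?thesis using has_derivative_transform_within_open[OF assms(1)] by blast
qed

lemma mdiff_compose:
  assumes f: "mdiff c d f p D" and g: "mdiff d e g (f p) D'"
  shows "mdiff c e (\<lambda>x. g (f x)) p (\<lambda>v. D' (D v))"
proof -
  have c: "is_chart c" "p \<in> fst c" "is_chart d" "f p \<in> fst d" "is_chart e" "g (f p) \<in> fst e"
    using f g by (auto simp: mdiff_def)
  have ev: "eventually (\<lambda>z. z \<in> snd c ` fst c \<and> f (cinv c z) \<in> fst d) (nhds (snd c p))"
    using eventually_chart[OF c(1,2), where P = "\<lambda>q. f q \<in> fst d"] isCont_eventually_open[where f = f and p = p and W = "fst d"]
      chart_open(1)[OF c(3)] c(4) f by (simp add: mdiff_def)
  have "(coord d e g has_derivative D') (at (coord c d f (snd c p)))"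
    using g unfolding coord_at[OF c(1,2)] mdiff_def by blast
  then have "(coord d e g \<circ> coord c d f has_derivative (D' \<circ> D)) (at (snd c p))"
    using f diff_chain_at unfolding mdiff_def by blast
  moreover have "eventually (\<lambda>z. (coord d e g \<circ> coord c d f) z = coord c e (\<lambda>x. g (f x)) z) (nhds (snd c p))"
    using ev by eventually_elim (simp add: coord_def cinv_chart[OF c(3)])
  ultimately have "(coord c e (\<lambda>x. g (f x)) has_derivative (D' \<circ> D)) (at (snd c p))"
    by (rule has_derivative_cong_nhds)
  moreover have "isCont (\<lambda>x. g (f x)) p" using f g isCont_o2 unfolding mdiff_def by blast
  ultimately show ?thesis using c by (simp add: mdiff_def o_def)
qed

lemma smooth_map_mdiff:
  assumes f: "smooth_map A B f" and AB: "chart_atlas A" "chart_atlas B"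
    and c: "c \<in> A" "d \<in> B" "p \<in> fst c" "f p \<in> fst d"
  shows "mdiff c d f p (differential c d f p)"
proof -
  have "snd c p \<in> coord_dom c d f" using c by (auto simp: coord_dom_def)
  then have "coord c d f differentiable (at (snd c p))"
    using f c smooth_on_differentiable unfolding smooth_map_def by blast
  then have "(coord c d f has_derivative differential c d f p) (at (snd c p))"
    unfolding differential_def by (rule has_derivative_frechet)
  then show ?thesis using f c chart_atlasD[OF AB(1) c(1)] chart_atlasD[OF AB(2) c(2)]
    unfolding mdiff_def smooth_map_def by (simp add: continuous_on_eq_continuous_at)
qed

lemma mdiff_holo:
  assumes cd: "is_chart c" "is_chart d" and f: "continuous_on UNIV f" "holo_on (coord_dom c d f) (coord c d f)"
    and p: "p \<in> fst c" "f p \<in> fst d"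
  shows "mdiff c d f p (differential c d f p)" "differential c d f p (J v) = J (differential c d f p v)"
proof -
  have "snd c p \<in> coord_dom c d f" using p by (auto simp: coord_dom_def)
  then obtain D where D: "(coord c d f has_derivative D) (at (snd c p))" "\<And>v. D (J v) = J (D v)"
    using f(2) unfolding holo_on_def by blast
  have m: "mdiff c d f p D" using cd f p D(1) by (simp add: mdiff_def continuous_on_eq_continuous_at)
  then show "mdiff c d f p (differential c d f p)" "differential c d f p (J v) = J (differential c d f p v)"
    using mdiff_differential[OF m] D(2) by simp_all
qed

lemma complex_atlas_id:
  assumes A: "complex_atlas A" and c: "c \<in> A" "d \<in> A" "p \<in> fst c" "p \<in> fst d"
  shows "mdiff c d id p (differential c d id p)" "differential c d id p (J v) = J (differential c d id p v)"
proof -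
  have h: "is_chart c" "is_chart d" "holo_on (coord_dom c d id) (coord c d id)"
    using A c unfolding complex_atlas_def by blast+
  show "mdiff c d id p (differential c d id p)" "differential c d id p (J v) = J (differential c d id p v)"
    using mdiff_holo[OF h(1,2) _ h(3) c(3)] c(4) by (simp_all add: continuous_on_id)
qed

text \<open>In a product chart, freezing one factor is an affine substitution.\<close>

lemma smooth_map_partial1:
  assumes AB: "chart_atlas A" "chart_atlas B" "chart_atlas C"
    and F: "smooth_map (prod_atlas A B) C (\<lambda>(x, y). F x y)"
  shows "smooth_map A C (\<lambda>x. F x y)"
  unfolding smooth_map_def
proof (intro conjI ballI)
  let ?F = "\<lambda>(x, y). F x y"
  have contF: "continuous_on UNIV ?F" using F by (simp add: smooth_map_def)
  have "continuous_on UNIV (\<lambda>x. ?F (x, y))"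
    by (rule continuous_on_compose2[OF contF]) (auto intro: continuous_on_Pair continuous_on_id continuous_on_const)
  then show cont: "continuous_on UNIV (\<lambda>x. F x y)" by simp
  fix a c assume ac: "a \<in> A" "c \<in> C"
  obtain b where b: "b \<in> B" "y \<in> fst b" "is_chart b" using chart_at[OF AB(2)] by blast
  have ca: "is_chart a" "is_chart c" using chart_atlasD[OF AB(1) ac(1)] chart_atlasD[OF AB(3) ac(2)] by blast+
  let ?p = "(fst a \<times> fst b, map_prod (snd a) (snd b))"
  have p: "?p \<in> prod_atlas A B" using ac b unfolding prod_atlas_def by blast
  have cp: "is_chart ?p" using is_chart_prod ca b by blast
  have sm: "smooth_on (coord_dom ?p c ?F) (coord ?p c ?F)" using F p ac unfolding smooth_map_def by blast
  have pinv: "cinv ?p (snd a x, snd b y) = (x, y)" if "x \<in> fst a" for x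
    using cinv_chart[OF cp, of "(x, y)"] that b by simp
  have "smooth_on (coord_dom a c (\<lambda>x. F x y)) (\<lambda>x. coord ?p c ?F ((0, snd b y) + (\<lambda>x. (x, 0)) x))"
  proof (rule smooth_on_compose_affine[OF open_coord_dom[OF cp ca(2) contF] _ sm])
    show "bounded_linear (\<lambda>x. (x, 0))" by (intro bounded_linear_Pair bounded_linear_ident bounded_linear_zero)
    show "open (coord_dom a c (\<lambda>x. F x y))" by (rule open_coord_dom[OF ca cont])
    show "coord_dom a c (\<lambda>x. F x y) \<subseteq> (\<lambda>x. (0, snd b y) + (x, 0)) -` coord_dom ?p c ?F"
    proof
      fix x assume "x \<in> coord_dom a c (\<lambda>x. F x y)"
      then obtain q where q: "q \<in> fst a" "x = snd a q" "F q y \<in> fst c" unfolding coord_dom_def by blast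
      have "(q, y) \<in> fst ?p \<inter> ?F -` fst c" using q b by simp
      moreover have "(0, snd b y) + (x, 0) = snd ?p (q, y)" by (simp add: q)
      ultimately show "x \<in> (\<lambda>x. (0, snd b y) + (x, 0)) -` coord_dom ?p c ?F"
        unfolding coord_dom_def vimage_eq by (metis image_eqI)
    qed
  qed
  then show "smooth_on (coord_dom a c (\<lambda>x. F x y)) (coord a c (\<lambda>x. F x y))"
  proof (rule smooth_on_cong[OF open_coord_dom[OF ca cont], rotated])
    fix x assume "x \<in> coord_dom a c (\<lambda>x. F x y)"
    then obtain q where q: "q \<in> fst a" "x = snd a q" unfolding coord_dom_def by blast
    have e: "(0, snd b y) + (x, 0) = (snd a q, snd b y)" by (simp add: q)
    show "coord ?p c ?F ((0, snd b y) + (x, 0)) = coord a c (\<lambda>x. F x y) x"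
      unfolding e unfolding q(2) unfolding coord_def comp_def pinv[OF q(1)] cinv_chart[OF ca(1) q(1)] by simp
  qed
qed

lemma smooth_map_partial2:
  assumes AB: "chart_atlas A" "chart_atlas B" "chart_atlas C"
    and F: "smooth_map (prod_atlas A B) C (\<lambda>(x, y). F x y)"
  shows "smooth_map B C (\<lambda>y. F x y)"
  unfolding smooth_map_def
proof (intro conjI ballI)
  let ?F = "\<lambda>(x, y). F x y"
  have contF: "continuous_on UNIV ?F" using F by (simp add: smooth_map_def)
  have "continuous_on UNIV (\<lambda>y. ?F (x, y))"
    by (rule continuous_on_compose2[OF contF]) (auto intro: continuous_on_Pair continuous_on_id continuous_on_const)
  then show cont: "continuous_on UNIV (\<lambda>y. F x y)" by simp
  fix b c assume bc: "b \<in> B" "c \<in> C"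
  obtain a where a: "a \<in> A" "x \<in> fst a" "is_chart a" using chart_at[OF AB(1)] by blast
  have cb: "is_chart b" "is_chart c" using chart_atlasD[OF AB(2) bc(1)] chart_atlasD[OF AB(3) bc(2)] by blast+
  let ?p = "(fst a \<times> fst b, map_prod (snd a) (snd b))"
  have p: "?p \<in> prod_atlas A B" using bc a unfolding prod_atlas_def by blast
  have cp: "is_chart ?p" using is_chart_prod cb a by blast
  have sm: "smooth_on (coord_dom ?p c ?F) (coord ?p c ?F)" using F p bc unfolding smooth_map_def by blast
  have pinv: "cinv ?p (snd a x, snd b y) = (x, y)" if "y \<in> fst b" for y
    using cinv_chart[OF cp, of "(x, y)"] that a by simp
  have "smooth_on (coord_dom b c (\<lambda>y. F x y)) (\<lambda>y. coord ?p c ?F ((snd a x, 0) + (\<lambda>y. (0, y)) y))"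
  proof (rule smooth_on_compose_affine[OF open_coord_dom[OF cp cb(2) contF] _ sm])
    show "bounded_linear (\<lambda>x. (0, x))" by (intro bounded_linear_Pair bounded_linear_ident bounded_linear_zero)
    show "open (coord_dom b c (\<lambda>y. F x y))" by (rule open_coord_dom[OF cb cont])
    show "coord_dom b c (\<lambda>y. F x y) \<subseteq> (\<lambda>y. (snd a x, 0) + (0, y)) -` coord_dom ?p c ?F"
    proof
      fix z assume "z \<in> coord_dom b c (\<lambda>y. F x y)"
      then obtain q where q: "q \<in> fst b" "z = snd b q" "F x q \<in> fst c" unfolding coord_dom_def by blast
      have "(x, q) \<in> fst ?p \<inter> ?F -` fst c" using q a by simp
      moreover have "(snd a x, 0) + (0, z) = snd ?p (x, q)" by (simp add: q)
      ultimately show "z \<in> (\<lambda>y. (snd a x, 0) + (0, y)) -` coord_dom ?p c ?F"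
        unfolding coord_dom_def vimage_eq by (metis image_eqI)
    qed
  qed
  then show "smooth_on (coord_dom b c (\<lambda>y. F x y)) (coord b c (\<lambda>y. F x y))"
  proof (rule smooth_on_cong[OF open_coord_dom[OF cb cont], rotated])
    fix z assume "z \<in> coord_dom b c (\<lambda>y. F x y)"
    then obtain q where q: "q \<in> fst b" "z = snd b q" unfolding coord_dom_def by blast
    have e: "(snd a x, 0) + (0, z) = (snd a x, snd b q)" by (simp add: q)
    show "coord ?p c ?F ((snd a x, 0) + (0, z)) = coord b c (\<lambda>y. F x y) z"
      unfolding e unfolding q(2) unfolding coord_def comp_def pinv[OF q(1)] cinv_chart[OF cb(1) q(1)] by simp
  qed
qed

section \<open>Isometric actions on a Kaehler manifold\<close>

locale lie_action =
  fixes A :: "('m::t2_space, complex^'n) chart set"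
    and G :: "('g::t2_space) monoid" and B :: "('g, 'e::euclidean_space) chart set"
    and \<phi> :: "'g \<Rightarrow> 'm \<Rightarrow> 'm"
  assumes complexA: "complex_atlas A" and lie: "compact_lie_group G B" and action: "smooth_action G B A \<phi>"
begin

abbreviation mul where "mul g h \<equiv> g \<otimes>\<^bsub>G\<^esub> h"
abbreviation ginv where "ginv g \<equiv> inv\<^bsub>G\<^esub> g"
abbreviation unit where "unit \<equiv> \<one>\<^bsub>G\<^esub>"

lemma atlasA: "chart_atlas A" using complex_atlas_chart_atlas[OF complexA] .

lemma atlasB: "chart_atlas B"
  using lie smooth_atlas_chart_atlas unfolding compact_lie_group_def by blast

lemma groupG: "group G" and carrierG: "carrier G = UNIV"
  using lie by (auto simp: compact_lie_group_def)

lemma gmul: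
  "mul (mul x y) z = mul x (mul y z)" "mul unit x = x" "mul x unit = x"
  "mul (ginv x) x = unit" "mul x (ginv x) = unit" "mul (ginv x) (mul x y) = y" "mul x (mul (ginv x) y) = y"
  "ginv (ginv x) = x" "ginv unit = unit"
proof -
  interpret group G by (rule groupG)
  show a: "mul (mul x y) z = mul x (mul y z)" "mul unit x = x" "mul x unit = x"
    "mul (ginv x) x = unit" "mul x (ginv x) = unit" for x y z using carrierG m_assoc by auto
  show "mul (ginv x) (mul x y) = y" "mul x (mul (ginv x) y) = y" "ginv (ginv x) = x" "ginv unit = unit"
    using a carrierG by (simp_all add: a(1)[symmetric])
qed

lemma act_mul: "\<phi> (mul g h) p = \<phi> g (\<phi> h p)"
proof -
  interpret group_action G UNIV \<phi> using action by (simp add: smooth_action_def)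
  show ?thesis using composition_rule[of p g h] carrierG by simp
qed

lemma act_one: "\<phi> unit p = p"
proof -
  interpret group_action G UNIV \<phi> using action by (simp add: smooth_action_def)
  show ?thesis using id_eq_one by (metis UNIV_I restrict_apply)
qed

lemma act_inv: "\<phi> (ginv g) (\<phi> g p) = p" "\<phi> g (\<phi> (ginv g) p) = p"
  by (simp_all add: act_mul[symmetric] gmul act_one)

lemma orbit_range: "orbit G \<phi> p = range (\<lambda>g. \<phi> g p)"
  by (auto simp: orbit_def carrierG)

lemma orbit_act: "orbit G \<phi> (\<phi> g p) = orbit G \<phi> p"
proof -
  have "\<phi> h p = \<phi> (mul h (ginv g)) (\<phi> g p)" for h by (simp add: act_mul act_inv)
  then show ?thesis unfolding orbit_range by (auto simp: act_mul[symmetric])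
qed

lemma orbit_self: "p \<in> orbit G \<phi> p"
  unfolding orbit_range using act_one by (metis rangeI)

lemma joint_smooth: "smooth_map (prod_atlas B A) A (\<lambda>(g, p). \<phi> g p)"
  using action by (simp add: smooth_action_def)

lemma act_smooth: "smooth_map A A (\<phi> g)"
  using smooth_map_partial2[OF atlasB atlasA atlasA joint_smooth] .

lemma orb_smooth: "smooth_map B A (\<lambda>g. \<phi> g p)"
  using smooth_map_partial1[OF atlasB atlasA atlasA joint_smooth] .

lemma mul_smooth: "smooth_map (prod_atlas B B) B (\<lambda>(x, y). mul x y)"
  using lie by (simp add: compact_lie_group_def)

lemma lmul_smooth: "smooth_map B B (\<lambda>h. mul g h)"
  using smooth_map_partial2[OF atlasB atlasB atlasB mul_smooth] .

lemma rmul_smooth: "smooth_map B B (\<lambda>h. mul h g)"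
  using smooth_map_partial1[OF atlasB atlasB atlasB mul_smooth] .

lemma act_cont: "continuous_on UNIV (\<phi> g)" and orb_cont: "continuous_on UNIV (\<lambda>g. \<phi> g p)"
  and joint_cont: "continuous_on UNIV (\<lambda>(g, p). \<phi> g p)"
  and rmul_cont: "continuous_on UNIV (\<lambda>h. mul h g)"
  using act_smooth orb_smooth joint_smooth rmul_smooth unfolding smooth_map_def by auto

lemma act_mdiff:
  "c \<in> A \<Longrightarrow> d \<in> A \<Longrightarrow> p \<in> fst c \<Longrightarrow> \<phi> g p \<in> fst d \<Longrightarrow> mdiff c d (\<phi> g) p (differential c d (\<phi> g) p)"
  by (rule smooth_map_mdiff[OF act_smooth atlasA atlasA])

lemma orb_mdiff:
  "b \<in> B \<Longrightarrow> d \<in> A \<Longrightarrow> g \<in> fst b \<Longrightarrow> \<phi> g p \<in> fst d \<Longrightarrow>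
   mdiff b d (\<lambda>g. \<phi> g p) g (differential b d (\<lambda>g. \<phi> g p) g)"
  by (rule smooth_map_mdiff[OF orb_smooth atlasB atlasA])

text \<open>One fixed chart at the identity identifies the Lie algebra with the model space
  \<open>'e\<close>.\<close>

definition b0 where "b0 = (SOME b. b \<in> B \<and> unit \<in> fst b)"

lemma b0: "b0 \<in> B" "unit \<in> fst b0"
proof -
  obtain b where "b \<in> B" "unit \<in> fst b" using chart_at[OF atlasB] by metis
  then have "b0 \<in> B \<and> unit \<in> fst b0" unfolding b0_def by (metis (mono_tags, lifting) someI)
  then show "b0 \<in> B" "unit \<in> fst b0" by auto
qed

text \<open>\<open>fld c p \<xi>\<close> is the value at \<open>p\<close> of the fundamental vector field of \<open>\<xi>\<close>, in the chart \<open>c\<close>.\<close>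

definition fld where "fld c p \<xi> = differential b0 c (\<lambda>g. \<phi> g p) unit \<xi>"

lemma fld_mdiff: "c \<in> A \<Longrightarrow> p \<in> fst c \<Longrightarrow> mdiff b0 c (\<lambda>g. \<phi> g p) unit (fld c p)"
  using orb_mdiff[OF b0(1) _ b0(2), of c p] unfolding fld_def[abs_def] by (simp add: act_one)

lemma fld_linear: "c \<in> A \<Longrightarrow> p \<in> fst c \<Longrightarrow> linear (fld c p)"
  using fld_mdiff mdiff_linear by blast

lemma fld_chart:
  assumes "c \<in> A" "d \<in> A" "p \<in> fst c" "p \<in> fst d"
  shows "fld d p \<xi> = differential c d id p (fld c p \<xi>)"
proof -
  have "mdiff b0 d (\<lambda>g. id (\<phi> g p)) unit (\<lambda>\<xi>. differential c d id p (fld c p \<xi>))"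
    using mdiff_compose[OF fld_mdiff[OF assms(1,3)], of d id] complex_atlas_id(1)[OF complexA assms] by (simp add: act_one)
  then show ?thesis using mdiff_unique[OF fld_mdiff[OF assms(2,4)]] by simp
qed

text \<open>The derivative of \<open>h \<mapsto> g\<^sup>-\<^sup>1 h g\<close>, hence the usual
  adjoint representation at the inverse of \<open>g\<close>.\<close>

definition Ad where "Ad g = differential b0 b0 (\<lambda>h. mul (ginv g) (mul h g)) unit"

lemma Ad_mdiff: "mdiff b0 b0 (\<lambda>h. mul (ginv g) (mul h g)) unit (Ad g)"
proof -
  obtain b where b: "b \<in> B" "g \<in> fst b" using chart_at[OF atlasB] by metis
  have 1: "mdiff b0 b (\<lambda>h. mul h g) unit (differential b0 b (\<lambda>h. mul h g) unit)"
    by (rule smooth_map_mdiff[OF rmul_smooth atlasB atlasB]) (use b b0 in \<open>simp_all add: gmul\<close>)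
  have 2: "mdiff b b0 (\<lambda>h. mul (ginv g) h) (mul unit g) (differential b b0 (\<lambda>h. mul (ginv g) h) (mul unit g))"
    by (rule smooth_map_mdiff[OF lmul_smooth atlasB atlasB]) (use b b0 in \<open>simp_all add: gmul\<close>)
  show ?thesis
    using mdiff_compose[OF 1 2] mdiff_differential[OF mdiff_compose[OF 1 2]] unfolding Ad_def by simp
qed

text \<open>Differentiate \<open>\<phi> h (\<phi> g p) = \<phi> g (\<phi> (g\<^sup>-\<^sup>1 h g)
  p)\<close> in \<open>h\<close> at the identity.\<close>

lemma fld_act:
  assumes c: "c \<in> A" "d \<in> A" "p \<in> fst c" "\<phi> g p \<in> fst d"
  shows "fld d (\<phi> g p) \<xi> = differential c d (\<phi> g) p (fld c p (Ad g \<xi>))"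
proof -
  have u: "mul (ginv g) (mul unit g) = unit" by (simp add: gmul)
  have "mdiff b0 c (\<lambda>h. \<phi> (mul (ginv g) (mul h g)) p) unit (\<lambda>\<xi>. fld c p (Ad g \<xi>))"
    using mdiff_compose[OF Ad_mdiff, of c "\<lambda>h. \<phi> h p" g] fld_mdiff[OF c(1,3)] unfolding u .
  from mdiff_compose[OF this, of d "\<phi> g"] act_mdiff[OF c]
  have "mdiff b0 d (\<lambda>h. \<phi> g (\<phi> (mul (ginv g) (mul h g)) p)) unit (\<lambda>\<xi>. differential c d (\<phi> g) p (fld c p (Ad g \<xi>)))"
    unfolding u act_one by blast
  then have "mdiff b0 d (\<lambda>h. \<phi> h (\<phi> g p)) unit (\<lambda>\<xi>. differential c d (\<phi> g) p (fld c p (Ad g \<xi>)))"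
    by (simp add: act_mul[symmetric] gmul)
  then show ?thesis using mdiff_unique[OF fld_mdiff[OF c(2,4)]] by simp
qed

text \<open>Writing \<open>h\<close> as \<open>g\<close> times \<open>g\<^sup>-\<^sup>1 h\<close>
  refers the orbit map back to the identity. The map \<open>k\<close> is left unspecified, since all
  that is wanted is that the rank nowhere exceeds the rank at the identity.\<close>

lemma orb_differential:
  assumes b: "b \<in> B" "g \<in> fst b" and c: "c \<in> A" "d \<in> A" "p \<in> fst c" "\<phi> g p \<in> fst d"
  shows "\<exists>k. differential b d (\<lambda>h. \<phi> h p) g = (\<lambda>\<eta>. differential c d (\<phi> g) p (fld c p (k \<eta>)))"
proof -
  have 1: "mdiff b b0 (\<lambda>h. mul (ginv g) h) g (differential b b0 (\<lambda>h. mul (ginv g) h) g)"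
    by (rule smooth_map_mdiff[OF lmul_smooth atlasB atlasB]) (use b b0 in \<open>simp_all add: gmul\<close>)
  let ?k = "differential b b0 (\<lambda>h. mul (ginv g) h) g"
  have "mdiff b c (\<lambda>h. \<phi> (mul (ginv g) h) p) g (\<lambda>\<eta>. fld c p (?k \<eta>))"
    using mdiff_compose[OF 1, of c "\<lambda>h. \<phi> h p"] fld_mdiff[OF c(1,3)] by (simp add: gmul)
  from mdiff_compose[OF this, of d "\<phi> g"] act_mdiff[OF c]
  have "mdiff b d (\<lambda>h. \<phi> g (\<phi> (mul (ginv g) h) p)) g (\<lambda>\<eta>. differential c d (\<phi> g) p (fld c p (?k \<eta>)))"
    by (simp add: gmul act_one)
  then have "mdiff b d (\<lambda>h. \<phi> h p) g (\<lambda>\<eta>. differential c d (\<phi> g) p (fld c p (?k \<eta>)))"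
    by (simp add: act_mul[symmetric] gmul)
  then show ?thesis using mdiff_differential by blast
qed

lemma id_mdiff: "c \<in> A \<Longrightarrow> p \<in> fst c \<Longrightarrow> mdiff c c id p (\<lambda>v. v)"
proof -
  assume c: "c \<in> A" "p \<in> fst c"
  have cc: "is_chart c" using c chart_atlasD atlasA by blast
  have "((\<lambda>z. z) has_derivative (\<lambda>v. v)) (at (snd c p))" by (rule has_derivative_ident)
  then have "(coord c c id has_derivative (\<lambda>v. v)) (at (snd c p))"
    by (rule has_derivative_transform_within_open[OF _ chart_open(2)[OF cc]])
      (use c in \<open>auto simp: coord_def chart_cinv\<close>)
  then show ?thesis using c cc by (simp add: mdiff_def id_def)
qed

lemma act_differential_inv:
  assumes c: "c \<in> A" "d \<in> A" "p \<in> fst c" "\<phi> g p \<in> fst d"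
  shows "differential d c (\<phi> (ginv g)) (\<phi> g p) (differential c d (\<phi> g) p v) = v"
proof -
  have "mdiff d c (\<phi> (ginv g)) (\<phi> g p) (differential d c (\<phi> (ginv g)) (\<phi> g p))"
    by (rule act_mdiff) (use c in \<open>simp_all add: act_inv\<close>)
  from mdiff_compose[OF act_mdiff[OF c] this]
  have "mdiff c c id p (\<lambda>v. differential d c (\<phi> (ginv g)) (\<phi> g p) (differential c d (\<phi> g) p v))"
    by (simp add: act_inv id_def)
  then show ?thesis using mdiff_unique[OF id_mdiff[OF c(1,3)]] by metis
qed

lemma id_differential_inv:
  assumes c: "c \<in> A" "d \<in> A" "p \<in> fst c" "p \<in> fst d"
  shows "differential d c id p (differential c d id p v) = v"
proof -
  have "mdiff c c (\<lambda>x. id (id x)) p (\<lambda>v. differential d c id p (differential c d id p v))"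
    using mdiff_compose[OF complex_atlas_id(1)[OF complexA c], of c id] complex_atlas_id(1)[OF complexA c(2,1,4,3)] by simp
  then show ?thesis using mdiff_unique[OF id_mdiff[OF c(1,3)]] by (simp add: id_def) metis
qed

lemma fld_dim_act:
  assumes c: "c \<in> A" "d \<in> A" "p \<in> fst c" "\<phi> g p \<in> fst d"
  shows "dim (range (fld d (\<phi> g p))) = dim (range (fld c p))"
proof -
  have le: "dim (range (fld d (\<phi> g p))) \<le> dim (range (fld c p))"
    if c: "c \<in> A" "d \<in> A" "p \<in> fst c" "\<phi> g p \<in> fst d" for c d p g
  proof -
    have "range (fld d (\<phi> g p)) \<subseteq> differential c d (\<phi> g) p ` range (fld c p)"
      using fld_act[OF that] by auto
    then have "dim (range (fld d (\<phi> g p))) \<le> dim (differential c d (\<phi> g) p ` range (fld c p))"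
      by (rule dim_subset)
    also have "\<dots> \<le> dim (range (fld c p))"
      using mdiff_linear[OF act_mdiff[OF that]] by (rule dim_image_le)
    finally show ?thesis .
  qed
  show ?thesis using le[OF c] le[of d c "\<phi> g p" "ginv g"] c by (simp add: act_inv)
qed

lemma orb_differential_dim:
  assumes b: "b \<in> B" "g \<in> fst b" and c: "c \<in> A" "d \<in> A" "p \<in> fst c" "\<phi> g p \<in> fst d"
  shows "dim (range (differential b d (\<lambda>h. \<phi> h p) g)) \<le> dim (range (fld c p))"
proof -
  obtain k where k: "differential b d (\<lambda>h. \<phi> h p) g = (\<lambda>\<eta>. differential c d (\<phi> g) p (fld c p (k \<eta>)))"
    using orb_differential[OF assms] by blast
  have "range (differential b d (\<lambda>h. \<phi> h p) g) \<subseteq> differential c d (\<phi> g) p ` range (fld c p)"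
    unfolding k by auto
  then have "dim (range (differential b d (\<lambda>h. \<phi> h p) g)) \<le> dim (differential c d (\<phi> g) p ` range (fld c p))"
    by (rule dim_subset)
  also have "\<dots> \<le> dim (range (fld c p))"
    using mdiff_linear[OF act_mdiff[OF c]] by (rule dim_image_le)
  finally show ?thesis .
qed

end

subsection \<open>Orbits are embedded\<close>

context lie_action begin

text \<open>The complement of \<open>N Stab(p)\<close> is compact, so its orbit is closed and misses \<open>p\<close>.\<close>

lemma orbit_neighbourhood:
  assumes N: "open N" "unit \<in> N"
  obtains V where "open V" "p \<in> V" "orbit G \<phi> p \<inter> V = (\<lambda>g. \<phi> g p) ` N"
proof -
  define H where "H = {h. \<phi> h p = p}"
  define NH where "NH = (\<Union>h\<in>H. (\<lambda>g. mul g (ginv h)) -` N)"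
  have "open NH" unfolding NH_def using N(1) rmul_cont by (intro open_UN ballI open_vimage) auto
  then have "closed (- NH)" by (simp add: closed_Compl)
  then have "compact (- NH)"
    using compact_Int_closed[of UNIV "- NH"] lie by (simp add: compact_lie_group_def)
  then have "compact ((\<lambda>g. \<phi> g p) ` (- NH))"
    by (rule compact_continuous_image[OF continuous_on_subset[OF orb_cont subset_UNIV]])
  then have cl: "closed ((\<lambda>g. \<phi> g p) ` (- NH))" by (rule compact_imp_closed)
  have hN: "\<phi> g p \<in> (\<lambda>g. \<phi> g p) ` N" if g: "g \<in> NH" for g
  proof -
    obtain h where h: "\<phi> h p = p" "mul g (ginv h) \<in> N" using g by (auto simp: NH_def H_def)
    have "\<phi> (mul g (ginv h)) p = \<phi> g p" using h(1) by (metis act_mul act_inv(1))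
    then show ?thesis using h(2) by (metis image_eqI)
  qed
  have Nn: "g \<in> NH" if "n \<in> N" "\<phi> n p = \<phi> g p" for n g
  proof -
    have "\<phi> (mul (ginv n) g) p = p" using that(2) by (metis act_mul act_inv(1))
    moreover have "mul g (ginv (mul (ginv n) g)) = n"
    proof -
      have "mul (mul g (ginv (mul (ginv n) g))) (mul (ginv n) g) = mul n (mul (ginv n) g)" by (simp add: gmul)
      then show ?thesis by (metis gmul(1,3,5))
    qed
    ultimately show ?thesis using that(1) unfolding NH_def H_def by blast
  qed
  show thesis
  proof (rule that[of "- ((\<lambda>g. \<phi> g p) ` (- NH))"])
    show "open (- ((\<lambda>g. \<phi> g p) ` (- NH)))" using cl by (simp add: open_Compl)
    show "p \<in> - ((\<lambda>g. \<phi> g p) ` (- NH))" using Nn[OF N(2)] act_one by fastforce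
    show "orbit G \<phi> p \<inter> - ((\<lambda>g. \<phi> g p) ` (- NH)) = (\<lambda>g. \<phi> g p) ` N"
    proof
      show "orbit G \<phi> p \<inter> - ((\<lambda>g. \<phi> g p) ` (- NH)) \<subseteq> (\<lambda>g. \<phi> g p) ` N"
        unfolding orbit_range using hN by auto
      show "(\<lambda>g. \<phi> g p) ` N \<subseteq> orbit G \<phi> p \<inter> - ((\<lambda>g. \<phi> g p) ` (- NH))"
        unfolding orbit_range using Nn by auto
    qed
  qed
qed

lemma open_coord_dom_orb: "c \<in> A \<Longrightarrow> b \<in> B \<Longrightarrow> open (coord_dom b c (\<lambda>g. \<phi> g p))"
  using open_coord_dom chart_atlasD atlasA atlasB orb_cont by metis

lemma smooth_orb: "c \<in> A \<Longrightarrow> b \<in> B \<Longrightarrow> smooth_on (coord_dom b c (\<lambda>g. \<phi> g p)) (coord b c (\<lambda>g. \<phi> g p))"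
  using orb_smooth unfolding smooth_map_def by blast

lemma b0_chart: "is_chart b0" using b0 chart_atlasD atlasB by blast

text \<open>The constant rank theorem describes the orbit map only near the identity;
  \<open>orbit_neighbourhood\<close> ensures that group elements far away contribute no further
  orbit points near \<open>p\<close>. Together they give a neighbourhood \<open>V\<close> in which
  the whole orbit is parametrized by \<open>O'\<close>.\<close>

lemma orbit_structure:
  assumes c: "c \<in> A" "p \<in> fst c"
  defines "f \<equiv> coord b0 c (\<lambda>g. \<phi> g p)" and "x0 \<equiv> snd b0 unit"
  obtains R O' h V where "linear R" "\<And>v. fld c p (R (fld c p v)) = fld c p v" "\<And>w. R (fld c p (R w)) = R w"
    "open O'" "x0 \<in> O'" "O' \<subseteq> coord_dom b0 c (\<lambda>g. \<phi> g p)"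
    "\<And>x. x \<in> O' \<Longrightarrow> h (f x) \<in> range R \<and> x0 + h (f x) \<in> O' \<and> f (x0 + h (f x)) = f x"
    "\<And>t. t \<in> range R \<Longrightarrow> x0 + t \<in> O' \<Longrightarrow> h (f (x0 + t)) = t"
    "\<And>x. x \<in> O' \<Longrightarrow> h differentiable (at (f x))"
    "open V" "p \<in> V" "orbit G \<phi> p \<inter> V = (\<lambda>g. \<phi> g p) ` (fst b0 \<inter> snd b0 -` O')"
proof -
  let ?S = "coord_dom b0 c (\<lambda>g. \<phi> g p)"
  have oS: "open ?S" using open_coord_dom_orb[OF c(1) b0(1)] .
  have x0: "x0 \<in> ?S" using b0 c act_one by (auto simp: coord_dom_def x0_def)
  have sm: "smooth_on ?S f" unfolding f_def using smooth_orb[OF c(1) b0(1)] .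
  have E: "fld c p = frechet_derivative f (at x0)"
    by (rule ext) (simp add: fld_def differential_def f_def x0_def)
  have rank: "dim (range (frechet_derivative f (at x))) \<le> dim (range (fld c p))" if x: "x \<in> ?S" for x
  proof -
    obtain g where g: "g \<in> fst b0" "x = snd b0 g" "\<phi> g p \<in> fst c" using x unfolding coord_dom_def by blast
    have "frechet_derivative f (at x) = differential b0 c (\<lambda>h. \<phi> h p) g"
      by (simp add: differential_def f_def g)
    then show ?thesis using orb_differential_dim[OF b0(1) g(1) c(1,1,2) g(3)] by simp
  qed
  obtain R where R: "linear R" "\<And>v. fld c p (R (fld c p v)) = fld c p v" "\<And>w. R (fld c p (R w)) = R w"
    using linear_quasi_inverse[OF fld_linear[OF c]] by metis
  obtain O' h where O': "open O'" "x0 \<in> O'" "O' \<subseteq> ?S"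
    "\<And>x. x \<in> O' \<Longrightarrow> h (f x) \<in> range R \<and> x0 + h (f x) \<in> O' \<and> f (x0 + h (f x)) = f x"
    "\<And>t. t \<in> range R \<Longrightarrow> x0 + t \<in> O' \<Longrightarrow> h (f (x0 + t)) = t"
    "\<And>x. x \<in> O' \<Longrightarrow> h differentiable (at (f x))"
    by (rule constant_rank[OF oS x0 smooth_onD[OF sm] E rank R]) (assumption, (rule that; assumption))
  have oN: "open (fst b0 \<inter> snd b0 -` O')"
    using continuous_open_preimage[OF chart_continuous[OF b0_chart] chart_open(1)[OF b0_chart] O'(1)] .
  have uN: "unit \<in> fst b0 \<inter> snd b0 -` O'" using b0 O'(2) by (simp add: x0_def)
  obtain V where V: "open V" "p \<in> V" "orbit G \<phi> p \<inter> V = (\<lambda>g. \<phi> g p) ` (fst b0 \<inter> snd b0 -` O')"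
    using orbit_neighbourhood[OF oN uN] by metis
  show thesis by (rule that[OF R O' V])
qed

lemma coord_orb: "g \<in> fst b0 \<Longrightarrow> coord b0 c (\<lambda>g. \<phi> g p) (snd b0 g) = snd c (\<phi> g p)"
  by (rule coord_at[OF b0_chart])

lemma fld_has_derivative:
  "c \<in> A \<Longrightarrow> p \<in> fst c \<Longrightarrow> (coord b0 c (\<lambda>g. \<phi> g p) has_derivative fld c p) (at (snd b0 unit))"
  using fld_mdiff unfolding mdiff_def by blast

text \<open>Values of the fundamental fields are velocities of straight lines in the chart at the
  identity. Conversely, a curve \<open>z\<close> in the orbit satisfies
  \<open>z = f (x0 + h z)\<close> near \<open>p\<close> with \<open>h\<close> differentiable there,
  so its velocity lies in the range of the derivative of \<open>f\<close>.\<close>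

lemma tangent_space_orbit:
  assumes c: "c \<in> A" "p \<in> fst c"
  shows "tangent_space c (orbit G \<phi> p) p = range (fld c p)"
proof
  define f where "f = coord b0 c (\<lambda>g. \<phi> g p)"
  define x0 where "x0 = snd b0 unit"
  have cc: "is_chart c" using chart_atlasD[OF atlasA c(1)] .
  have fx0: "f x0 = snd c p" unfolding f_def x0_def coord_orb[OF b0(2)] by (simp add: act_one)
  have df: "(f has_derivative fld c p) (at x0)" unfolding f_def x0_def by (rule fld_has_derivative[OF c])
  show "range (fld c p) \<subseteq> tangent_space c (orbit G \<phi> p) p"
  proof
    fix v assume "v \<in> range (fld c p)"
    then obtain \<xi> where v: "v = fld c p \<xi>" by blast
    let ?S = "coord_dom b0 c (\<lambda>g. \<phi> g p)"
    have oS: "open ?S" using open_coord_dom_orb[OF c(1) b0(1)] .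
    have x0: "x0 \<in> ?S" using b0 c act_one by (auto simp: coord_dom_def x0_def)
    have bl: "bounded_linear (\<lambda>t::real. t *\<^sub>R \<xi>)" by (rule bounded_linear_scaleR_left)
    define T where "T = (\<lambda>t::real. x0 + t *\<^sub>R \<xi>) -` ?S"
    have oT: "open T" unfolding T_def
      by (rule open_vimage[OF oS]) (intro continuous_intros)
    have "0 \<in> T" using x0 by (simp add: T_def)
    then obtain e where e: "0 < e" "ball 0 e \<subseteq> T" using oT openE by blast
    have eT: "{-e<..<e} \<subseteq> T" using e(2) by (simp add: ball_eq_greaterThanLessThan)
    define \<gamma> where "\<gamma> t = \<phi> (cinv b0 (x0 + t *\<^sub>R \<xi>)) p" for t
    have \<gamma>f: "(snd c \<circ> \<gamma>) t = f (x0 + t *\<^sub>R \<xi>)" for t by (simp add: \<gamma>_def f_def coord_def)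
    have \<gamma>c: "\<gamma> t \<in> fst c" if "t \<in> T" for t
      using that by (auto simp: T_def coord_dom_def \<gamma>_def cinv_chart[OF b0_chart])
    have "smooth_on {-e<..<e} (\<lambda>t. f (x0 + t *\<^sub>R \<xi>))"
      unfolding f_def
      by (rule smooth_on_compose_affine[OF oS bl smooth_orb[OF c(1) b0(1)]]) (use eT in \<open>auto simp: T_def\<close>)
    then have 1: "smooth_on {-e<..<e} (snd c \<circ> \<gamma>)" by (rule smooth_on_cong[rotated 2]) (simp_all add: \<gamma>f[symmetric])
    have "((\<lambda>t::real. x0 + t *\<^sub>R \<xi>) has_derivative (\<lambda>t. t *\<^sub>R \<xi>)) (at 0)"
      by (auto intro!: derivative_eq_intros)
    from diff_chain_at[OF this, of f "fld c p"] df
    have "((\<lambda>t. f (x0 + t *\<^sub>R \<xi>)) has_derivative (\<lambda>t. t *\<^sub>R v)) (at 0)"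
      using linear_scale[OF fld_linear[OF c]] by (simp add: o_def v)
    then have 2: "(snd c \<circ> \<gamma> has_vector_derivative v) (at 0)"
      unfolding has_vector_derivative_def using \<gamma>f by presburger
    have 3: "\<gamma> 0 = p" by (simp add: \<gamma>_def x0_def cinv_chart[OF b0_chart b0(2)] act_one)
    have 4: "\<gamma> ` {-e<..<e} \<subseteq> orbit G \<phi> p \<inter> fst c"
      using eT \<gamma>c by (auto simp: orbit_range \<gamma>_def)
    show "v \<in> tangent_space c (orbit G \<phi> p) p"
      unfolding tangent_space_def using e(1) 1 2 3 4 by blast
  qed
  show "tangent_space c (orbit G \<phi> p) p \<subseteq> range (fld c p)"
  proof
    fix v assume "v \<in> tangent_space c (orbit G \<phi> p) p"
    then obtain \<gamma> :: "real \<Rightarrow> 'm" and e where \<gamma>: "0 < e" "\<gamma> 0 = p" "\<gamma> ` {-e<..<e} \<subseteq> orbit G \<phi> p \<inter> fst c"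
      "(snd c \<circ> \<gamma> has_vector_derivative v) (at 0)" unfolding tangent_space_def by blast
    obtain R O' h V where R: "linear R" "\<And>v. fld c p (R (fld c p v)) = fld c p v" "\<And>w. R (fld c p (R w)) = R w"
    and O': "open O'" "x0 \<in> O'" "O' \<subseteq> coord_dom b0 c (\<lambda>g. \<phi> g p)"
    and h: "\<And>x. x \<in> O' \<Longrightarrow> h (f x) \<in> range R \<and> x0 + h (f x) \<in> O' \<and> f (x0 + h (f x)) = f x"
      "\<And>t. t \<in> range R \<Longrightarrow> x0 + t \<in> O' \<Longrightarrow> h (f (x0 + t)) = t"
      "\<And>x. x \<in> O' \<Longrightarrow> h differentiable (at (f x))"
    and V: "open V" "p \<in> V" "orbit G \<phi> p \<inter> V = (\<lambda>g. \<phi> g p) ` (fst b0 \<inter> snd b0 -` O')"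
    by (rule orbit_structure[OF c, folded f_def x0_def]) (rule that; assumption)
    define z where "z = snd c \<circ> \<gamma>"
    have z0: "z 0 = f x0" by (simp add: z_def \<gamma>(2) fx0)
    have dz: "(z has_derivative (\<lambda>t. t *\<^sub>R v)) (at 0)"
      using \<gamma>(4) by (simp add: z_def has_vector_derivative_def)
    have h0: "h (f x0) = 0" using h(2)[of 0] O'(2) R(1) by (metis add_0_right linear_0 rangeI)
    obtain h' where h': "(h has_derivative h') (at (z 0))" using h(3)[OF O'(2)] z0 by (auto simp: differentiable_def)
    have 1: "((\<lambda>t. x0 + h (z t)) has_derivative (\<lambda>t. h' (t *\<^sub>R v))) (at 0)"
      using has_derivative_add[OF has_derivative_const diff_chain_at[OF dz h']] by (simp add: o_def)
    have "((\<lambda>t. f (x0 + h (z t))) has_derivative (\<lambda>t. fld c p (h' (t *\<^sub>R v)))) (at 0)"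
      using diff_chain_at[OF 1, of f "fld c p"] df by (simp add: o_def z0 h0)
    moreover have "eventually (\<lambda>t. f (x0 + h (z t)) = z t) (nhds 0)"
    proof -
      have "isCont z 0" using dz has_derivative_continuous by blast
      then have tz: "(z \<longlongrightarrow> z 0) (nhds 0)" unfolding isCont_def tendsto_at_iff_tendsto_nhds .
      have pz: "z 0 = snd c p" by (simp add: z_def \<gamma>(2))
      have "eventually (\<lambda>q. q \<in> V) (nhds p)" using V by (auto simp: eventually_nhds)
      from eventually_chart[OF cc c(2) this]
      have "eventually (\<lambda>t. z t \<in> snd c ` fst c \<and> cinv c (z t) \<in> V) (nhds 0)"
        using tz unfolding pz by (rule eventually_compose_filterlim)
      moreover have "eventually (\<lambda>t. t \<in> {-e<..<e}) (nhds 0)"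
        using \<gamma>(1) by (intro eventually_nhds_in_open) auto
      ultimately show ?thesis
      proof eventually_elim
        case (elim t)
        have gt: "\<gamma> t \<in> orbit G \<phi> p \<inter> fst c" using elim(2) \<gamma>(3) by blast
        have "cinv c (z t) = \<gamma> t" using gt cinv_chart[OF cc] by (simp add: z_def)
        then have "\<gamma> t \<in> orbit G \<phi> p \<inter> V" using elim(1) gt by simp
        then obtain n where n: "n \<in> fst b0" "snd b0 n \<in> O'" "\<gamma> t = \<phi> n p" unfolding V(3) by blast
        have "z t = f (snd b0 n)" unfolding f_def coord_orb[OF n(1)] by (simp add: z_def n(3))
        then show ?case using h(1)[OF n(2)] by simp
      qed
    qed
    ultimately have "(z has_derivative (\<lambda>t. fld c p (h' (t *\<^sub>R v)))) (at 0)" by (rule has_derivative_cong_nhds)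
    then have "(\<lambda>t. fld c p (h' (t *\<^sub>R v))) = (\<lambda>t. t *\<^sub>R v)" using dz has_derivative_unique by blast
    from fun_cong[OF this, of 1] have "v = fld c p (h' v)" by simp
    then show "v \<in> range (fld c p)" by (rule image_eqI) simp
  qed
qed

text \<open>The parametrization is the orbit map restricted to \<open>x0 + range R\<close>, with
  \<open>range R\<close> identified with \<open>real^'n\<close>; its inverse comes from
  \<open>h\<close> in the chart \<open>c\<close>, which makes it a homeomorphism and an immersion at
  once.\<close>

lemma orbit_local_param:
  assumes c: "c \<in> A" "p \<in> fst c" and dim: "dim (range (fld c p)) = CARD('n)"
  shows "\<exists>W f. local_param A (orbit G \<phi> p) W f \<and> p \<in> f ` W"
proof -
  define f where "f = coord b0 c (\<lambda>g. \<phi> g p)"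
  define x0 where "x0 = snd b0 unit"
  have cc: "is_chart c" using chart_atlasD[OF atlasA c(1)] .
  obtain R O' h V where R: "linear R" "\<And>v. fld c p (R (fld c p v)) = fld c p v" "\<And>w. R (fld c p (R w)) = R w"
    and O': "open O'" "x0 \<in> O'" "O' \<subseteq> coord_dom b0 c (\<lambda>g. \<phi> g p)"
    and h: "\<And>x. x \<in> O' \<Longrightarrow> h (f x) \<in> range R \<and> x0 + h (f x) \<in> O' \<and> f (x0 + h (f x)) = f x"
      "\<And>t. t \<in> range R \<Longrightarrow> x0 + t \<in> O' \<Longrightarrow> h (f (x0 + t)) = t"
      "\<And>x. x \<in> O' \<Longrightarrow> h differentiable (at (f x))"
    and V: "open V" "p \<in> V" "orbit G \<phi> p \<inter> V = (\<lambda>g. \<phi> g p) ` (fst b0 \<inter> snd b0 -` O')"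
    by (rule orbit_structure[OF c, folded f_def x0_def]) (rule that; assumption)
  note lE = fld_linear[OF c]
  have "dim (range R) = dim (range (fld c p))"
  proof (rule antisym)
    have "R v \<in> R ` range (fld c p)" for v using R(3)[of v] by (metis image_eqI rangeI)
    then have "range R = R ` range (fld c p)" by blast
    then show "dim (range R) \<le> dim (range (fld c p))" using dim_image_le[OF R(1)] by metis
    have "fld c p v \<in> fld c p ` range R" for v using R(2)[of v] by (metis image_eqI rangeI)
    then have "range (fld c p) = fld c p ` range R" by blast
    then show "dim (range (fld c p)) \<le> dim (range R)" using dim_image_le[OF lE] by metis
  qed
  then have "dim (UNIV :: (real^'n) set) = dim (range R)" using dim by (simp add: dim_UNIV)
  then obtain L :: "real^'n \<Rightarrow> 'e" where L: "linear L" "L ` UNIV = range R" "inj L"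
    using subspace_isomorphism[OF subspace_UNIV linear_subspace_image[OF R(1) subspace_UNIV]] by metis
  obtain LI where LI: "linear LI" "LI \<circ> L = id" using linear_injective_left_inverse[OF L(1,3)] by blast
  have LIL: "LI (L t) = t" for t using LI(2) by (metis comp_apply id_apply)
  have bL: "bounded_linear L" and bLI: "bounded_linear LI" using L(1) LI(1) linear_conv_bounded_linear by auto
  have contL: "continuous_on UNIV (\<lambda>t. x0 + L t)"
    by (intro continuous_on_add continuous_on_const linear_continuous_on[OF bL])
  define W where "W = (\<lambda>t. x0 + L t) -` O'"
  define k where "k t = \<phi> (cinv b0 (x0 + L t)) p" for t
  have oW: "open W" unfolding W_def by (rule open_vimage[OF O'(1) contL])
  have Wb: "x0 + L t \<in> snd b0 ` fst b0" and kc: "k t \<in> fst c" if "t \<in> W" for t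
    using that O'(3) by (auto simp: W_def coord_dom_def k_def cinv_chart[OF b0_chart] subset_eq)
  have kf: "snd c (k t) = f (x0 + L t)" for t by (simp add: k_def f_def coord_def)
  have hk: "h (f (x0 + L t)) = L t" if "t \<in> W" for t using h(2)[of "L t"] L(2) that by (auto simp: W_def)
  have img: "k ` W = orbit G \<phi> p \<inter> V"
  proof
    show "k ` W \<subseteq> orbit G \<phi> p \<inter> V"
    proof
      fix q assume "q \<in> k ` W"
      then obtain t where t: "t \<in> W" "q = k t" by blast
      have "cinv b0 (x0 + L t) \<in> fst b0 \<inter> snd b0 -` O'"
        using Wb[OF t(1)] t(1) cinv_dom[OF Wb[OF t(1)]] chart_cinv[OF Wb[OF t(1)]] by (simp add: W_def)
      then show "q \<in> orbit G \<phi> p \<inter> V" unfolding V(3) t(2) k_def by blast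
    qed
    show "orbit G \<phi> p \<inter> V \<subseteq> k ` W"
    proof
      fix q assume "q \<in> orbit G \<phi> p \<inter> V"
      then obtain n where n: "n \<in> fst b0" "snd b0 n \<in> O'" "q = \<phi> n p" unfolding V(3) by blast
      have hn: "h (f (snd b0 n)) \<in> range R" "x0 + h (f (snd b0 n)) \<in> O'" "f (x0 + h (f (snd b0 n))) = f (snd b0 n)"
        using h(1)[OF n(2)] by auto
      obtain t where t: "h (f (snd b0 n)) = L t" using hn(1) L(2) by blast
      have tW: "t \<in> W" using hn(2) t by (simp add: W_def)
      have "snd b0 n \<in> coord_dom b0 c (\<lambda>g. \<phi> g p)" using n O'(3) by blast
      then have qc: "q \<in> fst c" using chart_inj[OF b0_chart] n by (auto simp: coord_dom_def inj_on_def)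
      have "snd c (k t) = snd c q" unfolding kf using hn(3) t coord_orb[OF n(1), of c p] n(3) by (simp add: f_def)
      then have "k t = q" using chart_inj[OF cc] kc[OF tW] qc by (simp add: inj_on_def)
      then show "q \<in> k ` W" using tW by blast
    qed
  qed
  have contk: "continuous_on W k"
  proof -
    have "continuous_on W (\<lambda>t. cinv b0 (x0 + L t))"
      by (rule continuous_on_compose2[OF cinv_continuous[OF b0_chart] continuous_on_subset[OF contL subset_UNIV]]) (use Wb in auto)
    then show ?thesis unfolding k_def by (rule continuous_on_compose2[OF orb_cont]) auto
  qed
  have hom: "homeomorphism W (k ` W) k (\<lambda>q. LI (h (snd c q)))"
  proof (rule homeomorphismI[OF contk])
    have kC: "k ` W \<subseteq> fst c" using kc by blast
    have "continuous_on (snd c ` k ` W) h"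
    proof (rule continuous_at_imp_continuous_on, rule ballI)
      fix z assume "z \<in> snd c ` k ` W"
      then obtain t where "t \<in> W" "z = f (x0 + L t)" using kf by auto
      then show "isCont h z" using h(3)[of "x0 + L t"] differentiable_imp_continuous_within by (auto simp: W_def)
    qed
    then have "continuous_on (k ` W) (\<lambda>q. h (snd c q))"
      by (rule continuous_on_compose2[OF _ continuous_on_subset[OF chart_continuous[OF cc] kC]]) auto
    then show "continuous_on (k ` W) (\<lambda>q. LI (h (snd c q)))" by (rule bounded_linear.continuous_on[OF bLI])
  qed (auto simp: kf hk LIL)
  have charts: "smooth_on (W \<inter> k -` fst d) (snd d \<circ> k) \<and>
      (\<forall>t\<in>W \<inter> k -` fst d. inj (frechet_derivative (snd d \<circ> k) (at t)))" if d: "d \<in> A" for d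
  proof (intro conjI ballI)
    let ?S = "coord_dom b0 d (\<lambda>g. \<phi> g p)" and ?F = "coord b0 d (\<lambda>g. \<phi> g p)"
    have kd: "(snd d \<circ> k) t = ?F (x0 + L t)" for t by (simp add: k_def coord_def)
    have dd: "is_chart d" using chart_atlasD[OF atlasA d] .
    have oT: "open (W \<inter> k -` fst d)"
      using continuous_open_preimage[OF contk oW chart_open(1)[OF dd]] .
    have TS: "W \<inter> k -` fst d \<subseteq> (\<lambda>t. x0 + L t) -` ?S"
    proof
      fix t assume t: "t \<in> W \<inter> k -` fst d"
      then obtain n where n: "n \<in> fst b0" "x0 + L t = snd b0 n" using Wb by blast
      then have "k t = \<phi> n p" by (simp add: k_def cinv_chart[OF b0_chart])
      then show "t \<in> (\<lambda>t. x0 + L t) -` ?S" using t n by (auto simp: coord_dom_def)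
    qed
    have sm: "smooth_on (W \<inter> k -` fst d) (\<lambda>t. ?F (x0 + L t))"
      by (rule smooth_on_compose_affine[OF open_coord_dom_orb[OF d b0(1)] bL smooth_orb[OF d b0(1)] TS oT])
    then show "smooth_on (W \<inter> k -` fst d) (snd d \<circ> k)"
      by (rule smooth_on_cong[OF oT, rotated]) (simp only: kd)
    fix t assume t: "t \<in> W \<inter> k -` fst d"
    then obtain n where n: "n \<in> fst b0" "x0 + L t = snd b0 n" using Wb by blast
    have knp: "k t = \<phi> n p" using n by (simp add: k_def cinv_chart[OF b0_chart])
    have nc: "\<phi> n p \<in> fst c" "\<phi> n p \<in> fst d" using kc[of t] t knp by auto
    let ?Dc = "differential b0 c (\<lambda>g. \<phi> g p) n" and ?Dd = "differential b0 d (\<lambda>g. \<phi> g p) n"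
    let ?I = "differential c d id (\<phi> n p)"
    have md: "mdiff b0 d (\<lambda>g. \<phi> g p) n ?Dd" by (rule orb_mdiff[OF b0(1) d n(1) nc(2)])
    have mc: "mdiff b0 c (\<lambda>g. \<phi> g p) n ?Dc" by (rule orb_mdiff[OF b0(1) c(1) n(1) nc(1)])
    have "mdiff b0 d (\<lambda>g. id (\<phi> g p)) n (\<lambda>v. ?I (?Dc v))"
      by (rule mdiff_compose[OF mc complex_atlas_id(1)[OF complexA c(1) d nc]])
    then have Dd: "?Dd v = ?I (?Dc v)" for v using mdiff_unique[OF md] by simp
    have dL: "((\<lambda>t. x0 + L t) has_derivative L) (at t)"
      using has_derivative_add[OF has_derivative_const bounded_linear_imp_has_derivative[OF bL]] by simp
    have "((\<lambda>t. ?F (x0 + L t)) has_derivative (\<lambda>v. ?Dd (L v))) (at t)"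
      using diff_chain_at[OF dL, of ?F ?Dd] md n(2) by (simp add: mdiff_def o_def)
    then have e: "frechet_derivative (snd d \<circ> k) (at t) = (\<lambda>v. ?Dd (L v))"
      using kd frechet_derivative_eq by (metis (no_types, lifting) ext)
    have fder: "((\<lambda>t. f (x0 + L t)) has_derivative (\<lambda>v. ?Dc (L v))) (at t)"
      using diff_chain_at[OF dL, of f ?Dc] mc n(2) by (simp add: mdiff_def o_def f_def)
    obtain h' where h': "(h has_derivative h') (at (f (x0 + L t)))"
      using h(3)[of "x0 + L t"] t by (auto simp: W_def differentiable_def)
    have 1: "((\<lambda>t. h (f (x0 + L t))) has_derivative (\<lambda>v. h' (?Dc (L v)))) (at t)"
      using diff_chain_at[OF fder h'] by (simp add: o_def)
    have "((\<lambda>t. h (f (x0 + L t))) has_derivative L) (at t)"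
      by (rule has_derivative_transform_within_open[OF bounded_linear_imp_has_derivative[OF bL] oW]) (use t hk in auto)
    \<comment> \<open>Since \<open>h\<close> undoes the parametrization, its derivative undoes
      \<open>?Dc\<close> on the range of \<open>L\<close>; passing to the chart \<open>d\<close>
      composes with an invertible map.\<close>
    then have hL: "h' (?Dc (L v)) = L v" for v using fun_cong[OF has_derivative_unique[OF 1], of L v] by blast
    show "inj (frechet_derivative (snd d \<circ> k) (at t))"
    proof (rule injI)
      fix u v assume "frechet_derivative (snd d \<circ> k) (at t) u = frechet_derivative (snd d \<circ> k) (at t) v"
      then have "?I (?Dc (L u)) = ?I (?Dc (L v))" by (simp add: e Dd)
      then have "?Dc (L u) = ?Dc (L v)" using id_differential_inv[OF c(1) d nc] by metis
      then show "u = v" using hL LIL by metis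
    qed
  qed
  have "p \<in> k ` W" using img V(2) orbit_self by blast
  moreover have "local_param A (orbit G \<phi> p) W k"
    unfolding local_param_def using oW img V(1) hom charts by blast
  ultimately show ?thesis by blast
qed

lemma orbit_submanifold:
  assumes c: "c \<in> A" "p \<in> fst c" and dim: "dim (range (fld c p)) = CARD('n)"
  shows "n_submanifold A (orbit G \<phi> p)"
  unfolding n_submanifold_def
proof
  fix q assume "q \<in> orbit G \<phi> p"
  then obtain g where g: "q = \<phi> g p" unfolding orbit_range by blast
  obtain d where d: "d \<in> A" "q \<in> fst d" using chart_at[OF atlasA] by metis
  have "dim (range (fld d q)) = CARD('n)" using fld_dim_act[OF c(1) d(1) c(2)] d(2) dim unfolding g by simp
  from orbit_local_param[OF d this] show "\<exists>W f. local_param A (orbit G \<phi> p) W f \<and> q \<in> f ` W"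
    unfolding g orbit_act .
qed

end

text \<open>With \<open>L\<close> a left inverse of \<open>M0\<close>, the maps
  \<open>L \<circ> M x\<close> tend to the identity, and a map at distance less than 1 from the
  identity has trivial kernel.\<close>

lemma eventually_inj_linear:
  fixes M :: "'x \<Rightarrow> 'a::euclidean_space \<Rightarrow> 'b::euclidean_space"
  assumes lin: "eventually (\<lambda>x. linear (M x)) F" and M0: "linear M0" "inj M0"
    and lim: "\<And>v. ((\<lambda>x. M x v) \<longlongrightarrow> M0 v) F"
  shows "eventually (\<lambda>x. inj (M x)) F"
proof -
  obtain L where L: "linear L" "L \<circ> M0 = id" using linear_injective_left_inverse[OF M0] by blast
  have LM: "L (M0 v) = v" for v using L(2) by (metis comp_def id_apply)
  define m where "m x = (\<Sum>b\<in>Basis. norm (L (M x b) - b))" for x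
  have "((\<lambda>x. L (M x b)) \<longlongrightarrow> L (M0 b)) F" for b
    using linear_continuous_at[of L "M0 b"] L(1) lim[of b]
    by (intro isCont_tendsto_compose[of _ L]) (auto simp: linear_conv_bounded_linear)
  then have "(m \<longlongrightarrow> (\<Sum>b\<in>(Basis::'a set). norm (L (M0 b) - b))) F"
    unfolding m_def by (intro tendsto_sum tendsto_norm tendsto_diff tendsto_const)
  then have "(m \<longlongrightarrow> 0) F" by (simp add: LM)
  then have "eventually (\<lambda>x. m x < 1) F" by (rule order_tendstoD(2)) simp
  with lin show ?thesis
  proof eventually_elim
    case (elim x)
    have linN: "linear (\<lambda>v. L (M x v) - v)"
      using linear_compose_sub[OF linear_compose[OF elim(1) L(1)] linear_id] by (simp add: o_def)
    have bound: "norm (L (M x v) - v) \<le> m x * norm v" for v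
      using norm_linear_le_sum[OF linN] by (simp add: m_def)
    show ?case
    proof (rule linear_injective_0[THEN iffD2, OF elim(1)], intro allI impI)
      fix v assume "M x v = 0"
      then have "norm v \<le> m x * norm v" using bound[of v] L(1) by (simp add: linear_0)
      then have "(1 - m x) * norm v \<le> 0" by (simp add: algebra_simps)
      then show "v = 0" using elim(2) by (simp add: mult_le_0_iff)
    qed
  qed
qed

lemma kahler_chartI:
  assumes "kahler_form A \<omega>" "c \<in> A" "is_chart c"
  shows "kahler_chart \<omega> c (snd c ` fst c)"
proof -
  have s: "\<And>u v. smooth_on (snd c ` fst c) (\<lambda>z. \<omega> c z u v)" using assms(1,2) unfolding kahler_form_def by blast
  have r: "bilinear (\<omega> c z) \<and> (\<forall>u v. \<omega> c z u v = - \<omega> c z v u) \<and> (\<forall>u v. \<omega> c z (J u) (J v) = \<omega> c z u v) \<and>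
        (\<forall>u. u \<noteq> 0 \<longrightarrow> metric \<omega> c z u u > 0) \<and>
        (\<forall>u v w. Dir u (\<lambda>y. \<omega> c y v w) z + Dir v (\<lambda>y. \<omega> c y w u) z + Dir w (\<lambda>y. \<omega> c y u v) z = 0)"
    if "z \<in> snd c ` fst c" for z
    using assms(1,2) that unfolding kahler_form_def by blast
  show ?thesis
    by (unfold_locales) (use s r chart_open(2)[OF assms(3)] in blast)+
qed

section \<open>The joint action in product charts\<close>

context lie_action begin

abbreviation pch where "pch b c \<equiv> (fst b \<times> fst c, map_prod (snd b) (snd c))"

definition Act where "Act b c d = coord (pch b c) d (\<lambda>(g, p). \<phi> g p)"
definition ActD where "ActD b c d = coord_dom (pch b c) d (\<lambda>(g, p). \<phi> g p)"

lemma Act_smooth: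
  assumes "b \<in> B" "c \<in> A" "d \<in> A" shows "open (ActD b c d)" "smooth_on (ActD b c d) (Act b c d)"
proof -
  have ch: "is_chart b" "is_chart c" "is_chart d"
    using assms chart_atlasD[OF atlasA] chart_atlasD[OF atlasB] by blast+
  show "open (ActD b c d)" unfolding ActD_def
    by (rule open_coord_dom[OF is_chart_prod[OF ch(1,2)] ch(3) joint_cont])
  have "pch b c \<in> prod_atlas B A" using assms unfolding prod_atlas_def by blast
  then show "smooth_on (ActD b c d) (Act b c d)"
    using joint_smooth assms unfolding smooth_map_def ActD_def Act_def by blast
qed

lemma ActD_I: "g \<in> fst b \<Longrightarrow> q \<in> fst c \<Longrightarrow> \<phi> g q \<in> fst d \<Longrightarrow> (snd b g, snd c q) \<in> ActD b c d"
  unfolding ActD_def coord_dom_def by (rule image_eqI[of _ _ "(g, q)"]) auto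

lemma ActD_E:
  assumes "y \<in> ActD b c d"
  obtains g q where "y = (snd b g, snd c q)" "g \<in> fst b" "q \<in> fst c" "\<phi> g q \<in> fst d"
  using assms unfolding ActD_def coord_dom_def by auto

lemma pch_chart: "b \<in> B \<Longrightarrow> c \<in> A \<Longrightarrow> is_chart (pch b c)"
  using is_chart_prod chart_atlasD[OF atlasA] chart_atlasD[OF atlasB] by blast

lemma Act_eq:
  assumes "b \<in> B" "c \<in> A" "g \<in> fst b" "q \<in> fst c"
  shows "Act b c d (snd b g, snd c q) = snd d (\<phi> g q)"
  using coord_at[OF pch_chart[OF assms(1,2)], of "(g, q)" d "\<lambda>(g, p). \<phi> g p"] assms(3,4) unfolding Act_def by simp

lemma joint_mdiff:
  assumes "b \<in> B" "c \<in> A" "d \<in> A" "g \<in> fst b" "q \<in> fst c" "\<phi> g q \<in> fst d"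
  shows "mdiff (pch b c) d (\<lambda>(g, p). \<phi> g p) (g, q) (\<lambda>w. Dir w (Act b c d) (snd b g, snd c q))"
proof -
  have "pch b c \<in> prod_atlas B A" using assms unfolding prod_atlas_def by blast
  from smooth_map_mdiff[OF joint_smooth chart_atlas_prod[OF atlasB atlasA] atlasA this assms(3), of "(g, q)"] assms
  show ?thesis unfolding differential_def Act_def by simp
qed

lemma incl2_mdiff:
  assumes "b \<in> B" "c \<in> A" "g \<in> fst b" "q \<in> fst c"
  shows "mdiff c (pch b c) (\<lambda>q. (g, q)) q (\<lambda>v. (0, v))"
proof -
  have c: "is_chart c" using assms chart_atlasD[OF atlasA] by blast
  have "((\<lambda>z. (snd b g, z)) has_derivative (\<lambda>v. (0, v))) (at (snd c q))"
    by (intro has_derivative_Pair has_derivative_const has_derivative_ident)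
  then have "(coord c (pch b c) (\<lambda>q. (g, q)) has_derivative (\<lambda>v. (0, v))) (at (snd c q))"
    by (rule has_derivative_transform_within_open[OF _ chart_open(2)[OF c]])
      (use assms in \<open>auto simp: coord_def cinv_chart[OF c]\<close>)
  moreover have "isCont (\<lambda>q. (g, q)) q" by (intro continuous_Pair continuous_const continuous_ident)
  ultimately show ?thesis using assms c pch_chart by (simp add: mdiff_def)
qed

lemma incl1_mdiff:
  assumes "b \<in> B" "c \<in> A" "g \<in> fst b" "q \<in> fst c"
  shows "mdiff b (pch b c) (\<lambda>g. (g, q)) g (\<lambda>v. (v, 0))"
proof -
  have b: "is_chart b" using assms chart_atlasD[OF atlasB] by blast
  have "((\<lambda>z. (z, snd c q)) has_derivative (\<lambda>v. (v, 0))) (at (snd b g))"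
    by (intro has_derivative_Pair has_derivative_const has_derivative_ident)
  then have "(coord b (pch b c) (\<lambda>g. (g, q)) has_derivative (\<lambda>v. (v, 0))) (at (snd b g))"
    by (rule has_derivative_transform_within_open[OF _ chart_open(2)[OF b]])
      (use assms in \<open>auto simp: coord_def cinv_chart[OF b]\<close>)
  moreover have "isCont (\<lambda>g. (g, q)) g" by (intro continuous_Pair continuous_const continuous_ident)
  ultimately show ?thesis using assms b pch_chart by (simp add: mdiff_def)
qed

text \<open>Seen as a partial derivative of one smooth function, the differential of
  \<open>\<phi> g\<close> can be differentiated in \<open>g\<close>, and the two differentiations
  can be interchanged.\<close>

lemma Act_Dir2:
  assumes "b \<in> B" "c \<in> A" "d \<in> A" "g \<in> fst b" "q \<in> fst c" "\<phi> g q \<in> fst d"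
  shows "Dir (0, v) (Act b c d) (snd b g, snd c q) = differential c d (\<phi> g) q v"
  using mdiff_differential[OF mdiff_compose[OF incl2_mdiff[OF assms(1,2,4,5)] joint_mdiff[OF assms]]] by simp

lemma Act_Dir1:
  assumes "b \<in> B" "c \<in> A" "d \<in> A" "g \<in> fst b" "q \<in> fst c" "\<phi> g q \<in> fst d"
  shows "Dir (\<eta>, 0) (Act b c d) (snd b g, snd c q) = differential b d (\<lambda>g. \<phi> g q) g \<eta>"
  using mdiff_differential[OF mdiff_compose[OF incl1_mdiff[OF assms(1,2,4,5)] joint_mdiff[OF assms]]] by simp

end

section \<open>Isometries in the group are holomorphic\<close>

locale kahler_action = lie_action A G B \<phi>
  for A :: "('m::t2_space, complex^'n) chart set"
    and G :: "('g::t2_space) monoid" and B :: "('g, 'e::euclidean_space) chart set"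
    and \<phi> :: "'g \<Rightarrow> 'm \<Rightarrow> 'm" +
  fixes \<omega> :: "('m, complex^'n) tensor2" and \<kappa> :: real
  assumes compactM: "compact (UNIV :: 'm set)"
    and kahler: "kahler_form A \<omega>" and \<kappa>_pos: "\<kappa> > 0"
    and einstein: "\<And>c z u v. c \<in> A \<Longrightarrow> z \<in> snd c ` fst c \<Longrightarrow> ricci_form \<omega> c z u v = \<kappa> * \<omega> c z u v"
    and isometric: "isometric_action G A \<omega> \<phi>"
    and connected_or_holomorphic: "connected (UNIV :: 'g set) \<or> (\<forall>g\<in>carrier G. holomorphic_map A (\<phi> g))"
begin

lemma kahler_chart_at: "c \<in> A \<Longrightarrow> kahler_chart \<omega> c (snd c ` fst c)"
  using kahler_chartI[OF kahler _ chart_atlasD[OF atlasA]] by blast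

lemma act_isometry:
  assumes "c \<in> A" "d \<in> A" "p \<in> fst c" "\<phi> g p \<in> fst d"
  shows "metric \<omega> d (snd d (\<phi> g p)) (differential c d (\<phi> g) p u) (differential c d (\<phi> g) p v) = metric \<omega> c (snd c p) u v"
  using isometric assms carrierG unfolding isometric_action_def preserves_def by blast

lemma kahler_isometry_act:
  assumes c: "c \<in> A" "d \<in> A"
  shows "kahler_isometry \<omega> c (snd c ` fst c) d (snd d ` fst d) (coord c d (\<phi> g)) (coord_dom c d (\<phi> g))"
proof -
  have cc: "is_chart c" and dd: "is_chart d" using c chart_atlasD[OF atlasA] by blast+
  interpret a: kahler_chart \<omega> c "snd c ` fst c" using kahler_chart_at c by blast
  interpret b: kahler_chart \<omega> d "snd d ` fst d" using kahler_chart_at c by blast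
  show ?thesis
  proof
    show "open (coord_dom c d (\<phi> g))" by (rule open_coord_dom[OF cc dd act_cont])
    show "coord_dom c d (\<phi> g) \<subseteq> snd c ` fst c" unfolding coord_dom_def by blast
    show "coord c d (\<phi> g) ` coord_dom c d (\<phi> g) \<subseteq> snd d ` fst d"
      unfolding coord_dom_def by (auto simp: coord_at[OF cc])
    show "smooth_on (coord_dom c d (\<phi> g)) (coord c d (\<phi> g))"
      using act_smooth c unfolding smooth_map_def by blast
    fix z u v assume "z \<in> coord_dom c d (\<phi> g)"
    then obtain q where q: "z = snd c q" "q \<in> fst c" "\<phi> g q \<in> fst d" unfolding coord_dom_def by blast
    show "metric \<omega> d (coord c d (\<phi> g) z) (Dir u (coord c d (\<phi> g)) z) (Dir v (coord c d (\<phi> g)) z) = metric \<omega> c z u v"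
      using act_isometry[OF c q(2,3)] unfolding differential_def q(1) coord_at[OF cc q(2)] .
  qed
qed

lemma holomorphic_if_surj:
  assumes c: "c \<in> A" "d \<in> A" "p \<in> fst c" "\<phi> g p \<in> fst d"
    and surj: "surj (\<lambda>u. J (differential c d (\<phi> g) p u) + differential c d (\<phi> g) p (J u))"
  shows "differential c d (\<phi> g) p (J v) = J (differential c d (\<phi> g) p v)"
proof -
  interpret kahler_isometry \<omega> c "snd c ` fst c" d "snd d ` fst d" "coord c d (\<phi> g)" "coord_dom c d (\<phi> g)"
    by (rule kahler_isometry_act[OF c(1,2)])
  have z: "snd c p \<in> coord_dom c d (\<phi> g)" using c by (auto simp: coord_dom_def)
  show ?thesis
    using holomorphic_if_close[OF z einstein[OF c(1)] _ surj[unfolded differential_def]] z \<kappa>_pos TS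
    unfolding differential_def by blast
qed

lemma holomorphic_chart_change:
  assumes c: "c \<in> A" "d \<in> A" "d' \<in> A" "p \<in> fst c" "\<phi> g p \<in> fst d" "\<phi> g p \<in> fst d'"
    and h: "\<And>v. differential c d (\<phi> g) p (J v) = J (differential c d (\<phi> g) p v)"
  shows "differential c d' (\<phi> g) p (J v) = J (differential c d' (\<phi> g) p v)"
proof -
  have "mdiff c d' (\<lambda>x. id (\<phi> g x)) p (\<lambda>v. differential d d' id (\<phi> g p) (differential c d (\<phi> g) p v))"
    by (rule mdiff_compose[OF act_mdiff[OF c(1,2,4,5)] complex_atlas_id(1)[OF complexA c(2,3,5,6)]])
  then have "differential c d' (\<phi> g) p = (\<lambda>v. differential d d' id (\<phi> g p) (differential c d (\<phi> g) p v))"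
    using mdiff_differential by fastforce
  then show ?thesis using h complex_atlas_id(2)[OF complexA c(2,3,5,6)] by simp
qed

text \<open>By joint smoothness, the differential of \<open>\<phi> g\<close> at a fixed point is a
  partial derivative of \<open>Act\<close>, continuous in the group variable.\<close>

lemma differential_continuous:
  assumes c: "c \<in> A" "d \<in> A" "p \<in> fst c" "\<phi> g0 p \<in> fst d"
  shows "((\<lambda>g. differential c d (\<phi> g) p v) \<longlongrightarrow> differential c d (\<phi> g0) p v) (nhds g0)"
    and "eventually (\<lambda>g. \<phi> g p \<in> fst d) (nhds g0)"
proof -
  obtain b where b: "b \<in> B" "g0 \<in> fst b" "is_chart b" using chart_at[OF atlasB] by metis
  have "isCont (\<lambda>g. \<phi> g p) g0" using orb_cont by (simp add: continuous_on_eq_continuous_at)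
  then show ev: "eventually (\<lambda>g. \<phi> g p \<in> fst d) (nhds g0)"
    using c chart_open(1)[OF chart_atlasD[OF atlasA c(2)]] by (intro isCont_eventually_open) auto
  have "continuous_on (ActD b c d) (\<lambda>y. Dir (0, v) (Act b c d) y)"
    using smooth_onD[OF smooth_on_Dir[OF Act_smooth(2)[OF b(1) c(1,2)]], of 0] by simp
  then have "isCont (\<lambda>y. Dir (0, v) (Act b c d) y) (snd b g0, snd c p)"
    using Act_smooth(1)[OF b(1) c(1,2)] ActD_I[OF b(2) c(3,4)] continuous_on_eq_continuous_at by blast
  moreover have "isCont (\<lambda>g. (snd b g, snd c p)) g0"
    using chart_isCont[OF b(3,2)] by (intro continuous_Pair continuous_const)
  ultimately have "isCont (\<lambda>g. Dir (0, v) (Act b c d) (snd b g, snd c p)) g0"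
    by (rule isCont_o2[rotated])
  then have "((\<lambda>g. Dir (0, v) (Act b c d) (snd b g, snd c p)) \<longlongrightarrow> Dir (0, v) (Act b c d) (snd b g0, snd c p)) (nhds g0)"
    using tendsto_at_iff_tendsto_nhds[of "\<lambda>g. Dir (0, v) (Act b c d) (snd b g, snd c p)" g0]
    unfolding isCont_def by blast
  note l = this
  have "eventually (\<lambda>g. g \<in> fst b) (nhds g0)" using b(2) chart_open(1)[OF b(3)] by (rule eventually_nhds_in_open[rotated])
  with ev have ev2: "eventually (\<lambda>g. Dir (0, v) (Act b c d) (snd b g, snd c p) = differential c d (\<phi> g) p v) (nhds g0)"
    by eventually_elim (rule Act_Dir2[OF b(1) c(1,2) _ c(3)])
  have e: "Dir (0, v) (Act b c d) (snd b g0, snd c p) = differential c d (\<phi> g0) p v"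
    by (rule Act_Dir2[OF b(1) c(1,2) b(2) c(3,4)])
  show "((\<lambda>g. differential c d (\<phi> g) p v) \<longlongrightarrow> differential c d (\<phi> g0) p v) (nhds g0)"
    using Lim_transform_eventually[OF l ev2] unfolding e .
qed

text \<open>For connected \<open>G\<close>, the set of \<open>g\<close> whose differential at \<open>p\<close> is complex linear is open and closed.\<close>

lemma act_holomorphic:
  assumes c: "c \<in> A" "d \<in> A" "p \<in> fst c" "\<phi> g p \<in> fst d"
  shows "differential c d (\<phi> g) p (J v) = J (differential c d (\<phi> g) p v)"
proof (cases "\<forall>g\<in>carrier G. holomorphic_map A (\<phi> g)")
  case True
  then have h: "holo_on (coord_dom c d (\<phi> g)) (coord c d (\<phi> g))"
    using carrierG c unfolding holomorphic_map_def by blast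
  show ?thesis
    by (rule mdiff_holo(2)[OF chart_atlasD[OF atlasA c(1)] chart_atlasD[OF atlasA c(2)] act_cont h c(3,4)])
next
  case False
  then have conn: "connected (UNIV :: 'g set)" using connected_or_holomorphic by blast
  \<comment> \<open>Quantifying over all charts at the image point makes the condition independent
    of the chart, which may change as \<open>g\<close> moves.\<close>
  define P where "P g \<longleftrightarrow> (\<forall>d\<in>A. \<phi> g p \<in> fst d \<longrightarrow>
     (\<forall>v. differential c d (\<phi> g) p (J v) = J (differential c d (\<phi> g) p v)))" for g
  have PI: "P g" if "d \<in> A" "\<phi> g p \<in> fst d" "\<And>v. differential c d (\<phi> g) p (J v) = J (differential c d (\<phi> g) p v)" for g d
    unfolding P_def using holomorphic_chart_change[OF c(1) that(1) _ c(3) that(2) _ that(3)] by blast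
  have oP: "open {g. P g}"
  proof (subst open_subopen, intro ballI)
    fix g0 assume "g0 \<in> {g. P g}"
    then have g0: "P g0" by simp
    obtain d where d: "d \<in> A" "\<phi> g0 p \<in> fst d" using chart_at[OF atlasA] by metis
    let ?D = "\<lambda>g. differential c d (\<phi> g) p"
    let ?M = "\<lambda>g u. J (?D g u) + ?D g (J u)"
    note dc = differential_continuous[OF c(1) d(1) c(3) d(2)]
    have lin: "linear (?M g)" if "\<phi> g p \<in> fst d" for g
    proof -
      have l: "linear (?D g)" using mdiff_linear[OF act_mdiff[OF c(1) d(1) c(3) that]] .
      show ?thesis using linear_compose_add[OF linear_compose[OF l linear_J] linear_compose[OF linear_J l]] by (simp add: o_def)
    qed
    \<comment> \<open>At \<open>g0\<close> the map \<open>?M\<close> is twice \<open>J\<close>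
      composed with an invertible differential; injectivity persists nearby and, by equality of
      dimensions, provides the surjectivity in \<open>holomorphic_if_surj\<close>.\<close>
    have "eventually (\<lambda>g. inj (?M g)) (nhds g0)"
    proof (rule eventually_inj_linear)
      show "eventually (\<lambda>g. linear (?M g)) (nhds g0)" using dc(2) by eventually_elim (rule lin)
      show "linear (?M g0)" by (rule lin[OF d(2)])
      show "((\<lambda>g. ?M g v) \<longlongrightarrow> ?M g0 v) (nhds g0)" for v
        by (intro tendsto_add dc(1) bounded_linear.tendsto[OF bounded_linear_J])
      show "inj (?M g0)"
      proof (rule injI)
        fix u v assume "?M g0 u = ?M g0 v"
        then have "J (?D g0 u) + J (?D g0 u) = J (?D g0 v) + J (?D g0 v)" using g0 d unfolding P_def by simp
        then have "J (?D g0 u) = J (?D g0 v)" by (simp only: scaleR_2[symmetric] scaleR_cancel_left) simp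
        then have "J (J (?D g0 u)) = J (J (?D g0 v))" by (rule arg_cong)
        then have "?D g0 u = ?D g0 v" unfolding J_J by simp
        then show "u = v" using act_differential_inv[OF c(1) d(1) c(3) d(2)] by metis
      qed
    qed
    with dc(2) have "eventually (\<lambda>g. P g) (nhds g0)"
    proof eventually_elim
      case (elim g)
      have "surj (?M g)" using linear_injective_imp_surjective[OF lin[OF elim(1)] elim(2)] by blast
      then show ?case using PI[OF d(1) elim(1)] holomorphic_if_surj[OF c(1) d(1) c(3) elim(1)] by blast
    qed
    then show "\<exists>T. open T \<and> g0 \<in> T \<and> T \<subseteq> {g. P g}" by (auto simp: eventually_nhds)
  qed
  have oN: "open {g. \<not> P g}"
  proof (subst open_subopen, intro ballI)
    fix g0 assume "g0 \<in> {g. \<not> P g}"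
    then obtain d v where d: "d \<in> A" "\<phi> g0 p \<in> fst d" and ne: "differential c d (\<phi> g0) p (J v) \<noteq> J (differential c d (\<phi> g0) p v)"
      unfolding P_def by blast
    let ?D = "\<lambda>g. differential c d (\<phi> g) p"
    note dc = differential_continuous[OF c(1) d(1) c(3) d(2)]
    have "((\<lambda>g. ?D g (J v) - J (?D g v)) \<longlongrightarrow> ?D g0 (J v) - J (?D g0 v)) (nhds g0)"
      by (intro tendsto_diff dc(1) bounded_linear.tendsto[OF bounded_linear_J])
    then have "eventually (\<lambda>g. ?D g (J v) - J (?D g v) \<noteq> 0) (nhds g0)"
      by (rule tendsto_imp_eventually_ne) (use ne in simp)
    with dc(2) have "eventually (\<lambda>g. \<not> P g) (nhds g0)"
      by eventually_elim (use d(1) P_def in auto)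
    then show "\<exists>T. open T \<and> g0 \<in> T \<and> T \<subseteq> {g. \<not> P g}" by (auto simp: eventually_nhds)
  qed
  have "P unit"
  proof (rule PI[OF c(1)])
    have e: "\<phi> unit = id" by (rule ext) (simp add: act_one)
    show "\<phi> unit p \<in> fst c" using c by (simp add: e)
    show "differential c c (\<phi> unit) p (J v) = J (differential c c (\<phi> unit) p v)" for v
      unfolding e by (rule complex_atlas_id(2)[OF complexA c(1,1,3,3)])
  qed
  then have "{g. \<not> P g} = {}"
    using connectedD[OF conn oP oN] by auto
  then show ?thesis using c(2,4) unfolding P_def by auto
qed

end

subsection \<open>Fundamental vector fields are holomorphic Killing fields\<close>

context kahler_action begin

definition Xf where "Xf c \<xi> z = fld c (cinv c z) \<xi>"

lemma chartA: "c \<in> A \<Longrightarrow> is_chart c" using chart_atlasD[OF atlasA] .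

lemma base_ActD: "c \<in> A \<Longrightarrow> z \<in> snd c ` fst c \<Longrightarrow> (snd b0 unit, z) \<in> ActD b0 c c"
  using ActD_I[OF b0(2), of _ c c] by (auto simp: act_one)

lemma Xf_Act:
  assumes c: "c \<in> A" "z \<in> snd c ` fst c"
  shows "Xf c \<xi> z = Dir (\<xi>, 0) (Act b0 c c) (snd b0 unit, z)"
proof -
  obtain q where q: "q \<in> fst c" "z = snd c q" using c by blast
  show ?thesis using Act_Dir1[OF b0(1) c(1) c(1) b0(2) q(1)] q(1)
    by (simp add: Xf_def q(2) cinv_chart[OF chartA[OF c(1)]] act_one fld_def)
qed

lemma Act_Dir_differentiable:
  "b \<in> B \<Longrightarrow> c \<in> A \<Longrightarrow> d \<in> A \<Longrightarrow> y \<in> ActD b c d \<Longrightarrow> (\<lambda>y. Dir w (Act b c d) y) differentiable (at y)"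
  "b \<in> B \<Longrightarrow> c \<in> A \<Longrightarrow> d \<in> A \<Longrightarrow> y \<in> ActD b c d \<Longrightarrow> Act b c d differentiable (at y)"
  using smooth_on_differentiable[OF smooth_on_Dir[OF Act_smooth(2)]] smooth_on_differentiable[OF Act_smooth(2)] by blast+

lemma Xf_smooth:
  assumes c: "c \<in> A" shows "smooth_on (snd c ` fst c) (Xf c \<xi>)"
proof -
  have oS: "open (snd c ` fst c)" using chart_open(2)[OF chartA[OF c]] .
  have bl: "bounded_linear (\<lambda>z::complex^'n. (0::'e, z))"
    by (intro bounded_linear_Pair bounded_linear_zero bounded_linear_ident)
  have "smooth_on (snd c ` fst c) (\<lambda>z. (\<lambda>y. Dir (\<xi>, 0) (Act b0 c c) y) ((snd b0 unit, 0) + (0, z)))"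
    by (rule smooth_on_compose_affine[OF Act_smooth(1)[OF b0(1) c c] bl smooth_on_Dir[OF Act_smooth(2)[OF b0(1) c c]] _ oS])
      (use base_ActD[OF c] in auto)
  then show ?thesis
    by (rule smooth_on_cong[OF oS, rotated]) (simp add: Xf_Act[OF c])
qed

text \<open>Interchanging derivatives identifies the derivative of a fundamental field with the
  derivative, in the group direction, of the differential of \<open>\<phi> g\<close>. Properties
  shared by all \<open>\<phi> g\<close> thereby pass to the fields.\<close>

lemma Xf_Dir:
  assumes c: "c \<in> A" "z \<in> snd c ` fst c"
  shows "Dir u (Xf c \<xi>) z = Dir (\<xi>, 0) (\<lambda>y. Dir (0, u) (Act b0 c c) y) (snd b0 unit, z)"
proof -
  note zD = base_ActD[OF c]
  have "((\<lambda>z::complex^'n. (snd b0 unit, z)) has_derivative (\<lambda>v. (0, v))) (at z)"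
    by (intro has_derivative_Pair has_derivative_const has_derivative_ident)
  from diff_chain_at[OF this has_derivative_frechet[OF Act_Dir_differentiable(1)[OF b0(1) c(1) c(1) zD]]]
  have "((\<lambda>z. Dir (\<xi>, 0) (Act b0 c c) (snd b0 unit, z)) has_derivative
      (\<lambda>v. Dir (0, v) (\<lambda>y. Dir (\<xi>, 0) (Act b0 c c) y) (snd b0 unit, z))) (at z)" by (simp add: o_def)
  then have "(Xf c \<xi> has_derivative (\<lambda>v. Dir (0, v) (\<lambda>y. Dir (\<xi>, 0) (Act b0 c c) y) (snd b0 unit, z))) (at z)"
    by (rule has_derivative_transform_within_open[OF _ chart_open(2)[OF chartA[OF c(1)]] c(2)]) (simp add: Xf_Act[OF c(1)])
  then have "Dir u (Xf c \<xi>) z = Dir (0, u) (\<lambda>y. Dir (\<xi>, 0) (Act b0 c c) y) (snd b0 unit, z)"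
    by (simp add: frechet_derivative_eq)
  also have "\<dots> = Dir (\<xi>, 0) (\<lambda>y. Dir (0, u) (Act b0 c c) y) (snd b0 unit, z)"
    by (rule second_derivative_symmetric[OF Act_smooth(1)[OF b0(1) c(1) c(1)] zD])
      (use Act_Dir_differentiable[OF b0(1) c(1) c(1)] zD in auto)
  finally show ?thesis .
qed

text \<open>Complex linearity of the differentials of \<open>\<phi> g\<close> is differentiated in
  \<open>g\<close> at the identity.\<close>

lemma Xf_holomorphic:
  assumes c: "c \<in> A" "z \<in> snd c ` fst c"
  shows "Dir (J u) (Xf c \<xi>) z = J (Dir u (Xf c \<xi>) z)"
proof -
  note zD = base_ActD[OF c]
  have J: "Dir (0, J u) (Act b0 c c) y = J (Dir (0, u) (Act b0 c c) y)" if y: "y \<in> ActD b0 c c" for y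
  proof -
    obtain g q where q: "y = (snd b0 g, snd c q)" "g \<in> fst b0" "q \<in> fst c" "\<phi> g q \<in> fst c"
      using ActD_E[OF y] by blast
    show ?thesis unfolding q(1) Act_Dir2[OF b0(1) c(1) c(1) q(2,3,4)] by (rule act_holomorphic[OF c(1) c(1) q(3,4)])
  qed
  have "Dir (\<xi>, 0) (\<lambda>y. Dir (0, J u) (Act b0 c c) y) (snd b0 unit, z) = Dir (\<xi>, 0) (\<lambda>y. J (Dir (0, u) (Act b0 c c) y)) (snd b0 unit, z)"
    using frechet_derivative_cong_open[OF Act_smooth(1)[OF b0(1) c(1) c(1)] zD J] by simp
  also have "\<dots> = J (Dir (\<xi>, 0) (\<lambda>y. Dir (0, u) (Act b0 c c) y) (snd b0 unit, z))"
    using frechet_derivative_eq[OF bounded_linear.has_derivative[OF bounded_linear_J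
        has_derivative_frechet[OF Act_Dir_differentiable(1)[OF b0(1) c(1) c(1) zD]]]] by simp
  finally show ?thesis unfolding Xf_Dir[OF c] .
qed

text \<open>The pulled back metric does not depend on \<open>g\<close>; differentiating it at the
  identity gives a vanishing Lie derivative, which metric compatibility and symmetry of
  \<open>\<Gamma>\<close> turn into Killing's equation.\<close>

lemma Xf_killing:
  assumes c: "c \<in> A" "z \<in> snd c ` fst c"
  shows "metric \<omega> c z (Dir u (Xf c \<xi>) z + christoffel (metric \<omega>) c z u (Xf c \<xi> z)) v
     + metric \<omega> c z u (Dir v (Xf c \<xi>) z + christoffel (metric \<omega>) c z v (Xf c \<xi> z)) = 0"
proof -
  interpret kahler_chart \<omega> c "snd c ` fst c" using kahler_chart_at c by blast
  note zD = base_ActD[OF c]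
  let ?\<Phi> = "Act b0 c c" and ?x0 = "snd b0 unit"
  define T where "T = (\<lambda>x. (x, z)) -` ActD b0 c c"
  have oT: "open T" unfolding T_def
    by (rule open_vimage[OF Act_smooth(1)[OF b0(1) c(1) c(1)]]) (intro continuous_intros)
  have x0T: "?x0 \<in> T" using zD by (simp add: T_def)
  have iso: "?\<Phi> (x, z) \<in> snd c ` fst c \<and> g (?\<Phi> (x, z)) (Dir (0, u) ?\<Phi> (x, z)) (Dir (0, v) ?\<Phi> (x, z)) = g z u v"
    if x: "x \<in> T" for x u v
  proof -
    have "(x, z) \<in> ActD b0 c c" using x by (simp add: T_def)
    then obtain h q where q: "(x, z) = (snd b0 h, snd c q)" "h \<in> fst b0" "q \<in> fst c" "\<phi> h q \<in> fst c"
      using ActD_E by blast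
    have zq: "z = snd c q" using q(1) by simp
    show ?thesis
      unfolding q(1) Act_Dir2[OF b0(1) c(1) c(1) q(2,3,4)] Act_eq[OF b0(1) c(1) q(2,3)]
      using act_isometry[OF c(1) c(1) q(3,4), of u v] q(4) zq by simp
  qed
  obtain q where q: "q \<in> fst c" "z = snd c q" using c(2) by blast
  have \<Phi>0: "?\<Phi> (?x0, z) = z" using Act_eq[OF b0(1) c(1) b0(2) q(1), of c] by (simp add: q(2) act_one)
  have D0: "Dir (0, w) ?\<Phi> (?x0, z) = w" for w
  proof -
    have e: "\<phi> unit = id" by (rule ext) (simp add: act_one)
    have "differential c c (\<phi> unit) q w = w"
      unfolding e using mdiff_differential[OF id_mdiff[OF c(1) q(1)]] by simp
    then show ?thesis using Act_Dir2[OF b0(1) c(1) c(1) b0(2) q(1), of w] q(1) by (simp add: q(2) act_one)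
  qed
  have inc: "((\<lambda>x::'e. (x, z)) has_derivative (\<lambda>v. (v, 0))) (at ?x0)"
    by (intro has_derivative_Pair has_derivative_const has_derivative_ident)
  have d\<Phi>: "((\<lambda>x. ?\<Phi> (x, z)) has_derivative (\<lambda>\<eta>. Dir (\<eta>, 0) ?\<Phi> (?x0, z))) (at ?x0)"
    using diff_chain_at[OF inc has_derivative_frechet[OF Act_Dir_differentiable(2)[OF b0(1) c(1) c(1) zD]]] by (simp add: o_def)
  have B': "((\<lambda>x. g (?\<Phi> (x, z)) p r) has_derivative (\<lambda>\<eta>. dg z (Dir (\<eta>, 0) ?\<Phi> (?x0, z)) p r)) (at ?x0)" for p r
    using diff_chain_at[OF d\<Phi>, of "\<lambda>y. g y p r"] has_derivative_frechet[OF g_diff[OF c(2)]] by (simp add: o_def \<Phi>0)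
  have a: "((\<lambda>x. Dir (0, w) ?\<Phi> (x, z)) has_derivative (\<lambda>\<eta>. Dir (\<eta>, 0) (\<lambda>y. Dir (0, w) ?\<Phi> y) (?x0, z))) (at ?x0)" for w
    using diff_chain_at[OF inc has_derivative_frechet[OF Act_Dir_differentiable(1)[OF b0(1) c(1) c(1) zD]]] by (simp add: o_def)
  have 1: "((\<lambda>x. g (?\<Phi> (x, z)) (Dir (0, u) ?\<Phi> (x, z)) (Dir (0, v) ?\<Phi> (x, z))) has_derivative
     (\<lambda>\<eta>. dg z (Dir (\<eta>, 0) ?\<Phi> (?x0, z)) (Dir (0, u) ?\<Phi> (?x0, z)) (Dir (0, v) ?\<Phi> (?x0, z))
        + g (?\<Phi> (?x0, z)) (Dir (\<eta>, 0) (\<lambda>y. Dir (0, u) ?\<Phi> y) (?x0, z)) (Dir (0, v) ?\<Phi> (?x0, z))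
        + g (?\<Phi> (?x0, z)) (Dir (0, u) ?\<Phi> (?x0, z)) (Dir (\<eta>, 0) (\<lambda>y. Dir (0, v) ?\<Phi> y) (?x0, z)))) (at ?x0)"
    by (rule has_derivative_bilinear_section[OF oT x0T _ B' a a]) (use iso bil_g in blast)
  have 2: "((\<lambda>x. g (?\<Phi> (x, z)) (Dir (0, u) ?\<Phi> (x, z)) (Dir (0, v) ?\<Phi> (x, z))) has_derivative (\<lambda>\<eta>. 0)) (at ?x0)"
    by (rule has_derivative_transform_within_open[OF has_derivative_const oT x0T]) (use iso in simp)
  have "dg z (Xf c \<xi> z) u v + g z (Dir u (Xf c \<xi>) z) v + g z u (Dir v (Xf c \<xi>) z) = 0"
    using fun_cong[OF has_derivative_unique[OF 1 2], of \<xi>] unfolding D0 \<Phi>0 Xf_Dir[OF c, symmetric] Xf_Act[OF c, symmetric] .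
  then show ?thesis
    by (simp add: metric_compatible[OF c(2)] bilinear_ladd[OF bil_g[OF c(2)]] bilinear_radd[OF bil_g[OF c(2)]]
      \<Gamma>_sym[OF c(2), of "Xf c \<xi> z"])
qed

lemma kahler_frame_Xf:
  assumes c: "c \<in> A" and U: "open U" "U \<subseteq> snd c ` fst c"
    and ind: "\<And>z. z \<in> U \<Longrightarrow> det (frame_matrix (\<lambda>j. Xf c (\<xi> j) z)) \<noteq> 0"
  shows "kahler_frame \<omega> c (snd c ` fst c) (\<lambda>j. Xf c (\<xi> j)) U"
proof -
  interpret kahler_chart \<omega> c "snd c ` fst c" using kahler_chart_at c by blast
  show ?thesis
    by unfold_locales
      (use U ind Xf_holomorphic[OF c] smooth_onD[OF smooth_on_subset[OF Xf_smooth[OF c] U(2)]] in auto)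
qed

subsection \<open>The volume of the orbits\<close>

abbreviation hg where "hg \<equiv> kahler_chart.hgram \<omega>"

lemma hgram_isometry:
  assumes c: "c \<in> A" "d \<in> A"
    and iso: "\<And>u v. metric \<omega> d z' (D u) (D v) = metric \<omega> c z u v" and J: "\<And>v. D (J v) = J (D v)"
  shows "hg d z' (\<lambda>j. D (X j)) = hg c z X"
proof -
  interpret a: kahler_chart \<omega> c "snd c ` fst c" using kahler_chart_at c by blast
  interpret b: kahler_chart \<omega> d "snd d ` fst d" using kahler_chart_at c by blast
  show ?thesis unfolding a.hgram_def b.hgram_def a.herm_def b.herm_def iso J[symmetric] ..
qed

text \<open>The function \<open>N\<close> of the overview evaluated in the chart \<open>c\<close>;
  by \<open>volc_chart\<close> the choice of the chart is immaterial.\<close>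

definition volc where "volc \<xi> c p = norm (det (hg c (snd c p) (\<lambda>j. fld c p (\<xi> j))))"

lemma volc_act:
  assumes c: "c \<in> A" "d \<in> A" "p \<in> fst c" "\<phi> g p \<in> fst d"
  shows "volc \<xi> d (\<phi> g p) = volc (\<lambda>j. Ad g (\<xi> j)) c p"
  unfolding volc_def fld_act[OF c]
  by (subst hgram_isometry[OF c(1,2) act_isometry[OF c] act_holomorphic[OF c]]) simp

lemma volc_chart:
  assumes c: "c \<in> A" "d \<in> A" "p \<in> fst c" "p \<in> fst d"
  shows "volc \<xi> d p = volc \<xi> c p"
proof -
  have J: "differential c d id p (J v) = J (differential c d id p v)" for v
    by (rule complex_atlas_id(2)[OF complexA c])
  have "\<omega> d (snd d p) (differential c d id p u) (differential c d id p v) = \<omega> c (snd c p) u v" for u v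
  proof -
    have "preserves A \<omega> id" using kahler unfolding kahler_form_def by blast
    moreover have "p \<in> fst c \<inter> id -` fst d" using c by simp
    ultimately have "\<omega> d (snd d (id p)) (differential c d id p u) (differential c d id p v) = \<omega> c (snd c p) u v"
      unfolding preserves_def using c(1,2) by blast
    then show ?thesis by simp
  qed
  then have "metric \<omega> d (snd d p) (differential c d id p u) (differential c d id p v) = metric \<omega> c (snd c p) u v" for u v
    unfolding metric_def J[symmetric] by blast
  from hgram_isometry[OF c(1,2) this J] show ?thesis
    unfolding volc_def fld_chart[OF c] by simp
qed

definition vol where "vol \<xi> p = volc \<xi> (SOME c. c \<in> A \<and> p \<in> fst c) p"

lemma vol_eq: assumes c: "c \<in> A" "p \<in> fst c" shows "vol \<xi> p = volc \<xi> c p"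
proof -
  let ?d = "SOME c. c \<in> A \<and> p \<in> fst c"
  have "?d \<in> A \<and> p \<in> fst ?d" by (rule someI[of _ c]) (use c in blast)
  then show ?thesis unfolding vol_def using volc_chart[OF c(1) _ c(2)] by blast
qed

lemma vol_act: "c \<in> A \<Longrightarrow> p \<in> fst c \<Longrightarrow> vol \<xi> (\<phi> g p) = volc (\<lambda>j. Ad g (\<xi> j)) c p"
proof -
  assume c: "c \<in> A" "p \<in> fst c"
  obtain d where d: "d \<in> A" "\<phi> g p \<in> fst d" using chart_at[OF atlasA] by metis
  show ?thesis unfolding vol_eq[OF d] by (rule volc_act[OF c(1) d(1) c(2) d(2)])
qed

lemma volc_combination:
  assumes c: "c \<in> A" "p \<in> fst c"
    and X: "\<And>j. fld c p (\<xi>' j) = (\<Sum>k\<in>UNIV. a j k *\<^sub>R fld c p (\<xi> k))"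
  shows "volc \<xi>' c p = (norm (det (\<chi> k j. complex_of_real (a j k)) :: complex))\<^sup>2 * volc \<xi> c p"
proof -
  interpret kahler_chart \<omega> c "snd c ` fst c" using kahler_chart_at c by blast
  have z: "snd c p \<in> snd c ` fst c" using c by blast
  have "frame_matrix (\<lambda>j. fld c p (\<xi>' j)) = frame_matrix (\<lambda>j. fld c p (\<xi> j)) ** (\<chi> k j. complex_of_real (a j k))"
  proof -
    have "fld c p (\<xi>' j) $ i = (\<Sum>k\<in>UNIV. fld c p (\<xi> k) $ i * complex_of_real (a j k))" for i j
      unfolding X sum_component vector_scaleR_component
      by (simp add: scaleR_conv_of_real[where 'a = complex] mult.commute)
    then show ?thesis by (simp add: frame_matrix_def matrix_matrix_mult_def vec_eq_iff)
  qed
  then have "det (frame_matrix (\<lambda>j. fld c p (\<xi>' j))) = det (frame_matrix (\<lambda>j. fld c p (\<xi> j))) * det (\<chi> k j. complex_of_real (a j k))"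
    by (simp add: det_mul)
  then show ?thesis unfolding volc_def det_hgram[OF z] by (simp add: norm_mult power2_eq_square)
qed

lemma volc_nz:
  assumes c: "c \<in> A" "p \<in> fst c"
  shows "volc \<xi> c p \<noteq> 0 \<longleftrightarrow> det (frame_matrix (\<lambda>j. fld c p (\<xi> j))) \<noteq> 0"
proof -
  interpret kahler_chart \<omega> c "snd c ` fst c" using kahler_chart_at c by blast
  have z: "snd c p \<in> snd c ` fst c" using c by blast
  show ?thesis unfolding volc_def using det_hgram_nz[OF z] by simp
qed

lemma det_continuous: "(\<And>i j. continuous_on S (\<lambda>x. M x $ i $ j)) \<Longrightarrow> continuous_on S (\<lambda>x. det (M x :: complex^'k^'k))"
  unfolding det_def by (intro continuous_on_sum continuous_on_mult continuous_on_prod continuous_on_const)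

lemma Xf_cont: "c \<in> A \<Longrightarrow> continuous_on (snd c ` fst c) (Xf c \<xi>)"
  using smooth_onD[OF Xf_smooth, of c 0] by simp

lemma vol_cont: "continuous_on UNIV (vol \<xi>)"
proof (rule continuous_at_imp_continuous_on, rule ballI)
  fix p :: 'm
  obtain c where c: "c \<in> A" "p \<in> fst c" "is_chart c" using chart_at[OF atlasA] by metis
  interpret kahler_chart \<omega> c "snd c ` fst c" using kahler_chart_at c by blast
  let ?S = "snd c ` fst c"
  have "continuous_on ?S (\<lambda>z. hgram z (\<lambda>j. Xf c (\<xi> j) z) $ j $ k)" for j k
  proof (rule continuous_at_imp_continuous_on, rule ballI)
    fix z assume z: "z \<in> ?S"
    have X: "((\<lambda>z. Xf c (\<xi> j) z) has_derivative frechet_derivative (Xf c (\<xi> j)) (at z)) (at z)" for j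
      using has_derivative_frechet[OF smooth_on_differentiable[OF Xf_smooth[OF c(1)] z]] .
    have "isCont (\<lambda>y. g y (Xf c (\<xi> j) y) (Xf c (\<xi> k) y)) z"
      by (rule has_derivative_continuous[OF has_derivative_bilinear_section[OF openS z bil_g has_derivative_frechet[OF g_diff[OF z]] X X]])
    moreover have "isCont (\<lambda>y. g y (Xf c (\<xi> j) y) (J (Xf c (\<xi> k) y))) z"
      by (rule has_derivative_continuous[OF has_derivative_bilinear_section[OF openS z bil_g has_derivative_frechet[OF g_diff[OF z]] X
        bounded_linear.has_derivative[OF bounded_linear_J X]]])
    ultimately show "isCont (\<lambda>z. hgram z (\<lambda>j. Xf c (\<xi> j) z) $ j $ k) z"
      unfolding hgram_def herm_def by (simp del: vector_smult_component)
  qed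
  then have "continuous_on ?S (\<lambda>z. norm (det (hgram z (\<lambda>j. Xf c (\<xi> j) z))))"
    by (intro continuous_on_norm det_continuous)
  then have "continuous_on (fst c) (\<lambda>q. norm (det (hgram (snd c q) (\<lambda>j. Xf c (\<xi> j) (snd c q)))))"
    by (rule continuous_on_compose2[OF _ chart_continuous[OF c(3)]]) auto
  then have "continuous_on (fst c) (vol \<xi>)"
    by (rule continuous_on_eq) (simp add: vol_eq[OF c(1)] volc_def Xf_def cinv_chart[OF c(3)])
  then show "isCont (vol \<xi>) p" using continuous_on_eq_continuous_at[OF chart_open(1)[OF c(3)]] c(2) by blast
qed

end

section \<open>A Lagrangian orbit of maximal volume\<close>

lemma linear_smult: "linear (\<lambda>u :: complex^'n. a *s u)"
  by (rule linearI) (simp_all add: vec_eq_iff algebra_simps)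

lemma bounded_linear_smult: "bounded_linear (\<lambda>u :: complex^'n. a *s u)"
  using linear_smult linear_conv_bounded_linear by blast

definition fcomb :: "('n \<Rightarrow> complex^'n) \<Rightarrow> complex^'n \<Rightarrow> complex^'n" where
  "fcomb X v = (\<Sum>j\<in>UNIV. v $ j *s X j)"

lemma fcomb_matrix: "frame_matrix X *v v = fcomb X v"
  by (simp add: frame_matrix_def fcomb_def matrix_vector_mult_def vec_eq_iff mult.commute)

lemma fcomb_linear: "linear (fcomb X)"
  unfolding fcomb_def by (rule linearI) (simp_all add: vec_eq_iff algebra_simps sum.distrib scaleR_sum_right sum_distrib_left)

lemma fcomb_J: "fcomb X (J v) = J (fcomb X v)"
  by (simp add: fcomb_def vec_eq_iff sum_distrib_left algebra_simps)

lemma fcomb_J': "fcomb (\<lambda>j. J (X j)) v = J (fcomb X v)"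
  by (simp add: fcomb_def vec_eq_iff sum_distrib_left algebra_simps)

lemma fcomb_inj:
  assumes "det (frame_matrix X) \<noteq> 0" shows "inj (fcomb X)"
proof (rule linear_injective_0[THEN iffD2, OF fcomb_linear], intro allI impI)
  fix v assume "fcomb X v = 0"
  then have "frame_matrix X *v v = 0" by (simp add: fcomb_matrix)
  moreover have "\<exists>B. B ** frame_matrix X = mat 1"
    using assms invertible_det_nz invertible_left_inverse by blast
  ultimately show "v = 0" by (auto simp: matrix_left_invertible_ker)
qed

lemma det_frame_nz:
  assumes "\<And>v. fcomb X v = 0 \<Longrightarrow> v = 0" shows "det (frame_matrix X) \<noteq> 0"
proof -
  have "\<exists>B. B ** frame_matrix X = mat 1"
    unfolding matrix_left_invertible_ker fcomb_matrix using assms by blast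
  then show ?thesis using invertible_det_nz invertible_left_inverse by blast
qed

lemma fcomb_re_im:
  "fcomb X v = (\<Sum>j\<in>UNIV. Re (v $ j) *\<^sub>R X j) + J (\<Sum>j\<in>UNIV. Im (v $ j) *\<^sub>R X j)"
proof -
  have "fcomb X v = (\<Sum>j\<in>UNIV. Re (v $ j) *\<^sub>R X j + J (Im (v $ j) *\<^sub>R X j))"
    unfolding fcomb_def by (intro sum.cong refl) (simp add: vec_eq_iff complex_eq_iff)
  also have "\<dots> = (\<Sum>j\<in>UNIV. Re (v $ j) *\<^sub>R X j) + J (\<Sum>j\<in>UNIV. Im (v $ j) *\<^sub>R X j)"
    unfolding sum.distrib linear_sum[OF linear_J] ..
  finally show ?thesis .
qed

lemma linear_axis_expansion:
  fixes L :: "real^'n \<Rightarrow> 'b::real_vector"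
  assumes "linear L" shows "L x = (\<Sum>j\<in>UNIV. x $ j *\<^sub>R L (axis j 1))"
proof -
  have "L x = L (\<Sum>j\<in>UNIV. x $ j *\<^sub>R axis j 1)"
    by (simp add: basis_expansion[where 'a = real, unfolded scalar_mult_eq_scaleR])
  then show ?thesis using assms by (simp add: linear_sum linear_scale)
qed

text \<open>A complex relation among vectors of \<open>T\<close> reads \<open>a + J b = 0\<close>
  with \<open>a\<close> and \<open>b\<close> in \<open>T\<close>; total reality forces both to
  vanish, which leaves two real relations.\<close>

lemma det_frame_totally_real:
  assumes T: "subspace T" "T \<inter> J ` T = {0}" and Y: "\<And>j. Y j \<in> T"
    and ind: "\<And>x::real^'n. (\<Sum>j\<in>UNIV. x $ j *\<^sub>R Y j) = 0 \<Longrightarrow> x = 0"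
  shows "det (frame_matrix Y) \<noteq> 0"
proof (rule det_frame_nz)
  fix v assume v: "fcomb Y v = 0"
  define x :: "real^'n" where "x = (\<chi> j. Re (v $ j))"
  define y :: "real^'n" where "y = (\<chi> j. Im (v $ j))"
  define a where "a = (\<Sum>j\<in>UNIV. x $ j *\<^sub>R Y j)"
  define b where "b = (\<Sum>j\<in>UNIV. y $ j *\<^sub>R Y j)"
  have ab: "a + J b = 0" using v unfolding fcomb_re_im by (simp add: a_def b_def x_def y_def)
  have aT: "a \<in> T" and bT: "b \<in> T" unfolding a_def b_def by (intro subspace_sum[OF T(1)] subspace_scale[OF T(1)] Y)+
  have "a = J (- b)" using ab by (simp add: J_minus add_eq_0_iff)
  moreover have "- b \<in> T" using bT T(1) by (simp add: subspace_neg)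
  ultimately have "a \<in> T \<inter> J ` T" using aT by blast
  then have a0: "a = 0" using T(2) by blast
  then have "J (J b) = J 0" using ab by simp
  then have b0: "b = 0" by (simp add: J_J J_zero)
  have "x = 0" "y = 0" using ind[of x] ind[of y] a0 b0 by (simp_all add: a_def b_def)
  then show "v = 0" by (simp add: x_def y_def vec_eq_iff complex_eq_iff)
qed

section \<open>Constant coefficients between fundamental fields\<close>

locale generic_action = kahler_action A G B \<phi> \<omega> \<kappa>
  for A :: "('m::t2_space, complex^'n) chart set"
    and G :: "('g::t2_space) monoid" and B :: "('g, 'e::euclidean_space) chart set"
    and \<phi> :: "'g \<Rightarrow> 'm \<Rightarrow> 'm" and \<omega> \<kappa> +
  fixes U0 :: "'m set"
  assumes denseU0: "closure U0 = UNIV"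
    and generic_totally_real: "\<And>p. p \<in> U0 \<Longrightarrow> totally_real A (orbit G \<phi> p)"
begin

lemma generic_real:
  assumes "p \<in> U0" "c \<in> A" "p \<in> fst c"
  shows "{u + J v | u v. u \<in> range (fld c p) \<and> v \<in> range (fld c p)} = UNIV"
    "range (fld c p) \<inter> J ` range (fld c p) = {0}"
proof -
  have "p \<in> orbit G \<phi> p \<inter> fst c" using orbit_self assms(3) by blast
  then have "{u + J v | u v. u \<in> tangent_space c (orbit G \<phi> p) p \<and> v \<in> tangent_space c (orbit G \<phi> p) p} = UNIV \<and>
        tangent_space c (orbit G \<phi> p) p \<inter> J ` tangent_space c (orbit G \<phi> p) p = {0}"
    using generic_totally_real[OF assms(1)] assms(2) unfolding totally_real_def by blast
  then show "{u + J v | u v. u \<in> range (fld c p) \<and> v \<in> range (fld c p)} = UNIV"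
    "range (fld c p) \<inter> J ` range (fld c p) = {0}"
    unfolding tangent_space_orbit[OF assms(2,3)] by blast+
qed

text \<open>At a generic point the orbit directions \<open>T\<close> and \<open>J T\<close> are
  complementary, so \<open>T\<close> has real dimension \<open>n\<close> and a real basis of
  \<open>T\<close> is complex independent.\<close>

lemma exists_frame: "\<exists>\<xi> p. vol \<xi> p \<noteq> 0"
proof -
  obtain p where p: "p \<in> U0" using denseU0 by fastforce
  obtain c where c: "c \<in> A" "p \<in> fst c" using chart_at[OF atlasA] by metis
  define T where "T = range (fld c p)"
  have lf: "linear (fld c p)" by (rule fld_linear[OF c])
  have sT: "subspace T" unfolding T_def by (rule linear_subspace_image[OF lf subspace_UNIV])
  have sJT: "subspace (J ` T)" by (rule linear_subspace_image[OF linear_J sT])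
  have injJ: "inj_on (J :: complex^'n \<Rightarrow> complex^'n) X" for X
    by (rule inj_on_inverseI[of _ "\<lambda>v. - J v"]) (simp add: J_J)
  have dJT: "dim (J ` T) = dim T" using dim_image_eq[OF linear_J injJ] by blast
  have "{u + w | u w. u \<in> T \<and> w \<in> J ` T} = UNIV" using generic_real(1)[OF p c] unfolding T_def by (force simp: set_eq_iff)
  then have "dim (UNIV :: (complex^'n) set) + dim (T \<inter> J ` T) = dim T + dim (J ` T)"
    using dim_sums_Int[OF sT sJT] by simp
  moreover have "T \<inter> J ` T = {0}" using generic_real(2)[OF p c] unfolding T_def .
  ultimately have "dim T = CARD('n)" by (simp add: dJT)
  then have "dim (UNIV :: (real^'n) set) = dim T" by simp
  then obtain L :: "real^'n \<Rightarrow> complex^'n" where L: "linear L" "L ` UNIV = T" "inj L"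
    using subspace_isomorphism[OF subspace_UNIV sT] by metis
  have "\<forall>j. \<exists>\<xi>. fld c p \<xi> = L (axis j 1)" using L(2) unfolding T_def by (metis rangeE rangeI)
  then obtain \<xi> where \<xi>: "\<And>j. fld c p (\<xi> j) = L (axis j 1)" by metis
  have "det (frame_matrix (\<lambda>j. fld c p (\<xi> j))) \<noteq> 0"
  proof (rule det_frame_totally_real[OF sT \<open>T \<inter> J ` T = {0}\<close>])
    show "fld c p (\<xi> j) \<in> T" for j by (simp add: T_def)
    fix x :: "real^'n" assume "(\<Sum>j\<in>UNIV. x $ j *\<^sub>R fld c p (\<xi> j)) = 0"
    then have "L x = L 0" unfolding \<xi> linear_axis_expansion[OF L(1), symmetric] by (simp add: linear_0[OF L(1)])
    then show "x = 0" by (rule injD[OF L(3)])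
  qed
  then show ?thesis using volc_nz[OF c] vol_eq[OF c] by metis
qed

text \<open>The coefficients are holomorphic, and real on a dense set, hence constant.\<close>

lemma local_coefficients:
  assumes c: "c \<in> A" and V: "open V" "connected V" "V \<subseteq> snd c ` fst c"
    and ind: "\<And>z. z \<in> V \<Longrightarrow> det (frame_matrix (\<lambda>j. Xf c (\<xi> j) z)) \<noteq> 0"
  shows "\<exists>a. \<forall>z\<in>V. Xf c \<eta> z = (\<Sum>j\<in>UNIV. a j *\<^sub>R Xf c (\<xi> j) z)"
proof -
  have cc: "is_chart c" by (rule chartA[OF c])
  define X where "X z = (\<lambda>j. Xf c (\<xi> j) z)" for z
  define a where "a z = matrix_inv (frame_matrix (X z)) *v Xf c \<eta> z" for z
  have inj: "inj (fcomb (X z))" if "z \<in> V" for z unfolding X_def by (rule fcomb_inj[OF ind[OF that]])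
  have a: "fcomb (X z) (a z) = Xf c \<eta> z" if "z \<in> V" for z
  proof -
    have "frame_matrix (X z) ** matrix_inv (frame_matrix (X z)) = mat 1"
      using matrix_inv_works(2)[of "frame_matrix (X z)"] invertible_det_nz ind[OF that] unfolding X_def by blast
    then show ?thesis by (simp add: a_def fcomb_matrix[symmetric] matrix_vector_mul_assoc)
  qed
  have dX: "(Xf c \<zeta> has_derivative (\<lambda>h. Dir h (Xf c \<zeta>) z)) (at z)" if "z \<in> V" for z \<zeta>
    using has_derivative_frechet[OF smooth_on_differentiable[OF Xf_smooth[OF c]]] that V(3) by blast
  define X' where "X' z h = (\<lambda>j. Dir h (Xf c (\<xi> j)) z)" for z h
  have dcomb: "((\<lambda>z. fcomb (X z) v) has_derivative (\<lambda>h. fcomb (X' z h) v)) (at z)" if "z \<in> V" for z v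
    unfolding fcomb_def X_def X'_def
    by (intro has_derivative_sum bounded_linear.has_derivative[OF bounded_linear_smult] dX that)
  have da: "a differentiable (at z)" if "z \<in> V" for z
    by (rule differentiable_linear_solution[where G = "\<lambda>z. fcomb (X z)" and K = "Xf c \<eta>", OF V(1) that fcomb_linear])
      (use dcomb[OF that] dX[OF that] inj[OF that] a in \<open>auto simp: differentiable_def\<close>)
  have conta: "continuous_on V a"
    using da by (auto intro!: continuous_at_imp_continuous_on differentiable_imp_continuous_within)
  have X'J: "X' z (J h) = (\<lambda>j. J (X' z h j))" if "z \<in> V" for z h
    unfolding X'_def using Xf_holomorphic[OF c] that V(3) by (intro ext) blast
  \<comment> \<open>Cauchy-Riemann equations for \<open>a\<close>: differentiate
    \<open>fcomb (X z) (a z) = Xf c \<eta> z\<close>, whose frame and right-hand side are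
    holomorphic, and use that \<open>fcomb (X z)\<close> is injective and complex linear.\<close>
  have aJ: "Dir (J h) a z = J (Dir h a z)" if z: "z \<in> V" for z h
  proof -
    have 1: "((\<lambda>z. fcomb (X z) (a z)) has_derivative (\<lambda>h. fcomb (X' z h) (a z) + fcomb (X z) (Dir h a z))) (at z)"
      by (rule has_derivative_linear_section[OF V(1) z fcomb_linear dcomb[OF z] has_derivative_frechet[OF da[OF z]]])
    have 2: "((\<lambda>z. fcomb (X z) (a z)) has_derivative (\<lambda>h. Dir h (Xf c \<eta>) z)) (at z)"
      by (rule has_derivative_transform_within_open[OF dX[OF z] V(1) z]) (simp add: a)
    have e: "fcomb (X' z h) (a z) + fcomb (X z) (Dir h a z) = Dir h (Xf c \<eta>) z" for h
      using fun_cong[OF has_derivative_unique[OF 1 2], of h] .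
    have zS: "z \<in> snd c ` fst c" using z V(3) by blast
    have s1: "fcomb (X z) (Dir (J h) a z) = Dir (J h) (Xf c \<eta>) z - fcomb (X' z (J h)) (a z)"
      using e[of "J h"] by (simp add: algebra_simps)
    have s2: "Dir (J h) (Xf c \<eta>) z - fcomb (X' z (J h)) (a z) = J (Dir h (Xf c \<eta>) z - fcomb (X' z h) (a z))"
      unfolding Xf_holomorphic[OF c zS] X'J[OF z] fcomb_J' J_diff ..
    have s3: "Dir h (Xf c \<eta>) z - fcomb (X' z h) (a z) = fcomb (X z) (Dir h a z)"
      unfolding e[of h, symmetric] by simp
    have "fcomb (X z) (Dir (J h) a z) = fcomb (X z) (J (Dir h a z))"
      unfolding s1 s2 s3 by (rule fcomb_J[symmetric])
    then show ?thesis by (rule injD[OF inj[OF z]])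
  qed
  \<comment> \<open>The imaginary part of the combination, multiplied by \<open>J\<close>, is a
    difference of two vectors tangent to the orbit, hence lies in the intersection of the tangent
    space with its image under \<open>J\<close>.\<close>
  have real_generic: "Im (a z $ j) = 0" if z: "z \<in> V" "cinv c z \<in> U0" for z j
  proof -
    let ?q = "cinv c z"
    have q: "?q \<in> fst c" by (rule cinv_dom) (use z V(3) in blast)
    have lf: "linear (fld c ?q)" by (rule fld_linear[OF c q])
    have s: "subspace (range (fld c ?q))" by (rule linear_subspace_image[OF lf subspace_UNIV])
    have inr: "(\<Sum>j\<in>UNIV. b j *\<^sub>R Xf c (\<xi> j) z) \<in> range (fld c ?q)" for b
      unfolding Xf_def by (intro subspace_sum[OF s] subspace_scale[OF s] rangeI)
    define Y where "Y = (\<Sum>j\<in>UNIV. Im (a z $ j) *\<^sub>R Xf c (\<xi> j) z)"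
    have "J Y = Xf c \<eta> z - (\<Sum>j\<in>UNIV. Re (a z $ j) *\<^sub>R Xf c (\<xi> j) z)"
      using a[OF z(1)] unfolding fcomb_re_im X_def Y_def by (simp add: algebra_simps)
    moreover have "Xf c \<eta> z \<in> range (fld c ?q)" by (simp add: Xf_def)
    ultimately have "J Y \<in> range (fld c ?q)" using s inr[of "\<lambda>j. Re (a z $ j)"] by (simp add: subspace_diff)
    moreover have "J Y \<in> J ` range (fld c ?q)" using inr[of "\<lambda>j. Im (a z $ j)"] unfolding Y_def by blast
    ultimately have "J Y = 0" using generic_real(2)[OF z(2) c q] by blast
    then have "J (J Y) = J 0" by simp
    then have Y0: "Y = 0" by (simp add: J_J J_zero)
    define y :: "complex^'n" where "y = (\<chi> j. of_real (Im (a z $ j)))"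
    have "fcomb (X z) y = 0" unfolding fcomb_re_im using Y0 by (simp add: y_def X_def Y_def J_zero)
    then have "y = 0" using injD[OF inj[OF z(1)], of y 0] linear_0[OF fcomb_linear, of "X z"] by argo
    then show ?thesis by (simp add: y_def vec_eq_iff)
  qed
  have real: "Im (a z $ j) = 0" if z: "z \<in> V" for z j
  proof (rule ccontr)
    assume ne: "Im (a z $ j) \<noteq> 0"
    have cIm: "continuous_on V (\<lambda>z. Im (a z $ j))" by (intro continuous_intros conta)
    define V' where "V' = V \<inter> (\<lambda>z. Im (a z $ j)) -` (- {0})"
    have oV': "open V'" unfolding V'_def
      by (rule continuous_open_preimage[OF cIm V(1)]) (simp add: open_Compl)
    \<comment> \<open>A nonreal coefficient would persist on an open subset of the manifold, which
      meets the dense set \<open>U0\<close>.\<close>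
    define W where "W = fst c \<inter> snd c -` V'"
    have oW: "open W" unfolding W_def by (rule continuous_open_preimage[OF chart_continuous[OF cc] chart_open(1)[OF cc] oV'])
    have zS: "z \<in> snd c ` fst c" using z V(3) by blast
    have "cinv c z \<in> W" using zS z ne cinv_dom[OF zS] chart_cinv[OF zS] by (simp add: W_def V'_def)
    then have "W \<inter> U0 \<noteq> {}" using open_Int_closure_eq_empty[OF oW, of U0] denseU0 by auto
    then obtain q where q: "q \<in> W" "q \<in> U0" by blast
    then have "Im (a (snd c q) $ j) = 0" using real_generic[of "snd c q" j] cinv_chart[OF cc] by (auto simp: W_def V'_def)
    then show False using q by (simp add: W_def V'_def)
  qed
  have "(a has_derivative (\<lambda>h. 0)) (at z)" if z: "z \<in> V" for z
  proof -
    have D: "(a has_derivative (\<lambda>h. Dir h a z)) (at z)" by (rule has_derivative_frechet[OF da[OF z]])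
    have Im0: "Im (Dir h a z $ j) = 0" for h j
    proof -
      have 1: "((\<lambda>z. Im (a z $ j)) has_derivative (\<lambda>h. Im (Dir h a z $ j))) (at z)"
        by (intro bounded_linear.has_derivative[OF bounded_linear_Im] bounded_linear.has_derivative[OF bounded_linear_vec_nth] D)
      have 2: "((\<lambda>z. Im (a z $ j)) has_derivative (\<lambda>h. 0)) (at z)"
        by (rule has_derivative_transform_within_open[OF has_derivative_const V(1) z]) (simp add: real)
      show ?thesis using fun_cong[OF has_derivative_unique[OF 1 2], of h] .
    qed
    \<comment> \<open>The imaginary part of the derivative along \<open>J h\<close> is the real part
      of the derivative along \<open>h\<close>.\<close>
    have "Re (Dir h a z $ j) = 0" for h j using Im0[of "J h" j] unfolding aJ[OF z] by simp
    then have "Dir h a z = 0" for h using Im0 by (simp add: vec_eq_iff complex_eq_iff)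
    then show ?thesis using D by simp
  qed
  then have const: "a z = a z'" if "z \<in> V" "z' \<in> V" for z z'
    using has_derivative_zero_unique_connected[OF V(1,2)] that by metis
  show ?thesis
  proof (cases "V = {}")
    case True
    then show ?thesis by blast
  next
    case False
    then obtain z0 where z0: "z0 \<in> V" by blast
    show ?thesis
    proof (intro exI[of _ "\<lambda>j. Re (a z0 $ j)"] ballI)
      fix z assume z: "z \<in> V"
      have "Xf c \<eta> z = (\<Sum>j\<in>UNIV. Re (a z $ j) *\<^sub>R Xf c (\<xi> j) z) + J (\<Sum>j\<in>UNIV. Im (a z $ j) *\<^sub>R Xf c (\<xi> j) z)"
        using a[OF z] unfolding fcomb_re_im X_def by simp
      then show "Xf c \<eta> z = (\<Sum>j\<in>UNIV. Re (a z0 $ j) *\<^sub>R Xf c (\<xi> j) z)"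
        using const[OF z z0] real[OF z] by (simp add: J_zero)
    qed
  qed
qed

end

lemma real_comb:
  fixes X :: "'n \<Rightarrow> complex^'n" and x :: "real^'n"
  shows "(\<Sum>j\<in>UNIV. x $ j *\<^sub>R X j) = fcomb X (\<chi> j. of_real (x $ j))"
  unfolding fcomb_re_im by (simp add: J_zero)

lemma real_comb_linear: "linear (\<lambda>x::real^'n. \<Sum>j\<in>UNIV. x $ j *\<^sub>R (X j :: 'b::real_vector))"
  by (rule linearI) (simp_all add: scaleR_add_left sum.distrib scaleR_sum_right)

lemma real_comb_inj:
  assumes "det (frame_matrix X) \<noteq> 0"
  shows "inj (\<lambda>x::real^'n. \<Sum>j\<in>UNIV. x $ j *\<^sub>R X j)"
proof (rule linear_injective_0[THEN iffD2, OF real_comb_linear], intro allI impI)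
  fix x :: "real^'n" assume "(\<Sum>j\<in>UNIV. x $ j *\<^sub>R X j) = 0"
  then have "fcomb X (\<chi> j. of_real (x $ j)) = 0" unfolding real_comb .
  then have "(\<chi> j. complex_of_real (x $ j)) = 0"
    using fcomb_inj[OF assms] linear_0[OF fcomb_linear] by (metis injD)
  then show "x = 0" by (simp add: vec_eq_iff)
qed

section \<open>Critical points of the volume\<close>

context kahler_action begin

lemma form_act:
  assumes c: "c \<in> A" "d \<in> A" "p \<in> fst c" "\<phi> g p \<in> fst d"
  shows "\<omega> d (snd d (\<phi> g p)) (differential c d (\<phi> g) p u) (differential c d (\<phi> g) p v) = \<omega> c (snd c p) u v"
proof -
  interpret a: kahler_chart \<omega> c "snd c ` fst c" using kahler_chart_at c by blast
  interpret b: kahler_chart \<omega> d "snd d ` fst d" using kahler_chart_at c by blast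
  have z: "snd c p \<in> snd c ` fst c" "snd d (\<phi> g p) \<in> snd d ` fst d" using c by auto
  show ?thesis unfolding a.form_g[OF z(1)] b.form_g[OF z(2)] act_holomorphic[OF c, symmetric] act_isometry[OF c] ..
qed

lemma vol_pos: "vol \<xi> q \<ge> 0"
proof -
  obtain c where "c \<in> A" "q \<in> fst c" using chart_at[OF atlasA] by metis
  then show ?thesis by (simp add: vol_eq volc_def)
qed

lemma Act_base:
  assumes c: "c \<in> A" "q \<in> fst c"
  shows "Act b0 c c (snd b0 unit, snd c q) = snd c q"
    "((\<lambda>x. Act b0 c c (x, snd c q)) has_derivative (\<lambda>\<eta>. Xf c \<eta> (snd c q))) (at (snd b0 unit))"
proof -
  show "Act b0 c c (snd b0 unit, snd c q) = snd c q"
    using Act_eq[OF b0(1) c(1) b0(2) c(2), of c] by (simp add: act_one)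
  have z: "snd c q \<in> snd c ` fst c" using c by blast
  have inc: "((\<lambda>x::'e. (x, snd c q)) has_derivative (\<lambda>v. (v, 0))) (at (snd b0 unit))"
    by (intro has_derivative_Pair has_derivative_const has_derivative_ident)
  show "((\<lambda>x. Act b0 c c (x, snd c q)) has_derivative (\<lambda>\<eta>. Xf c \<eta> (snd c q))) (at (snd b0 unit))"
    using diff_chain_at[OF inc has_derivative_frechet[OF Act_Dir_differentiable(2)[OF b0(1) c(1) c(1) base_ActD[OF c(1) z]]]]
    unfolding Xf_Act[OF c(1) z] by (simp add: o_def)
qed

lemma frame_neighbourhood:
  assumes d: "d \<in> A" "q \<in> fst d" and nz: "det (frame_matrix (\<lambda>j. fld d q (\<xi> j))) \<noteq> 0"
  obtains U where "open U" "snd d q \<in> U" "U \<subseteq> snd d ` fst d"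
    "\<And>z. z \<in> U \<Longrightarrow> det (frame_matrix (\<lambda>j. Xf d (\<xi> j) z)) \<noteq> 0"
proof -
  let ?S = "snd d ` fst d"
  have dd: "is_chart d" by (rule chartA[OF d(1)])
  have contD: "continuous_on ?S (\<lambda>z. det (frame_matrix (\<lambda>j. Xf d (\<xi> j) z)))"
    by (rule det_continuous) (simp add: frame_matrix_def, intro continuous_intros Xf_cont d)
  define U where "U = ?S \<inter> (\<lambda>z. det (frame_matrix (\<lambda>j. Xf d (\<xi> j) z))) -` (- {0})"
  have oU: "open U" unfolding U_def
    by (rule continuous_open_preimage[OF contD chart_open(2)[OF dd]]) (simp add: open_Compl)
  have "snd d q \<in> U" using d nz by (simp add: U_def Xf_def cinv_chart[OF dd])
  with oU show thesis by (rule that) (auto simp: U_def)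
qed

lemma \<beta>_zero_at_maximum:
  assumes fr: "kahler_frame \<omega> d (snd d ` fst d) (\<lambda>j. Xf d (\<xi> j)) U"
    and d: "d \<in> A" "q \<in> fst d" "snd d q \<in> U"
    and N: "open N" "q \<in> N" "\<And>y. y \<in> N \<Longrightarrow> vol \<xi> y \<le> vol \<xi> q"
  shows "kahler_frame.\<beta> \<omega> d (\<lambda>j. Xf d (\<xi> j)) (snd d q) w = 0"
proof -
  interpret kahler_frame \<omega> d "snd d ` fst d" "\<lambda>j. Xf d (\<xi> j)" U by (rule fr)
  have dd: "is_chart d" by (rule chartA[OF d(1)])
  define T where "T = U \<inter> snd d ` (fst d \<inter> N)"
  have oT: "open T" unfolding T_def using openU chart_open_image[OF dd N(1)] by blast
  have qT: "snd d q \<in> T" using d N by (auto simp: T_def)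
  have lv: "lnvol (snd d y) = ln (vol \<xi> y)" if "y \<in> fst d" for y
    using that by (simp add: lnvol_def vol_eq[OF d(1)] volc_def Xf_def cinv_chart[OF dd])
  have pos: "vol \<xi> y > 0" if y: "y \<in> fst d" "snd d y \<in> U" for y
  proof -
    have "vol \<xi> y \<noteq> 0" using indep[OF y(2)] volc_nz[OF d(1) y(1), of \<xi>] y(1)
      by (simp add: vol_eq[OF d(1)] Xf_def cinv_chart[OF dd])
    then show ?thesis using vol_pos[of \<xi> y] by simp
  qed
  have "\<forall>z\<in>T. lnvol z \<le> lnvol (snd d q)"
  proof
    fix z assume "z \<in> T"
    then obtain y where y: "z = snd d y" "y \<in> fst d" "y \<in> N" "snd d y \<in> U" by (auto simp: T_def)
    show "lnvol z \<le> lnvol (snd d q)"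
      unfolding y(1) lv[OF y(2)] lv[OF d(2)] using N(3)[OF y(3)] pos[OF y(2,4)] pos[OF d(2,3)] by simp
  qed
  then have "\<beta> (snd d q) = (\<lambda>v. 0)"
    using differential_zero_maxmin[OF qT oT lnvol_has_derivative[OF d(3)]] by blast
  then show ?thesis by simp
qed

end

text \<open>The domain is a ball because constancy of the coefficients requires a connected set on
  which the fields stay independent. The point \<open>p\<close> itself may lie outside
  \<open>U0\<close>.\<close>

locale max_point = generic_action A G B \<phi> \<omega> \<kappa> U0
  for A :: "('m::t2_space, complex^'n) chart set"
    and G :: "('g::t2_space) monoid" and B :: "('g, 'e::euclidean_space) chart set"
    and \<phi> :: "'g \<Rightarrow> 'm \<Rightarrow> 'm" and \<omega> \<kappa> U0 +
  fixes \<xi> :: "'n \<Rightarrow> 'e" and p c r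
  assumes c: "c \<in> A" "p \<in> fst c" and max: "\<And>q. vol \<xi> q \<le> vol \<xi> p"
    and r: "r > 0" "ball (snd c p) r \<subseteq> snd c ` fst c"
    and ind: "\<And>z. z \<in> ball (snd c p) r \<Longrightarrow> det (frame_matrix (\<lambda>j. Xf c (\<xi> j) z)) \<noteq> 0"

text \<open>Compactness gives a maximum, and its value is positive because \<open>vol\<close> does
  not vanish identically, so the frame is independent there.\<close>

lemma (in generic_action) exists_max_point:
  "\<exists>\<xi> p c r. max_point A G B \<phi> \<omega> \<kappa> U0 \<xi> p c r"
proof -
  obtain \<xi> q0 where q0: "vol \<xi> q0 \<noteq> 0" using exists_frame by blast
  obtain p where p: "\<And>q. vol \<xi> q \<le> vol \<xi> p"
    using continuous_attains_sup[OF compactM _ vol_cont[of \<xi>]] by auto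
  have "vol \<xi> p \<noteq> 0" using p[of q0] q0 vol_pos[of \<xi> q0] by linarith
  obtain c where c: "c \<in> A" "p \<in> fst c" using chart_at[OF atlasA] by metis
  have "det (frame_matrix (\<lambda>j. fld c p (\<xi> j))) \<noteq> 0"
    using volc_nz[OF c, of \<xi>] \<open>vol \<xi> p \<noteq> 0\<close> by (simp add: vol_eq[OF c])
  then obtain U where U: "open U" "snd c p \<in> U" "U \<subseteq> snd c ` fst c"
    "\<And>z. z \<in> U \<Longrightarrow> det (frame_matrix (\<lambda>j. Xf c (\<xi> j) z)) \<noteq> 0"
    by (rule frame_neighbourhood[OF c]) (rule that; assumption)
  obtain r where r: "r > 0" "ball (snd c p) r \<subseteq> U" using openE[OF U(1,2)] .
  have "max_point A G B \<phi> \<omega> \<kappa> U0 \<xi> p c r"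
    by unfold_locales (use c p r U(3,4) in blast)+
  then show ?thesis by blast
qed

section \<open>The orbit through a maximum of the volume\<close>

context max_point begin

abbreviation z0 where "z0 \<equiv> snd c p"
abbreviation V where "V \<equiv> ball z0 r"
abbreviation X where "X j \<equiv> Xf c (\<xi> j)"

lemma cc: "is_chart c" using chartA c by blast

lemma frame: "kahler_frame \<omega> c (snd c ` fst c) (\<lambda>j. X j) V"
  by (rule kahler_frame_Xf[OF c(1) open_ball r(2) ind])

sublocale fr: kahler_frame \<omega> c "snd c ` fst c" "\<lambda>j. X j" V by (rule frame)

definition W where "W = fst c \<inter> snd c -` V"

lemma open_W: "open W"
  unfolding W_def by (rule continuous_open_preimage[OF chart_continuous[OF cc] chart_open(1)[OF cc] open_ball])

lemma W: "q \<in> W \<Longrightarrow> q \<in> fst c" "q \<in> W \<Longrightarrow> snd c q \<in> V" and pW: "p \<in> W"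
  using c r by (auto simp: W_def)

lemma z0V: "z0 \<in> V" using r by simp

lemma X_fld: "q \<in> fst c \<Longrightarrow> Xf c \<eta> (snd c q) = fld c q \<eta>"
  by (simp add: Xf_def cinv_chart[OF cc])

lemma coefficients: "\<exists>a. \<forall>z\<in>V. Xf c \<eta> z = (\<Sum>j\<in>UNIV. a j *\<^sub>R X j z)"
  by (rule local_coefficients[OF c(1) open_ball connected_ball r(2) ind])

lemma vol_W: "q \<in> W \<Longrightarrow> vol \<xi> q > 0"
proof -
  assume q: "q \<in> W"
  have "vol \<xi> q \<noteq> 0" using ind[OF W(2)[OF q]] volc_nz[OF c(1) W(1)[OF q], of \<xi>]
    by (simp add: vol_eq[OF c(1) W(1)[OF q]] X_fld[OF W(1)[OF q]])
  then show ?thesis using vol_pos[of \<xi> q] by simp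
qed

text \<open>The fields of \<open>\<xi>'\<close> are combinations of those of \<open>\<xi>\<close>
  with constant coefficients on the ball, and the determinant of these coefficients does not depend
  on the point.\<close>

lemma combination_factor:
  "\<exists>m\<ge>0. \<forall>q\<in>W. volc \<xi>' c q = m * vol \<xi> q"
proof -
  have "\<exists>a. \<forall>j. \<forall>z\<in>V. Xf c (\<xi>' j) z = (\<Sum>k\<in>UNIV. a j k *\<^sub>R X k z)"
    by (rule choice, rule allI, rule coefficients)
  then obtain a where a: "\<And>j z. z \<in> V \<Longrightarrow> Xf c (\<xi>' j) z = (\<Sum>k\<in>UNIV. a j k *\<^sub>R X k z)" by blast
  have "volc \<xi>' c q = (norm (det (\<chi> k j. complex_of_real (a j k)) :: complex))\<^sup>2 * vol \<xi> q" if q: "q \<in> W" for q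
    unfolding vol_eq[OF c(1) W(1)[OF q]]
    by (rule volc_combination[OF c(1) W(1)[OF q]]) (use a[OF W(2)[OF q]] in \<open>simp add: X_fld[OF W(1)[OF q]]\<close>)
  then show ?thesis by (intro exI[of _ "(norm (det (\<chi> k j. complex_of_real (a j k)) :: complex))\<^sup>2"]) auto
qed

lemma act_factor: "\<exists>m\<ge>0. \<forall>q\<in>W. vol \<xi> (\<phi> g q) = m * vol \<xi> q"
proof -
  obtain m where m: "m \<ge> 0" "\<forall>q\<in>W. volc (\<lambda>j. Ad g (\<xi> j)) c q = m * vol \<xi> q"
    using combination_factor[of "\<lambda>j. Ad g (\<xi> j)"] by blast
  then show ?thesis using vol_act[OF c(1) W(1)] by (intro exI[of _ m]) simp
qed

text \<open>Near the identity, \<open>\<phi> g\<close> multiplies the volume by a constant, which is \<open>1\<close> at the maximum.\<close>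

lemma vol_invariant:
  assumes g: "\<phi> g p \<in> W" and q: "q \<in> W" shows "vol \<xi> (\<phi> g q) = vol \<xi> q"
proof -
  obtain m where m: "m \<ge> 0" "\<And>q. q \<in> W \<Longrightarrow> vol \<xi> (\<phi> g q) = m * vol \<xi> q" using act_factor[of g] by blast
  obtain m' where m': "m' \<ge> 0" "\<And>q. q \<in> W \<Longrightarrow> vol \<xi> (\<phi> (ginv g) q) = m' * vol \<xi> q" using act_factor[of "ginv g"] by blast
  have pos: "vol \<xi> p > 0" using vol_W[OF pW] .
  have "m' * vol \<xi> p \<le> 1 * vol \<xi> p" using m'(2)[OF pW] max[of "\<phi> (ginv g) p"] by simp
  then have "m' \<le> 1" using pos by simp
  \<comment> \<open>Applying \<open>ginv g\<close> to the point \<open>\<phi> g p\<close> of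
    \<open>W\<close> gives the reverse inequality, so \<open>\<phi> g p\<close> is again a
    maximum.\<close>
  have "vol \<xi> p = m' * vol \<xi> (\<phi> g p)" using m'(2)[OF g] by (simp add: act_inv)
  also have "\<dots> \<le> 1 * vol \<xi> (\<phi> g p)" using \<open>m' \<le> 1\<close> vol_pos by (rule mult_right_mono)
  finally have "vol \<xi> (\<phi> g p) = vol \<xi> p" using max[of "\<phi> g p"] by simp
  then have "m = 1" using m(2)[OF pW] pos by simp
  then show ?thesis using m(2)[OF q] by simp
qed

text \<open>\<open>vol_invariant\<close> requires that \<open>p\<close> be moved within
  \<open>W\<close>, so the motions of \<open>q\<close> and of \<open>p\<close> are controlled
  together.\<close>

lemma near_base:
  assumes q: "q \<in> W"
  obtains T where "open T" "snd b0 unit \<in> T"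
    "\<And>x. x \<in> T \<Longrightarrow> \<exists>g. Act b0 c c (x, snd c q) = snd c (\<phi> g q) \<and> \<phi> g q \<in> W \<and> \<phi> g p \<in> W"
proof -
  let ?O = "ActD b0 c c \<inter> Act b0 c c -` V"
  have oO: "open ?O"
    using continuous_open_preimage[OF _ Act_smooth(1)[OF b0(1) c(1) c(1)] open_ball[of z0 r]]
      smooth_onD[OF Act_smooth(2)[OF b0(1) c(1) c(1)], of 0] by simp
  define T where "T = (\<lambda>x. (x, snd c q)) -` ?O \<inter> (\<lambda>x. (x, snd c p)) -` ?O"
  have "open T" unfolding T_def by (intro open_Int open_vimage oO continuous_intros)
  moreover have "(snd b0 unit, snd c y) \<in> ?O" if "y \<in> W" for y
    using base_ActD[OF c(1), of "snd c y"] Act_base(1)[OF c(1) W(1)[OF that]] W[OF that] by auto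
  then have "snd b0 unit \<in> T" using q pW unfolding T_def by blast
  moreover have "\<exists>g. Act b0 c c (x, snd c q) = snd c (\<phi> g q) \<and> \<phi> g q \<in> W \<and> \<phi> g p \<in> W" if x: "x \<in> T" for x
  proof -
    have xq: "(x, snd c q) \<in> ActD b0 c c" "Act b0 c c (x, snd c q) \<in> V"
      and xp: "(x, snd c p) \<in> ActD b0 c c" "Act b0 c c (x, snd c p) \<in> V" using x by (auto simp: T_def)
    obtain g q' where g: "(x, snd c q) = (snd b0 g, snd c q')" "g \<in> fst b0" "q' \<in> fst c" "\<phi> g q' \<in> fst c"
      using ActD_E[OF xq(1)] by blast
    obtain h p' where h: "(x, snd c p) = (snd b0 h, snd c p')" "h \<in> fst b0" "p' \<in> fst c" "\<phi> h p' \<in> fst c"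
      using ActD_E[OF xp(1)] by blast
    have e: "q' = q" "p' = p" "h = g"
      using g h inj_onD[OF chart_inj[OF cc]] inj_onD[OF chart_inj[OF b0_chart]] W(1)[OF q] c(2) by auto
    have Aq: "Act b0 c c (x, snd c q) = snd c (\<phi> g q)" and Ap: "Act b0 c c (x, snd c p) = snd c (\<phi> g p)"
      using Act_eq[OF b0(1) c(1) g(2), of _ c] g(1,3) h(1,3) unfolding e by auto
    show ?thesis using Aq Ap xq xp g(4) h(4) unfolding e W_def by auto
  qed
  ultimately show thesis by (rule that)
qed

text \<open>The volume is locally constant along the orbit of any point of \<open>W\<close>, since
  \<open>\<phi> g\<close> preserves it for \<open>g\<close> near the identity.\<close>

lemma \<beta>_X:
  assumes z: "z \<in> V" shows "fr.\<beta> z (Xf c \<eta> z) = 0"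
proof -
  obtain q where q: "q \<in> fst c" "z = snd c q" using z r(2) by blast
  have qW: "q \<in> W" using z q by (simp add: W_def)
  obtain T where T: "open T" "snd b0 unit \<in> T"
    "\<And>x. x \<in> T \<Longrightarrow> \<exists>g. Act b0 c c (x, snd c q) = snd c (\<phi> g q) \<and> \<phi> g q \<in> W \<and> \<phi> g p \<in> W"
    using near_base[OF qW] by metis
  have lv: "fr.lnvol (snd c y) = ln (vol \<xi> y)" if "y \<in> fst c" for y
    using that by (simp add: fr.lnvol_def vol_eq[OF c(1)] volc_def X_fld)
  have dl: "(fr.lnvol has_derivative fr.\<beta> z) (at (Act b0 c c (snd b0 unit, snd c q)))"
    unfolding Act_base(1)[OF c(1) q(1)] unfolding q(2)[symmetric] by (rule fr.lnvol_has_derivative[OF z])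
  have 1: "((\<lambda>x. fr.lnvol (Act b0 c c (x, snd c q))) has_derivative (\<lambda>\<eta>. fr.\<beta> z (Xf c \<eta> z))) (at (snd b0 unit))"
    using diff_chain_at[OF Act_base(2)[OF c(1) q(1)] dl] by (simp add: o_def q(2))
  have 2: "((\<lambda>x. fr.lnvol (Act b0 c c (x, snd c q))) has_derivative (\<lambda>\<eta>. 0)) (at (snd b0 unit))"
  proof (rule has_derivative_transform_within_open[OF has_derivative_const T(1,2)])
    fix x assume "x \<in> T"
    then obtain g where g: "Act b0 c c (x, snd c q) = snd c (\<phi> g q)" "\<phi> g q \<in> W" "\<phi> g p \<in> W" using T(3) by blast
    show "ln (vol \<xi> q) = fr.lnvol (Act b0 c c (x, snd c q))"
      unfolding g(1) lv[OF W(1)[OF g(2)]] vol_invariant[OF g(3) qW] ..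
  qed
  show ?thesis using fun_cong[OF has_derivative_unique[OF 1 2], of \<eta>] .
qed

text \<open>Points of the orbit near \<open>p\<close> are maxima too, so \<open>\<beta>\<close>
  vanishes at all of them.\<close>

lemma \<beta>_along_orbit: "Dir (Xf c \<eta> z0) (\<lambda>y. fr.\<beta> y w) z0 = 0"
proof -
  obtain T where T: "open T" "snd b0 unit \<in> T"
    "\<And>x. x \<in> T \<Longrightarrow> \<exists>g. Act b0 c c (x, z0) = snd c (\<phi> g p) \<and> \<phi> g p \<in> W \<and> \<phi> g p \<in> W"
    using near_base[OF pW] by metis
  have db: "((\<lambda>y. fr.\<beta> y w) has_derivative (\<lambda>h. Dir h (\<lambda>y. fr.\<beta> y w) z0)) (at (Act b0 c c (snd b0 unit, z0)))"
    unfolding Act_base(1)[OF c] by (rule has_derivative_frechet[OF fr.\<beta>_diff[OF z0V]])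
  have 1: "((\<lambda>x. fr.\<beta> (Act b0 c c (x, z0)) w) has_derivative (\<lambda>\<eta>. Dir (Xf c \<eta> z0) (\<lambda>y. fr.\<beta> y w) z0)) (at (snd b0 unit))"
    using diff_chain_at[OF Act_base(2)[OF c] db] by (simp add: o_def)
  have 2: "((\<lambda>x. fr.\<beta> (Act b0 c c (x, z0)) w) has_derivative (\<lambda>\<eta>. 0)) (at (snd b0 unit))"
  proof (rule has_derivative_transform_within_open[OF has_derivative_const T(1,2)])
    fix x assume "x \<in> T"
    then obtain g where g: "Act b0 c c (x, z0) = snd c (\<phi> g p)" "\<phi> g p \<in> W" using T(3) by blast
    have "vol \<xi> y \<le> vol \<xi> (\<phi> g p)" for y using vol_invariant[OF g(2) pW] max[of y] by simp
    then show "0 = fr.\<beta> (Act b0 c c (x, z0)) w"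
      unfolding g(1) using \<beta>_zero_at_maximum[OF frame c(1) W(1)[OF g(2)] W(2)[OF g(2)] open_UNIV] by simp
  qed
  show ?thesis using fun_cong[OF has_derivative_unique[OF 1 2], of \<eta>] .
qed

text \<open>In the Einstein identity the first term differentiates \<open>\<beta>\<close> along the
  orbit; in the second, \<open>J J = - 1\<close> and the symmetry of the derivative of
  \<open>\<beta>\<close> again produce a derivative along the orbit. Both vanish, and
  \<open>\<kappa>\<close> is positive.\<close>

lemma form_X: "\<omega> c z0 (X j z0) (X k z0) = 0"
proof -
  have zS: "z0 \<in> snd c ` fst c" using c by blast
  have m: "Dir h (\<lambda>y. fr.\<beta> y (- w)) z0 = - Dir h (\<lambda>y. fr.\<beta> y w) z0" for h w
  proof -
    have "((\<lambda>y. - fr.\<beta> y w) has_derivative (\<lambda>h. - Dir h (\<lambda>y. fr.\<beta> y w) z0)) (at z0)"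
      by (rule has_derivative_minus[OF has_derivative_frechet[OF fr.\<beta>_diff[OF z0V]]])
    then have "((\<lambda>y. fr.\<beta> y (- w)) has_derivative (\<lambda>h. - Dir h (\<lambda>y. fr.\<beta> y w) z0)) (at z0)"
      by (rule has_derivative_transform_within_open[OF _ open_ball z0V]) (simp add: linear_neg[OF fr.linear_\<beta>])
    then show ?thesis by (simp add: frechet_derivative_eq)
  qed
  have "Dir (X j z0) (\<lambda>y. fr.\<beta> y (J (X k z0))) z0 + Dir (J (X j z0)) (\<lambda>y. fr.\<beta> y (J (J (X k z0)))) z0
      = - 2 * \<kappa> * fr.g z0 (X j z0) (J (X k z0))"
    by (rule fr.\<beta>_einstein[OF z0V einstein[OF c(1) zS]])
  moreover have "Dir (J (X j z0)) (\<lambda>y. fr.\<beta> y (J (J (X k z0)))) z0 = 0"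
    unfolding J_J m fr.\<beta>_symmetric[OF z0V, where v = "J (X j z0)"] \<beta>_along_orbit by simp
  ultimately have "\<kappa> * fr.g z0 (X j z0) (J (X k z0)) = 0" unfolding \<beta>_along_orbit by simp
  then show ?thesis using \<kappa>_pos fr.form_g[OF zS] by simp
qed

lemma range_fld:
  assumes q: "q \<in> W"
  shows "range (fld c q) = range (\<lambda>x::real^'n. \<Sum>j\<in>UNIV. x $ j *\<^sub>R fld c q (\<xi> j))"
    "dim (range (fld c q)) = CARD('n)"
proof -
  have lf: "linear (fld c q)" by (rule fld_linear[OF c(1) W(1)[OF q]])
  show e: "range (fld c q) = range (\<lambda>x::real^'n. \<Sum>j\<in>UNIV. x $ j *\<^sub>R fld c q (\<xi> j))"
  proof
    show "range (fld c q) \<subseteq> range (\<lambda>x::real^'n. \<Sum>j\<in>UNIV. x $ j *\<^sub>R fld c q (\<xi> j))"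
    proof
      fix v assume "v \<in> range (fld c q)"
      then obtain \<eta> where \<eta>: "v = fld c q \<eta>" by blast
      obtain a where "\<And>z. z \<in> V \<Longrightarrow> Xf c \<eta> z = (\<Sum>j\<in>UNIV. a j *\<^sub>R X j z)" using coefficients by blast
      from this[OF W(2)[OF q]] have "v = (\<Sum>j\<in>UNIV. (\<chi> j. a j) $ j *\<^sub>R fld c q (\<xi> j))"
        by (simp add: X_fld[OF W(1)[OF q]] \<eta>)
      then show "v \<in> range (\<lambda>x::real^'n. \<Sum>j\<in>UNIV. x $ j *\<^sub>R fld c q (\<xi> j))" by (rule image_eqI) simp
    qed
    have "subspace (range (fld c q))" by (rule linear_subspace_image[OF lf subspace_UNIV])
    then show "range (\<lambda>x::real^'n. \<Sum>j\<in>UNIV. x $ j *\<^sub>R fld c q (\<xi> j)) \<subseteq> range (fld c q)"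
      by (auto intro!: subspace_sum subspace_scale)
  qed
  have nz: "det (frame_matrix (\<lambda>j. fld c q (\<xi> j))) \<noteq> 0" using ind[OF W(2)[OF q]] by (simp add: X_fld[OF W(1)[OF q]])
  have "dim (range (\<lambda>x::real^'n. \<Sum>j\<in>UNIV. x $ j *\<^sub>R fld c q (\<xi> j))) = dim (UNIV :: (real^'n) set)"
    by (rule dim_image_eq[OF real_comb_linear]) (use real_comb_inj[OF nz] in \<open>simp add: inj_on_subset\<close>)
  then show "dim (range (fld c q)) = CARD('n)" unfolding e by simp
qed

lemma fld_dim: assumes q: "q \<in> W" "d \<in> A" "\<phi> g q \<in> fst d" shows "dim (range (fld d (\<phi> g q))) = CARD('n)"
  using fld_dim_act[OF c(1) q(2) W(1)[OF q(1)] q(3)] range_fld(2)[OF q(1)] by simp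

text \<open>At \<open>p\<close> the fields of the \<open>\<xi> j\<close> span the tangent space; the
  other points of the orbit are reached by holomorphic isometries, which preserve
  \<open>\<omega>\<close>.\<close>

lemma lagrangian_orbit: "lagrangian A \<omega> (orbit G \<phi> p)"
  unfolding lagrangian_def
proof (intro conjI ballI)
  show "n_submanifold A (orbit G \<phi> p)" by (rule orbit_submanifold[OF c range_fld(2)[OF pW]])
  fix d q u v assume d: "d \<in> A" and q: "q \<in> orbit G \<phi> p \<inter> fst d"
    and u: "u \<in> tangent_space d (orbit G \<phi> p) q" and v: "v \<in> tangent_space d (orbit G \<phi> p) q"
  obtain g where g: "q = \<phi> g p" using q unfolding orbit_range by blast
  have gd: "\<phi> g p \<in> fst d" using q g by blast
  have t: "tangent_space d (orbit G \<phi> p) q = range (fld d (\<phi> g p))"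
    unfolding g using tangent_space_orbit[OF d gd] unfolding orbit_act .
  have zS: "z0 \<in> snd c ` fst c" using c by blast
  have z: "\<omega> c z0 (fld c p \<eta>) (fld c p \<theta>) = 0" for \<eta> \<theta>
  proof -
    have ex: "\<exists>x::real^'n. fld c p \<eta> = (\<Sum>j\<in>UNIV. x $ j *\<^sub>R fld c p (\<xi> j))" for \<eta>
      using range_fld(1)[OF pW] by blast
    obtain x :: "real^'n" where x: "fld c p \<eta> = (\<Sum>j\<in>UNIV. x $ j *\<^sub>R fld c p (\<xi> j))" using ex[of \<eta>] by blast
    obtain y :: "real^'n" where y: "fld c p \<theta> = (\<Sum>j\<in>UNIV. y $ j *\<^sub>R fld c p (\<xi> j))" using ex[of \<theta>] by blast
    have "\<omega> c z0 (fld c p (\<xi> j)) (fld c p (\<xi> k)) = 0" for j k using form_X[of j k] by (simp add: X_fld[OF c(2)])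
    then show ?thesis unfolding x y bilinear_sum[OF fr.bil_form[OF zS]]
      by (simp add: bilinear_lmul[OF fr.bil_form[OF zS]] bilinear_rmul[OF fr.bil_form[OF zS]])
  qed
  obtain \<eta> \<theta> where "u = fld d (\<phi> g p) \<eta>" "v = fld d (\<phi> g p) \<theta>" using u v unfolding t by blast
  then show "\<omega> d (snd d q) u v = 0"
    unfolding g by (simp add: fld_act[OF c(1) d c(2) gd] form_act[OF c(1) d c(2) gd] z)
qed

end

section \<open>Mean curvature of the orbits\<close>

text \<open>A vector in the moving subspace \<open>range (M y)\<close> is close to
  \<open>range (M x0)\<close> relative to its length. As \<open>u\<close> vanishes at
  \<open>x0\<close>, its length is at most of the order of \<open>y - x0\<close>, so the projection
  \<open>P\<close> that kills \<open>range (M x0)\<close> leaves only a term of smaller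
  order.\<close>

lemma derivative_in_range:
  fixes M :: "'a::euclidean_space \<Rightarrow> 'b::euclidean_space \<Rightarrow> 'c::euclidean_space"
  assumes S: "open S" "x0 \<in> S" and lin: "\<And>y. y \<in> S \<Longrightarrow> linear (M y)"
    and cont: "\<And>v. isCont (\<lambda>y. M y v) x0" and inj: "inj (M x0)"
    and u: "(u has_derivative u') (at x0)" "u x0 = 0" and rng: "\<And>y. y \<in> S \<Longrightarrow> u y \<in> range (M y)"
  shows "u' h \<in> range (M x0)"
proof -
  note l0 = lin[OF S(2)]
  obtain L where L: "linear L" "L \<circ> M x0 = id" using linear_injective_left_inverse[OF l0 inj] by blast
  have LM: "L (M x0 v) = v" for v using L(2) by (metis comp_def id_apply)
  define P where "P w = w - M x0 (L w)" for w
  have linP: "linear P"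
    using linear_compose_sub[OF linear_id linear_compose[OF L(1) l0]] unfolding P_def[abs_def] by (simp add: o_def id_def)
  have PM: "P (M x0 v) = 0" for v by (simp add: P_def LM)
  define \<delta> where "\<delta> y = (\<Sum>b\<in>Basis. norm (M y b - M x0 b))" for y
  have \<delta>b: "norm (M y v - M x0 v) \<le> \<delta> y * norm v" if "y \<in> S" for y v
    using norm_linear_le_sum[OF linear_compose_sub[OF lin[OF that] l0], of v] by (simp add: \<delta>_def)
  have \<delta>0: "\<delta> y \<ge> 0" for y by (simp add: \<delta>_def sum_nonneg)
  have "isCont \<delta> x0" unfolding \<delta>_def by (intro continuous_intros cont)
  moreover have "\<delta> x0 = 0" by (simp add: \<delta>_def)
  ultimately have \<delta>lim: "(\<delta> \<longlongrightarrow> 0) (nhds x0)"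
    using tendsto_at_iff_tendsto_nhds[of \<delta> x0] unfolding isCont_def by simp
  define C where "C = (\<Sum>b\<in>Basis. norm (L b)) + 1"
  have C: "C > 0" by (simp add: C_def add_nonneg_pos sum_nonneg)
  have CL: "norm (L w) \<le> C * norm w" for w
    using norm_linear_le_sum[OF L(1), of w] norm_ge_zero[of w] unfolding C_def distrib_right by linarith
  define C2 where "C2 = (\<Sum>b\<in>Basis. norm (P b)) + 1"
  have C2: "C2 > 0" by (simp add: C2_def add_nonneg_pos sum_nonneg)
  have CP: "norm (P w) \<le> C2 * norm w" for w
    using norm_linear_le_sum[OF linP, of w] norm_ge_zero[of w] unfolding C2_def distrib_right by linarith
  define C3 where "C3 = (\<Sum>b\<in>Basis. norm (u' b)) + 1"
  have C3: "C3 > 0" by (simp add: C3_def add_nonneg_pos sum_nonneg)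
  have uC: "eventually (\<lambda>y. norm (u y) \<le> C3 * norm (y - x0)) (nhds x0)"
  proof -
    have "\<forall>e>0. \<exists>d>0. \<forall>y. norm (y - x0) < d \<longrightarrow> norm (u y - u x0 - u' (y - x0)) \<le> e * norm (y - x0)"
      using u(1) unfolding has_derivative_at_alt by blast
    then obtain d where d: "d > 0" "\<And>y. norm (y - x0) < d \<Longrightarrow> norm (u y - u x0 - u' (y - x0)) \<le> 1 * norm (y - x0)"
      using zero_less_one by blast
    have "norm (u y) \<le> C3 * norm (y - x0)" if "norm (y - x0) < d" for y
    proof -
      have "norm (u y) \<le> norm (u y - u x0 - u' (y - x0)) + norm (u' (y - x0))"
        using norm_triangle_ineq[of "u y - u' (y - x0)" "u' (y - x0)"] by (simp add: u(2))
      also have "\<dots> \<le> 1 * norm (y - x0) + (\<Sum>b\<in>Basis. norm (u' b)) * norm (y - x0)"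
        using d(2)[OF that] norm_linear_le_sum[OF has_derivative_linear[OF u(1)]] by (intro add_mono) auto
      finally show ?thesis by (simp add: C3_def distrib_right add.commute)
    qed
    then show ?thesis using d(1) unfolding eventually_nhds_metric dist_norm by blast
  qed
  have 1: "((\<lambda>y. P (u y)) has_derivative (\<lambda>h. 0)) (at x0)"
    unfolding has_derivative_at_alt
  proof (intro conjI allI impI)
    show "bounded_linear (\<lambda>h. 0)" by (rule bounded_linear_zero)
    fix e :: real assume e: "e > 0"
    \<comment> \<open>The first bound absorbs \<open>norm m\<close> in its own estimate, giving
      \<open>norm m \<le> 2 * C * norm (u y)\<close>; the second makes the final factor
      \<open>\<delta> y * (2 * C * C2 * C3)\<close> at most \<open>e\<close>.\<close>
    define k where "k = min (1 / (2 * C)) (e / (2 * C * C2 * C3))"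
    have k: "k > 0" using C C2 C3 e by (simp add: k_def)
    have "eventually (\<lambda>y. \<delta> y < k) (nhds x0)" by (rule order_tendstoD(2)[OF \<delta>lim k])
    moreover have "eventually (\<lambda>y. y \<in> S) (nhds x0)" using S by (rule eventually_nhds_in_open)
    ultimately have "eventually (\<lambda>y. norm (P (u y) - P (u x0) - 0) \<le> e * norm (y - x0)) (nhds x0)"
      using uC
    proof eventually_elim
      case (elim y)
      obtain m where m: "u y = M y m" using rng[OF elim(2)] by blast
      have "m = L (u y) - L (M y m - M x0 m)" using L(1) by (simp add: m linear_diff LM)
      then have "norm m \<le> norm (L (u y)) + norm (L (M y m - M x0 m))" by (metis norm_triangle_ineq4)
      also have "\<dots> \<le> C * norm (u y) + C * (\<delta> y * norm m)"
        using CL[of "M y m - M x0 m"] \<delta>b[OF elim(2), of m] C by (intro add_mono CL) (meson mult_left_mono order.strict_implies_order order_trans)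
      also have "C * (\<delta> y * norm m) \<le> (1/2) * norm m"
      proof -
        have "C * \<delta> y \<le> C * (1 / (2 * C))" using elim(1) C by (intro mult_left_mono) (auto simp: k_def)
        then have "C * \<delta> y \<le> 1/2" using C by simp
        then have "(C * \<delta> y) * norm m \<le> (1/2) * norm m" by (rule mult_right_mono) simp
        then show ?thesis by (simp add: mult.assoc)
      qed
      finally have mb: "norm m \<le> 2 * C * norm (u y)" by simp
      have "P (u y) = P (M y m - M x0 m)" using linP PM by (simp add: m linear_diff)
      then have "norm (P (u y)) \<le> C2 * (\<delta> y * norm m)"
        using CP[of "M y m - M x0 m"] \<delta>b[OF elim(2), of m] C2 by (metis mult_left_mono order.strict_implies_order order_trans)
      also have "\<dots> \<le> C2 * (\<delta> y * (2 * C * (C3 * norm (y - x0))))"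
      proof -
        have "norm m \<le> 2 * C * (C3 * norm (y - x0))"
          using mb elim(3) C by (meson mult_left_mono order_trans less_imp_le mult_pos_pos zero_less_numeral)
        then show ?thesis using C2 \<delta>0[of y] by (intro mult_left_mono) auto
      qed
      also have "\<dots> = (\<delta> y * (2 * C * C2 * C3)) * norm (y - x0)" by simp
      also have "\<dots> \<le> e * norm (y - x0)"
      proof (rule mult_right_mono)
        have "\<delta> y \<le> e / (2 * C * C2 * C3)" using elim(1) by (simp add: k_def)
        then show "\<delta> y * (2 * C * C2 * C3) \<le> e" using C C2 C3 by (simp add: pos_le_divide_eq)
      qed simp
      finally show ?case using linP by (simp add: u(2) linear_0)
    qed
    then show "\<exists>d>0. \<forall>y. norm (y - x0) < d \<longrightarrow> norm (P (u y) - P (u x0) - 0) \<le> e * norm (y - x0)"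
      unfolding eventually_nhds_metric dist_norm .
  qed
  have 2: "((\<lambda>y. P (u y)) has_derivative (\<lambda>h. P (u' h))) (at x0)"
    using bounded_linear.has_derivative[OF _ u(1)] linP linear_conv_bounded_linear by blast
  have "P (u' h) = 0" using fun_cong[OF has_derivative_unique[OF 2 1], of h] .
  then have "u' h = M x0 (L (u' h))" by (simp add: P_def)
  then show ?thesis by blast
qed

lemma local_paramD:
  assumes lp: "local_param A L Wd f" and d: "d \<in> A" "is_chart d"
  shows "open (Wd \<inter> f -` fst d)" "smooth_on (Wd \<inter> f -` fst d) (snd d \<circ> f)"
    "\<And>x. x \<in> Wd \<Longrightarrow> f x \<in> fst d \<Longrightarrow> inj (frechet_derivative (snd d \<circ> f) (at x))"
    "\<And>x. x \<in> Wd \<Longrightarrow> f x \<in> L"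
proof -
  obtain h where "homeomorphism Wd (f ` Wd) f h" using lp unfolding local_param_def by blast
  then have "continuous_on Wd f" by (simp add: homeomorphism_def)
  then show "open (Wd \<inter> f -` fst d)"
    using continuous_open_preimage chart_open(1)[OF d(2)] lp unfolding local_param_def by blast
  show "smooth_on (Wd \<inter> f -` fst d) (snd d \<circ> f)"
    "\<And>x. x \<in> Wd \<Longrightarrow> f x \<in> fst d \<Longrightarrow> inj (frechet_derivative (snd d \<circ> f) (at x))"
    using lp d(1) unfolding local_param_def by blast+
  show "\<And>x. x \<in> Wd \<Longrightarrow> f x \<in> L" using lp unfolding local_param_def by blast
qed

lemma param_tangent:
  fixes f :: "real^'n \<Rightarrow> 'm::t2_space" and A :: "('m, complex^'n) chart set"
  assumes lp: "local_param A L Wd f" and d: "d \<in> A" "is_chart d" and y: "y \<in> Wd" "f y \<in> fst d"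
  shows "Dir v (snd d \<circ> f) y \<in> tangent_space d L (f y)"
proof -
  define T where "T = Wd \<inter> f -` fst d"
  have oT: "open T" and sm: "smooth_on T (snd d \<circ> f)" using local_paramD[OF lp d] by (auto simp: T_def)
  define I where "I = (\<lambda>t::real. y + t *\<^sub>R v) -` T"
  have oI: "open I" unfolding I_def by (rule open_vimage[OF oT]) (intro continuous_intros)
  have "0 \<in> I" using y by (simp add: I_def T_def)
  then obtain e where e: "0 < e" "ball 0 e \<subseteq> I" using oI openE by blast
  have eI: "{-e<..<e} \<subseteq> I" using e(2) by (simp add: ball_eq_greaterThanLessThan)
  define \<gamma> where "\<gamma> t = f (y + t *\<^sub>R v)" for t :: real
  have "smooth_on {-e<..<e} (\<lambda>t. (snd d \<circ> f) (y + t *\<^sub>R v))"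
    by (rule smooth_on_compose_affine[OF oT bounded_linear_scaleR_left sm]) (use eI in \<open>auto simp: I_def\<close>)
  then have 1: "smooth_on {-e<..<e} (snd d \<circ> \<gamma>)" by (simp add: \<gamma>_def[abs_def] o_def)
  have dy: "((\<lambda>t::real. y + t *\<^sub>R v) has_derivative (\<lambda>t. t *\<^sub>R v)) (at 0)" by (auto intro!: derivative_eq_intros)
  have yT: "y \<in> T" using y by (simp add: T_def)
  have dF: "(snd d \<circ> f) differentiable (at y)" using smooth_on_differentiable[OF sm yT] .
  have "(snd d \<circ> f has_derivative frechet_derivative (snd d \<circ> f) (at y)) (at (y + 0 *\<^sub>R v))"
    using has_derivative_frechet[OF dF] by simp
  from diff_chain_at[OF dy this]
  have "(snd d \<circ> \<gamma> has_derivative (\<lambda>t. Dir (t *\<^sub>R v) (snd d \<circ> f) y)) (at 0)"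
    by (simp add: \<gamma>_def[abs_def] o_def)
  then have 2: "(snd d \<circ> \<gamma> has_vector_derivative Dir v (snd d \<circ> f) y) (at 0)"
    unfolding has_vector_derivative_def using linear_scale[OF linear_frechet_derivative[OF dF]] by simp
  have 3: "\<gamma> ` {-e<..<e} \<subseteq> L \<inter> fst d"
    using eI local_paramD(4)[OF lp d] by (auto simp: \<gamma>_def I_def T_def)
  have 4: "\<gamma> 0 = f y" by (simp add: \<gamma>_def)
  show ?thesis unfolding tangent_space_def using e(1) 1 2 3 4 by blast
qed

context kahler_action begin

text \<open>The vector \<open>S\<close> of the overview with its tangential part kept; the mean
  curvature is its normal part when the fields agree with a coordinate frame of the orbit at
  \<open>q\<close>.\<close>

definition mcv :: "('m, complex^'n) chart \<Rightarrow> 'm \<Rightarrow> ('n \<Rightarrow> 'e) \<Rightarrow> complex^'n" where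
  "mcv d q \<xi> = (let z = snd d q; Ginv = matrix_inv ((\<chi> a b. metric \<omega> d z (Xf d (\<xi> a) z) (Xf d (\<xi> b) z)) :: real^'n^'n) in
     \<Sum>a\<in>UNIV. \<Sum>b\<in>UNIV. Ginv $ a $ b *\<^sub>R (Dir (Xf d (\<xi> a) z) (Xf d (\<xi> b)) z
        + christoffel (metric \<omega>) d z (Xf d (\<xi> a) z) (Xf d (\<xi> b) z)))"

text \<open>The derivative of the coordinate frame and that of the fields \<open>X\<^sub>b\<close> which agree with it at \<open>x\<close>
  differ by a tangent vector, because the difference of the two is tangent and vanishes at \<open>x\<close>.\<close>

lemma mean_curvature_orbit:
  assumes d: "d \<in> A" and lp: "local_param A (orbit G \<phi> q0) Wd f" and x: "x \<in> Wd" "f x \<in> fst d"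
    and dim: "dim (range (fld d (f x))) = CARD('n)"
    and fr: "\<And>b. fld d (f x) (\<xi> b) = Dir (axis b 1) (snd d \<circ> f) x"
  shows "\<exists>t. mean_curvature (metric \<omega>) d f x = mcv d (f x) \<xi> - (\<Sum>b\<in>UNIV. t b *\<^sub>R fld d (f x) (\<xi> b))"
    and "mcv d (f x) \<xi> = 0 \<Longrightarrow> mean_curvature (metric \<omega>) d f x = 0"
proof -
  have dd: "is_chart d" by (rule chartA[OF d])
  interpret kahler_chart \<omega> d "snd d ` fst d" using kahler_chart_at d by blast
  define F where "F = snd d \<circ> f"
  define z where "z = F x"
  have zS: "z \<in> snd d ` fst d" using x by (simp add: z_def F_def)
  define X where "X b = fld d (f x) (\<xi> b)" for b
  have Xz: "Xf d (\<xi> b) z = X b" for b using x by (simp add: Xf_def X_def z_def F_def cinv_chart[OF dd])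
  define T where "T = Wd \<inter> f -` fst d"
  have oT: "open T" and sm: "smooth_on T F" using local_paramD[OF lp d dd] by (auto simp: T_def F_def)
  have xT: "x \<in> T" using x by (simp add: T_def)
  have dF: "F differentiable (at y)" if "y \<in> T" for y using smooth_on_differentiable[OF sm that] .
  have linM: "linear (\<lambda>v. Dir v F y)" if "y \<in> T" for y by (rule linear_Dir[OF dF[OF that]])
  have injM: "inj (\<lambda>v. Dir v F y)" if "y \<in> T" for y
    using local_paramD(3)[OF lp d dd, of y] that by (simp add: T_def F_def)
  have FrX: "Dir (axis b 1) F x = X b" for b using fr by (simp add: F_def X_def)
  have Mx: "Dir v F x = (\<Sum>b\<in>UNIV. v $ b *\<^sub>R X b)" for v
    using linear_axis_expansion[OF linM[OF xT], of v] unfolding FrX .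
  \<comment> \<open>Coordinate vectors are velocities of curves in the orbit, which gives one
    inclusion; both spaces have dimension \<open>n\<close>.\<close>
  have rangeM: "range (\<lambda>v. Dir v F y) = range (fld d (f y))" if y: "y \<in> T" for y
  proof (rule subspace_dim_equal)
    have fy: "f y \<in> fst d" "y \<in> Wd" using y by (auto simp: T_def)
    have o: "f y \<in> orbit G \<phi> q0" "f x \<in> orbit G \<phi> q0" using local_paramD(4)[OF lp d dd] fy x by auto
    obtain g h where gh: "f y = \<phi> g q0" "f x = \<phi> h q0" using o unfolding orbit_range by blast
    have e: "f y = \<phi> (mul g (ginv h)) (f x)" unfolding gh by (simp add: act_mul act_inv)
    have lf: "linear (fld d (f y))" by (rule fld_linear[OF d fy(1)])
    show "subspace (range (\<lambda>v. Dir v F y))" "subspace (range (fld d (f y)))"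
      by (rule linear_subspace_image[OF linM[OF y] subspace_UNIV], rule linear_subspace_image[OF lf subspace_UNIV])
    have "tangent_space d (orbit G \<phi> q0) (f y) = range (fld d (f y))"
      using tangent_space_orbit[OF d fy(1)] unfolding gh(1) orbit_act .
    then show "range (\<lambda>v. Dir v F y) \<subseteq> range (fld d (f y))"
      using param_tangent[OF lp d dd fy(2,1)] unfolding F_def by blast
    have "dim (range (fld d (f y))) = CARD('n)"
      using fld_dim_act[OF d d x(2), of "mul g (ginv h)"] dim fy(1) unfolding e[symmetric] by simp
    moreover have "dim (range (\<lambda>v. Dir v F y)) = dim (UNIV :: (real^'n) set)"
      by (rule dim_image_eq[OF linM[OF y]]) (use injM[OF y] in \<open>simp add: inj_on_subset\<close>)
    ultimately show "dim (range (fld d (f y))) \<le> dim (range (\<lambda>v. Dir v F y))" by simp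
  qed
  define gram :: "real^'n^'n" where "gram = (\<chi> a b. g z (X a) (X b))"
  define Ginv where "Ginv = matrix_inv gram"
  have "\<exists>B. B ** gram = mat 1"
    unfolding matrix_left_invertible_ker
  proof (intro allI impI)
    fix v assume v: "gram *v v = 0"
    have "g z (Dir v F x) (Dir v F x) = (\<Sum>a\<in>UNIV. v $ a * (gram *v v) $ a)"
      unfolding Mx bilinear_sum[OF bil_g[OF zS]] gram_def matrix_vector_mult_def sum.cartesian_product[symmetric]
      by (simp add: bilinear_lmul[OF bil_g[OF zS]] bilinear_rmul[OF bil_g[OF zS]] sum_distrib_left mult_ac)
    also have "\<dots> = 0" by (simp add: v)
    finally have "Dir v F x = Dir 0 F x" using pos[OF zS, of "Dir v F x"] linear_0[OF linM[OF xT]] by fastforce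
    then show "v = 0" using injM[OF xT] by (meson injD)
  qed
  then have "invertible gram" using invertible_left_inverse by blast
  then have GG: "gram ** Ginv = mat 1" unfolding Ginv_def by (rule matrix_inv_works(2))
  define nor where "nor w = w - (\<Sum>a\<in>UNIV. \<Sum>b\<in>UNIV. (Ginv $ a $ b * g z w (X a)) *\<^sub>R X b)" for w
  have lg: "linear (\<lambda>w. g z w v)" for v using bil_g[OF zS] by (simp add: bilinear_def)
  have linN: "linear nor"
    unfolding nor_def
    by (rule linearI) (simp_all add: linear_add[OF lg] linear_scale[OF lg] distrib_left scaleR_add_left sum.distrib
      scaleR_diff_right scaleR_sum_right mult.left_commute)
  have norX: "nor (X k) = 0" for k
  proof -
    have "(\<Sum>a\<in>UNIV. \<Sum>b\<in>UNIV. (Ginv $ a $ b * g z (X k) (X a)) *\<^sub>R X b) = (\<Sum>b\<in>UNIV. (gram ** Ginv) $ k $ b *\<^sub>R X b)"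
      unfolding matrix_matrix_mult_def gram_def
      by (subst sum.swap) (simp add: scaleR_sum_left mult.commute)
    also have "\<dots> = X k" unfolding GG mat_def by (simp add: if_distrib if_distribR cong: if_cong)
    finally show ?thesis by (simp add: nor_def)
  qed
  have norM: "nor (Dir v F x) = 0" for v
    unfolding Mx linear_sum[OF linN] linear_scale[OF linN] norX by simp
  define nab where "nab a b = Dir (X a) (Xf d (\<xi> b)) z + \<Gamma> z (X a) (X b)" for a b
  define cov where "cov a b = Dir (axis a 1) (\<lambda>y. Dir (axis b 1) F y) x + \<Gamma> z (X a) (X b)" for a b
  have norcov: "nor (cov a b) = nor (nab a b)" for a b
  proof -
    define u where "u y = Dir (axis b 1) F y - Xf d (\<xi> b) (F y)" for y
    have d1: "((\<lambda>y. Dir (axis b 1) F y) has_derivative (\<lambda>h. Dir h (\<lambda>y. Dir (axis b 1) F y) x)) (at x)"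
      using has_derivative_frechet[OF smooth_on_differentiable[OF smooth_on_Dir[OF sm] xT]] .
    have dX: "(Xf d (\<xi> b) has_derivative frechet_derivative (Xf d (\<xi> b)) (at z)) (at (F x))"
      using has_derivative_frechet[OF smooth_on_differentiable[OF Xf_smooth[OF d] zS]] by (simp add: z_def)
    have d2: "((\<lambda>y. Xf d (\<xi> b) (F y)) has_derivative (\<lambda>h. Dir (Dir h F x) (Xf d (\<xi> b)) z)) (at x)"
      using diff_chain_at[OF has_derivative_frechet[OF dF[OF xT]] dX] by (simp add: o_def)
    have du: "(u has_derivative (\<lambda>h. Dir h (\<lambda>y. Dir (axis b 1) F y) x - Dir (Dir h F x) (Xf d (\<xi> b)) z)) (at x)"
      unfolding u_def[abs_def] by (rule has_derivative_diff[OF d1 d2])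
    have u0: "u x = 0" using Xz by (simp add: u_def FrX z_def)
    have ur: "u y \<in> range (\<lambda>v. Dir v F y)" if y: "y \<in> T" for y
    proof -
      have "f y \<in> fst d" using y by (simp add: T_def)
      then have "Xf d (\<xi> b) (F y) = fld d (f y) (\<xi> b)" by (simp add: Xf_def F_def cinv_chart[OF dd])
      then have "Xf d (\<xi> b) (F y) \<in> range (\<lambda>v. Dir v F y)" unfolding rangeM[OF y] by blast
      moreover have "subspace (range (\<lambda>v. Dir v F y))" by (rule linear_subspace_image[OF linM[OF y] subspace_UNIV])
      ultimately show ?thesis unfolding u_def by (intro subspace_diff) auto
    qed
    have contM: "isCont (\<lambda>y. Dir v F y) x" for v
      using smooth_on_differentiable[OF smooth_on_Dir[OF sm] xT] by (rule differentiable_imp_continuous_within)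
    have "Dir (axis a 1) (\<lambda>y. Dir (axis b 1) F y) x - Dir (Dir (axis a 1) F x) (Xf d (\<xi> b)) z \<in> range (\<lambda>v. Dir v F x)"
      by (rule derivative_in_range[where M = "\<lambda>y v. Dir v F y", OF oT xT linM contM injM[OF xT] du u0 ur])
    then obtain v where v: "Dir (axis a 1) (\<lambda>y. Dir (axis b 1) F y) x - Dir (X a) (Xf d (\<xi> b)) z = Dir v F x"
      unfolding FrX by blast
    have "cov a b = nab a b + Dir v F x" unfolding cov_def nab_def v[symmetric] by simp
    then show ?thesis using linear_add[OF linN] norM by simp
  qed
  have mc: "mean_curvature (metric \<omega>) d f x = (\<Sum>a\<in>UNIV. \<Sum>b\<in>UNIV. Ginv $ a $ b *\<^sub>R nor (cov a b))"
    unfolding mean_curvature_def Let_def F_def[symmetric] z_def[symmetric] FrX gram_def[symmetric] Ginv_def[symmetric]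
      nor_def cov_def ..
  also have "\<dots> = nor (\<Sum>a\<in>UNIV. \<Sum>b\<in>UNIV. Ginv $ a $ b *\<^sub>R nab a b)"
    unfolding norcov linear_sum[OF linN] linear_scale[OF linN] ..
  also have "(\<Sum>a\<in>UNIV. \<Sum>b\<in>UNIV. Ginv $ a $ b *\<^sub>R nab a b) = mcv d (f x) \<xi>"
  proof -
    have "snd d (f x) = z" by (simp add: z_def F_def)
    then show ?thesis unfolding mcv_def Let_def nab_def Ginv_def gram_def by (simp only: Xz)
  qed
  finally have mc: "mean_curvature (metric \<omega>) d f x = nor (mcv d (f x) \<xi>)" .
  show "\<exists>t. mean_curvature (metric \<omega>) d f x = mcv d (f x) \<xi> - (\<Sum>b\<in>UNIV. t b *\<^sub>R fld d (f x) (\<xi> b))"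
  proof (intro exI[of _ "\<lambda>b. \<Sum>a\<in>UNIV. Ginv $ a $ b * g z (mcv d (f x) \<xi>) (X a)"])
    show "mean_curvature (metric \<omega>) d f x = mcv d (f x) \<xi>
       - (\<Sum>b\<in>UNIV. (\<Sum>a\<in>UNIV. Ginv $ a $ b * g z (mcv d (f x) \<xi>) (X a)) *\<^sub>R fld d (f x) (\<xi> b))"
      unfolding mc nor_def scaleR_sum_left X_def[symmetric] by (subst sum.swap) simp
  qed
  show "mean_curvature (metric \<omega>) d f x = 0" if "mcv d (f x) \<xi> = 0"
    unfolding mc that using linear_0[OF linN] .
qed

end

section \<open>Minimality and isolation\<close>

text \<open>With \<open>L\<close> a left inverse of \<open>f'\<close>, the vector
  \<open>L (f v)\<close> differs from \<open>v\<close> by at most half of \<open>norm v\<close> near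
  0.\<close>

lemma isolated_zero:
  fixes f :: "'a::euclidean_space \<Rightarrow> 'b::euclidean_space"
  assumes f: "(f has_derivative f') (at 0)" "f 0 = 0" "inj f'"
  obtains e where "e > 0" "\<And>v. norm v < e \<Longrightarrow> f v = 0 \<Longrightarrow> v = 0"
proof -
  have lf: "linear f'" using f(1) has_derivative_linear by blast
  obtain L where L: "linear L" "L \<circ> f' = id" using linear_injective_left_inverse[OF lf f(3)] by blast
  have Lf: "L (f' v) = v" for v using L(2) by (metis comp_def id_apply)
  have bL: "bounded_linear L" using L(1) linear_conv_bounded_linear by blast
  have D: "((\<lambda>v. L (f v)) has_derivative (\<lambda>v. v)) (at 0)"
    using bounded_linear.has_derivative[OF bL f(1)] by (simp add: Lf)
  have "\<forall>e>0. \<exists>d>0. \<forall>y. norm (y - 0) < d \<longrightarrow> norm (L (f y) - L (f 0) - (y - 0)) \<le> e * norm (y - 0)"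
    using D unfolding has_derivative_at_alt by blast
  then obtain d where d: "d > 0" "\<And>y. norm (y - 0) < d \<Longrightarrow> norm (L (f y) - L (f 0) - (y - 0)) \<le> (1/2) * norm (y - 0)"
    by (meson half_gt_zero zero_less_one)
  show thesis
  proof (rule that[OF d(1)])
    fix v assume v: "norm v < d" "f v = 0"
    have "norm v \<le> (1/2) * norm v" using d(2)[of v] v L(1) f(2) by (simp add: linear_0)
    then show "v = 0" by simp
  qed
qed

section \<open>Frames of Lagrangian orbits\<close>

context kahler_action begin

lemma \<beta>_mcv:
  assumes fr: "kahler_frame \<omega> d (snd d ` fst d) (\<lambda>j. Xf d (\<xi> j)) U"
    and d: "d \<in> A" "q \<in> fst d" "snd d q \<in> U"
    and lag: "\<And>j k. \<omega> d (snd d q) (fld d q (\<xi> j)) (fld d q (\<xi> k)) = 0"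
  shows "kahler_frame.\<beta> \<omega> d (\<lambda>j. Xf d (\<xi> j)) (snd d q) w = - 2 * metric \<omega> d (snd d q) w (mcv d q \<xi>)"
proof -
  interpret kahler_frame \<omega> d "snd d ` fst d" "\<lambda>j. Xf d (\<xi> j)" U by (rule fr)
  have zS: "snd d q \<in> snd d ` fst d" using d by blast
  have X: "Xf d \<eta> (snd d q) = fld d q \<eta>" for \<eta> using d by (simp add: Xf_def cinv_chart[OF chartA[OF d(1)]])
  show ?thesis
    unfolding mcv_def Let_def
  proof (rule \<beta>_lagrangian[OF d(3)])
    show "\<omega> d (snd d q) (Xf d (\<xi> j) (snd d q)) (Xf d (\<xi> k) (snd d q)) = 0" for j k
      unfolding X by (rule lag)
  qed (rule Xf_killing[OF d(1) zS])
qed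

text \<open>A Lagrangian tangent space is totally real: a vector \<open>u\<close> that is both
  tangent and \<open>J\<close> of a tangent vector has length zero, because \<open>g\<close> of a
  tangent vector with \<open>J\<close> of another is \<open>\<omega>\<close> up to sign.\<close>

lemma lagrangian_frame_det:
  assumes lag: "lagrangian A \<omega> (orbit G \<phi> q)" and d: "d \<in> A" "q \<in> fst d"
    and ind: "\<And>x::real^'n. (\<Sum>j\<in>UNIV. x $ j *\<^sub>R fld d q (\<xi> j)) = 0 \<Longrightarrow> x = 0"
  shows "det (frame_matrix (\<lambda>j. fld d q (\<xi> j))) \<noteq> 0"
    and "\<omega> d (snd d q) (fld d q \<eta>) (fld d q \<theta>) = 0"
proof -
  interpret kahler_chart \<omega> d "snd d ` fst d" using kahler_chart_at d by blast
  have zS: "snd d q \<in> snd d ` fst d" using d by blast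
  have z: "\<omega> d (snd d q) (fld d q \<eta>) (fld d q \<theta>) = 0" for \<eta> \<theta>
  proof -
    have "\<forall>u\<in>tangent_space d (orbit G \<phi> q) q. \<forall>v\<in>tangent_space d (orbit G \<phi> q) q. \<omega> d (snd d q) u v = 0"
      using lag d orbit_self[of q] unfolding lagrangian_def by blast
    then show ?thesis unfolding tangent_space_orbit[OF d] by blast
  qed
  then show "\<omega> d (snd d q) (fld d q \<eta>) (fld d q \<theta>) = 0" .
  let ?T = "range (fld d q)"
  have sT: "subspace ?T" by (rule linear_subspace_image[OF fld_linear[OF d] subspace_UNIV])
  have "u = 0" if u: "u \<in> ?T" "u \<in> J ` ?T" for u
  proof -
    obtain \<eta> \<theta> where e: "u = fld d q \<eta>" "u = J (fld d q \<theta>)" using u by blast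
    have "g (snd d q) u u = g (snd d q) (fld d q \<eta>) (J (fld d q \<theta>))" using e by simp
    also have "\<dots> = 0" using z[of \<eta> \<theta>] form_g[OF zS] by simp
    finally show ?thesis using pos[OF zS, of u] by fastforce
  qed
  moreover have "0 \<in> ?T \<inter> J ` ?T" using subspace_0[OF sT] J_zero by (metis IntI image_eqI)
  ultimately have "?T \<inter> J ` ?T = {0}" by blast
  then show "det (frame_matrix (\<lambda>j. fld d q (\<xi> j))) \<noteq> 0"
    by (rule det_frame_totally_real[OF sT]) (use ind in auto)
qed

text \<open>Minimality refers to arbitrary parametrizations. At the single point \<open>f x\<close>
  their coordinate frame can be matched by fundamental fields, since these exhaust the tangent space
  of the orbit.\<close>

lemma param_frame:
  assumes d: "d \<in> A" and lp: "local_param A (orbit G \<phi> q) Wd f" and x: "x \<in> Wd" "f x \<in> fst d"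
  obtains \<xi> where "\<And>b. fld d (f x) (\<xi> b) = Dir (axis b 1) (snd d \<circ> f) x"
    "\<And>v::real^'n. (\<Sum>b\<in>UNIV. v $ b *\<^sub>R fld d (f x) (\<xi> b)) = 0 \<Longrightarrow> v = 0"
    "orbit G \<phi> (f x) = orbit G \<phi> q"
proof -
  have dd: "is_chart d" by (rule chartA[OF d])
  obtain g where g: "f x = \<phi> g q" using local_paramD(4)[OF lp d dd x(1)] unfolding orbit_range by blast
  have o: "orbit G \<phi> (f x) = orbit G \<phi> q" unfolding g by (rule orbit_act)
  have "Dir (axis b 1) (snd d \<circ> f) x \<in> range (fld d (f x))" for b
    using param_tangent[OF lp d dd x, of "axis b 1"] tangent_space_orbit[OF d x(2)] unfolding o by blast
  then have "\<forall>b. \<exists>\<eta>. fld d (f x) \<eta> = Dir (axis b 1) (snd d \<circ> f) x" by (metis rangeE)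
  from choice[OF this] obtain \<xi> where \<xi>: "\<And>b. fld d (f x) (\<xi> b) = Dir (axis b 1) (snd d \<circ> f) x" by blast
  have sm: "smooth_on (Wd \<inter> f -` fst d) (snd d \<circ> f)" by (rule local_paramD(2)[OF lp d dd])
  have lin: "linear (\<lambda>v. Dir v (snd d \<circ> f) x)" by (rule linear_Dir[OF smooth_on_differentiable[OF sm]]) (use x in simp)
  have "v = 0" if v: "(\<Sum>b\<in>UNIV. v $ b *\<^sub>R fld d (f x) (\<xi> b)) = 0" for v :: "real^'n"
  proof -
    have "Dir v (snd d \<circ> f) x = (\<Sum>b\<in>UNIV. v $ b *\<^sub>R fld d (f x) (\<xi> b))"
      using linear_axis_expansion[OF lin, of v] unfolding \<xi> .
    also have "\<dots> = Dir 0 (snd d \<circ> f) x" using v linear_0[OF lin] by simp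
    finally show ?thesis by (rule injD[OF local_paramD(3)[OF lp d dd x]])
  qed
  with \<xi> show thesis using o by (rule that)
qed

end

context max_point begin

text \<open>At each point of the orbit an adapted \<open>\<xi>'\<close> replaces
  \<open>\<xi>\<close>. Transported to \<open>W\<close> by the inverse of \<open>g\<close>, its
  volume is a constant multiple of that of \<open>\<xi>\<close>, so it has a local maximum at
  \<open>f x\<close>; there its \<open>\<beta>\<close> vanishes, and on a Lagrangian orbit this
  makes \<open>mcv\<close> vanish.\<close>

lemma minimal_orbit: "minimal_submanifold A (metric \<omega>) (orbit G \<phi> p)"
  unfolding minimal_submanifold_def
proof (intro conjI allI impI ballI)
  show "n_submanifold A (orbit G \<phi> p)" by (rule orbit_submanifold[OF c range_fld(2)[OF pW]])
  fix Wd f d x assume lp: "local_param A (orbit G \<phi> p) Wd f" and d: "d \<in> A" and "x \<in> Wd \<inter> f -` fst d"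
  then have x: "x \<in> Wd" "f x \<in> fst d" by auto
  have dd: "is_chart d" by (rule chartA[OF d])
  obtain g where g: "f x = \<phi> g p" using local_paramD(4)[OF lp d dd x(1)] unfolding orbit_range by blast
  obtain \<xi>' where \<xi>': "\<And>b. fld d (f x) (\<xi>' b) = Dir (axis b 1) (snd d \<circ> f) x"
    and ind': "\<And>v::real^'n. (\<Sum>b\<in>UNIV. v $ b *\<^sub>R fld d (f x) (\<xi>' b)) = 0 \<Longrightarrow> v = 0"
    and o: "orbit G \<phi> (f x) = orbit G \<phi> p"
    by (rule param_frame[OF d lp x]) (rule that; assumption)
  have lag: "lagrangian A \<omega> (orbit G \<phi> (f x))" unfolding o by (rule lagrangian_orbit)
  have nz: "det (frame_matrix (\<lambda>j. fld d (f x) (\<xi>' j))) \<noteq> 0"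
    by (rule lagrangian_frame_det(1)[OF lag d x(2) ind'])
  have form0: "\<omega> d (snd d (f x)) (fld d (f x) \<eta>) (fld d (f x) \<theta>) = 0" for \<eta> \<theta>
    by (rule lagrangian_frame_det(2)[OF lag d x(2) ind'])
  obtain U where U: "open U" "snd d (f x) \<in> U" "U \<subseteq> snd d ` fst d"
    "\<And>z. z \<in> U \<Longrightarrow> det (frame_matrix (\<lambda>j. Xf d (\<xi>' j) z)) \<noteq> 0"
    by (rule frame_neighbourhood[OF d x(2) nz]) (rule that; assumption)
  have fr': "kahler_frame \<omega> d (snd d ` fst d) (\<lambda>j. Xf d (\<xi>' j)) U"
    by (rule kahler_frame_Xf[OF d U(1,3,4)])
  interpret kahler_chart \<omega> d "snd d ` fst d" using kahler_chart_at d by blast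
  \<comment> \<open>A neighbourhood of \<open>f x\<close> that the inverse of \<open>g\<close>
    carries into \<open>W\<close>, where proportionality of the volumes is known.\<close>
  define N where "N = \<phi> (ginv g) -` W"
  have oN: "open N" unfolding N_def by (rule open_vimage[OF open_W act_cont])
  have qN: "f x \<in> N" using pW by (simp add: N_def g act_inv)
  obtain m where m: "m \<ge> 0" "\<And>y. y \<in> W \<Longrightarrow> volc (\<lambda>j. Ad g (\<xi>' j)) c y = m * vol \<xi> y"
    using combination_factor[of "\<lambda>j. Ad g (\<xi>' j)"] by blast
  have mx: "vol \<xi>' y \<le> vol \<xi>' (f x)" if y: "y \<in> N" for y
  proof -
    let ?y = "\<phi> (ginv g) y"
    have yW: "?y \<in> W" using y by (simp add: N_def)
    have "vol \<xi>' y = vol \<xi>' (\<phi> g ?y)" by (simp add: act_inv)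
    also have "\<dots> = m * vol \<xi> ?y" unfolding vol_act[OF c(1) W(1)[OF yW]] by (rule m(2)[OF yW])
    also have "\<dots> \<le> m * vol \<xi> p" using max m(1) by (rule mult_left_mono)
    also have "\<dots> = vol \<xi>' (f x)" unfolding g vol_act[OF c] m(2)[OF pW] ..
    finally show ?thesis .
  qed
  have zS: "snd d (f x) \<in> snd d ` fst d" using x by blast
  have "metric \<omega> d (snd d (f x)) w (mcv d (f x) \<xi>') = 0" for w
    using \<beta>_zero_at_maximum[OF fr' d x(2) U(2) oN qN mx, of w] \<beta>_mcv[OF fr' d x(2) U(2) form0, of w] by simp
  then have "mcv d (f x) \<xi>' = 0" using pos[OF zS, of "mcv d (f x) \<xi>'"] by fastforce
  then show "mean_curvature (metric \<omega>) d f x = 0"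
    by (rule mean_curvature_orbit(2)[OF d lp x _ \<xi>', rotated]) (use fld_dim[OF pW d] x(2) in \<open>simp add: g\<close>)
qed

text \<open>Vanishing mean curvature only says that \<open>mcv\<close> is tangent to the orbit. But
  \<open>\<beta>\<close> equals \<open>- 2 g(\<cdot>, mcv)\<close> and kills tangent vectors, so
  \<open>mcv\<close> is orthogonal to itself.\<close>

lemma minimal_lagrangian_critical:
  assumes s: "s \<in> W" and ml: "minimal_lagrangian A \<omega> (orbit G \<phi> s)"
  shows "fr.\<beta> (snd c s) w = 0"
proof -
  have lag: "lagrangian A \<omega> (orbit G \<phi> s)" and min: "minimal_submanifold A (metric \<omega>) (orbit G \<phi> s)"
    using ml by (auto simp: minimal_lagrangian_def)
  obtain Wd f where lp: "local_param A (orbit G \<phi> s) Wd f" and sf: "s \<in> f ` Wd"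
    using lag orbit_self[of s] unfolding lagrangian_def n_submanifold_def by blast
  obtain x where x: "x \<in> Wd" "s = f x" using sf by blast
  have sc: "s \<in> fst c" by (rule W(1)[OF s])
  have fx: "f x \<in> fst c" using sc x by simp
  let ?z = "snd c s"
  have zS: "?z \<in> snd c ` fst c" using sc by blast
  have zV: "?z \<in> V" by (rule W(2)[OF s])
  obtain \<xi>' where \<xi>': "\<And>b. fld c s (\<xi>' b) = Dir (axis b 1) (snd c \<circ> f) x"
    and ind': "\<And>v::real^'n. (\<Sum>b\<in>UNIV. v $ b *\<^sub>R fld c s (\<xi>' b)) = 0 \<Longrightarrow> v = 0"
    by (rule param_frame[OF c(1) lp x(1) fx, folded x(2)]) (rule that; assumption)
  have nz: "det (frame_matrix (\<lambda>j. fld c s (\<xi>' j))) \<noteq> 0"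
    by (rule lagrangian_frame_det(1)[OF lag c(1) sc ind'])
  have form0: "\<omega> c ?z (fld c s \<eta>) (fld c s \<theta>) = 0" for \<eta> \<theta>
    by (rule lagrangian_frame_det(2)[OF lag c(1) sc ind'])
  obtain U where U: "open U" "?z \<in> U" "U \<subseteq> snd c ` fst c"
    "\<And>z. z \<in> U \<Longrightarrow> det (frame_matrix (\<lambda>j. Xf c (\<xi>' j) z)) \<noteq> 0"
    by (rule frame_neighbourhood[OF c(1) sc nz]) (rule that; assumption)
  have fr': "kahler_frame \<omega> c (snd c ` fst c) (\<lambda>j. Xf c (\<xi>' j)) U"
    by (rule kahler_frame_Xf[OF c(1) U(1,3,4)])
  interpret f2: kahler_frame \<omega> c "snd c ` fst c" "\<lambda>j. Xf c (\<xi>' j)" U by (rule fr')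
  have mc0: "mean_curvature (metric \<omega>) c f x = 0"
    using min lp c(1) x fx unfolding minimal_submanifold_def by blast
  have dim: "dim (range (fld c (f x))) = CARD('n)" using range_fld(2)[OF s] unfolding x(2) .
  have "\<exists>t. mean_curvature (metric \<omega>) c f x = mcv c (f x) \<xi>' - (\<Sum>b\<in>UNIV. t b *\<^sub>R fld c (f x) (\<xi>' b))"
    by (rule mean_curvature_orbit(1)[OF c(1) lp x(1) fx dim]) (use \<xi>' x(2) in simp)
  then obtain t where t: "mcv c s \<xi>' = (\<Sum>b\<in>UNIV. t b *\<^sub>R fld c s (\<xi>' b))"
    using mc0 unfolding x(2)[symmetric] by auto
  have "subspace (range (fld c s))" by (rule linear_subspace_image[OF fld_linear[OF c(1) sc] subspace_UNIV])
  then have "mcv c s \<xi>' \<in> range (fld c s)" unfolding t by (intro subspace_sum subspace_scale) auto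
  then obtain \<eta> where \<eta>: "mcv c s \<xi>' = fld c s \<eta>" by blast
  have \<beta>': "f2.\<beta> ?z w = - 2 * fr.g ?z w (mcv c s \<xi>')" for w
    by (rule \<beta>_mcv[OF fr' c(1) sc U(2) form0])
  obtain m where m: "m \<ge> 0" "\<And>y. y \<in> W \<Longrightarrow> volc \<xi>' c y = m * vol \<xi> y" using combination_factor[of \<xi>'] by blast
  have "volc \<xi>' c s \<noteq> 0" using volc_nz[OF c(1) sc] nz by blast
  then have mpos: "m > 0" using m(1) m(2)[OF s] by (cases "m = 0") auto
  \<comment> \<open>The volumes of \<open>\<xi>'\<close> and \<open>\<xi>\<close> differ by a
    positive constant, whose logarithm drops out on differentiation; so both choices have the same
    \<open>\<beta>\<close>.\<close>
  have lv: "f2.lnvol z = ln m + fr.lnvol z" if z: "z \<in> V" for z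
  proof -
    obtain y where y: "y \<in> fst c" "z = snd c y" using z r(2) by blast
    have yW: "y \<in> W" using y z by (simp add: W_def)
    have "f2.lnvol z = ln (volc \<xi>' c y)" by (simp add: f2.lnvol_def volc_def y X_fld)
    also have "\<dots> = ln m + ln (vol \<xi> y)" unfolding m(2)[OF yW] using mpos vol_W[OF yW] by (simp add: ln_mult)
    also have "ln (vol \<xi> y) = fr.lnvol z" by (simp add: fr.lnvol_def vol_eq[OF c(1) y(1)] volc_def y X_fld)
    finally show ?thesis .
  qed
  have "((\<lambda>z. ln m + fr.lnvol z) has_derivative (\<lambda>h. 0 + fr.\<beta> ?z h)) (at ?z)"
    by (intro has_derivative_add has_derivative_const fr.lnvol_has_derivative[OF zV])
  then have "(f2.lnvol has_derivative (\<lambda>h. 0 + fr.\<beta> ?z h)) (at ?z)"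
    by (rule has_derivative_transform_within_open[OF _ open_ball zV]) (simp add: lv)
  then have \<beta>eq: "f2.\<beta> ?z w = fr.\<beta> ?z w" for w
    using fun_cong[OF has_derivative_unique[OF f2.lnvol_has_derivative[OF U(2)]], of _ w] by simp
  have "fr.\<beta> ?z (fld c s \<eta>) = 0" using \<beta>_X[OF zV, of \<eta>] by (simp add: X_fld[OF sc])
  then have "fr.g ?z (mcv c s \<xi>') (mcv c s \<xi>') = 0" using \<beta>'[of "mcv c s \<xi>'"] unfolding \<beta>eq \<eta> by simp
  then have "mcv c s \<xi>' = 0" using fr.pos[OF zS, of "mcv c s \<xi>'"] by fastforce
  then show ?thesis using \<beta>'[of w] bilinear_rzero[OF fr.bil_g[OF zS]] unfolding \<beta>eq by simp
qed

text \<open>A flat slice in the chart \<open>c\<close>. It need not be invariant under the isotropy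
  group; transversality to the orbit is what matters.\<close>

definition slice where "slice v = z0 + J (\<Sum>k\<in>UNIV. (v :: real^'n) $ k *\<^sub>R X k z0)"

lemma slice_linear: "linear (\<lambda>v::real^'n. J (\<Sum>k\<in>UNIV. v $ k *\<^sub>R X k z0))"
  using linear_compose[OF real_comb_linear linear_J] by (simp add: o_def)

lemma slice_has_derivative: "(slice has_derivative (\<lambda>v. J (\<Sum>k\<in>UNIV. v $ k *\<^sub>R X k z0))) (at v0)"
proof -
  have bl: "bounded_linear (\<lambda>v::real^'n. J (\<Sum>k\<in>UNIV. v $ k *\<^sub>R X k z0))"
    using slice_linear linear_conv_bounded_linear by blast
  show ?thesis unfolding slice_def[abs_def]
    using has_derivative_add[OF has_derivative_const bounded_linear_imp_has_derivative[OF bl]] by simp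
qed

lemma slice_0: "slice 0 = z0"
  using linear_0[OF slice_linear] by (simp add: slice_def)

text \<open>The components of \<open>\<beta>\<close> on the vectors \<open>J X\<^sub>j\<close> give
  a map \<open>b\<close> between spaces of dimension \<open>n\<close>. In the Einstein identity the
  term along the orbit vanishes, so the derivative of \<open>b\<close> at 0 is
  \<open>- 2\<kappa>\<close> times the Gram matrix of the fields, which is invertible.\<close>

lemma slice_isolated:
  obtains e where "e > 0" "\<And>v. norm v < e \<Longrightarrow> slice v \<in> V"
    "\<And>v. norm v < e \<Longrightarrow> (\<forall>w. fr.\<beta> (slice v) w = 0) \<Longrightarrow> v = 0"
proof -
  have zS: "z0 \<in> snd c ` fst c" using c by blast
  define b where "b v = (\<Sum>j\<in>UNIV. fr.\<beta> (slice v) (J (X j z0)) *\<^sub>R axis j (1::real))" for v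
  define b' where "b' v = (\<Sum>j\<in>UNIV. Dir (J (\<Sum>k\<in>UNIV. v $ k *\<^sub>R X k z0)) (\<lambda>y. fr.\<beta> y (J (X j z0))) z0 *\<^sub>R axis j (1::real))"
    for v :: "real^'n"
  have db: "(b has_derivative b') (at 0)"
    unfolding b_def[abs_def] b'_def[abs_def]
  proof (intro has_derivative_sum has_derivative_scaleR_left)
    fix j :: 'n
    have "((\<lambda>y. fr.\<beta> y (J (X j z0))) has_derivative (\<lambda>h. Dir h (\<lambda>y. fr.\<beta> y (J (X j z0))) z0)) (at (slice 0))"
      unfolding slice_0 by (rule has_derivative_frechet[OF fr.\<beta>_diff[OF z0V]])
    from diff_chain_at[OF slice_has_derivative this]
    show "((\<lambda>v. fr.\<beta> (slice v) (J (X j z0))) has_derivative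
       (\<lambda>v. Dir (J (\<Sum>k\<in>UNIV. v $ k *\<^sub>R X k z0)) (\<lambda>y. fr.\<beta> y (J (X j z0))) z0)) (at 0)" by (simp add: o_def)
  qed
  have crit: "fr.\<beta> z0 w = 0" for w
    by (rule \<beta>_zero_at_maximum[OF frame c(1) c(2) z0V open_UNIV UNIV_I max])
  have b0: "b 0 = 0" by (simp add: b_def slice_0 crit)
  have comp: "(\<Sum>j\<in>UNIV. a j *\<^sub>R axis j (1::real)) $ i = a i" for a :: "'n \<Rightarrow> real" and i
    by (simp add: axis_def if_distrib cong: if_cong)
  have "inj b'"
  proof (rule linear_injective_0[THEN iffD2, OF has_derivative_linear[OF db]], intro allI impI)
    fix v assume v: "b' v = 0"
    define u where "u = (\<Sum>k\<in>UNIV. v $ k *\<^sub>R X k z0)"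
    have "fr.g z0 u (X j z0) = 0" for j
    proof -
      have "b' v $ j = 0" using v by simp
      then have 1: "Dir (J u) (\<lambda>y. fr.\<beta> y (J (X j z0))) z0 = 0" unfolding b'_def comp u_def .
      have "Dir u (\<lambda>y. fr.\<beta> y (X j z0)) z0 = 0"
        unfolding u_def linear_sum[OF linear_Dir[OF fr.\<beta>_diff[OF z0V]]] linear_scale[OF linear_Dir[OF fr.\<beta>_diff[OF z0V]]]
          \<beta>_along_orbit by simp
      moreover have "Dir u (\<lambda>y. fr.\<beta> y (X j z0)) z0 + Dir (J u) (\<lambda>y. fr.\<beta> y (J (X j z0))) z0 = - 2 * \<kappa> * fr.g z0 u (X j z0)"
        by (rule fr.\<beta>_einstein[OF z0V einstein[OF c(1) zS]])
      ultimately show ?thesis using 1 \<kappa>_pos by simp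
    qed
    moreover have "linear (fr.g z0 u)" using fr.bil_g[OF zS] by (simp add: bilinear_def)
    then have "fr.g z0 u u = (\<Sum>k\<in>UNIV. v $ k *\<^sub>R fr.g z0 u (X k z0))"
      by (subst (2) u_def) (simp add: linear_sum linear_scale)
    ultimately have "fr.g z0 u u = 0" by simp
    then have "u = 0" using fr.pos[OF zS, of u] by fastforce
    then show "v = 0" using injD[OF real_comb_inj[OF ind[OF z0V]], of v 0] by (simp add: u_def)
  qed
  then obtain e1 where e1: "e1 > 0" "\<And>v. norm v < e1 \<Longrightarrow> b v = 0 \<Longrightarrow> v = 0"
    using isolated_zero[OF db b0] by blast
  have "isCont slice 0" using slice_has_derivative has_derivative_continuous by blast
  then have "eventually (\<lambda>v. slice v \<in> V) (nhds 0)"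
    using isCont_eventually_open[of 0 slice V] z0V by (simp add: slice_0)
  then obtain e2 where e2: "e2 > 0" "\<And>v. norm v < e2 \<Longrightarrow> slice v \<in> V"
    unfolding eventually_nhds_metric by (auto simp: dist_norm)
  show thesis
  proof (rule that[of "min e1 e2"])
    show "min e1 e2 > 0" using e1 e2 by simp
    show "slice v \<in> V" if "norm v < min e1 e2" for v using e2(2) that by simp
    show "v = 0" if "norm v < min e1 e2" "\<forall>w. fr.\<beta> (slice v) w = 0" for v
      using e1(2)[of v] that by (simp add: b_def)
  qed
qed

text \<open>The map \<open>(g, v) \<mapsto> \<phi> g (slice v)\<close> is a submersion at the identity.\<close>

lemma slice_covers:
  assumes e: "e > 0"
  obtains N where "open N" "p \<in> N"
    "\<And>q. q \<in> N \<Longrightarrow> \<exists>g s v. q = \<phi> g s \<and> s \<in> fst c \<and> snd c s = slice v \<and> norm v < e"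
proof -
  let ?x0 = "snd b0 unit" and ?\<Phi> = "Act b0 c c"
  have zS: "z0 \<in> snd c ` fst c" using c by blast
  define \<Psi> where "\<Psi> y = ?\<Phi> (fst y, slice (snd y))" for y
  define T where "T = (\<lambda>y. (fst y, slice (snd y))) -` ActD b0 c c"
  have cs: "continuous_on UNIV slice"
    by (intro continuous_at_imp_continuous_on ballI) (use slice_has_derivative has_derivative_continuous in blast)
  have cp: "continuous_on UNIV (\<lambda>y::'e \<times> (real^'n). (fst y, slice (snd y)))"
    by (intro continuous_on_Pair continuous_on_fst continuous_on_id continuous_on_compose2[OF cs] continuous_on_snd) auto
  have oT: "open T" unfolding T_def by (rule open_vimage[OF Act_smooth(1)[OF b0(1) c(1) c(1)] cp])
  have base: "(?x0, 0) \<in> T" using base_ActD[OF c(1) zS] by (simp add: T_def slice_0)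
  have "continuous_on (ActD b0 c c) ?\<Phi>" using smooth_onD[OF Act_smooth(2)[OF b0(1) c(1) c(1)], of 0] by simp
  then have cont: "continuous_on T \<Psi>"
    unfolding \<Psi>_def by (rule continuous_on_compose2[OF _ continuous_on_subset[OF cp subset_UNIV]]) (auto simp: T_def)
  define D where "D y = Xf c (fst y) z0 + J (\<Sum>k\<in>UNIV. snd y $ k *\<^sub>R X k z0)" for y
  have dA: "(?\<Phi> has_derivative (\<lambda>w. Dir w ?\<Phi> (?x0, z0))) (at (fst (?x0, 0), slice (snd (?x0, 0))))"
    unfolding fst_conv snd_conv slice_0
    by (rule has_derivative_frechet[OF Act_Dir_differentiable(2)[OF b0(1) c(1) c(1) base_ActD[OF c(1) zS]]])
  have dp: "((\<lambda>y. (fst y, slice (snd y))) has_derivative (\<lambda>y. (fst y, J (\<Sum>k\<in>UNIV. snd y $ k *\<^sub>R X k z0)))) (at (?x0, 0))"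
    using diff_chain_at[OF has_derivative_snd[OF has_derivative_ident] slice_has_derivative]
    by (intro has_derivative_Pair has_derivative_fst has_derivative_ident) (simp add: o_def)
  have D: "(\<Psi> has_derivative D) (at (?x0, 0))"
  proof -
    have lin: "linear (\<lambda>w. Dir w ?\<Phi> (?x0, z0))" using dA has_derivative_linear by blast
    have D0: "Dir (0, w) ?\<Phi> (?x0, z0) = w" for w
    proof -
      have eid: "\<phi> unit = id" by (rule ext) (simp add: act_one)
      have "differential c c (\<phi> unit) p w = w"
        unfolding eid using mdiff_differential[OF id_mdiff[OF c]] by simp
      then show ?thesis using Act_Dir2[OF b0(1) c(1) c(1) b0(2) c(2), of w] c(2) by (simp add: act_one)
    qed
    have "Dir (\<eta>, w) ?\<Phi> (?x0, z0) = Xf c \<eta> z0 + w" for \<eta> w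
    proof -
      have "Dir ((\<eta>, 0) + (0, w)) ?\<Phi> (?x0, z0) = Dir (\<eta>, 0) ?\<Phi> (?x0, z0) + Dir (0, w) ?\<Phi> (?x0, z0)"
        by (rule linear_add[OF lin])
      then show ?thesis by (simp add: D0 Xf_Act[OF c(1) zS])
    qed
    then show ?thesis using diff_chain_at[OF dp dA] by (simp add: o_def \<Psi>_def[abs_def] D_def[abs_def])
  qed
  \<comment> \<open>Orbit directions supply the real parts and the slice the imaginary parts of a
    complex combination of the frame.\<close>
  have "surj D"
  proof -
    have "\<exists>y. w = D y" for w
    proof -
      have "surj (fcomb (\<lambda>j. X j z0))"
        using linear_injective_imp_surjective[OF fcomb_linear fcomb_inj[OF ind[OF z0V]]] by blast
      then obtain y where y: "w = fcomb (\<lambda>j. X j z0) y" by (metis surjD)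
      have "Xf c (\<Sum>j\<in>UNIV. Re (y $ j) *\<^sub>R \<xi> j) z0 = (\<Sum>j\<in>UNIV. Re (y $ j) *\<^sub>R X j z0)"
        unfolding X_fld[OF c(2)] linear_sum[OF fld_linear[OF c]] linear_scale[OF fld_linear[OF c]] ..
      then have "w = D (\<Sum>j\<in>UNIV. Re (y $ j) *\<^sub>R \<xi> j, \<chi> j. Im (y $ j))"
        unfolding y fcomb_re_im D_def by simp
      then show ?thesis by blast
    qed
    then show ?thesis by (auto simp: surj_def)
  qed
  then obtain R where R: "linear R" "D \<circ> R = id"
    using linear_surjective_right_inverse[OF has_derivative_linear[OF D]] by blast
  define T' where "T' = T \<inter> {y. norm (snd y) < e}"
  have oT': "open T'" unfolding T'_def by (intro open_Int oT open_Collect_less continuous_intros)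
  have "(?x0, 0) \<in> interior T'" unfolding interior_open[OF oT'] using base e by (simp add: T'_def)
  moreover have bR: "bounded_linear R" using R(1) linear_conv_bounded_linear by blast
  \<comment> \<open>An open mapping theorem that asks for differentiability at one point, with a
    right inverse of the derivative there, and continuity elsewhere.\<close>
  ultimately have int: "\<Psi> (?x0, 0) \<in> interior (\<Psi> ` T')"
    using sussmann_open_mapping[OF oT cont base D bR R(2), of T'] by (simp add: T'_def)
  have \<Psi>0: "\<Psi> (?x0, 0) = z0" using Act_base(1)[OF c] by (simp add: \<Psi>_def slice_0)
  define N where "N = fst c \<inter> snd c -` interior (\<Psi> ` T')"
  have oN: "open N" unfolding N_def
    by (rule continuous_open_preimage[OF chart_continuous[OF cc] chart_open(1)[OF cc] open_interior])
  have "p \<in> N" using int c by (simp add: N_def \<Psi>0)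
  moreover have "\<exists>g s v. q = \<phi> g s \<and> s \<in> fst c \<and> snd c s = slice v \<and> norm v < e" if q: "q \<in> N" for q
  proof -
    have qc: "q \<in> fst c" and "snd c q \<in> \<Psi> ` T'" using q interior_subset by (auto simp: N_def)
    then obtain x v where xv: "(x, v) \<in> T'" "snd c q = \<Psi> (x, v)" by auto
    have "(x, slice v) \<in> ActD b0 c c" using xv(1) by (simp add: T'_def T_def)
    then obtain g s where g: "(x, slice v) = (snd b0 g, snd c s)" "g \<in> fst b0" "s \<in> fst c" "\<phi> g s \<in> fst c"
      using ActD_E by blast
    have "\<Psi> (x, v) = snd c (\<phi> g s)" unfolding \<Psi>_def fst_conv snd_conv g(1) by (rule Act_eq[OF b0(1) c(1) g(2,3)])
    then have "q = \<phi> g s" using inj_onD[OF chart_inj[OF cc]] xv(2) qc g(4) by metis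
    moreover have "norm v < e" using xv(1) by (simp add: T'_def)
    moreover have "snd c s = slice v" using g(1) by simp
    ultimately show ?thesis using g(3) by blast
  qed
  ultimately show thesis using oN by (rule that[rotated])
qed

text \<open>Every orbit inside \<open>U\<close> meets \<open>N\<close> and so contains a point of
  the small slice; if it is minimal Lagrangian, that point is a zero of \<open>\<beta>\<close>,
  hence the base point.\<close>

lemma isolated_orbit:
  "\<exists>U. open U \<and> orbit G \<phi> p \<subseteq> U \<and>
     (\<forall>L'. minimal_lagrangian_orbit G \<phi> A \<omega> L' \<and> L' \<subseteq> U \<longrightarrow> L' = orbit G \<phi> p)"
proof -
  obtain e where e: "e > 0" "\<And>v. norm v < e \<Longrightarrow> slice v \<in> V"
    "\<And>v. norm v < e \<Longrightarrow> (\<forall>w. fr.\<beta> (slice v) w = 0) \<Longrightarrow> v = 0"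
    by (rule slice_isolated) (rule that; assumption)
  obtain N where N: "open N" "p \<in> N"
    "\<And>q. q \<in> N \<Longrightarrow> \<exists>g s v. q = \<phi> g s \<and> s \<in> fst c \<and> snd c s = slice v \<and> norm v < e"
    by (rule slice_covers[OF e(1)]) (rule that; assumption)
  \<comment> \<open>The saturation of \<open>N\<close> under the group, which contains the whole
    orbit of \<open>p\<close> and not just a piece of it.\<close>
  define U where "U = (\<Union>g. \<phi> g -` N)"
  have "open U" unfolding U_def by (intro open_UN ballI open_vimage N(1) act_cont)
  moreover have "orbit G \<phi> p \<subseteq> U"
  proof
    fix q assume "q \<in> orbit G \<phi> p"
    then obtain g where "q = \<phi> g p" unfolding orbit_range by blast
    then have "\<phi> (ginv g) q \<in> N" using N(2) by (simp add: act_inv)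
    then show "q \<in> U" by (auto simp: U_def)
  qed
  moreover have "L' = orbit G \<phi> p" if L': "minimal_lagrangian_orbit G \<phi> A \<omega> L'" "L' \<subseteq> U" for L'
  proof -
    obtain y where y: "L' = orbit G \<phi> y" and ml: "minimal_lagrangian A \<omega> L'"
      using L'(1) unfolding minimal_lagrangian_orbit_def by blast
    have "y \<in> U" using L'(2) orbit_self[of y] unfolding y by blast
    then obtain h where "\<phi> h y \<in> N" by (auto simp: U_def)
    then obtain g s v where s: "\<phi> h y = \<phi> g s" "s \<in> fst c" "snd c s = slice v" "norm v < e" using N(3) by blast
    have o: "orbit G \<phi> s = L'" unfolding y using orbit_act[of h y] orbit_act[of g s] s(1) by simp
    have sW: "s \<in> W" using s e(2)[OF s(4)] by (simp add: W_def)
    have "fr.\<beta> (slice v) w = 0" for w using minimal_lagrangian_critical[OF sW, of w] ml unfolding o s(3) by blast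
    then have "v = 0" using e(3)[OF s(4)] by blast
    then have "snd c s = snd c p" using s(3) slice_0 by simp
    then have "s = p" using inj_onD[OF chart_inj[OF cc]] s(2) c(2) by blast
    then show ?thesis using o by simp
  qed
  ultimately show ?thesis by blast
qed

end

theorem theorem5p1:
  fixes A :: "('m::t2_space, complex^'n) chart set"
    and \<omega> :: "('m, complex^'n) tensor2"
    and G :: "('g::t2_space) monoid"
    and B :: "('g, 'e::euclidean_space) chart set"
    and \<phi> :: "'g \<Rightarrow> 'm \<Rightarrow> 'm"
  assumes "complex_atlas A"
    and "compact (UNIV :: 'm set)"
    and "positive_kahler_einstein A \<omega>"
    and "compact_lie_group G B"
    and "smooth_action G B A \<phi>"
    and "isometric_action G A \<omega> \<phi>"
    and "connected (UNIV :: 'g set) \<or> (\<forall>g\<in>carrier G. holomorphic_map A (\<phi> g))"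
    and "generic_orbit G \<phi> (totally_real A)"
  shows "\<exists>L. minimal_lagrangian A \<omega> L \<and> (\<exists>p. L = orbit G \<phi> p) \<and>
             isolated_minimal_lagrangian_orbit G \<phi> A \<omega> L"
proof -
  obtain \<kappa> where \<kappa>: "kahler_form A \<omega>" "\<kappa> > 0"
    "\<And>c z u v. c \<in> A \<Longrightarrow> z \<in> snd c ` fst c \<Longrightarrow> ricci_form \<omega> c z u v = \<kappa> * \<omega> c z u v"
    using assms(3) unfolding positive_kahler_einstein_def by blast
  obtain U0 where U0: "closure U0 = UNIV" "\<And>p. p \<in> U0 \<Longrightarrow> totally_real A (orbit G \<phi> p)"
    using assms(8) unfolding generic_orbit_def by blast
  interpret generic_action A G B \<phi> \<omega> \<kappa> U0
    by unfold_locales (fact assms \<kappa> U0)+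
  obtain \<xi> p c r where "max_point A G B \<phi> \<omega> \<kappa> U0 \<xi> p c r" using exists_max_point by blast
  then interpret max_point A G B \<phi> \<omega> \<kappa> U0 \<xi> p c r .
  have "minimal_lagrangian A \<omega> (orbit G \<phi> p)"
    using lagrangian_orbit minimal_orbit by (simp add: minimal_lagrangian_def)
  then show ?thesis
    using isolated_orbit unfolding isolated_minimal_lagrangian_orbit_def minimal_lagrangian_orbit_def by blast
qed

end
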